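(* Let $\mathcal C$ be a strict monoidal category with coequalizers in which every object is left coflat, and let $A$ be an algebra in $\mathcal C$ such that every left $A$-module in $\mathcal C$ is robust. Let $(A,X,\psi)$ be a cowreath in $\mathcal C$ and assume that $X\dashv Y$ in $\mathcal C$ (with $b:\underline 1\to YX$, $d:XY\to\underline 1$). Then the following assertions are equivalent: (i) $(X,\psi)$ is a Frobenius coalgebra in $\mathcal T_A^\#$; (ii) $YA$ is a Frobenius $A$-ring; (iii) $(Y,\varphi)$ is a Frobenius algebra in ${}_A^\#\mathcal T$; (iv) the algebra extension $Ym\circ\eta_\#A:A\to YA$ is Frobenius; (v) $AX$ and $YA$ are isomorphic as left $A$-, right $YA$-modules in $\mathcal C$; (vi) $AX$ and $YA$ are isomorphic as left $A$-modules and as entwined modules (i.e. there is an isomorphism which is both left $A$-linear and a morphism of entwined modules over $(A,X,\psi)$); (vii) there exists a morphism $t:\underline 1\to X$ in $\mathcal T_A^\#$ such that $$\Phi=m^2X\circ AA\psi\circ AAXdA\circ A\delta YA\circ tYA:\ YA\to AX$$ is an isomorphism in $\mathcal C$, where $m^2=m\circ mA$; (viii) there exists a morphism $B:XX\to\underline 1$ in $\mathcal T_A^\#$ satisfying $mX\circ A\psi\circ AXB\circ\delta X=mX\circ ABX\circ\psi XX\circ X\delta$ (i.e. a Casimir morphism for $(X,\psi)$) such that $$\Psi=Ym\circ YAB\circ Y\psi X\circ bAX:\ AX\to YA$$ is an isomorphism in $\mathcal C$. If moreover $\underline 1$ is a left $\otimes$-generator of $\mathcal C$, then these statements are also equivalent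 to (ix) the forgetful functor $F:\mathcal C(\psi)_A^X\to\mathcal C_A$ is a Frobenius functor.
   Context: Conventions: $\mathcal C$ is a strict monoidal category with unit object $\underline 1$; the tensor product is written by juxtaposition, and the identity morphism of $X$ is written $X$ (so $fA=f\otimes \mathrm{Id}_A$). $(A,m,\eta)$ is an algebra in $\mathcal C$. Right (left) actions are denoted $\mu$ ($\nu$). $X\dashv Y$ means $b:\underline 1\to YX$, $d:XY\to\underline 1$ satisfy $Yd\circ bY=Y$, $dX\circ Xb=X$; put $d^2=d\circ XdY:XXYY\to\underline 1$. A Frobenius functor is a functor with a right adjoint that is also a left adjoint. $P\in\mathcal C$ is a left $\otimes$-generator if, for all $f,g:YZ\to W$, $f\circ hZ=g\circ hZ$ for all $h:P\to Y$ implies $f=g$. $\mathcal T_A^\#$: objects $(X,\psi)$, $\psi:XA\to AX$ with $\psi\circ Xm=mX\circ A\psi\circ\psi A$, $\psi\circ X\eta=\eta X$. Morphisms $(X,\psi_X)\to(Y,\psi_Y)$: $f:X\to AY$ in $\mathcal C$ with $mY\circ Af\circ\psi_X=mY\circ A\psi_Y\circ fA$; composition $g\bullet f=mZ\circ Ag\circ f$, identity $\eta X$; tensor product of objects $(XY,\psi_XY\circ X\psi_Y)$, of morphisms $f:X\to AX'$, $g:Y\to AY'$: $mX'Y'\circ A\psi_{X'}Y'\circ fg$; unit $(\underline 1,A)$. So a morphism $\underline 1\to X$ is $t:\underline 1\to AX$ with $mX\circ At=mX\circ A\psi\circ tA$, and a morphism $XX\to\underline 1$ is $B:XX\to A$ with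 $m\circ BA=m\circ AB\circ\psi X\circ X\psi$. ${}_A^\#\mathcal T$ (mirror image): objects $(Y,\varphi)$, $\varphi:AY\to YA$ with $\varphi\circ mY=Ym\circ\varphi A\circ A\varphi$, $\varphi\circ\eta Y=Y\eta$. Morphisms $(X,\varphi_X)\to (Y,\varphi_Y)$: $f:X\to YA$ with $Ym\circ fA\circ\varphi_X=Ym\circ\varphi_YA\circ Af$; composition $g\bullet f=Zm\circ gA\circ f$, identity $X\eta$; tensor product of objects $(XY,X\varphi_Y\circ\varphi_XY)$, of morphisms $f:X\to X'A$, $g:Y\to Y'A$: $X'Y'm\circ X'\varphi_{Y'}A\circ fg$; unit $(\underline 1,A)$. Cowreath: $(A,X,\psi)$ with $(X,\psi)$ a coalgebra in $\mathcal T_A^\#$; explicitly there are $\delta:X\to AXX$, $\epsilon:X\to A$ with $mXX\circ A\psi X\circ AX\psi\circ\delta A=mXX\circ A\delta\circ\psi$; $mXXX\circ A\delta X\circ\delta=mXXX\circ A\psi XX\circ AX\delta\circ\delta$; $m\circ A\epsilon\circ\psi=m\circ\epsilon A$; $mX\circ A\epsilon X\circ\delta=\eta X=mX\circ A\psi\circ AX\epsilon\circ\delta$. Entwined modules: objects of $\mathcal C(\psi)_A^X$ are $(M,\mu,\rho)$ with $(M,\mu)\in\mathcal C_A$, $\rho:M\to MX$, $\rho\circ\mu=\mu X\circ M\psi\circ\rho A$, $\rho X\circ\rho=\mu XX\circ M\delta\circ\rho$, $\mu\circ M\epsilon\circ\rho=M$; morphisms are right $A$-linear $f$ with $fX\circ\rho=\rho\circ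 f$. The dual side: $\varphi=YAd\circ Y\psi Y\circ bAY:AY\to YA$; $(Y,\varphi)$ is an algebra in ${}_A^\#\mathcal T$ with multiplication $YAd^2\circ Y\delta YY\circ bYY:YY\to YA$ and unit $Y\epsilon\circ b:\underline 1\to YA$. The wreath product $YA$ is an algebra in $\mathcal C$ with multiplication $m_\#=Ym\circ YmA\circ YAAdA\circ YA\psi YA\circ YAXdAYA\circ Y\delta YAYA\circ bYAYA$ and unit $\eta_\#=Y\epsilon\circ b$. $Ym\circ\eta_\#A:A\to YA$ is an algebra morphism. Module structures: $AX$ has left $A$-action $mX$, right $A$-action $mX\circ A\psi$, coaction $mXX\circ A\delta$ (an entwined module). $YA$ has left $A$-action $\nu_{YA}=Ym\circ\varphi A$ and right $A$-action $Ym$. $\mathcal C(\psi)_A^X$ and $\mathcal C_{YA}$ are isomorphic: an entwined module $M$ is a right $YA$-module via $\overline\mu=\mu\circ MdA\circ\rho YA$; conversely a right $YA$-module $(M,\overline\mu)$ is an entwined module via $\mu=\overline\mu\circ MYm\circ MY\epsilon A\circ MbA$, $\rho=\overline\mu X\circ MY\eta X\circ Mb$. In (v) $YA$ is the regular right $YA$-module and $AX$ has the induced $YA$-action; in (vi) $YA$ has the entwined structure induced by its regular right $YA$-module structure. Bimodules: $X$ is left coflat if $-\otimes X$ preserves coequalizers. For $X\in\mathcal C_A$, $Y\in{}_A\mathcal C$, $q:XY\to X\otimes_AY$ is the coequalizer of $\mu Y,X\nu:XAY\to XY$. $Y\in{}_A\mathcal C$ is robust if $Mq$ is the coequalizer of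 $M\mu Y$, $MX\nu:MXAY\to MXY$ for all $M\in\mathcal C$, $X\in\mathcal C_A$. Under the present hypotheses $({}_A\mathcal C_A,\otimes_A,A)$ is monoidal. An $A$-ring is an algebra in ${}_A\mathcal C_A$; $A$-rings correspond to algebra morphisms (algebra extensions) $A\to S$ in $\mathcal C$. $YA$ is the $A$-ring corresponding to the wreath product algebra $YA$ with the extension $Ym\circ\eta_\#A$. A Frobenius $A$-ring is a Frobenius algebra in ${}_A\mathcal C_A$, and $A\to S$ is a Frobenius algebra extension if $S$ is a Frobenius algebra in ${}_A\mathcal C_A$. Frobenius (co)algebras: a coalgebra $(C,\Delta,\varepsilon)$ in a monoidal category is Frobenius if there are $t:\underline 1\to C$, $B:CC\to\underline 1$ with $CB\circ\Delta C=BC\circ C\Delta$ and $B\circ tC=\varepsilon=B\circ Ct$. Dually, an algebra $(S,m,\eta)$ is Frobenius if there are $\vartheta:S\to\underline 1$, $e:\underline 1\to SS$ with $Sm\circ eS=mS\circ Se$ and $\vartheta S\circ e=\eta=S\vartheta\circ e$. *)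

theory Defs
  imports Main
begin

section \<open>Categories, functors, adjunctions\<close>

text \<open>
  Objects and arrows are taken from carrier sets; values of the operations outside the carriers
  are irrelevant.
\<close>

record ('o, 'a) category =
  Ob :: "'o set"
  Ar :: "'a set"
  Dom :: "'a \<Rightarrow> 'o"
  Cod :: "'a \<Rightarrow> 'o"
  Id :: "'o \<Rightarrow> 'a"
  Comp :: "'a \<Rightarrow> 'a \<Rightarrow> 'a"  (infixl "\<cdot>\<index>" 55)

context fixes C :: "('o, 'a, 'z) category_scheme" (structure)
begin

definition hom :: "'o \<Rightarrow> 'o \<Rightarrow> 'a set" where
  "hom X Y = {f \<in> Ar C. Dom C f = X \<and> Cod C f = Y}"

definition is_category :: bool where
  "is_category \<longleftrightarrow>
     (\<forall>f\<in>Ar C. Dom C f \<in> Ob C \<and> Cod C f \<in> Ob C) \<and>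
     (\<forall>X\<in>Ob C. Id C X \<in> hom X X) \<and>
     (\<forall>f\<in>Ar C. \<forall>g\<in>Ar C. Dom C g = Cod C f \<longrightarrow> g \<cdot> f \<in> hom (Dom C f) (Cod C g)) \<and>
     (\<forall>f\<in>Ar C. f \<cdot> Id C (Dom C f) = f \<and> Id C (Cod C f) \<cdot> f = f) \<and>
     (\<forall>f\<in>Ar C. \<forall>g\<in>Ar C. \<forall>h\<in>Ar C. Dom C g = Cod C f \<and> Dom C h = Cod C g \<longrightarrow>
        (h \<cdot> g) \<cdot> f = h \<cdot> (g \<cdot> f))"

definition inverse_arrows :: "'a \<Rightarrow> 'a \<Rightarrow> bool" where
  "inverse_arrows f g \<longleftrightarrow>
     f \<in> Ar C \<and> g \<in> hom (Cod C f) (Dom C f) \<and>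
     g \<cdot> f = Id C (Dom C f) \<and> f \<cdot> g = Id C (Cod C f)"

definition is_iso :: "'a \<Rightarrow> bool" where
  "is_iso f \<longleftrightarrow> (\<exists>g. inverse_arrows f g)"

definition inverse_arrow :: "'a \<Rightarrow> 'a" where
  "inverse_arrow f = (THE g. inverse_arrows f g)"

definition isomorphic :: "'o \<Rightarrow> 'o \<Rightarrow> bool" where
  "isomorphic X Y \<longleftrightarrow> (\<exists>f\<in>hom X Y. is_iso f)"

definition is_coequalizer :: "'a \<Rightarrow> 'a \<Rightarrow> 'a \<Rightarrow> bool" where
  "is_coequalizer f g q \<longleftrightarrow>
     f \<in> Ar C \<and> g \<in> hom (Dom C f) (Cod C f) \<and> q \<in> Ar C \<and> Dom C q = Cod C f \<and>
     q \<cdot> f = q \<cdot> g \<and>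
     (\<forall>h\<in>Ar C. Dom C h = Cod C f \<and> h \<cdot> f = h \<cdot> g \<longrightarrow>
        (\<exists>!k. k \<in> hom (Cod C q) (Cod C h) \<and> k \<cdot> q = h))"

definition has_coequalizers :: bool where
  "has_coequalizers \<longleftrightarrow>
     (\<forall>f\<in>Ar C. \<forall>g\<in>hom (Dom C f) (Cod C f). \<exists>q. is_coequalizer f g q)"

end

definition is_functor ::
  "('o, 'a, 'z) category_scheme \<Rightarrow> ('p, 'b, 'y) category_scheme \<Rightarrow>
     ('o \<Rightarrow> 'p) \<Rightarrow> ('a \<Rightarrow> 'b) \<Rightarrow> bool" where
  "is_functor C D FO FA \<longleftrightarrow>
     (\<forall>X\<in>Ob C. FO X \<in> Ob D) \<and>
     (\<forall>f\<in>Ar C. FA f \<in> hom D (FO (Dom C f)) (FO (Cod C f))) \<and>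
     (\<forall>X\<in>Ob C. FA (Id C X) = Id D (FO X)) \<and>
     (\<forall>f\<in>Ar C. \<forall>g\<in>Ar C. Dom C g = Cod C f \<longrightarrow> FA (g \<cdot>\<^bsub>C\<^esub> f) = FA g \<cdot>\<^bsub>D\<^esub> FA f)"

text \<open>The functor \<open>(FO, FA)\<close> from \<open>C\<close> to \<open>D\<close> is left adjoint to \<open>(GO, GA)\<close>,
  with unit \<open>u\<close> and counit \<open>c\<close>.\<close>

definition is_adjunction ::
  "('o, 'a, 'z) category_scheme \<Rightarrow> ('p, 'b, 'y) category_scheme \<Rightarrow>
     ('o \<Rightarrow> 'p) \<Rightarrow> ('a \<Rightarrow> 'b) \<Rightarrow> ('p \<Rightarrow> 'o) \<Rightarrow> ('b \<Rightarrow> 'a) \<Rightarrow> bool" where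
  "is_adjunction C D FO FA GO GA \<longleftrightarrow>
     is_functor C D FO FA \<and> is_functor D C GO GA \<and>
     (\<exists>u c.
        (\<forall>X\<in>Ob C. u X \<in> hom C X (GO (FO X))) \<and>
        (\<forall>f\<in>Ar C. u (Cod C f) \<cdot>\<^bsub>C\<^esub> f = GA (FA f) \<cdot>\<^bsub>C\<^esub> u (Dom C f)) \<and>
        (\<forall>Y\<in>Ob D. c Y \<in> hom D (FO (GO Y)) Y) \<and>
        (\<forall>g\<in>Ar D. g \<cdot>\<^bsub>D\<^esub> c (Dom D g) = c (Cod D g) \<cdot>\<^bsub>D\<^esub> FA (GA g)) \<and>
        (\<forall>X\<in>Ob C. c (FO X) \<cdot>\<^bsub>D\<^esub> FA (u X) = Id D (FO X)) \<and>
        (\<forall>Y\<in>Ob D. GA (c Y) \<cdot>\<^bsub>C\<^esub> u (GO Y) = Id C (GO Y)))"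

definition frobenius_functor ::
  "('o, 'a, 'z) category_scheme \<Rightarrow> ('p, 'b, 'y) category_scheme \<Rightarrow>
     ('o \<Rightarrow> 'p) \<Rightarrow> ('a \<Rightarrow> 'b) \<Rightarrow> bool" where
  "frobenius_functor C D FO FA \<longleftrightarrow>
     (\<exists>GO GA. is_adjunction C D FO FA GO GA \<and> is_adjunction D C GO GA FO FA)"


section \<open>Monoidal categories, Frobenius algebras and coalgebras\<close>

text \<open>
  \<open>Assoc X Y Z\<close> goes from \<open>(X \<otimes> Y) \<otimes> Z\<close> to \<open>X \<otimes> (Y \<otimes> Z)\<close>, \<open>Lun X\<close> from \<open>\<one> \<otimes> X\<close> to \<open>X\<close>, and
  \<open>Run X\<close> from \<open>X \<otimes> \<one>\<close> to \<open>X\<close>.  They are needed because bimodules over an algebra form a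
  monoidal category which is not strict; in a strict monoidal category they are identities.
\<close>

record ('o, 'a) monoidal = "('o, 'a) category" +
  TenO :: "'o \<Rightarrow> 'o \<Rightarrow> 'o"  (infixr "\<otimes>\<index>" 74)
  TenA :: "'a \<Rightarrow> 'a \<Rightarrow> 'a"  (infixr "\<boxtimes>\<index>" 74)
  Unit :: 'o  ("\<one>\<index>")
  Assoc :: "'o \<Rightarrow> 'o \<Rightarrow> 'o \<Rightarrow> 'a"
  Lun :: "'o \<Rightarrow> 'a"
  Run :: "'o \<Rightarrow> 'a"

text \<open>Whiskering \<open>X \<lhd> f\<close> is \<open>X f\<close> and \<open>f \<rhd> X\<close> is \<open>f X\<close> in juxtaposition notation.  In order of
  decreasing binding strength: \<open>\<otimes>\<close>, \<open>\<rhd>\<close>, \<open>\<lhd>\<close>, \<open>\<cdot>\<close>; for example, \<open>X \<otimes> Y \<lhd> f \<rhd> Z \<cdot> g\<close> is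
  \<open>((X \<otimes> Y) \<lhd> (f \<rhd> Z)) \<cdot> g\<close>.\<close>

definition lwhisker :: "('o, 'a) monoidal \<Rightarrow> 'o \<Rightarrow> 'a \<Rightarrow> 'a"  (infixr "\<lhd>\<index>" 72) where
  "X \<lhd>\<^bsub>C\<^esub> f = Id C X \<boxtimes>\<^bsub>C\<^esub> f"

definition rwhisker :: "('o, 'a) monoidal \<Rightarrow> 'a \<Rightarrow> 'o \<Rightarrow> 'a"  (infixl "\<rhd>\<index>" 73) where
  "f \<rhd>\<^bsub>C\<^esub> X = f \<boxtimes>\<^bsub>C\<^esub> Id C X"

context fixes C :: "('o, 'a) monoidal" (structure)
begin

definition strict_monoidal_category :: bool where
  "strict_monoidal_category \<longleftrightarrow>
     is_category C \<and> \<one> \<in> Ob C \<and>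
     (\<forall>X\<in>Ob C. \<forall>Y\<in>Ob C. X \<otimes> Y \<in> Ob C) \<and>
     (\<forall>f\<in>Ar C. \<forall>g\<in>Ar C.
        f \<boxtimes> g \<in> hom C (Dom C f \<otimes> Dom C g) (Cod C f \<otimes> Cod C g)) \<and>
     (\<forall>X\<in>Ob C. \<forall>Y\<in>Ob C. Id C X \<boxtimes> Id C Y = Id C (X \<otimes> Y)) \<and>
     (\<forall>f\<in>Ar C. \<forall>g\<in>Ar C. \<forall>f'\<in>Ar C. \<forall>g'\<in>Ar C. Dom C f' = Cod C f \<and> Dom C g' = Cod C g \<longrightarrow>
        (f' \<cdot> f) \<boxtimes> (g' \<cdot> g) = (f' \<boxtimes> g') \<cdot> (f \<boxtimes> g)) \<and>
     (\<forall>X\<in>Ob C. \<forall>Y\<in>Ob C. \<forall>Z\<in>Ob C. (X \<otimes> Y) \<otimes> Z = X \<otimes> (Y \<otimes> Z)) \<and>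
     (\<forall>f\<in>Ar C. \<forall>g\<in>Ar C. \<forall>h\<in>Ar C. (f \<boxtimes> g) \<boxtimes> h = f \<boxtimes> (g \<boxtimes> h)) \<and>
     (\<forall>X\<in>Ob C. \<one> \<otimes> X = X \<and> X \<otimes> \<one> = X) \<and>
     (\<forall>f\<in>Ar C. Id C \<one> \<boxtimes> f = f \<and> f \<boxtimes> Id C \<one> = f) \<and>
     (\<forall>X\<in>Ob C. \<forall>Y\<in>Ob C. \<forall>Z\<in>Ob C. Assoc C X Y Z = Id C (X \<otimes> Y \<otimes> Z)) \<and>
     (\<forall>X\<in>Ob C. Lun C X = Id C X \<and> Run C X = Id C X)"

definition algebra :: "'o \<Rightarrow> 'a \<Rightarrow> 'a \<Rightarrow> bool" where
  "algebra S m \<eta> \<longleftrightarrow>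
     S \<in> Ob C \<and> m \<in> hom C (S \<otimes> S) S \<and> \<eta> \<in> hom C \<one> S \<and>
     m \<cdot> (m \<rhd> S) = m \<cdot> (S \<lhd> m) \<cdot> Assoc C S S S \<and>
     m \<cdot> (\<eta> \<rhd> S) = Lun C S \<and>
     m \<cdot> (S \<lhd> \<eta>) = Run C S"

definition coalgebra :: "'o \<Rightarrow> 'a \<Rightarrow> 'a \<Rightarrow> bool" where
  "coalgebra D \<Delta> \<epsilon> \<longleftrightarrow>
     D \<in> Ob C \<and> \<Delta> \<in> hom C D (D \<otimes> D) \<and> \<epsilon> \<in> hom C D \<one> \<and>
     Assoc C D D D \<cdot> (\<Delta> \<rhd> D) \<cdot> \<Delta> = (D \<lhd> \<Delta>) \<cdot> \<Delta> \<and>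
     Lun C D \<cdot> (\<epsilon> \<rhd> D) \<cdot> \<Delta> = Id C D \<and>
     Run C D \<cdot> (D \<lhd> \<epsilon>) \<cdot> \<Delta> = Id C D"

definition frobenius_algebra :: "'o \<Rightarrow> 'a \<Rightarrow> 'a \<Rightarrow> bool" where
  "frobenius_algebra S m \<eta> \<longleftrightarrow>
     algebra S m \<eta> \<and>
     (\<exists>\<theta>\<in>hom C S \<one>. \<exists>e\<in>hom C \<one> (S \<otimes> S).
        (S \<lhd> m) \<cdot> Assoc C S S S \<cdot> (e \<rhd> S) \<cdot> inverse_arrow C (Lun C S) =
        (m \<rhd> S) \<cdot> inverse_arrow C (Assoc C S S S) \<cdot> (S \<lhd> e) \<cdot> inverse_arrow C (Run C S) \<and>
        Lun C S \<cdot> (\<theta> \<rhd> S) \<cdot> e = \<eta> \<and>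
        Run C S \<cdot> (S \<lhd> \<theta>) \<cdot> e = \<eta>)"

definition frobenius_coalgebra :: "'o \<Rightarrow> 'a \<Rightarrow> 'a \<Rightarrow> bool" where
  "frobenius_coalgebra D \<Delta> \<epsilon> \<longleftrightarrow>
     coalgebra D \<Delta> \<epsilon> \<and>
     (\<exists>t\<in>hom C \<one> D. \<exists>B\<in>hom C (D \<otimes> D) \<one>.
        Run C D \<cdot> (D \<lhd> B) \<cdot> Assoc C D D D \<cdot> (\<Delta> \<rhd> D) =
        Lun C D \<cdot> (B \<rhd> D) \<cdot> inverse_arrow C (Assoc C D D D) \<cdot> (D \<lhd> \<Delta>) \<and>
        B \<cdot> (t \<rhd> D) \<cdot> inverse_arrow C (Lun C D) = \<epsilon> \<and>
        B \<cdot> (D \<lhd> t) \<cdot> inverse_arrow C (Run C D) = \<epsilon>)"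

end


section \<open>Adjoint objects, modules and bimodules in a strict monoidal category\<close>

context fixes C :: "('o, 'a) monoidal" (structure)
begin

definition adjoint_objects :: "'o \<Rightarrow> 'o \<Rightarrow> 'a \<Rightarrow> 'a \<Rightarrow> bool" where
  "adjoint_objects X Y b d \<longleftrightarrow>
     X \<in> Ob C \<and> Y \<in> Ob C \<and> b \<in> hom C \<one> (Y \<otimes> X) \<and> d \<in> hom C (X \<otimes> Y) \<one> \<and>
     (Y \<lhd> d) \<cdot> (b \<rhd> Y) = Id C Y \<and> (d \<rhd> X) \<cdot> (X \<lhd> b) = Id C X"

definition left_tensor_generator :: "'o \<Rightarrow> bool" where
  "left_tensor_generator P \<longleftrightarrow>
     P \<in> Ob C \<and>
     (\<forall>Y\<in>Ob C. \<forall>Z\<in>Ob C. \<forall>W\<in>Ob C. \<forall>f\<in>hom C (Y \<otimes> Z) W. \<forall>g\<in>hom C (Y \<otimes> Z) W.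
        (\<forall>h\<in>hom C P Y. f \<cdot> (h \<rhd> Z) = g \<cdot> (h \<rhd> Z)) \<longrightarrow> f = g)"

definition left_coflat :: "'o \<Rightarrow> bool" where
  "left_coflat X \<longleftrightarrow>
     (\<forall>f g q. is_coequalizer C f g q \<longrightarrow> is_coequalizer C (f \<rhd> X) (g \<rhd> X) (q \<rhd> X))"

definition right_module :: "'o \<Rightarrow> 'a \<Rightarrow> 'a \<Rightarrow> 'o \<Rightarrow> 'a \<Rightarrow> bool" where
  "right_module A m \<eta> M \<mu> \<longleftrightarrow>
     M \<in> Ob C \<and> \<mu> \<in> hom C (M \<otimes> A) M \<and>
     \<mu> \<cdot> (\<mu> \<rhd> A) = \<mu> \<cdot> (M \<lhd> m) \<and> \<mu> \<cdot> (M \<lhd> \<eta>) = Id C M"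

definition left_module :: "'o \<Rightarrow> 'a \<Rightarrow> 'a \<Rightarrow> 'o \<Rightarrow> 'a \<Rightarrow> bool" where
  "left_module A m \<eta> M \<nu> \<longleftrightarrow>
     M \<in> Ob C \<and> \<nu> \<in> hom C (A \<otimes> M) M \<and>
     \<nu> \<cdot> (A \<lhd> \<nu>) = \<nu> \<cdot> (m \<rhd> M) \<and> \<nu> \<cdot> (\<eta> \<rhd> M) = Id C M"

definition right_linear :: "'o \<Rightarrow> 'a \<Rightarrow> 'a \<Rightarrow> 'a \<Rightarrow> bool" where
  "right_linear A \<mu> \<mu>' f \<longleftrightarrow> f \<cdot> \<mu> = \<mu>' \<cdot> (f \<rhd> A)"

definition left_linear :: "'o \<Rightarrow> 'a \<Rightarrow> 'a \<Rightarrow> 'a \<Rightarrow> bool" where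
  "left_linear A \<nu> \<nu>' f \<longleftrightarrow> f \<cdot> \<nu> = \<nu>' \<cdot> (A \<lhd> f)"

definition robust :: "'o \<Rightarrow> 'a \<Rightarrow> 'a \<Rightarrow> 'o \<Rightarrow> 'a \<Rightarrow> bool" where
  "robust A m \<eta> Y \<nu> \<longleftrightarrow>
     (\<forall>M\<in>Ob C. \<forall>X \<mu> q. right_module A m \<eta> X \<mu> \<and> is_coequalizer C (\<mu> \<rhd> Y) (X \<lhd> \<nu>) q \<longrightarrow>
        is_coequalizer C (M \<lhd> \<mu> \<rhd> Y) (M \<otimes> X \<lhd> \<nu>) (M \<lhd> q))"

text \<open>
  In the categories of structured objects below, an arrow is a triple consisting of its source,
  the underlying arrow of \<open>C\<close>, and its target.
\<close>

definition right_modules ::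
  "'o \<Rightarrow> 'a \<Rightarrow> 'a \<Rightarrow> ('o \<times> 'a, ('o \<times> 'a) \<times> 'a \<times> ('o \<times> 'a)) category" where
  "right_modules A m \<eta> = \<lparr>
     Ob = {(M, \<mu>). right_module A m \<eta> M \<mu>},
     Ar = {((M, \<mu>), f, (N, \<mu>')). right_module A m \<eta> M \<mu> \<and> right_module A m \<eta> N \<mu>' \<and>
             f \<in> hom C M N \<and> right_linear A \<mu> \<mu>' f},
     Dom = (\<lambda>(P, f, Q). P),
     Cod = (\<lambda>(P, f, Q). Q),
     Id = (\<lambda>(M, \<mu>). ((M, \<mu>), Id C M, (M, \<mu>))),
     Comp = (\<lambda>(_, g, R) (P, f, _). (P, g \<cdot> f, R))\<rparr>"

text \<open>The category of left \<open>A\<close>-, right \<open>R\<close>-modules \<open>(M, \<nu>, \<mu>)\<close>,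
  where \<open>(A, m, \<eta>)\<close> and \<open>(R, n, \<upsilon>)\<close> are algebras.\<close>

definition bimodule ::
  "'o \<Rightarrow> 'a \<Rightarrow> 'a \<Rightarrow> 'o \<Rightarrow> 'a \<Rightarrow> 'a \<Rightarrow> 'o \<Rightarrow> 'a \<Rightarrow> 'a \<Rightarrow> bool" where
  "bimodule A m \<eta> R n \<upsilon> M \<nu> \<mu> \<longleftrightarrow>
     left_module A m \<eta> M \<nu> \<and> right_module R n \<upsilon> M \<mu> \<and> \<mu> \<cdot> (\<nu> \<rhd> R) = \<nu> \<cdot> (A \<lhd> \<mu>)"

definition bimodules ::
  "'o \<Rightarrow> 'a \<Rightarrow> 'a \<Rightarrow> 'o \<Rightarrow> 'a \<Rightarrow> 'a \<Rightarrow>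
     ('o \<times> 'a \<times> 'a, ('o \<times> 'a \<times> 'a) \<times> 'a \<times> ('o \<times> 'a \<times> 'a)) category" where
  "bimodules A m \<eta> R n \<upsilon> = \<lparr>
     Ob = {(M, \<nu>, \<mu>). bimodule A m \<eta> R n \<upsilon> M \<nu> \<mu>},
     Ar = {((M, \<nu>, \<mu>), f, (N, \<nu>', \<mu>')).
             bimodule A m \<eta> R n \<upsilon> M \<nu> \<mu> \<and> bimodule A m \<eta> R n \<upsilon> N \<nu>' \<mu>' \<and>
             f \<in> hom C M N \<and> left_linear A \<nu> \<nu>' f \<and> right_linear R \<mu> \<mu>' f},
     Dom = (\<lambda>(P, f, Q). P),
     Cod = (\<lambda>(P, f, Q). Q),
     Id = (\<lambda>(M, \<nu>, \<mu>). ((M, \<nu>, \<mu>), Id C M, (M, \<nu>, \<mu>))),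
     Comp = (\<lambda>(_, g, R) (P, f, _). (P, g \<cdot> f, R))\<rparr>"


section \<open>The monoidal category of bimodules over an algebra\<close>

text \<open>
  The tensor product over \<open>A\<close> uses a fixed choice of the coequalizer \<open>q\<close>.  The module structures on
  it, the tensor product of arrows and the structural isomorphisms are the unique arrows
  compatible with the projections \<open>q\<close>.
\<close>

definition balanced_proj :: "'o \<times> 'a \<times> 'a \<Rightarrow> 'o \<times> 'a \<times> 'a \<Rightarrow> 'a" where
  "balanced_proj = (\<lambda>(M, \<nu>, \<mu>) (N, \<nu>', \<mu>'). SOME q. is_coequalizer C (\<mu> \<rhd> N) (M \<lhd> \<nu>') q)"

definition balanced_tensor ::
  "'o \<Rightarrow> 'o \<times> 'a \<times> 'a \<Rightarrow> 'o \<times> 'a \<times> 'a \<Rightarrow> 'o \<times> 'a \<times> 'a" where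
  "balanced_tensor A = (\<lambda>(M, \<nu>, \<mu>) (N, \<nu>', \<mu>').
     let q = balanced_proj (M, \<nu>, \<mu>) (N, \<nu>', \<mu>'); Q = Cod C q
     in (Q,
         THE l. l \<in> hom C (A \<otimes> Q) Q \<and> l \<cdot> (A \<lhd> q) = q \<cdot> (\<nu> \<rhd> N),
         THE r. r \<in> hom C (Q \<otimes> A) Q \<and> r \<cdot> (q \<rhd> A) = q \<cdot> (M \<lhd> \<mu>')))"

definition bimodules_monoidal ::
  "'o \<Rightarrow> 'a \<Rightarrow> 'a \<Rightarrow>
     ('o \<times> 'a \<times> 'a, ('o \<times> 'a \<times> 'a) \<times> 'a \<times> ('o \<times> 'a \<times> 'a)) monoidal" where
  "bimodules_monoidal A m \<eta> = category.extend (bimodules A m \<eta> A m \<eta>) (monoidal.fields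
     (balanced_tensor A)
     (\<lambda>(P, f, P') (Q, g, Q').
        (balanced_tensor A P Q,
         THE h. h \<in> hom C (fst (balanced_tensor A P Q)) (fst (balanced_tensor A P' Q')) \<and>
                h \<cdot> balanced_proj P Q = balanced_proj P' Q' \<cdot> (f \<boxtimes> g),
         balanced_tensor A P' Q'))
     (A, m, m)
     (\<lambda>P Q R.
        let PQ = balanced_tensor A P Q; QR = balanced_tensor A Q R;
            S = balanced_tensor A PQ R; T = balanced_tensor A P QR
        in (S,
            THE a. a \<in> hom C (fst S) (fst T) \<and>
                   a \<cdot> balanced_proj PQ R \<cdot> (balanced_proj P Q \<rhd> fst R) =
                   balanced_proj P QR \<cdot> (fst P \<lhd> balanced_proj Q R),
            T))
     (\<lambda>(M, \<nu>, \<mu>).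
        let S = balanced_tensor A (A, m, m) (M, \<nu>, \<mu>)
        in (S, THE l. l \<in> hom C (fst S) M \<and> l \<cdot> balanced_proj (A, m, m) (M, \<nu>, \<mu>) = \<nu>,
            (M, \<nu>, \<mu>)))
     (\<lambda>(M, \<nu>, \<mu>).
        let S = balanced_tensor A (M, \<nu>, \<mu>) (A, m, m)
        in (S, THE r. r \<in> hom C (fst S) M \<and> r \<cdot> balanced_proj (M, \<nu>, \<mu>) (A, m, m) = \<mu>,
            (M, \<nu>, \<mu>))))"


section \<open>Rings over an algebra and algebra extensions\<close>

text \<open>
  An \<open>A\<close>-ring consists of a bimodule together with a multiplication and a unit in the monoidal
  category of bimodules.
\<close>

definition frobenius_ring ::
  "'o \<Rightarrow> 'a \<Rightarrow> 'a \<Rightarrow> 'o \<times> 'a \<times> 'a \<Rightarrow>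
     ('o \<times> 'a \<times> 'a) \<times> 'a \<times> ('o \<times> 'a \<times> 'a) \<Rightarrow>
     ('o \<times> 'a \<times> 'a) \<times> 'a \<times> ('o \<times> 'a \<times> 'a) \<Rightarrow> bool" where
  "frobenius_ring A m \<eta> S mS uS \<longleftrightarrow> frobenius_algebra (bimodules_monoidal A m \<eta>) S mS uS"

definition algebra_morphism ::
  "'o \<Rightarrow> 'a \<Rightarrow> 'a \<Rightarrow> 'o \<Rightarrow> 'a \<Rightarrow> 'a \<Rightarrow> 'a \<Rightarrow> bool" where
  "algebra_morphism A m \<eta> S n \<upsilon> i \<longleftrightarrow>
     i \<in> hom C A S \<and> i \<cdot> m = n \<cdot> (i \<boxtimes> i) \<and> i \<cdot> \<eta> = \<upsilon>"

text \<open>The \<open>A\<close>-ring corresponding to an algebra morphism \<open>i\<close> from \<open>A\<close> to \<open>(S, n, \<upsilon>)\<close>: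
  the underlying bimodule is \<open>S\<close> with the actions obtained by restriction along \<open>i\<close>, the
  multiplication is the factorization of \<open>n\<close> through the tensor product over \<open>A\<close>, and the unit
  is \<open>i\<close>.\<close>

definition extension_bimodule :: "'o \<Rightarrow> 'a \<Rightarrow> 'a \<Rightarrow> 'o \<times> 'a \<times> 'a" where
  "extension_bimodule S n i = (S, n \<cdot> (i \<rhd> S), n \<cdot> (S \<lhd> i))"

definition extension_mult ::
  "'o \<Rightarrow> 'o \<Rightarrow> 'a \<Rightarrow> 'a \<Rightarrow> ('o \<times> 'a \<times> 'a) \<times> 'a \<times> ('o \<times> 'a \<times> 'a)" where
  "extension_mult A S n i =
     (let P = extension_bimodule S n i; PP = balanced_tensor A P P
      in (PP, THE h. h \<in> hom C (fst PP) S \<and> h \<cdot> balanced_proj P P = n, P))"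

definition extension_unit ::
  "'o \<Rightarrow> 'a \<Rightarrow> 'o \<Rightarrow> 'a \<Rightarrow> 'a \<Rightarrow> ('o \<times> 'a \<times> 'a) \<times> 'a \<times> ('o \<times> 'a \<times> 'a)" where
  "extension_unit A m S n i = ((A, m, m), i, extension_bimodule S n i)"

definition frobenius_extension ::
  "'o \<Rightarrow> 'a \<Rightarrow> 'a \<Rightarrow> 'o \<Rightarrow> 'a \<Rightarrow> 'a \<Rightarrow> 'a \<Rightarrow> bool" where
  "frobenius_extension A m \<eta> S n \<upsilon> i \<longleftrightarrow>
     algebra C S n \<upsilon> \<and> algebra_morphism A m \<eta> S n \<upsilon> i \<and>
     frobenius_algebra (bimodules_monoidal A m \<eta>)
       (extension_bimodule S n i) (extension_mult A S n i) (extension_unit A m S n i)"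


section \<open>The categories of transfer morphisms\<close>

text \<open>\<open>right_transfer\<close> is the category usually written with \<open>A\<close> and \<open>#\<close> to the right of
  \<open>\<T>\<close>, and \<open>left_transfer\<close> is its mirror image.  Both are strict monoidal.\<close>

definition is_right_transfer :: "'o \<Rightarrow> 'a \<Rightarrow> 'a \<Rightarrow> 'o \<Rightarrow> 'a \<Rightarrow> bool" where
  "is_right_transfer A m \<eta> X \<psi> \<longleftrightarrow>
     X \<in> Ob C \<and> \<psi> \<in> hom C (X \<otimes> A) (A \<otimes> X) \<and>
     \<psi> \<cdot> (X \<lhd> m) = (m \<rhd> X) \<cdot> (A \<lhd> \<psi>) \<cdot> (\<psi> \<rhd> A) \<and>
     \<psi> \<cdot> (X \<lhd> \<eta>) = \<eta> \<rhd> X"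

definition right_transfer ::
  "'o \<Rightarrow> 'a \<Rightarrow> 'a \<Rightarrow> ('o \<times> 'a, ('o \<times> 'a) \<times> 'a \<times> ('o \<times> 'a)) monoidal" where
  "right_transfer A m \<eta> =
     (let ten = \<lambda>(X, \<psi>) (Y, \<psi>'). (X \<otimes> Y, (\<psi> \<rhd> Y) \<cdot> (X \<lhd> \<psi>'));
          ident = \<lambda>(X, \<psi>). ((X, \<psi>), \<eta> \<rhd> X, (X, \<psi>))
      in \<lparr>
     Ob = {(X, \<psi>). is_right_transfer A m \<eta> X \<psi>},
     Ar = {((X, \<psi>), f, (Y, \<psi>')). is_right_transfer A m \<eta> X \<psi> \<and> is_right_transfer A m \<eta> Y \<psi>' \<and>
             f \<in> hom C X (A \<otimes> Y) \<and>
             (m \<rhd> Y) \<cdot> (A \<lhd> f) \<cdot> \<psi> = (m \<rhd> Y) \<cdot> (A \<lhd> \<psi>') \<cdot> (f \<rhd> A)},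
     Dom = (\<lambda>(P, f, Q). P),
     Cod = (\<lambda>(P, f, Q). Q),
     Id = ident,
     Comp = (\<lambda>(_, g, (Z, \<psi>'')) (P, f, _). (P, (m \<rhd> Z) \<cdot> (A \<lhd> g) \<cdot> f, (Z, \<psi>''))),
     TenO = ten,
     TenA = (\<lambda>(P, f, (X', \<psi>)) (Q, g, (Y', \<psi>')).
               (ten P Q, (m \<rhd> X' \<otimes> Y') \<cdot> (A \<lhd> \<psi> \<rhd> Y') \<cdot> (f \<boxtimes> g), ten (X', \<psi>) (Y', \<psi>'))),
     Unit = (\<one>, Id C A),
     Assoc = (\<lambda>P Q R. ident (ten P (ten Q R))),
     Lun = ident,
     Run = ident\<rparr>)"

definition is_left_transfer :: "'o \<Rightarrow> 'a \<Rightarrow> 'a \<Rightarrow> 'o \<Rightarrow> 'a \<Rightarrow> bool" where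
  "is_left_transfer A m \<eta> Y \<phi> \<longleftrightarrow>
     Y \<in> Ob C \<and> \<phi> \<in> hom C (A \<otimes> Y) (Y \<otimes> A) \<and>
     \<phi> \<cdot> (m \<rhd> Y) = (Y \<lhd> m) \<cdot> (\<phi> \<rhd> A) \<cdot> (A \<lhd> \<phi>) \<and>
     \<phi> \<cdot> (\<eta> \<rhd> Y) = Y \<lhd> \<eta>"

definition left_transfer ::
  "'o \<Rightarrow> 'a \<Rightarrow> 'a \<Rightarrow> ('o \<times> 'a, ('o \<times> 'a) \<times> 'a \<times> ('o \<times> 'a)) monoidal" where
  "left_transfer A m \<eta> =
     (let ten = \<lambda>(X, \<phi>) (Y, \<phi>'). (X \<otimes> Y, (X \<lhd> \<phi>') \<cdot> (\<phi> \<rhd> Y));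
          ident = \<lambda>(X, \<phi>). ((X, \<phi>), X \<lhd> \<eta>, (X, \<phi>))
      in \<lparr>
     Ob = {(X, \<phi>). is_left_transfer A m \<eta> X \<phi>},
     Ar = {((X, \<phi>), f, (Y, \<phi>')). is_left_transfer A m \<eta> X \<phi> \<and> is_left_transfer A m \<eta> Y \<phi>' \<and>
             f \<in> hom C X (Y \<otimes> A) \<and>
             (Y \<lhd> m) \<cdot> (f \<rhd> A) \<cdot> \<phi> = (Y \<lhd> m) \<cdot> (\<phi>' \<rhd> A) \<cdot> (A \<lhd> f)},
     Dom = (\<lambda>(P, f, Q). P),
     Cod = (\<lambda>(P, f, Q). Q),
     Id = ident,
     Comp = (\<lambda>(_, g, (Z, \<phi>'')) (P, f, _). (P, (Z \<lhd> m) \<cdot> (g \<rhd> A) \<cdot> f, (Z, \<phi>''))),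
     TenO = ten,
     TenA = (\<lambda>(P, f, (X', \<phi>)) (Q, g, (Y', \<phi>')).
               (ten P Q, (X' \<otimes> Y' \<lhd> m) \<cdot> (X' \<lhd> \<phi>' \<rhd> A) \<cdot> (f \<boxtimes> g), ten (X', \<phi>) (Y', \<phi>'))),
     Unit = (\<one>, Id C A),
     Assoc = (\<lambda>P Q R. ident (ten P (ten Q R))),
     Lun = ident,
     Run = ident\<rparr>)"


section \<open>Cowreaths and entwined modules\<close>

definition cowreath_comult ::
  "'o \<Rightarrow> 'a \<Rightarrow> 'a \<Rightarrow> 'o \<Rightarrow> 'a \<Rightarrow> 'a \<Rightarrow> ('o \<times> 'a) \<times> 'a \<times> ('o \<times> 'a)" where
  "cowreath_comult A m \<eta> X \<psi> \<delta> = ((X, \<psi>), \<delta>, (X, \<psi>) \<otimes>\<^bsub>right_transfer A m \<eta>\<^esub> (X, \<psi>))"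

definition cowreath_counit ::
  "'o \<Rightarrow> 'a \<Rightarrow> 'a \<Rightarrow> 'o \<Rightarrow> 'a \<Rightarrow> 'a \<Rightarrow> ('o \<times> 'a) \<times> 'a \<times> ('o \<times> 'a)" where
  "cowreath_counit A m \<eta> X \<psi> \<epsilon> = ((X, \<psi>), \<epsilon>, \<one>\<^bsub>right_transfer A m \<eta>\<^esub>)"

definition cowreath ::
  "'o \<Rightarrow> 'a \<Rightarrow> 'a \<Rightarrow> 'o \<Rightarrow> 'a \<Rightarrow> 'a \<Rightarrow> 'a \<Rightarrow> bool" where
  "cowreath A m \<eta> X \<psi> \<delta> \<epsilon> \<longleftrightarrow>
     algebra C A m \<eta> \<and>
     coalgebra (right_transfer A m \<eta>) (X, \<psi>)
       (cowreath_comult A m \<eta> X \<psi> \<delta>) (cowreath_counit A m \<eta> X \<psi> \<epsilon>)"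

definition entwined_module ::
  "'o \<Rightarrow> 'a \<Rightarrow> 'a \<Rightarrow> 'o \<Rightarrow> 'a \<Rightarrow> 'a \<Rightarrow> 'a \<Rightarrow> 'o \<Rightarrow> 'a \<Rightarrow> 'a \<Rightarrow> bool" where
  "entwined_module A m \<eta> X \<psi> \<delta> \<epsilon> M \<mu> \<rho> \<longleftrightarrow>
     right_module A m \<eta> M \<mu> \<and> \<rho> \<in> hom C M (M \<otimes> X) \<and>
     \<rho> \<cdot> \<mu> = (\<mu> \<rhd> X) \<cdot> (M \<lhd> \<psi>) \<cdot> (\<rho> \<rhd> A) \<and>
     (\<rho> \<rhd> X) \<cdot> \<rho> = (\<mu> \<rhd> X \<otimes> X) \<cdot> (M \<lhd> \<delta>) \<cdot> \<rho> \<and>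
     \<mu> \<cdot> (M \<lhd> \<epsilon>) \<cdot> \<rho> = Id C M"

definition entwined_modules ::
  "'o \<Rightarrow> 'a \<Rightarrow> 'a \<Rightarrow> 'o \<Rightarrow> 'a \<Rightarrow> 'a \<Rightarrow> 'a \<Rightarrow>
     ('o \<times> 'a \<times> 'a, ('o \<times> 'a \<times> 'a) \<times> 'a \<times> ('o \<times> 'a \<times> 'a)) category" where
  "entwined_modules A m \<eta> X \<psi> \<delta> \<epsilon> = \<lparr>
     Ob = {(M, \<mu>, \<rho>). entwined_module A m \<eta> X \<psi> \<delta> \<epsilon> M \<mu> \<rho>},
     Ar = {((M, \<mu>, \<rho>), f, (N, \<mu>', \<rho>')).
             entwined_module A m \<eta> X \<psi> \<delta> \<epsilon> M \<mu> \<rho> \<and> entwined_module A m \<eta> X \<psi> \<delta> \<epsilon> N \<mu>' \<rho>' \<and>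
             f \<in> hom C M N \<and> right_linear A \<mu> \<mu>' f \<and> (f \<rhd> X) \<cdot> \<rho> = \<rho>' \<cdot> f},
     Dom = (\<lambda>(P, f, Q). P),
     Cod = (\<lambda>(P, f, Q). Q),
     Id = (\<lambda>(M, \<mu>, \<rho>). ((M, \<mu>, \<rho>), Id C M, (M, \<mu>, \<rho>))),
     Comp = (\<lambda>(_, g, R) (P, f, _). (P, g \<cdot> f, R))\<rparr>"


section \<open>The algebra on the adjoint object and the wreath product\<close>

definition dual_transfer :: "'o \<Rightarrow> 'o \<Rightarrow> 'a \<Rightarrow> 'o \<Rightarrow> 'a \<Rightarrow> 'a \<Rightarrow> 'a" where
  "dual_transfer A X \<psi> Y b d = (Y \<otimes> A \<lhd> d) \<cdot> (Y \<lhd> \<psi> \<rhd> Y) \<cdot> (b \<rhd> A \<otimes> Y)"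

text \<open>The multiplication uses \<open>d \<cdot> (X \<lhd> d \<rhd> Y)\<close>, the evaluation of \<open>X X\<close> against \<open>Y Y\<close>.\<close>

definition dual_mult ::
  "'o \<Rightarrow> 'a \<Rightarrow> 'a \<Rightarrow> 'o \<Rightarrow> 'a \<Rightarrow> 'a \<Rightarrow> 'o \<Rightarrow> 'a \<Rightarrow> 'a \<Rightarrow>
     ('o \<times> 'a) \<times> 'a \<times> ('o \<times> 'a)" where
  "dual_mult A m \<eta> X \<psi> \<delta> Y b d =
     (let P = (Y, dual_transfer A X \<psi> Y b d)
      in (P \<otimes>\<^bsub>left_transfer A m \<eta>\<^esub> P,
          (Y \<otimes> A \<lhd> (d \<cdot> (X \<lhd> d \<rhd> Y))) \<cdot> (Y \<lhd> \<delta> \<rhd> Y \<otimes> Y) \<cdot> (b \<rhd> Y \<otimes> Y),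
          P))"

definition dual_unit ::
  "'o \<Rightarrow> 'a \<Rightarrow> 'a \<Rightarrow> 'o \<Rightarrow> 'a \<Rightarrow> 'a \<Rightarrow> 'o \<Rightarrow> 'a \<Rightarrow> 'a \<Rightarrow>
     ('o \<times> 'a) \<times> 'a \<times> ('o \<times> 'a)" where
  "dual_unit A m \<eta> X \<psi> \<epsilon> Y b d =
     (\<one>\<^bsub>left_transfer A m \<eta>\<^esub>, (Y \<lhd> \<epsilon>) \<cdot> b, (Y, dual_transfer A X \<psi> Y b d))"

definition wreath_mult :: "'o \<Rightarrow> 'a \<Rightarrow> 'o \<Rightarrow> 'a \<Rightarrow> 'a \<Rightarrow> 'o \<Rightarrow> 'a \<Rightarrow> 'a \<Rightarrow> 'a" where
  "wreath_mult A m X \<psi> \<delta> Y b d =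
     (Y \<lhd> m) \<cdot> (Y \<lhd> m \<rhd> A) \<cdot> (Y \<otimes> A \<otimes> A \<lhd> d \<rhd> A) \<cdot> (Y \<otimes> A \<lhd> \<psi> \<rhd> Y \<otimes> A) \<cdot>
     (Y \<otimes> A \<otimes> X \<lhd> d \<rhd> A \<otimes> Y \<otimes> A) \<cdot> (Y \<lhd> \<delta> \<rhd> Y \<otimes> A \<otimes> Y \<otimes> A) \<cdot> (b \<rhd> Y \<otimes> A \<otimes> Y \<otimes> A)"

definition wreath_unit :: "'a \<Rightarrow> 'o \<Rightarrow> 'a \<Rightarrow> 'a" where
  "wreath_unit \<epsilon> Y b = (Y \<lhd> \<epsilon>) \<cdot> b"

definition wreath_extension :: "'o \<Rightarrow> 'a \<Rightarrow> 'a \<Rightarrow> 'o \<Rightarrow> 'a \<Rightarrow> 'a" where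
  "wreath_extension A m \<epsilon> Y b = (Y \<lhd> m) \<cdot> (wreath_unit \<epsilon> Y b \<rhd> A)"

definition wreath_left_action :: "'o \<Rightarrow> 'a \<Rightarrow> 'o \<Rightarrow> 'a \<Rightarrow> 'o \<Rightarrow> 'a \<Rightarrow> 'a \<Rightarrow> 'a" where
  "wreath_left_action A m X \<psi> Y b d = (Y \<lhd> m) \<cdot> (dual_transfer A X \<psi> Y b d \<rhd> A)"

text \<open>The passage from entwined modules \<open>(M, \<mu>, \<rho>)\<close> to right modules over the wreath product,
  and back from right modules \<open>(M, \<omega>)\<close> over the wreath product to entwined modules.\<close>

definition entwined_to_wreath :: "'o \<Rightarrow> 'o \<Rightarrow> 'a \<Rightarrow> 'o \<times> 'a \<times> 'a \<Rightarrow> 'o \<times> 'a" where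
  "entwined_to_wreath A Y d = (\<lambda>(M, \<mu>, \<rho>). (M, \<mu> \<cdot> (M \<lhd> d \<rhd> A) \<cdot> (\<rho> \<rhd> Y \<otimes> A)))"

definition wreath_to_entwined ::
  "'o \<Rightarrow> 'a \<Rightarrow> 'a \<Rightarrow> 'o \<Rightarrow> 'a \<Rightarrow> 'o \<Rightarrow> 'a \<Rightarrow> 'o \<times> 'a \<Rightarrow> 'o \<times> 'a \<times> 'a" where
  "wreath_to_entwined A m \<eta> X \<epsilon> Y b = (\<lambda>(M, \<omega>).
     (M, \<omega> \<cdot> (M \<otimes> Y \<lhd> m) \<cdot> (M \<otimes> Y \<lhd> \<epsilon> \<rhd> A) \<cdot> (M \<lhd> b \<rhd> A),
         (\<omega> \<rhd> X) \<cdot> (M \<otimes> Y \<lhd> \<eta> \<rhd> X) \<cdot> (M \<lhd> b)))"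

definition AX_entwined :: "'o \<Rightarrow> 'a \<Rightarrow> 'o \<Rightarrow> 'a \<Rightarrow> 'a \<Rightarrow> 'o \<times> 'a \<times> 'a" where
  "AX_entwined A m X \<psi> \<delta> =
     (A \<otimes> X, (m \<rhd> X) \<cdot> (A \<lhd> \<psi>), (m \<rhd> X \<otimes> X) \<cdot> (A \<lhd> \<delta>))"

text \<open>\<open>A X\<close> and \<open>Y A\<close> as left \<open>A\<close>-, right \<open>Y A\<close>-modules.\<close>

definition AX_bimodule ::
  "'o \<Rightarrow> 'a \<Rightarrow> 'o \<Rightarrow> 'a \<Rightarrow> 'a \<Rightarrow> 'o \<Rightarrow> 'a \<Rightarrow> 'o \<times> 'a \<times> 'a" where
  "AX_bimodule A m X \<psi> \<delta> Y d =
     (A \<otimes> X, m \<rhd> X, snd (entwined_to_wreath A Y d (AX_entwined A m X \<psi> \<delta>)))"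

definition YA_bimodule ::
  "'o \<Rightarrow> 'a \<Rightarrow> 'o \<Rightarrow> 'a \<Rightarrow> 'a \<Rightarrow> 'o \<Rightarrow> 'a \<Rightarrow> 'a \<Rightarrow> 'o \<times> 'a \<times> 'a" where
  "YA_bimodule A m X \<psi> \<delta> Y b d =
     (Y \<otimes> A, wreath_left_action A m X \<psi> Y b d, wreath_mult A m X \<psi> \<delta> Y b d)"

definition YA_entwined ::
  "'o \<Rightarrow> 'a \<Rightarrow> 'a \<Rightarrow> 'o \<Rightarrow> 'a \<Rightarrow> 'a \<Rightarrow> 'a \<Rightarrow> 'o \<Rightarrow> 'a \<Rightarrow> 'a \<Rightarrow> 'o \<times> 'a \<times> 'a" where
  "YA_entwined A m \<eta> X \<psi> \<delta> \<epsilon> Y b d =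
     wreath_to_entwined A m \<eta> X \<epsilon> Y b (Y \<otimes> A, wreath_mult A m X \<psi> \<delta> Y b d)"

end

definition forget_object :: "'o \<times> 'a \<times> 'a \<Rightarrow> 'o \<times> 'a" where
  "forget_object = (\<lambda>(M, \<mu>, \<rho>). (M, \<mu>))"

definition forget_arrow ::
  "('o \<times> 'a \<times> 'a) \<times> 'a \<times> ('o \<times> 'a \<times> 'a) \<Rightarrow> ('o \<times> 'a) \<times> 'a \<times> ('o \<times> 'a)" where
  "forget_arrow = (\<lambda>(P, f, Q). (forget_object P, f, forget_object Q))"

end

theory Submission
  imports Defs
begin

text \<open>
  A Frobenius structure on the coalgebra \<open>(X, \<psi>)\<close> amounts to a self-duality of \<open>(X, \<psi>)\<close> whose evaluation \<open>B\<close> is a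
  Casimir morphism, and equally to one whose coevaluation \<open>s\<close> is the comultiplication applied to a morphism \<open>t\<close> from
  the unit object.  Such \<open>s\<close> and \<open>B\<close> correspond bijectively to the \<open>A\<close>-bimodule morphisms \<open>YA \<rightarrow> AX\<close> and \<open>AX \<rightarrow> YA\<close>,
  and the two conditions of a self-duality say that these are inverse to each other.  This gives (vii) and (viii).
  The morphism \<open>AX \<rightarrow> YA\<close> given by \<open>B\<close> is colinear if and only if \<open>B\<close> is Casimir, which gives (vi), and linearity over
  the wreath product is the same as linearity over \<open>A\<close> together with colinearity, which gives (v).

  Transposition along the adjunction of \<open>X\<close> and \<open>Y\<close> reverses arrows and tensor products, and turns a Frobenius system of \<open>(X, \<psi>)\<close> into
  one of \<open>(Y, \<phi>)\<close>, hence (iii).  As \<open>YA\<close> is free as a right \<open>A\<close>-module, its tensor product over \<open>A\<close> with \<open>N\<close> is \<open>YN\<close>;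
  under this identification the Frobenius systems of the \<open>A\<close>-ring \<open>YA\<close> are those of \<open>(Y, \<phi>)\<close>, hence (ii) and (iv).

  The forgetful functor is left adjoint to \<open>M \<mapsto> MX\<close>, so (ix) asks for the opposite adjunction.  Its unit and counit
  are built from \<open>t\<close> and \<open>B\<close>; conversely, naturality with respect to morphisms out of free modules, tested on the
  generator, shows that they are determined by their components at \<open>A\<close> and \<open>AX\<close>, and from these \<open>t\<close> and \<open>B\<close> are recovered.
\<close>

section \<open>Rewriting string diagrams\<close>

text \<open>The main obstacle is bookkeeping: almost every step is an identity between long
  composites that agree only up to interchange, associativity and units. Strictness turns a tensor
  product of objects into a list and a composite into a list of layers, so an identity is certified
  by a list of rewriting steps whose soundness is proved once. Since both transfer categories are
  again strict monoidal, the facts on Frobenius objects are proved for an arbitrary strict monoidal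
  category and then instantiated; the left transfer category arises from the right one by reversing
  the tensor product. The category of bimodules is not strict, and its tensor product is known only
  through a choice of coequalizer and definite descriptions. It is not shown to be monoidal; instead
  the five tensor products that occur are computed. Inserting the unit of \<open>A\<close> gives a
  section of each projection, and a split projection can be cancelled after whiskering on either
  side. In (ix) the right adjoint is only asserted to exist, so uniqueness of right adjoints is used
  to move the second adjunction to the functor \<open>M \<mapsto> M X\<close>.\<close>

type_synonym ('o, 'a) layer = "'o list \<times> 'o list \<times> 'a \<times> 'o list \<times> 'o list"

text \<open>\<open>Right i\<close> and \<open>Left i\<close> interchange the layers \<open>i\<close> and \<open>i + 1\<close> of a diagram, where the second one lies to the right,
  respectively left, of the first.  \<open>Apply k i n\<close> replaces the left-hand side of rule \<open>k\<close>, found from layer \<open>i\<close>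
  onwards with \<open>n\<close> objects to its left, by the right-hand side; \<open>Undo\<close> goes in the other direction.\<close>

datatype step = Right nat | Left nat | Apply nat nat nat | Undo nat nat nat

section \<open>Elementary laws of categories and strict monoidal categories\<close>

locale category_structure =
  fixes D :: "('o, 'a, 'z) category_scheme" (structure)
  assumes category: "is_category D"
begin

lemma homD: "f \<in> hom D X Y \<Longrightarrow> f \<in> Ar D \<and> Dom D f = X \<and> Cod D f = Y \<and> X \<in> Ob D \<and> Y \<in> Ob D"
  using category by (auto simp: hom_def is_category_def)

lemma comp_in_hom [intro]: "f \<in> hom D X Y \<Longrightarrow> g \<in> hom D Y Z \<Longrightarrow> g \<cdot> f \<in> hom D X Z"
  using category unfolding hom_def is_category_def by simp

lemma Id_in_hom [intro]: "X \<in> Ob D \<Longrightarrow> Id D X \<in> hom D X X"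
  using category by (simp add: is_category_def)

lemma comp_Id: "f \<in> hom D X Y \<Longrightarrow> f \<cdot> Id D X = f"
  and Id_comp: "f \<in> hom D X Y \<Longrightarrow> Id D Y \<cdot> f = f"
  using category by (auto simp: hom_def is_category_def)

lemma comp_assoc:
  "f \<in> hom D X Y \<Longrightarrow> g \<in> hom D Y Z \<Longrightarrow> h \<in> hom D Z W \<Longrightarrow> (h \<cdot> g) \<cdot> f = h \<cdot> (g \<cdot> f)"
  using category unfolding hom_def is_category_def by simp

end

locale strict_monoidal =
  fixes C :: "('o, 'a) monoidal" (structure)
  assumes strict_monoidal: "strict_monoidal_category C"

sublocale strict_monoidal \<subseteq> category_structure C
  using strict_monoidal by unfold_locales (simp add: strict_monoidal_category_def)

context strict_monoidal
begin

lemma unit_in_Ob [simp, intro]: "\<one> \<in> Ob C"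
  and ten_in_Ob [simp, intro]: "X \<in> Ob C \<Longrightarrow> Y \<in> Ob C \<Longrightarrow> X \<otimes> Y \<in> Ob C"
  and ten_assoc: "X \<in> Ob C \<Longrightarrow> Y \<in> Ob C \<Longrightarrow> Z \<in> Ob C \<Longrightarrow> (X \<otimes> Y) \<otimes> Z = X \<otimes> (Y \<otimes> Z)"
  and unit_ten [simp]: "X \<in> Ob C \<Longrightarrow> \<one> \<otimes> X = X" "X \<in> Ob C \<Longrightarrow> X \<otimes> \<one> = X"
  and Id_tenA: "X \<in> Ob C \<Longrightarrow> Y \<in> Ob C \<Longrightarrow> Id C X \<boxtimes> Id C Y = Id C (X \<otimes> Y)"
  and Assoc_eq: "X \<in> Ob C \<Longrightarrow> Y \<in> Ob C \<Longrightarrow> Z \<in> Ob C \<Longrightarrow> Assoc C X Y Z = Id C (X \<otimes> Y \<otimes> Z)"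
  and Lun_eq: "X \<in> Ob C \<Longrightarrow> Lun C X = Id C X"
  and Run_eq: "X \<in> Ob C \<Longrightarrow> Run C X = Id C X"
  using strict_monoidal by (simp_all add: strict_monoidal_category_def)

lemma tenA_in_hom: "f \<in> hom C X X' \<Longrightarrow> g \<in> hom C Y Y' \<Longrightarrow> f \<boxtimes> g \<in> hom C (X \<otimes> Y) (X' \<otimes> Y')"
  using strict_monoidal by (auto simp: strict_monoidal_category_def hom_def)

lemma tenA_comp:
  "f \<in> hom C X X' \<Longrightarrow> g \<in> hom C Y Y' \<Longrightarrow> f' \<in> hom C X' X'' \<Longrightarrow> g' \<in> hom C Y' Y'' \<Longrightarrow>
     (f' \<cdot> f) \<boxtimes> (g' \<cdot> g) = (f' \<boxtimes> g') \<cdot> (f \<boxtimes> g)"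
  using strict_monoidal by (simp add: strict_monoidal_category_def hom_def)

lemma tenA_assoc:
  "f \<in> hom C X X' \<Longrightarrow> g \<in> hom C Y Y' \<Longrightarrow> h \<in> hom C Z Z' \<Longrightarrow> (f \<boxtimes> g) \<boxtimes> h = f \<boxtimes> (g \<boxtimes> h)"
  using strict_monoidal by (simp add: strict_monoidal_category_def hom_def)

lemma tenA_unit: "f \<in> hom C X X' \<Longrightarrow> Id C \<one> \<boxtimes> f = f" "f \<in> hom C X X' \<Longrightarrow> f \<boxtimes> Id C \<one> = f"
  using strict_monoidal by (simp_all add: strict_monoidal_category_def hom_def)

text \<open>This and \<open>tenA_eq'\<close> are the two readings of a tensor product as a composite
  of whiskerings; their agreement is the interchange law behind \<open>Right\<close> and
  \<open>Left\<close>.\<close>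

lemma tenA_eq: "f \<in> hom C X X' \<Longrightarrow> g \<in> hom C Y Y' \<Longrightarrow> f \<boxtimes> g = (X' \<lhd> g) \<cdot> (f \<rhd> Y)"
  using tenA_comp[of f X X' "Id C Y" Y Y "Id C X'" X' g Y'] homD[of f X X'] homD[of g Y Y']
  by (simp add: lwhisker_def rwhisker_def Id_comp comp_Id Id_in_hom)

lemma tenA_eq': "f \<in> hom C X X' \<Longrightarrow> g \<in> hom C Y Y' \<Longrightarrow> f \<boxtimes> g = (f \<rhd> Y') \<cdot> (X \<lhd> g)"
  using tenA_comp[of "Id C X" X X g Y Y' f X' "Id C Y'" Y'] homD[of f X X'] homD[of g Y Y']
  by (simp add: lwhisker_def rwhisker_def Id_comp comp_Id Id_in_hom)

section \<open>Words of objects, layers and diagrams\<close>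

definition obj :: "'o list \<Rightarrow> 'o" where
  "obj w = foldr (\<lambda>X Y. X \<otimes> Y) w \<one>"

lemma obj_simps [simp]: "obj [] = \<one>" "obj (X # w) = X \<otimes> obj w"
  by (simp_all add: obj_def)

lemma obj_in_Ob [simp]: "set w \<subseteq> Ob C \<Longrightarrow> obj w \<in> Ob C"
  by (induction w) auto

text \<open>The trailing unit object of \<open>obj v\<close> is absorbed by strictness. This is what
  turns associativity and unit laws for objects into equality of lists.\<close>

lemma obj_append: "set v \<subseteq> Ob C \<Longrightarrow> set w \<subseteq> Ob C \<Longrightarrow> obj (v @ w) = obj v \<otimes> obj w"
  by (induction v) (auto simp: ten_assoc)

text \<open>A layer \<open>(l, u, f, v, r)\<close> is the arrow \<open>f\<close> from \<open>u\<close> to \<open>v\<close>, whiskered by the words \<open>rev l\<close>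
  and \<open>r\<close>.\<close>

fun layer_arrow :: "('o, 'a) layer \<Rightarrow> 'a" where
  "layer_arrow (l, u, f, v, r) = Id C (obj (rev l)) \<boxtimes> f \<boxtimes> Id C (obj r)"

fun layer_dom :: "('o, 'a) layer \<Rightarrow> 'o list" where
  "layer_dom (l, u, f, v, r) = rev l @ u @ r"

fun layer_cod :: "('o, 'a) layer \<Rightarrow> 'o list" where
  "layer_cod (l, u, f, v, r) = rev l @ v @ r"

fun layer_ok :: "('o, 'a) layer \<Rightarrow> bool" where
  "layer_ok (l, u, f, v, r) \<longleftrightarrow>
     set l \<subseteq> Ob C \<and> set u \<subseteq> Ob C \<and> set v \<subseteq> Ob C \<and> set r \<subseteq> Ob C \<and> f \<in> hom C (obj u) (obj v)"

text \<open>Composability is equality of words, not of the objects they denote, so that it can be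
  checked by computing with lists. Typing of every layer is part of the predicate.\<close>

fun path :: "'o list \<Rightarrow> ('o, 'a) layer list \<Rightarrow> 'o list \<Rightarrow> bool" where
  "path w [] w' \<longleftrightarrow> w = w' \<and> set w \<subseteq> Ob C"
| "path w (L # D) w' \<longleftrightarrow> layer_ok L \<and> w = layer_dom L \<and> path (layer_cod L) D w'"

text \<open>The head of the list is the layer applied first, that is, the rightmost factor of the
  composite.\<close>

fun ev :: "'o list \<Rightarrow> ('o, 'a) layer list \<Rightarrow> 'a" where
  "ev w [] = Id C (obj w)"
| "ev w (L # D) = ev (layer_cod L) D \<cdot> layer_arrow L"

lemma layer_ok_words: "layer_ok L \<Longrightarrow> set (layer_dom L) \<subseteq> Ob C \<and> set (layer_cod L) \<subseteq> Ob C"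
  by (cases L) auto

lemma layer_in_hom: "layer_ok L \<Longrightarrow> layer_arrow L \<in> hom C (obj (layer_dom L)) (obj (layer_cod L))"
  by (cases L) (auto simp: obj_append intro!: tenA_in_hom Id_in_hom)

lemma path_words: "path w D w' \<Longrightarrow> set w \<subseteq> Ob C \<and> set w' \<subseteq> Ob C"
  by (induction D arbitrary: w) (auto dest: layer_ok_words)

lemma ev_in_hom: "path w D w' \<Longrightarrow> ev w D \<in> hom C (obj w) (obj w')"
  by (induction D arbitrary: w) (auto dest: layer_in_hom)

lemma path_append: "path w D v \<Longrightarrow> path v E w' \<Longrightarrow> path w (D @ E) w'"
  by (induction D arbitrary: w) auto

lemma path_split: "path w (D @ E) w' \<Longrightarrow> \<exists>v. path w D v \<and> path v E w'"
proof (induction D arbitrary: w)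
  case Nil
  then show ?case using path_words by auto
qed auto

lemma ev_append: "path w D v \<Longrightarrow> path v E w' \<Longrightarrow> ev w (D @ E) = ev v E \<cdot> ev w D"
proof (induction D arbitrary: w)
  case Nil
  then show ?case using comp_Id[OF ev_in_hom] by auto
next
  case (Cons L D)
  then have "ev (layer_cod L) D \<in> hom C (obj (layer_cod L)) (obj v)" "ev v E \<in> hom C (obj v) (obj w')"
    "layer_arrow L \<in> hom C (obj w) (obj (layer_cod L))"
    using ev_in_hom layer_in_hom by auto
  then show ?case using Cons by (simp add: comp_assoc)
qed

text \<open>Both diagrams are required to be well typed between the same words, so a chain of
  rewriting steps needs a typing argument only at its start.\<close>

definition eqv :: "'o list \<Rightarrow> ('o, 'a) layer list \<Rightarrow> ('o, 'a) layer list \<Rightarrow> 'o list \<Rightarrow> bool" where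
  "eqv w D E w' \<longleftrightarrow> path w D w' \<and> path w E w' \<and> ev w D = ev w E"

lemma eqv_refl: "path w D w' \<Longrightarrow> eqv w D D w'"
  by (simp add: eqv_def)

lemma eqv_trans: "eqv w D E w' \<Longrightarrow> eqv w E F w' \<Longrightarrow> eqv w D F w'"
  by (simp add: eqv_def)

lemma eqv_append: "eqv w D E v \<Longrightarrow> path v F w' \<Longrightarrow> eqv w (D @ F) (E @ F) w'"
  by (auto simp: eqv_def path_append ev_append)

lemma eqv_Cons: "layer_ok L \<Longrightarrow> eqv (layer_cod L) D E w' \<Longrightarrow> eqv (layer_dom L) (L # D) (L # E) w'"
  by (auto simp: eqv_def)

subsection \<open>Whiskering a diagram\<close>

text \<open>Each context word begins with the strand nearest to the arrow, hence the reversal of the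
  left one; adding strands outside is then an append on both sides.\<close>

fun shift :: "'o list \<Rightarrow> 'o list \<Rightarrow> ('o, 'a) layer \<Rightarrow> ('o, 'a) layer" where
  "shift cl cr (l, u, f, v, r) = (l @ cl, u, f, v, r @ cr)"

lemma shift_simps:
  "layer_dom (shift cl cr L) = rev cl @ layer_dom L @ cr"
  "layer_cod (shift cl cr L) = rev cl @ layer_cod L @ cr"
  by (cases L; simp)+

lemma shift_ok: "layer_ok L \<Longrightarrow> set cl \<subseteq> Ob C \<Longrightarrow> set cr \<subseteq> Ob C \<Longrightarrow> layer_ok (shift cl cr L)"
  by (cases L) auto

lemma shift_arrow:
  assumes "layer_ok L" "set cl \<subseteq> Ob C" "set cr \<subseteq> Ob C"
  shows "layer_arrow (shift cl cr L) = Id C (obj (rev cl)) \<boxtimes> layer_arrow L \<boxtimes> Id C (obj cr)"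
proof (cases L)
  case (fields l u f v r)
  have o: "obj (rev cl) \<in> Ob C" "obj (rev l) \<in> Ob C" "obj r \<in> Ob C" "obj cr \<in> Ob C"
    using assms fields by auto
  have f: "f \<in> hom C (obj u) (obj v)" using assms fields by simp
  have "Id C (obj (rev l)) \<boxtimes> f \<in> hom C (obj (rev l) \<otimes> obj u) (obj (rev l) \<otimes> obj v)"
    "f \<boxtimes> Id C (obj r) \<in> hom C (obj u \<otimes> obj r) (obj v \<otimes> obj r)"
    "f \<boxtimes> Id C (obj r) \<boxtimes> Id C (obj cr) \<in> hom C (obj u \<otimes> obj r \<otimes> obj cr) (obj v \<otimes> obj r \<otimes> obj cr)"
    using f o by (auto intro!: tenA_in_hom)
  then show ?thesis
    using assms fields f o
    by (simp add: obj_append Id_tenA[symmetric] tenA_assoc[OF Id_in_hom Id_in_hom]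
        tenA_assoc[OF f Id_in_hom Id_in_hom] tenA_assoc[OF Id_in_hom _ Id_in_hom])
qed

lemma shift_id: "map (shift [] []) D = D"
  by (induction D) (auto split: prod.splits)

lemma path_shift:
  "path w D w' \<Longrightarrow> set cl \<subseteq> Ob C \<Longrightarrow> set cr \<subseteq> Ob C \<Longrightarrow>
     path (rev cl @ w @ cr) (map (shift cl cr) D) (rev cl @ w' @ cr)"
  by (induction D arbitrary: w) (auto simp: shift_simps shift_ok)

lemma ev_shift:
  assumes "path w D w'" "set cl \<subseteq> Ob C" "set cr \<subseteq> Ob C"
  shows "ev (rev cl @ w @ cr) (map (shift cl cr) D) = Id C (obj (rev cl)) \<boxtimes> ev w D \<boxtimes> Id C (obj cr)"
  using assms
proof (induction D arbitrary: w)
  case Nil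
  then have "set w' \<subseteq> Ob C" "w = w'" by auto
  then show ?case using Nil.prems by (simp add: obj_append Id_tenA)
next
  case (Cons L D)
  have o: "obj (rev cl) \<in> Ob C" "obj cr \<in> Ob C" using Cons.prems by auto
  have L: "layer_arrow L \<in> hom C (obj (layer_dom L)) (obj (layer_cod L))"
    and D: "ev (layer_cod L) D \<in> hom C (obj (layer_cod L)) (obj w')"
    using Cons.prems layer_in_hom ev_in_hom by auto
  \<comment> \<open>The outer identities are doubled so that functoriality of the tensor product can
    split the composite in all three factors.\<close>
  have "Id C (obj (rev cl)) \<boxtimes> (ev (layer_cod L) D \<cdot> layer_arrow L) \<boxtimes> Id C (obj cr)
    = (Id C (obj (rev cl)) \<cdot> Id C (obj (rev cl))) \<boxtimes>
      ((ev (layer_cod L) D \<cdot> layer_arrow L) \<boxtimes> (Id C (obj cr) \<cdot> Id C (obj cr)))"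
    using o by (simp add: comp_Id[OF Id_in_hom])
  also have "\<dots> = (Id C (obj (rev cl)) \<boxtimes> ev (layer_cod L) D \<boxtimes> Id C (obj cr)) \<cdot>
       (Id C (obj (rev cl)) \<boxtimes> layer_arrow L \<boxtimes> Id C (obj cr))"
    using o L D by (simp add: tenA_comp[OF L Id_in_hom D Id_in_hom]
        tenA_comp[OF Id_in_hom tenA_in_hom[OF L Id_in_hom] Id_in_hom tenA_in_hom[OF D Id_in_hom]])
  finally show ?case
    using Cons by (simp add: shift_simps shift_arrow)
qed

lemma eqv_shift:
  "eqv w D E w' \<Longrightarrow> set cl \<subseteq> Ob C \<Longrightarrow> set cr \<subseteq> Ob C \<Longrightarrow>
     eqv (rev cl @ w @ cr) (map (shift cl cr) D) (map (shift cl cr) E) (rev cl @ w' @ cr)"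
  by (auto simp: eqv_def path_shift ev_shift)

subsection \<open>The interchange law\<close>

text \<open>The strands \<open>w\<close> between the two boxes are attached to the second arrow; the
  two layerings are then the two readings of a single tensor product given by \<open>tenA_eq\<close>
  and \<open>tenA_eq'\<close>. The outer contexts are restored by \<open>eqv_shift\<close>.\<close>

lemma interchange:
  assumes f: "f \<in> hom C (obj u) (obj v)" and f': "f' \<in> hom C (obj u') (obj v')"
    and w: "set l \<subseteq> Ob C" "set u \<subseteq> Ob C" "set v \<subseteq> Ob C" "set w \<subseteq> Ob C"
      "set u' \<subseteq> Ob C" "set v' \<subseteq> Ob C" "set r \<subseteq> Ob C"
  shows "eqv (rev l @ u @ w @ u' @ r) [(l, u, f, v, w @ u' @ r), (rev w @ rev v @ l, u', f', v', r)]
           [(rev w @ rev u @ l, u', f', v', r), (l, u, f, v, w @ v' @ r)] (rev l @ v @ w @ v' @ r)"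
proof -
  have o: "obj u \<in> Ob C" "obj v \<in> Ob C" "obj w \<in> Ob C" "obj u' \<in> Ob C" "obj v' \<in> Ob C"
    using w by auto
  note I = Id_in_hom[OF o(3)]
  have If: "Id C (obj w) \<boxtimes> f' \<in> hom C (obj w \<otimes> obj u') (obj w \<otimes> obj v')"
    by (intro tenA_in_hom I f')
  have left: "layer_arrow ([], u, f, v, w @ x) = f \<rhd> (obj w \<otimes> obj x)" if "set x \<subseteq> Ob C" for x
    using that w o f tenA_in_hom[OF f Id_in_hom[of "obj w \<otimes> obj x"]]
    by (simp add: obj_append rwhisker_def tenA_unit)
  have right: "layer_arrow (rev w @ rev x, u', f', v', []) = obj x \<lhd> (Id C (obj w) \<boxtimes> f')"
    if "set x \<subseteq> Ob C" for x
  proof -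
    have "layer_arrow (rev w @ rev x, u', f', v', []) = Id C (obj x \<otimes> obj w) \<boxtimes> f'"
      using that w f' by (simp add: obj_append tenA_unit)
    also have "\<dots> = (Id C (obj x) \<boxtimes> Id C (obj w)) \<boxtimes> f'"
      using that w by (simp add: Id_tenA)
    also have "\<dots> = obj x \<lhd> (Id C (obj w) \<boxtimes> f')"
      using that w f' tenA_assoc[OF Id_in_hom Id_in_hom f'] by (simp add: lwhisker_def)
    finally show ?thesis .
  qed
  have base: "eqv (u @ w @ u') [([], u, f, v, w @ u'), (rev w @ rev v, u', f', v', [])]
           [(rev w @ rev u, u', f', v', []), ([], u, f, v, w @ v')] (v @ w @ v')"
    (is "eqv _ [?L1, ?L2] [?L3, ?L4] _")
  proof -
    have p: "path (u @ w @ u') [?L1, ?L2] (v @ w @ v')" "path (u @ w @ u') [?L3, ?L4] (v @ w @ v')"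
      using w f f' by auto
    then have "layer_arrow ?L2 \<in> hom C (obj (v @ w @ u')) (obj (v @ w @ v'))"
      "layer_arrow ?L4 \<in> hom C (obj (u @ w @ v')) (obj (v @ w @ v'))"
      using layer_in_hom[of ?L2] layer_in_hom[of ?L4] by (auto simp del: layer_arrow.simps)
    then have "ev (u @ w @ u') [?L1, ?L2] = layer_arrow ?L2 \<cdot> layer_arrow ?L1"
      "ev (u @ w @ u') [?L3, ?L4] = layer_arrow ?L4 \<cdot> layer_arrow ?L3"
      by (simp_all add: Id_comp del: layer_arrow.simps)
    moreover have "layer_arrow ?L2 \<cdot> layer_arrow ?L1 = layer_arrow ?L4 \<cdot> layer_arrow ?L3"
      using w tenA_eq[OF f If] tenA_eq'[OF f If] by (simp add: left right del: layer_arrow.simps)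
    ultimately show ?thesis using p by (simp only: eqv_def simp_thms)
  qed
  show ?thesis using eqv_shift[OF base, of l r] w by simp
qed

subsection \<open>Rewriting diagrams\<close>

text \<open>The objects are variables whose equality is undecided, so positions are compared by
  length only; that the words themselves fit is guaranteed by \<open>path\<close>. Here
  \<open>w\<close> is the reversed word of the strands between the two boxes.\<close>

fun swap_right :: "('o, 'a) layer \<Rightarrow> ('o, 'a) layer \<Rightarrow> ('o, 'a) layer list option" where
  "swap_right (l, u, f, v, r) (l', u', f', v', r') =
     (let n = length l + length v; w = take (length l' - n) l'
      in if n \<le> length l' then Some [(w @ rev u @ l, u', f', v', r'), (l, u, f, v, rev w @ v' @ r')]
         else None)"

fun swap_left :: "('o, 'a) layer \<Rightarrow> ('o, 'a) layer \<Rightarrow> ('o, 'a) layer list option" where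
  "swap_left (l, u, f, v, r) (l', u', f', v', r') =
     (let n = length l' + length u'; w = take (length l - n) l
      in if n \<le> length l then Some [(l', u', f', v', rev w @ u @ r), (w @ rev v' @ l', u, f, v, r)]
         else None)"

text \<open>The word between the two layers is written in two ways. Cutting both at the right end of
  the output of the first box forces the shape that \<open>interchange\<close> requires.\<close>

lemma swap_right_eqv:
  assumes "path x [L, L'] y" "swap_right L L' = Some E"
  shows "eqv x [L, L'] E y"
proof -
  obtain l u f v r where L: "L = (l, u, f, v, r)" by (cases L)
  obtain l' u' f' v' r' where L': "L' = (l', u', f', v', r')" by (cases L')
  define w where "w = take (length l' - (length l + length v)) l'"
  have n: "length l + length v \<le> length l'" using assms(2) by (simp add: L L' Let_def split: if_splits)
  have "rev l @ v @ r = rev l' @ u' @ r'" using assms(1) by (simp add: L L')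
  then have "take (length l + length v) (rev l @ v @ r) = take (length l + length v) (rev l' @ u' @ r')"
    "drop (length l + length v) (rev l @ v @ r) = drop (length l + length v) (rev l' @ u' @ r')"
    by simp_all
  then have "take (length l + length v) (rev l') = rev l @ v" "r = drop (length l + length v) (rev l') @ u' @ r'"
    using n by simp_all
  moreover have "drop (length l + length v) (rev l') = rev w"
    using n by (simp add: w_def drop_rev)
  ultimately have r: "r = rev w @ u' @ r'" and "rev l' = rev l @ v @ rev w"
    using append_take_drop_id[of "length l + length v" "rev l'"] by auto
  then have "rev (rev l') = rev (rev l @ v @ rev w)" by simp
  then have l': "l' = w @ rev v @ l" by simp
  have E: "E = [(w @ rev u @ l, u', f', v', r'), (l, u, f, v, rev w @ v' @ r')]"
    using assms(2) n by (simp add: L L' w_def Let_def)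
  show ?thesis
    using interchange[of f u v f' u' v' l "rev w" r'] assms(1)
    by (simp add: L L' E r l')
qed

text \<open>The cut is now at the right end of the input of the second box, and
  \<open>interchange\<close> is read backwards.\<close>

lemma swap_left_eqv:
  assumes "path x [L, L'] y" "swap_left L L' = Some E"
  shows "eqv x [L, L'] E y"
proof -
  obtain l u f v r where L: "L = (l, u, f, v, r)" by (cases L)
  obtain l' u' f' v' r' where L': "L' = (l', u', f', v', r')" by (cases L')
  define w where "w = take (length l - (length l' + length u')) l"
  have n: "length l' + length u' \<le> length l" using assms(2) by (simp add: L L' Let_def split: if_splits)
  have "rev l' @ u' @ r' = rev l @ v @ r" using assms(1) by (simp add: L L')
  then have "take (length l' + length u') (rev l' @ u' @ r') = take (length l' + length u') (rev l @ v @ r)"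
    "drop (length l' + length u') (rev l' @ u' @ r') = drop (length l' + length u') (rev l @ v @ r)"
    by simp_all
  then have "take (length l' + length u') (rev l) = rev l' @ u'" "r' = drop (length l' + length u') (rev l) @ v @ r"
    using n by simp_all
  moreover have "drop (length l' + length u') (rev l) = rev w"
    using n by (simp add: w_def drop_rev)
  ultimately have r: "r' = rev w @ v @ r" and "rev l = rev l' @ u' @ rev w"
    using append_take_drop_id[of "length l' + length u'" "rev l"] by auto
  then have "rev (rev l) = rev (rev l' @ u' @ rev w)" by simp
  then have l: "l = w @ rev u' @ l'" by simp
  have E: "E = [(l', u', f', v', rev w @ u @ r), (w @ rev v' @ l', u, f, v, r)]"
    using assms(2) n by (simp add: L L' w_def Let_def)
  show ?thesis
    using interchange[of f' u' v' f u v l' "rev w" r] assms(1)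
    by (auto simp: L L' E r l eqv_def)
qed

fun swap :: "bool \<Rightarrow> nat \<Rightarrow> ('o, 'a) layer list \<Rightarrow> ('o, 'a) layer list option" where
  "swap _ _ [] = None"
| "swap c i (L # D) =
     (if i = 0 then (case D of [] \<Rightarrow> None | L' # D' \<Rightarrow>
        map_option (\<lambda>E. E @ D') (if c then swap_right L L' else swap_left L L'))
      else map_option ((#) L) (swap c (i - 1) D))"

lemma swap_eqv: "path x D y \<Longrightarrow> swap c i D = Some E \<Longrightarrow> eqv x D E y"
proof (induction c i D arbitrary: x E rule: swap.induct)
  case (2 c i L D)
  show ?case
  proof (cases "i = 0")
    case True
    then obtain L' D' E' where D: "D = L' # D'" "E = E' @ D'"
      and E': "(if c then swap_right L L' else swap_left L L') = Some E'"
      using "2.prems" by (auto split: list.splits)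
    obtain z where z: "path x [L, L'] z" "path z D' y"
      using "2.prems"(1) path_split[of x "[L, L']" D' y] D by auto
    have "eqv x [L, L'] E' z"
      using z(1) E' swap_right_eqv[of x L L' z E'] swap_left_eqv[of x L L' z E']
      by (simp only: split: if_splits)
    then show ?thesis using eqv_append z D by force
  next
    case False
    then obtain E' where E': "swap c (i - 1) D = Some E'" "E = L # E'"
      using "2.prems" by auto
    have "layer_ok L" "x = layer_dom L" "path (layer_cod L) D y" using "2.prems"(1) by auto
    then show ?thesis using "2.IH"[OF False _ E'(1)] E'(2) eqv_Cons by blast
  qed
qed auto

type_synonym ('p, 'b) rewrite_rule =
  "'p list \<times> ('p, 'b) layer list \<times> ('p, 'b) layer list \<times> 'p list"

definition valid :: "('o, 'a) rewrite_rule list \<Rightarrow> bool" where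
  "valid R \<longleftrightarrow> (\<forall>(u, D, E, v) \<in> set R. eqv u D E v)"

text \<open>The rule is whiskered by the first \<open>n\<close> strands and by those after its
  source word, and must then coincide literally with the layers at hand; bringing these together is
  the task of earlier interchange steps. The flag \<open>c\<close> selects the direction.\<close>

fun rewrite :: "('o, 'a) rewrite_rule \<Rightarrow> bool \<Rightarrow> nat \<Rightarrow> nat \<Rightarrow> 'o list \<Rightarrow> ('o, 'a) layer list \<Rightarrow>
    ('o, 'a) layer list option" where
  "rewrite (u, D, E, v) c i n w F =
     (if i = 0 then
        (let s = shift (rev (take n w)) (drop (n + length u) w);
             D' = map s (if c then D else E); k = length D'
         in if w = take n w @ u @ drop (n + length u) w \<and> take k F = D'
            then Some (map s (if c then E else D) @ drop k F) else None)
      else (case F of [] \<Rightarrow> None | L # F' \<Rightarrow>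
        map_option ((#) L) (rewrite (u, D, E, v) c (i - 1) n (layer_cod L) F')))"

declare rewrite.simps [simp del]

lemma rewrite_eqv:
  assumes R: "eqv u D E v"
  shows "path w F y \<Longrightarrow> rewrite (u, D, E, v) c i n w F = Some G \<Longrightarrow> eqv w F G y"
proof (induction i arbitrary: w F G)
  case 0
  let ?cl = "rev (take n w)" and ?cr = "drop (n + length u) w"
  let ?A = "if c then D else E" and ?B = "if c then E else D"
  have w: "w = rev ?cl @ u @ ?cr"
    and F: "take (length ?A) F = map (shift ?cl ?cr) ?A"
    and G: "G = map (shift ?cl ?cr) ?B @ drop (length ?A) F"
    using 0 by (auto simp: rewrite.simps[of _ _ _ _ _ 0] Let_def split: if_splits)
  have F: "F = map (shift ?cl ?cr) ?A @ drop (length ?A) F"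
    using F append_take_drop_id by metis
  then obtain z where z: "path w (map (shift ?cl ?cr) ?A) z" "path z (drop (length ?A) F) y"
    using path_split 0(1) by metis
  have "set w \<subseteq> Ob C" using 0(1) path_words by blast
  then have s: "set ?cl \<subseteq> Ob C" "set ?cr \<subseteq> Ob C"
    using set_take_subset set_drop_subset by fastforce+
  have "eqv u ?A ?B v" using R by (auto simp: eqv_def)
  then have e: "eqv w (map (shift ?cl ?cr) ?A) (map (shift ?cl ?cr) ?B) (rev ?cl @ v @ ?cr)"
    using eqv_shift[OF _ s] w by metis
  \<comment> \<open>The layers of a path determine its final word, so the cut \<open>z\<close> is
    the whiskered target of the rule.\<close>
  have "path w D x \<Longrightarrow> path w D x' \<Longrightarrow> x = x'" for w x x' and D :: "('o, 'a) layer list"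
    by (induction D arbitrary: w) auto
  then have "z = rev ?cl @ v @ ?cr" using z e by (auto simp: eqv_def)
  then show ?case using eqv_append[OF e] z F G by metis
next
  case (Suc i)
  then obtain L F' G' where "F = L # F'" "G = L # G'"
    "rewrite (u, D, E, v) c i n (layer_cod L) F' = Some G'"
    by (auto simp: rewrite.simps[of _ _ _ _ _ "Suc i"] split: list.splits)
  then show ?case using Suc eqv_Cons by auto
qed

fun perform :: "('o, 'a) rewrite_rule list \<Rightarrow> 'o list \<Rightarrow> step \<Rightarrow> ('o, 'a) layer list \<Rightarrow>
    ('o, 'a) layer list option" where
  "perform R w (Right i) D = swap True i D"
| "perform R w (Left i) D = swap False i D"
| "perform R w (Apply k i n) D = (if k < length R then rewrite (R ! k) True i n w D else None)"
| "perform R w (Undo k i n) D = (if k < length R then rewrite (R ! k) False i n w D else None)"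

lemma perform_eqv:
  assumes R: "valid R" and D: "path w D y" and E: "perform R w s D = Some E"
  shows "eqv w D E y"
proof -
  have "eqv w D E y" if k: "k < length R" and E: "rewrite (R ! k) c i n w D = Some E" for k c i n
  proof -
    obtain u A B v where k': "R ! k = (u, A, B, v)" by (cases "R ! k")
    then have "eqv u A B v" using R nth_mem[OF k] by (auto simp: valid_def)
    then show ?thesis using rewrite_eqv D E unfolding k' by blast
  qed
  then show ?thesis using E swap_eqv[OF D] by (cases s) (auto split: if_splits)
qed

fun run :: "('o, 'a) rewrite_rule list \<Rightarrow> 'o list \<Rightarrow> step list \<Rightarrow> ('o, 'a) layer list \<Rightarrow>
    ('o, 'a) layer list option" where
  "run R w [] D = Some D"
| "run R w (s # S) D = (case perform R w s D of None \<Rightarrow> None | Some E \<Rightarrow> run R w S E)"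

text \<open>Soundness of the checker. A step list that evaluates to \<open>Some E\<close> is a
  certificate, and later equations are verified by evaluating such a list with the
  simplifier.\<close>

lemma run_eqv: "valid R \<Longrightarrow> path w D y \<Longrightarrow> run R w S D = Some E \<Longrightarrow> eqv w D E y"
proof (induction S arbitrary: D)
  case Nil
  then show ?case by (simp add: eqv_refl)
next
  case (Cons s S)
  then obtain F where F: "perform R w s D = Some F" "run R w S F = Some E" by (auto split: option.splits)
  then have "eqv w D F y" using perform_eqv Cons.prems by blast
  then show ?case using Cons.IH Cons.prems(1) F(2) eqv_trans by (auto simp: eqv_def)
qed

subsection \<open>Reading off diagrams from arrows\<close>

text \<open>\<open>word X w v\<close>: the word \<open>v\<close> is \<open>w\<close> preceded by the factors of \<open>X\<close>.
  \<open>reads l r f u v D E\<close>: the diagram \<open>E\<close> is \<open>D\<close> preceded by the layers of \<open>f\<close> from \<open>u\<close> to \<open>v\<close>,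
  whiskered by \<open>rev l\<close> and \<open>r\<close>.  Resolution with the rules below computes these relations.\<close>

definition word :: "'o \<Rightarrow> 'o list \<Rightarrow> 'o list \<Rightarrow> bool" where
  "word X w v \<longleftrightarrow> (\<exists>x. v = x @ w \<and> set x \<subseteq> Ob C \<and> obj x = X)"

definition app :: "'o list \<Rightarrow> 'o list \<Rightarrow> 'o list \<Rightarrow> bool" where
  "app x y z \<longleftrightarrow> z = x @ y"

definition rev_app :: "'o list \<Rightarrow> 'o list \<Rightarrow> 'o list \<Rightarrow> bool" where
  "rev_app x y z \<longleftrightarrow> z = rev x @ y"

definition reads :: "'o list \<Rightarrow> 'o list \<Rightarrow> 'a \<Rightarrow> 'o list \<Rightarrow> 'o list \<Rightarrow> ('o, 'a) layer list \<Rightarrow>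
    ('o, 'a) layer list \<Rightarrow> bool" where
  "reads l r f u v D E \<longleftrightarrow> (\<exists>F. E = map (shift l r) F @ D \<and> path u F v \<and> ev u F = f)"

lemma word_ten: "word Y w v \<Longrightarrow> word X v v' \<Longrightarrow> word (X \<otimes> Y) w v'"
  unfolding word_def
proof (elim exE conjE)
  fix x y
  assume "v = x @ w" "set x \<subseteq> Ob C" "obj x = Y" "v' = y @ v" "set y \<subseteq> Ob C" "obj y = X"
  then show "\<exists>z. v' = z @ w \<and> set z \<subseteq> Ob C \<and> obj z = X \<otimes> Y"
    by (intro exI[of _ "y @ x"]) (auto simp: obj_append)
qed

lemma word_unit: "word \<one> w w"
  by (auto simp: word_def intro: exI[of _ "[]"])

lemma word_atom: "X \<in> Ob C \<Longrightarrow> word X w (X # w)"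
  by (auto simp: word_def intro: exI[of _ "[X]"])

lemma app_simps: "app [] y y" "app x y z \<Longrightarrow> app (X # x) y (X # z)"
  "rev_app [] y y" "rev_app x (X # y) z \<Longrightarrow> rev_app (X # x) y z"
  by (simp_all add: app_def rev_app_def)

lemma reads_Id: "word X [] u \<Longrightarrow> reads l r (Id C X) u u D D"
  by (auto simp: reads_def word_def intro!: exI[of _ "[]"])

lemma reads_atom:
  "f \<in> hom C X Y \<Longrightarrow> word X [] u \<Longrightarrow> word Y [] v \<Longrightarrow> reads l r f u v D ((l, u, f, v, r) # D)"
  using tenA_in_hom[of f X Y]
  by (auto simp: reads_def word_def tenA_unit Id_comp intro!: exI[of _ "[([], u, f, v, [])]"])

lemma reads_comp: "reads l r g v w D E \<Longrightarrow> reads l r f u v E F \<Longrightarrow> reads l r (g \<cdot> f) u w D F"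
  unfolding reads_def
proof (elim exE conjE)
  fix G H
  assume "E = map (shift l r) G @ D" "path v G w" "ev v G = g"
    and "F = map (shift l r) H @ E" "path u H v" "ev u H = f"
  then show "\<exists>K. F = map (shift l r) K @ D \<and> path u K w \<and> ev u K = g \<cdot> f"
    by (intro exI[of _ "H @ G"]) (auto simp: ev_append path_append)
qed

lemma shift_shift: "shift l r (shift l' r' L) = shift (l' @ l) (r' @ r) L"
  by (cases L) simp

lemma reads_lwhisker:
  assumes "word X [] x" "rev_app x l l'" "reads l' r f u v D E" "app x u u'" "app x v v'"
  shows "reads l r (X \<lhd> f) u' v' D E"
proof -
  have x: "l' = rev x @ l" "set x \<subseteq> Ob C" "obj x = X" "u' = x @ u" "v' = x @ v"
    using assms by (auto simp: word_def app_def rev_app_def)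
  obtain F where F: "E = map (shift l' r) F @ D" "path u F v" "ev u F = f"
    using assms(3) by (auto simp: reads_def)
  have "f \<in> hom C (obj u) (obj v)" using F ev_in_hom by auto
  then have "X \<lhd> f = ev u' (map (shift (rev x) []) F)"
    using ev_shift[OF F(2), of "rev x" "[]"] x F(3) tenA_in_hom[OF Id_in_hom]
    by (simp add: lwhisker_def tenA_unit)
  moreover have "path u' (map (shift (rev x) []) F) v'"
    using path_shift[OF F(2), of "rev x" "[]"] x by simp
  moreover have "E = map (shift l r) (map (shift (rev x) []) F) @ D"
    using F(1) x(1) by (simp add: comp_def shift_shift)
  ultimately show ?thesis unfolding reads_def by metis
qed

lemma reads_rwhisker:
  assumes "word X [] x" "app x r r'" "reads l r' f u v D E" "app u x u'" "app v x v'"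
  shows "reads l r (f \<rhd> X) u' v' D E"
proof -
  have x: "r' = x @ r" "set x \<subseteq> Ob C" "obj x = X" "u' = u @ x" "v' = v @ x"
    using assms by (auto simp: word_def app_def rev_app_def)
  obtain F where F: "E = map (shift l r') F @ D" "path u F v" "ev u F = f"
    using assms(3) by (auto simp: reads_def)
  have f: "f \<in> hom C (obj u) (obj v)" using F ev_in_hom by auto
  have "X \<in> Ob C" using x(2,3) by auto
  then have "f \<rhd> X = ev u' (map (shift [] x) F)"
    using ev_shift[OF F(2), of "[]" x] x F(3) tenA_unit(1)[OF tenA_in_hom[OF f Id_in_hom]]
    by (simp add: rwhisker_def)
  moreover have "path u' (map (shift [] x) F) v'"
    using path_shift[OF F(2), of "[]" x] x by simp
  moreover have "E = map (shift l r) (map (shift [] x) F) @ D"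
    using F(1) x(1) by (simp add: comp_def shift_shift)
  ultimately show ?thesis unfolding reads_def by metis
qed

text \<open>The first two premises read both factors in an empty context only to learn their words,
  on which the contexts of the actual reading depend. The factor \<open>f\<close> is placed before
  \<open>g\<close>, as in \<open>tenA_eq\<close>.\<close>

lemma reads_tenA:
  assumes "reads [] [] f u v [] F\<^sub>0" "reads [] [] g u' v' [] G\<^sub>0" "rev_app v l l'"
    "reads l' r g u' v' D E" "app u' r r'" "reads l r' f u v E F" "app u u' x" "app v v' y"
  shows "reads l r (f \<boxtimes> g) x y D F"
proof -
  have w: "set u \<subseteq> Ob C" "set v \<subseteq> Ob C" "set u' \<subseteq> Ob C" "set v' \<subseteq> Ob C"
    and f: "f \<in> hom C (obj u) (obj v)" and g: "g \<in> hom C (obj u') (obj v')"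
    using assms(1,2) ev_in_hom unfolding reads_def by (blast dest: path_words)+
  have l: "rev_app v [] (rev v)" "app v a (v @ a)" "app a b (a @ b)" for a b :: "'o list"
    by (simp_all add: rev_app_def app_def)
  have word: "word (obj a) [] a" if "set a \<subseteq> Ob C" for a
    using that by (auto simp: word_def)
  have "reads l r (obj v \<lhd> g) (v @ u') (v @ v') D E"
    by (rule reads_lwhisker[OF word[OF w(2)] assms(3,4) l(2,2)])
  moreover have "reads l r (f \<rhd> obj u') (u @ u') (v @ u') E F"
    by (rule reads_rwhisker[OF word[OF w(3)] assms(5,6) l(3,3)])
  ultimately have "reads l r ((obj v \<lhd> g) \<cdot> (f \<rhd> obj u')) (u @ u') (v @ v') D F"
    by (rule reads_comp)
  then show ?thesis
    using assms(7,8) by (simp add: tenA_eq[OF f g] app_def)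
qed

lemma valid_Nil: "valid []"
  by (simp add: valid_def)

lemma valid_Cons:
  "f = g \<Longrightarrow> valid R \<Longrightarrow> reads [] [] f u v [] D \<Longrightarrow> reads [] [] g u v [] E \<Longrightarrow> valid ((u, D, E, v) # R)"
  by (auto simp: valid_def eqv_def reads_def shift_id)

text \<open>The form in which diagram equations are proved: both sides are read as lists of layers,
  the certificate is run on the left one, and the results are compared. The empty certificate
  already proves whatever holds by associativity, units and functoriality of whiskering.\<close>

lemma diagram_eq:
  "valid R \<Longrightarrow> reads [] [] f u v [] D \<Longrightarrow> reads [] [] g u v [] E \<Longrightarrow> run R u S D = Some E \<Longrightarrow> f = g"
  using run_eqv[of R u D v S E] by (auto simp: eqv_def reads_def shift_id)

text \<open>Typing of a composite comes from the same reading, through the words at its two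
  ends.\<close>

lemma in_hom: "reads [] [] f u v [] D \<Longrightarrow> word X [] u \<Longrightarrow> word Y [] v \<Longrightarrow> f \<in> hom C X Y"
  using ev_in_hom by (auto simp: reads_def word_def)

text \<open>The order matters: composites, whiskerings and tensor products are taken apart before
  \<open>reads_atom\<close> and \<open>word_atom\<close> can treat a term as a single box or
  strand.\<close>

lemmas reads = reads_comp reads_lwhisker reads_rwhisker reads_tenA reads_Id
  word_ten word_unit app_simps reads_atom word_atom

text \<open>The digit counts the equations that serve as rewrite rules. In a certificate they are
  numbered from 0, in the order in which they are supplied.\<close>

lemmas diagram0 = diagram_eq[OF valid_Nil]
lemmas diagram1 = diagram_eq[OF valid_Cons[OF _ valid_Nil]]
lemmas diagram2 = diagram_eq[OF valid_Cons[OF _ valid_Cons[OF _ valid_Nil]]]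
lemmas diagram3 = diagram_eq[OF valid_Cons[OF _ valid_Cons[OF _ valid_Cons[OF _ valid_Nil]]]]
lemmas diagram4 = diagram_eq[OF valid_Cons[OF _ valid_Cons[OF _ valid_Cons[OF _ valid_Cons[OF _ valid_Nil]]]]]
lemmas diagram5 = diagram_eq[OF valid_Cons[OF _ valid_Cons[OF _ valid_Cons[OF _ valid_Cons[OF _ valid_Cons[OF _ valid_Nil]]]]]]
lemmas diagram6 = diagram_eq[OF valid_Cons[OF _ valid_Cons[OF _ valid_Cons[OF _ valid_Cons[OF _ valid_Cons[OF _ valid_Cons[OF _ valid_Nil]]]]]]]
lemmas diagram7 = diagram_eq[OF valid_Cons[OF _ valid_Cons[OF _ valid_Cons[OF _ valid_Cons[OF _ valid_Cons[OF _ valid_Cons[OF _ valid_Cons[OF _ valid_Nil]]]]]]]]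
lemmas diagram8 = diagram_eq[OF valid_Cons[OF _ valid_Cons[OF _ valid_Cons[OF _ valid_Cons[OF _ valid_Cons[OF _ valid_Cons[OF _ valid_Cons[OF _ valid_Cons[OF _ valid_Nil]]]]]]]]]
lemmas diagram9 = diagram_eq[OF valid_Cons[OF _ valid_Cons[OF _ valid_Cons[OF _ valid_Cons[OF _ valid_Cons[OF _ valid_Cons[OF _ valid_Cons[OF _ valid_Cons[OF _ valid_Cons[OF _ valid_Nil]]]]]]]]]]

lemmas run_simps = run.simps perform.simps rewrite.simps swap.simps swap_left.simps swap_right.simps Let_def

end

text \<open>Typing facts for the fixed objects and arrows, at which the reading of a diagram stops;
  those of a single proof are found by \<open>fact\<close>.\<close>

named_theorems arrows

declare (in strict_monoidal) unit_in_Ob [arrows]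

section \<open>The right transfer category\<close>

locale algebra_in = strict_monoidal C for C :: "('o, 'a) monoidal" (structure) +
  fixes A :: 'o and m \<eta> :: 'a
  assumes algebra: "algebra C A m \<eta>"
begin

lemma A_in_Ob [arrows]: "A \<in> Ob C"
  and m_in_hom [arrows]: "m \<in> hom C (A \<otimes> A) A"
  and eta_in_hom [arrows]: "\<eta> \<in> hom C \<one> A"
  using algebra by (simp_all add: algebra_def)

lemma m_assoc: "m \<cdot> (m \<rhd> A) = m \<cdot> (A \<lhd> m)"
proof -
  have "A \<lhd> m \<in> hom C (A \<otimes> A \<otimes> A) (A \<otimes> A)"
    unfolding lwhisker_def by (intro tenA_in_hom Id_in_hom m_in_hom A_in_Ob)
  moreover have "m \<cdot> (A \<lhd> m) \<cdot> Id C (A \<otimes> A \<otimes> A) = m \<cdot> ((A \<lhd> m) \<cdot> Id C (A \<otimes> A \<otimes> A))"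
    using calculation A_in_Ob m_in_hom by (intro comp_assoc) (auto intro!: Id_in_hom)
  ultimately show ?thesis
    using algebra A_in_Ob m_in_hom by (simp add: algebra_def Assoc_eq comp_Id)
qed

lemma m_unit_left: "m \<cdot> (\<eta> \<rhd> A) = Id C A"
  using algebra A_in_Ob by (simp add: algebra_def Lun_eq)

lemma m_unit_right: "m \<cdot> (A \<lhd> \<eta>) = Id C A"
  using algebra A_in_Ob by (simp add: algebra_def Run_eq)

abbreviation T where "T \<equiv> right_transfer C A m \<eta>"
abbreviation right_obj where "right_obj X \<psi> \<equiv> is_right_transfer C A m \<eta> X \<psi>"

text \<open>Morphisms of \<open>T\<close> through their underlying arrows, so that diagrams can be
  drawn in \<open>C\<close> without the source and target components of a triple.\<close>

definition right_arr :: "'o \<Rightarrow> 'a \<Rightarrow> 'o \<Rightarrow> 'a \<Rightarrow> 'a \<Rightarrow> bool" where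
  "right_arr X \<psi> Y \<psi>' f \<longleftrightarrow> right_obj X \<psi> \<and> right_obj Y \<psi>' \<and> f \<in> hom C X (A \<otimes> Y) \<and>
     (m \<rhd> Y) \<cdot> (A \<lhd> f) \<cdot> \<psi> = (m \<rhd> Y) \<cdot> (A \<lhd> \<psi>') \<cdot> (f \<rhd> A)"

lemma right_objD:
  assumes "right_obj X \<psi>"
  shows "X \<in> Ob C" "\<psi> \<in> hom C (X \<otimes> A) (A \<otimes> X)"
    "\<psi> \<cdot> (X \<lhd> m) = (m \<rhd> X) \<cdot> (A \<lhd> \<psi>) \<cdot> (\<psi> \<rhd> A)" "\<psi> \<cdot> (X \<lhd> \<eta>) = \<eta> \<rhd> X"
  using assms by (simp_all add: is_right_transfer_def)

lemma right_arrD: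
  assumes "right_arr X \<psi> Y \<psi>' f"
  shows "right_obj X \<psi>" "right_obj Y \<psi>'" "f \<in> hom C X (A \<otimes> Y)"
    "(m \<rhd> Y) \<cdot> (A \<lhd> f) \<cdot> \<psi> = (m \<rhd> Y) \<cdot> (A \<lhd> \<psi>') \<cdot> (f \<rhd> A)"
  using assms by (simp_all add: right_arr_def)

abbreviation right_comp where "right_comp Z g f \<equiv> (m \<rhd> Z) \<cdot> (A \<lhd> g) \<cdot> f"

text \<open>The commutation squares of \<open>f\<close> and \<open>g\<close> are pasted together;
  associativity of \<open>m\<close> regroups the factors in \<open>A\<close> between them.\<close>

lemma right_comp_arr:
  assumes f: "right_arr X \<psi>\<^sub>X Y \<psi>\<^sub>Y f" and g: "right_arr Y \<psi>\<^sub>Y Z \<psi>\<^sub>Z g"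
  shows "right_arr X \<psi>\<^sub>X Z \<psi>\<^sub>Z (right_comp Z g f)"
proof -
  have ob: "X \<in> Ob C" "Y \<in> Ob C" "Z \<in> Ob C"
    and t: "\<psi>\<^sub>X \<in> hom C (X \<otimes> A) (A \<otimes> X)" "\<psi>\<^sub>Y \<in> hom C (Y \<otimes> A) (A \<otimes> Y)" "\<psi>\<^sub>Z \<in> hom C (Z \<otimes> A) (A \<otimes> Z)"
    and h: "f \<in> hom C X (A \<otimes> Y)" "g \<in> hom C Y (A \<otimes> Z)"
    and cf: "(m \<rhd> Y) \<cdot> (A \<lhd> f) \<cdot> \<psi>\<^sub>X = (m \<rhd> Y) \<cdot> (A \<lhd> \<psi>\<^sub>Y) \<cdot> (f \<rhd> A)"
    and cg: "(m \<rhd> Z) \<cdot> (A \<lhd> g) \<cdot> \<psi>\<^sub>Y = (m \<rhd> Z) \<cdot> (A \<lhd> \<psi>\<^sub>Z) \<cdot> (g \<rhd> A)"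
    using right_arrD[OF f] right_arrD[OF g] by (auto dest: right_objD)
  have "(m \<rhd> Z) \<cdot> (A \<lhd> ((m \<rhd> Z) \<cdot> (A \<lhd> g) \<cdot> f)) \<cdot> \<psi>\<^sub>X =
      (m \<rhd> Z) \<cdot> (A \<lhd> \<psi>\<^sub>Z) \<cdot> (((m \<rhd> Z) \<cdot> (A \<lhd> g) \<cdot> f) \<rhd> A)"
    by (rule diagram3[OF m_assoc cf cg, where S = "[Undo 0 3 0, Left 2, Apply 1 0 0, Right 2, Apply 0 3 0,
      Apply 2 1 1, Undo 0 3 0, Left 2]"], (rule reads arrows | fact)+, simp add: run_simps)
  moreover have "(m \<rhd> Z) \<cdot> (A \<lhd> g) \<cdot> f \<in> hom C X (A \<otimes> Z)"
    by (rule in_hom, (rule reads arrows | fact)+)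
  ultimately show ?thesis
    using right_arrD[OF f] right_arrD[OF g] by (simp add: right_arr_def)
qed

lemma right_comp_assoc:
  assumes "X \<in> Ob C" "Y \<in> Ob C" "Z \<in> Ob C" "W \<in> Ob C"
    and "f \<in> hom C X (A \<otimes> Y)" and "g \<in> hom C Y (A \<otimes> Z)" "h \<in> hom C Z (A \<otimes> W)"
  shows "(m \<rhd> W) \<cdot> (A \<lhd> ((m \<rhd> W) \<cdot> (A \<lhd> h) \<cdot> g)) \<cdot> f = (m \<rhd> W) \<cdot> (A \<lhd> h) \<cdot> ((m \<rhd> Z) \<cdot> (A \<lhd> g) \<cdot> f)"
  by (rule diagram1[OF m_assoc, where S = "[Undo 0 3 0, Left 2]"], (rule reads arrows | fact)+,
      simp add: run_simps)

lemma right_comp_Id: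
  assumes "X \<in> Ob C" "Y \<in> Ob C" "f \<in> hom C X (A \<otimes> Y)"
  shows "(m \<rhd> Y) \<cdot> (A \<lhd> f) \<cdot> (\<eta> \<rhd> X) = f"
  by (rule diagram1[OF m_unit_left, where S = "[Right 0, Apply 0 1 0]"], (rule reads arrows | fact)+,
      simp add: run_simps)

lemma right_Id_comp:
  assumes "X \<in> Ob C" "Y \<in> Ob C" "f \<in> hom C X (A \<otimes> Y)"
  shows "(m \<rhd> Y) \<cdot> (A \<lhd> \<eta> \<rhd> Y) \<cdot> f = f"
  by (rule diagram1[OF m_unit_right, where S = "[Apply 0 1 0]"], (rule reads arrows | fact)+, simp add: run_simps)

lemma right_Id_arr:
  assumes "right_obj X \<psi>"
  shows "right_arr X \<psi> X \<psi> (\<eta> \<rhd> X)"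
proof -
  note t = right_objD(1,2)[OF assms]
  have t': "X \<in> Ob C" "\<psi> \<in> hom C (X \<otimes> A) (A \<otimes> X)" by (fact t)+
  have "(m \<rhd> X) \<cdot> (A \<lhd> \<eta> \<rhd> X) \<cdot> \<psi> = (m \<rhd> X) \<cdot> (A \<lhd> \<psi>) \<cdot> (\<eta> \<rhd> X \<rhd> A)"
    by (rule diagram2[OF m_unit_right m_unit_left, where S = "[Apply 0 1 0, Undo 1 1 0, Left 0]"],
      (rule reads arrows | fact)+, simp add: run_simps)
  moreover have "\<eta> \<rhd> X \<in> hom C X (A \<otimes> X)"
    by (rule in_hom, (rule reads arrows | fact)+)
  ultimately show ?thesis using assms by (simp add: right_arr_def)
qed

lemma right_unit_obj: "right_obj \<one> (Id C A)"
proof -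
  have "Id C A \<cdot> (\<one> \<lhd> m) = (m \<rhd> \<one>) \<cdot> (A \<lhd> Id C A) \<cdot> (Id C A \<rhd> A)"
    by (rule diagram0[where S = "[]"], (rule reads arrows | fact)+, simp add: run_simps)
  moreover have "Id C A \<cdot> (\<one> \<lhd> \<eta>) = \<eta> \<rhd> \<one>"
    by (rule diagram0[where S = "[]"], (rule reads arrows | fact)+, simp add: run_simps)
  moreover have "Id C A \<in> hom C (\<one> \<otimes> A) (A \<otimes> \<one>)"
    by (rule in_hom, (rule reads arrows | fact)+)
  ultimately show ?thesis by (simp add: is_right_transfer_def)
qed

lemma right_ten_obj:
  assumes "right_obj X \<psi>\<^sub>X" "right_obj Y \<psi>\<^sub>Y"
  shows "right_obj (X \<otimes> Y) ((\<psi>\<^sub>X \<rhd> Y) \<cdot> (X \<lhd> \<psi>\<^sub>Y))"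
proof -
  have ob: "X \<in> Ob C" "Y \<in> Ob C"
    and t: "\<psi>\<^sub>X \<in> hom C (X \<otimes> A) (A \<otimes> X)" "\<psi>\<^sub>Y \<in> hom C (Y \<otimes> A) (A \<otimes> Y)"
    and mx: "\<psi>\<^sub>X \<cdot> (X \<lhd> m) = (m \<rhd> X) \<cdot> (A \<lhd> \<psi>\<^sub>X) \<cdot> (\<psi>\<^sub>X \<rhd> A)"
    and my: "\<psi>\<^sub>Y \<cdot> (Y \<lhd> m) = (m \<rhd> Y) \<cdot> (A \<lhd> \<psi>\<^sub>Y) \<cdot> (\<psi>\<^sub>Y \<rhd> A)"
    and ex: "\<psi>\<^sub>X \<cdot> (X \<lhd> \<eta>) = \<eta> \<rhd> X" and ey: "\<psi>\<^sub>Y \<cdot> (Y \<lhd> \<eta>) = \<eta> \<rhd> Y"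
    using right_objD[OF assms(1)] right_objD[OF assms(2)] by auto
  have "(\<psi>\<^sub>X \<rhd> Y) \<cdot> (X \<lhd> \<psi>\<^sub>Y) \<cdot> (X \<otimes> Y \<lhd> m) =
      (m \<rhd> X \<otimes> Y) \<cdot> (A \<lhd> ((\<psi>\<^sub>X \<rhd> Y) \<cdot> (X \<lhd> \<psi>\<^sub>Y))) \<cdot> (((\<psi>\<^sub>X \<rhd> Y) \<cdot> (X \<lhd> \<psi>\<^sub>Y)) \<rhd> A)"
    by (rule diagram2[OF my mx, where S = "[Apply 0 0 1, Apply 1 2 0, Left 1]"], (rule reads arrows | fact)+,
      simp add: run_simps)
  moreover have "(\<psi>\<^sub>X \<rhd> Y) \<cdot> (X \<lhd> \<psi>\<^sub>Y) \<cdot> (X \<otimes> Y \<lhd> \<eta>) = \<eta> \<rhd> X \<otimes> Y"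
    by (rule diagram2[OF ey ex, where S = "[Apply 0 0 1, Apply 1 0 0]"], (rule reads arrows | fact)+,
      simp add: run_simps)
  moreover have "(\<psi>\<^sub>X \<rhd> Y) \<cdot> (X \<lhd> \<psi>\<^sub>Y) \<in> hom C ((X \<otimes> Y) \<otimes> A) (A \<otimes> X \<otimes> Y)"
    by (rule in_hom, (rule reads arrows | fact)+)
  ultimately show ?thesis using ob by (simp add: is_right_transfer_def)
qed

abbreviation right_ten where
  "right_ten X' \<psi>' Y' f g \<equiv> (m \<rhd> X' \<otimes> Y') \<cdot> (A \<lhd> \<psi>' \<rhd> Y') \<cdot> (f \<boxtimes> g)"

lemma right_ten_arr:
  assumes f: "right_arr X \<psi>\<^sub>X X' \<psi>\<^sub>X' f" and g: "right_arr Y \<psi>\<^sub>Y Y' \<psi>\<^sub>Y' g"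
  shows "right_arr (X \<otimes> Y) ((\<psi>\<^sub>X \<rhd> Y) \<cdot> (X \<lhd> \<psi>\<^sub>Y)) (X' \<otimes> Y') ((\<psi>\<^sub>X' \<rhd> Y') \<cdot> (X' \<lhd> \<psi>\<^sub>Y'))
    (right_ten X' \<psi>\<^sub>X' Y' f g)"
proof -
  have ob: "X \<in> Ob C" "Y \<in> Ob C" "X' \<in> Ob C" "Y' \<in> Ob C"
    and t: "\<psi>\<^sub>X \<in> hom C (X \<otimes> A) (A \<otimes> X)" "\<psi>\<^sub>Y \<in> hom C (Y \<otimes> A) (A \<otimes> Y)"
     "\<psi>\<^sub>X' \<in> hom C (X' \<otimes> A) (A \<otimes> X')" "\<psi>\<^sub>Y' \<in> hom C (Y' \<otimes> A) (A \<otimes> Y')"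
    and h: "f \<in> hom C X (A \<otimes> X')" "g \<in> hom C Y (A \<otimes> Y')"
    and cf: "(m \<rhd> X') \<cdot> (A \<lhd> f) \<cdot> \<psi>\<^sub>X = (m \<rhd> X') \<cdot> (A \<lhd> \<psi>\<^sub>X') \<cdot> (f \<rhd> A)"
    and cg: "(m \<rhd> Y') \<cdot> (A \<lhd> g) \<cdot> \<psi>\<^sub>Y = (m \<rhd> Y') \<cdot> (A \<lhd> \<psi>\<^sub>Y') \<cdot> (g \<rhd> A)"
    and mx: "\<psi>\<^sub>X' \<cdot> (X' \<lhd> m) = (m \<rhd> X') \<cdot> (A \<lhd> \<psi>\<^sub>X') \<cdot> (\<psi>\<^sub>X' \<rhd> A)"
    using right_arrD[OF f] right_arrD[OF g] by (auto dest: right_objD)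
  have "(m \<rhd> X' \<otimes> Y') \<cdot> (A \<lhd> ((m \<rhd> X' \<otimes> Y') \<cdot> (A \<lhd> \<psi>\<^sub>X' \<rhd> Y') \<cdot> (f \<boxtimes> g))) \<cdot> ((\<psi>\<^sub>X \<rhd> Y) \<cdot> (X \<lhd> \<psi>\<^sub>Y))
    = (m \<rhd> X' \<otimes> Y') \<cdot> (A \<lhd> ((\<psi>\<^sub>X' \<rhd> Y') \<cdot> (X' \<lhd> \<psi>\<^sub>Y'))) \<cdot> (((m \<rhd> X' \<otimes> Y') \<cdot> (A \<lhd> \<psi>\<^sub>X' \<rhd> Y') \<cdot> (f \<boxtimes> g)) \<rhd> A)"
    by (rule diagram4[OF m_assoc cf mx cg, where S = "[Undo 0 5 0, Right 2, Right 1, Left 4, Apply 1 2 0, Right 4,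
      Apply 0 5 0, Undo 2 3 1, Left 1, Left 0, Apply 3 1 2, Apply 2 3 1, Left 2, Undo 0 5 0, Left 4, Left 3]"],
      (rule reads arrows | fact)+, simp add: run_simps)
  moreover have "(m \<rhd> X' \<otimes> Y') \<cdot> (A \<lhd> \<psi>\<^sub>X' \<rhd> Y') \<cdot> (f \<boxtimes> g) \<in> hom C (X \<otimes> Y) (A \<otimes> X' \<otimes> Y')"
    by (rule in_hom, (rule reads arrows | fact)+)
  ultimately show ?thesis
    using right_arrD[OF f] right_arrD[OF g] by (simp add: right_arr_def right_ten_obj)
qed

lemma right_ten_Id:
  assumes "right_obj X \<psi>\<^sub>X" "right_obj Y \<psi>\<^sub>Y"
  shows "right_ten X \<psi>\<^sub>X Y (\<eta> \<rhd> X) (\<eta> \<rhd> Y) = \<eta> \<rhd> X \<otimes> Y"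
proof -
  have ob: "X \<in> Ob C" "Y \<in> Ob C"
    and t: "\<psi>\<^sub>X \<in> hom C (X \<otimes> A) (A \<otimes> X)" "\<psi>\<^sub>Y \<in> hom C (Y \<otimes> A) (A \<otimes> Y)"
    and ex: "\<psi>\<^sub>X \<cdot> (X \<lhd> \<eta>) = \<eta> \<rhd> X"
    using right_objD[OF assms(1)] right_objD[OF assms(2)] by auto
  show "(m \<rhd> X \<otimes> Y) \<cdot> (A \<lhd> \<psi>\<^sub>X \<rhd> Y) \<cdot> ((\<eta> \<rhd> X) \<boxtimes> (\<eta> \<rhd> Y)) = \<eta> \<rhd> X \<otimes> Y"
    by (rule diagram2[OF m_unit_left ex, where S = "[Right 0, Right 1, Apply 0 2 0, Apply 1 0 0]"],
      (rule reads arrows | fact)+, simp add: run_simps)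
qed

text \<open>Interchange in \<open>T\<close> rests on the square of \<open>f'\<close>: in the
  composite of tensor products \<open>f'\<close> acts after \<open>\<psi>\<^sub>X'\<close>, whereas
  in the tensor product of composites it acts before \<open>\<psi>\<^sub>X''\<close>.\<close>

lemma right_ten_comp:
  assumes f: "right_arr X \<psi>\<^sub>X X' \<psi>\<^sub>X' f" and g: "right_arr Y \<psi>\<^sub>Y Y' \<psi>\<^sub>Y' g"
    and f': "right_arr X' \<psi>\<^sub>X' X'' \<psi>\<^sub>X'' f'" and g': "right_arr Y' \<psi>\<^sub>Y' Y'' \<psi>\<^sub>Y'' g'"
  shows "right_ten X'' \<psi>\<^sub>X'' Y'' (right_comp X'' f' f) (right_comp Y'' g' g) =
    right_comp (X'' \<otimes> Y'') (right_ten X'' \<psi>\<^sub>X'' Y'' f' g') (right_ten X' \<psi>\<^sub>X' Y' f g)"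
proof -
  have ob: "X \<in> Ob C" "Y \<in> Ob C" "X' \<in> Ob C" "Y' \<in> Ob C" "X'' \<in> Ob C" "Y'' \<in> Ob C"
    and t: "\<psi>\<^sub>X' \<in> hom C (X' \<otimes> A) (A \<otimes> X')" "\<psi>\<^sub>X'' \<in> hom C (X'' \<otimes> A) (A \<otimes> X'')"
    and h: "f \<in> hom C X (A \<otimes> X')" "g \<in> hom C Y (A \<otimes> Y')" "f' \<in> hom C X' (A \<otimes> X'')" "g' \<in> hom C Y' (A \<otimes> Y'')"
    and cf: "(m \<rhd> X'') \<cdot> (A \<lhd> f') \<cdot> \<psi>\<^sub>X' = (m \<rhd> X'') \<cdot> (A \<lhd> \<psi>\<^sub>X'') \<cdot> (f' \<rhd> A)"
    and mx: "\<psi>\<^sub>X'' \<cdot> (X'' \<lhd> m) = (m \<rhd> X'') \<cdot> (A \<lhd> \<psi>\<^sub>X'') \<cdot> (\<psi>\<^sub>X'' \<rhd> A)"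
    using right_arrD[OF f] right_arrD[OF g] right_arrD[OF f'] right_arrD[OF g'] by (auto dest: right_objD)
  show "(m \<rhd> X'' \<otimes> Y'') \<cdot> (A \<lhd> \<psi>\<^sub>X'' \<rhd> Y'') \<cdot> (((m \<rhd> X'') \<cdot> (A \<lhd> f') \<cdot> f) \<boxtimes> ((m \<rhd> Y'') \<cdot> (A \<lhd> g') \<cdot> g)) =
    (m \<rhd> X'' \<otimes> Y'') \<cdot> (A \<lhd> ((m \<rhd> X'' \<otimes> Y'') \<cdot> (A \<lhd> \<psi>\<^sub>X'' \<rhd> Y'') \<cdot> (f' \<boxtimes> g'))) \<cdot>
      ((m \<rhd> X' \<otimes> Y') \<cdot> (A \<lhd> \<psi>\<^sub>X' \<rhd> Y') \<cdot> (f \<boxtimes> g))"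
    by (rule diagram3[OF m_assoc mx cf, where S = "[Right 2, Right 3, Right 4, Right 5, Apply 0 6 0, Apply 1 4 2,
      Undo 0 6 1, Right 1, Right 2, Left 5, Undo 2 3 1, Right 5, Left 2, Left 3, Apply 0 6 1, Undo 0 7 0, Left 6,
      Left 5, Left 4, Left 3]"], (rule reads arrows | fact)+, simp add: run_simps)
qed

lemma right_ten_assoc:
  assumes f: "right_arr X \<psi>\<^sub>X X' \<psi>\<^sub>X' f" and g: "right_arr Y \<psi>\<^sub>Y Y' \<psi>\<^sub>Y' g" and h: "right_arr Z \<psi>\<^sub>Z Z' \<psi>\<^sub>Z' h"
  shows "right_ten (X' \<otimes> Y') ((\<psi>\<^sub>X' \<rhd> Y') \<cdot> (X' \<lhd> \<psi>\<^sub>Y')) Z' (right_ten X' \<psi>\<^sub>X' Y' f g) h =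
    right_ten X' \<psi>\<^sub>X' (Y' \<otimes> Z') f (right_ten Y' \<psi>\<^sub>Y' Z' g h)"
proof -
  have ob: "X \<in> Ob C" "Y \<in> Ob C" "Z \<in> Ob C" "X' \<in> Ob C" "Y' \<in> Ob C" "Z' \<in> Ob C"
    and t: "\<psi>\<^sub>X' \<in> hom C (X' \<otimes> A) (A \<otimes> X')" "\<psi>\<^sub>Y' \<in> hom C (Y' \<otimes> A) (A \<otimes> Y')"
    and h': "f \<in> hom C X (A \<otimes> X')" "g \<in> hom C Y (A \<otimes> Y')" "h \<in> hom C Z (A \<otimes> Z')"
    and mx: "\<psi>\<^sub>X' \<cdot> (X' \<lhd> m) = (m \<rhd> X') \<cdot> (A \<lhd> \<psi>\<^sub>X') \<cdot> (\<psi>\<^sub>X' \<rhd> A)"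
    using right_arrD[OF f] right_arrD[OF g] right_arrD[OF h] by (auto dest: right_objD)
  show "(m \<rhd> (X' \<otimes> Y') \<otimes> Z') \<cdot> (A \<lhd> ((\<psi>\<^sub>X' \<rhd> Y') \<cdot> (X' \<lhd> \<psi>\<^sub>Y')) \<rhd> Z') \<cdot>
      (((m \<rhd> X' \<otimes> Y') \<cdot> (A \<lhd> \<psi>\<^sub>X' \<rhd> Y') \<cdot> (f \<boxtimes> g)) \<boxtimes> h) =
    (m \<rhd> X' \<otimes> Y' \<otimes> Z') \<cdot> (A \<lhd> \<psi>\<^sub>X' \<rhd> Y' \<otimes> Z') \<cdot> (f \<boxtimes> ((m \<rhd> Y' \<otimes> Z') \<cdot> (A \<lhd> \<psi>\<^sub>Y' \<rhd> Z') \<cdot> (g \<boxtimes> h)))"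
    by (rule diagram2[OF m_assoc mx, where S = "[Right 3, Right 4, Right 5, Apply 0 6 0, Right 2, Right 3,
      Undo 1 4 1]"], (rule reads arrows | fact)+, simp add: run_simps)
qed

lemma right_ten_obj_assoc:
  assumes "right_obj X \<psi>\<^sub>X" "right_obj Y \<psi>\<^sub>Y" "right_obj Z \<psi>\<^sub>Z"
  shows "(((\<psi>\<^sub>X \<rhd> Y) \<cdot> (X \<lhd> \<psi>\<^sub>Y)) \<rhd> Z) \<cdot> (X \<otimes> Y \<lhd> \<psi>\<^sub>Z) = (\<psi>\<^sub>X \<rhd> Y \<otimes> Z) \<cdot> (X \<lhd> ((\<psi>\<^sub>Y \<rhd> Z) \<cdot> (Y \<lhd> \<psi>\<^sub>Z)))"
proof -
  have ob: "X \<in> Ob C" "Y \<in> Ob C" "Z \<in> Ob C"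
    and t: "\<psi>\<^sub>X \<in> hom C (X \<otimes> A) (A \<otimes> X)" "\<psi>\<^sub>Y \<in> hom C (Y \<otimes> A) (A \<otimes> Y)" "\<psi>\<^sub>Z \<in> hom C (Z \<otimes> A) (A \<otimes> Z)"
    using assms by (auto dest: right_objD)
  show "(((\<psi>\<^sub>X \<rhd> Y) \<cdot> (X \<lhd> \<psi>\<^sub>Y)) \<rhd> Z) \<cdot> (X \<otimes> Y \<lhd> \<psi>\<^sub>Z) = (\<psi>\<^sub>X \<rhd> Y \<otimes> Z) \<cdot> (X \<lhd> ((\<psi>\<^sub>Y \<rhd> Z) \<cdot> (Y \<lhd> \<psi>\<^sub>Z)))"
    by (rule diagram0[where S = "[]"], (rule reads arrows | fact)+, simp add: run_simps)
qed

lemma right_ten_unit: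
  assumes "right_obj X \<psi>"
  shows "(Id C A \<rhd> X) \<cdot> (\<one> \<lhd> \<psi>) = \<psi>" "(\<psi> \<rhd> \<one>) \<cdot> (X \<lhd> Id C A) = \<psi>"
proof -
  have ob: "X \<in> Ob C" and t: "\<psi> \<in> hom C (X \<otimes> A) (A \<otimes> X)"
    using assms by (auto dest: right_objD)
  show "(Id C A \<rhd> X) \<cdot> (\<one> \<lhd> \<psi>) = \<psi>"
    by (rule diagram0[where S = "[]"], (rule reads arrows | fact)+, simp add: run_simps)
  show "(\<psi> \<rhd> \<one>) \<cdot> (X \<lhd> Id C A) = \<psi>"
    by (rule diagram0[where S = "[]"], (rule reads arrows | fact)+, simp add: run_simps)
qed

lemma right_ten_Id_left:
  assumes "right_obj Z \<psi>" "f \<in> hom C X (A \<otimes> Y)" "X \<in> Ob C" "Y \<in> Ob C"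
  shows "right_ten Z \<psi> Y (\<eta> \<rhd> Z) f = (\<psi> \<rhd> Y) \<cdot> (Z \<lhd> f)"
proof -
  have ob: "X \<in> Ob C" "Z \<in> Ob C" "Y \<in> Ob C"
    and t: "\<psi> \<in> hom C (Z \<otimes> A) (A \<otimes> Z)" "f \<in> hom C X (A \<otimes> Y)"
    using assms by (auto dest: right_objD)
  show "(m \<rhd> Z \<otimes> Y) \<cdot> (A \<lhd> \<psi> \<rhd> Y) \<cdot> ((\<eta> \<rhd> Z) \<boxtimes> f) = (\<psi> \<rhd> Y) \<cdot> (Z \<lhd> f)"
    by (rule diagram1[OF m_unit_left, where S = "[Right 0, Right 1, Apply 0 2 0]"], (rule reads arrows | fact)+,
      simp add: run_simps)
qed

lemma right_ten_Id_right:
  assumes "right_obj Y \<psi>" "f \<in> hom C X (A \<otimes> Y)" "X \<in> Ob C" "Z \<in> Ob C"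
  shows "right_ten Y \<psi> Z f (\<eta> \<rhd> Z) = f \<rhd> Z"
proof -
  have ob: "X \<in> Ob C" "Z \<in> Ob C" "Y \<in> Ob C"
    and t: "\<psi> \<in> hom C (Y \<otimes> A) (A \<otimes> Y)" "f \<in> hom C X (A \<otimes> Y)"
    and e: "\<psi> \<cdot> (Y \<lhd> \<eta>) = \<eta> \<rhd> Y"
    using assms by (auto dest: right_objD)
  show "(m \<rhd> Y \<otimes> Z) \<cdot> (A \<lhd> \<psi> \<rhd> Z) \<cdot> (f \<boxtimes> (\<eta> \<rhd> Z)) = f \<rhd> Z"
    by (rule diagram2[OF e m_unit_right, where S = "[Apply 0 1 1, Apply 1 1 0]"], (rule reads arrows | fact)+,
      simp add: run_simps)
qed

lemma right_transfer_Ar: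
  "((X, \<psi>), f, (Y, \<psi>')) \<in> Ar T \<longleftrightarrow> right_arr X \<psi> Y \<psi>' f"
  by (auto simp: right_transfer_def right_arr_def Let_def)

lemma right_transfer_simps [simp]:
  "(X, \<psi>) \<in> Ob T \<longleftrightarrow> right_obj X \<psi>"
  "Dom T (P, f, Q) = P" "Cod T (P, f, Q) = Q"
  "Id T (X, \<psi>) = ((X, \<psi>), \<eta> \<rhd> X, (X, \<psi>))"
  "(R, g, (Z, \<psi>'')) \<cdot>\<^bsub>T\<^esub> (P, f, Q) = (P, (m \<rhd> Z) \<cdot> (A \<lhd> g) \<cdot> f, (Z, \<psi>''))"
  "(X, \<psi>) \<otimes>\<^bsub>T\<^esub> (Y, \<psi>') = (X \<otimes> Y, (\<psi> \<rhd> Y) \<cdot> (X \<lhd> \<psi>'))"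
  "(P, f, (X', \<psi>)) \<boxtimes>\<^bsub>T\<^esub> (Q, g, (Y', \<psi>')) =
     (P \<otimes>\<^bsub>T\<^esub> Q, (m \<rhd> X' \<otimes> Y') \<cdot> (A \<lhd> \<psi> \<rhd> Y') \<cdot> (f \<boxtimes> g), (X' \<otimes> Y', (\<psi> \<rhd> Y') \<cdot> (X' \<lhd> \<psi>')))"
  "\<one>\<^bsub>T\<^esub> = (\<one>, Id C A)"
  "Assoc T P Q R = Id T (P \<otimes>\<^bsub>T\<^esub> Q \<otimes>\<^bsub>T\<^esub> R)"
  "Lun T P = Id T P" "Run T P = Id T P"
  by (auto simp: right_transfer_def Let_def)

lemma right_transfer_hom:
  "F \<in> hom T (X, \<psi>) (Y, \<psi>') \<longleftrightarrow> (\<exists>f. F = ((X, \<psi>), f, (Y, \<psi>')) \<and> right_arr X \<psi> Y \<psi>' f)"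
  by (cases F) (auto simp: hom_def right_transfer_Ar)

lemma right_transfer_ArE:
  assumes "F \<in> Ar T"
  obtains X \<psi> f Y \<psi>' where "F = ((X, \<psi>), f, (Y, \<psi>'))" "right_arr X \<psi> Y \<psi>' f"
proof -
  obtain X \<psi> f Y \<psi>' where "F = ((X, \<psi>), f, (Y, \<psi>'))" by (metis prod.exhaust)
  then show thesis using that assms right_transfer_Ar by blast
qed

text \<open>This allows the general statements on Frobenius objects in a strict monoidal category to
  be instantiated at \<open>T\<close>.\<close>

lemma right_transfer_strict: "strict_monoidal_category T"
  unfolding strict_monoidal_category_def
proof (intro conjI ballI impI)
  show "is_category T"
    unfolding is_category_def
  proof (intro conjI ballI impI)
    fix F assume "F \<in> Ar T"
    then obtain X \<psi> f Y \<psi>' where F: "F = ((X, \<psi>), f, (Y, \<psi>'))" and f: "right_arr X \<psi> Y \<psi>' f"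
      by (rule right_transfer_ArE)
    then have *: "right_obj X \<psi>" "right_obj Y \<psi>'" "f \<in> hom C X (A \<otimes> Y)" "X \<in> Ob C" "Y \<in> Ob C"
      by (auto dest: right_arrD right_objD)
    show "Dom T F \<in> Ob T" "Cod T F \<in> Ob T" using * F by auto
    show "F \<cdot>\<^bsub>T\<^esub> Id T (Dom T F) = F" "Id T (Cod T F) \<cdot>\<^bsub>T\<^esub> F = F"
      using * F by (simp_all add: right_comp_Id right_Id_comp)
    fix G assume "G \<in> Ar T"
    then obtain X' \<psi>\<^sub>1 g Z \<psi>'' where G: "G = ((X', \<psi>\<^sub>1), g, (Z, \<psi>''))" and g: "right_arr X' \<psi>\<^sub>1 Z \<psi>'' g"
      by (rule right_transfer_ArE)
    then have **: "right_obj X' \<psi>\<^sub>1" "right_obj Z \<psi>''" "g \<in> hom C X' (A \<otimes> Z)" "Z \<in> Ob C"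
      by (auto dest: right_arrD right_objD)
    show "G \<cdot>\<^bsub>T\<^esub> F \<in> hom T (Dom T F) (Cod T G)" if "Dom T G = Cod T F"
      using that F G f g by (auto simp: right_transfer_hom intro: right_comp_arr)
    fix H assume "H \<in> Ar T"
    then obtain W' \<psi>\<^sub>2 h W \<psi>\<^sub>3 where H: "H = ((W', \<psi>\<^sub>2), h, (W, \<psi>\<^sub>3))" and h: "right_arr W' \<psi>\<^sub>2 W \<psi>\<^sub>3 h"
      by (rule right_transfer_ArE)
    then have "h \<in> hom C W' (A \<otimes> W)" "W \<in> Ob C"
      by (auto dest: right_arrD right_objD)
    then show "H \<cdot>\<^bsub>T\<^esub> G \<cdot>\<^bsub>T\<^esub> F = H \<cdot>\<^bsub>T\<^esub> (G \<cdot>\<^bsub>T\<^esub> F)" if "Dom T G = Cod T F \<and> Dom T H = Cod T G"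
      using that F G H * ** right_comp_assoc[of X Y Z W f g h] by auto
  next
    fix P assume "P \<in> Ob T"
    then show "Id T P \<in> hom T P P"
      by (cases P) (auto simp: right_transfer_hom intro: right_Id_arr)
  qed
  show "\<one>\<^bsub>T\<^esub> \<in> Ob T" by (simp add: right_unit_obj)
next
  fix P Q assume "P \<in> Ob T" "Q \<in> Ob T"
  then show "P \<otimes>\<^bsub>T\<^esub> Q \<in> Ob T" "Id T P \<boxtimes>\<^bsub>T\<^esub> Id T Q = Id T (P \<otimes>\<^bsub>T\<^esub> Q)"
    by (cases P; cases Q; simp add: right_ten_obj right_ten_Id)+
  fix R assume "R \<in> Ob T"
  with \<open>P \<in> Ob T\<close> \<open>Q \<in> Ob T\<close> show "(P \<otimes>\<^bsub>T\<^esub> Q) \<otimes>\<^bsub>T\<^esub> R = P \<otimes>\<^bsub>T\<^esub> Q \<otimes>\<^bsub>T\<^esub> R"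
    by (cases P; cases Q; cases R; simp add: right_ten_obj_assoc ten_assoc right_objD)
  show "Assoc T P Q R = Id T (P \<otimes>\<^bsub>T\<^esub> Q \<otimes>\<^bsub>T\<^esub> R)" by simp
next
  fix P assume "P \<in> Ob T"
  then show "\<one>\<^bsub>T\<^esub> \<otimes>\<^bsub>T\<^esub> P = P" "P \<otimes>\<^bsub>T\<^esub> \<one>\<^bsub>T\<^esub> = P" "Lun T P = Id T P" "Run T P = Id T P"
    by (cases P; simp add: right_ten_unit right_objD)+
next
  fix F G assume "F \<in> Ar T" "G \<in> Ar T"
  from \<open>F \<in> Ar T\<close> obtain X \<psi> f X' \<psi>' where F: "F = ((X, \<psi>), f, (X', \<psi>'))" and f: "right_arr X \<psi> X' \<psi>' f"
    by (rule right_transfer_ArE)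
  from \<open>G \<in> Ar T\<close> obtain Y \<phi> g Y' \<phi>' where G: "G = ((Y, \<phi>), g, (Y', \<phi>'))" and g: "right_arr Y \<phi> Y' \<phi>' g"
    by (rule right_transfer_ArE)
  show "F \<boxtimes>\<^bsub>T\<^esub> G \<in> hom T (Dom T F \<otimes>\<^bsub>T\<^esub> Dom T G) (Cod T F \<otimes>\<^bsub>T\<^esub> Cod T G)"
    using F G right_ten_arr[OF f g] by (simp add: right_transfer_hom)
  fix H assume "H \<in> Ar T"
  then obtain Z \<chi> h Z' \<chi>' where H: "H = ((Z, \<chi>), h, (Z', \<chi>'))" and h: "right_arr Z \<chi> Z' \<chi>' h"
    by (rule right_transfer_ArE)
  show "(F \<boxtimes>\<^bsub>T\<^esub> G) \<boxtimes>\<^bsub>T\<^esub> H = F \<boxtimes>\<^bsub>T\<^esub> G \<boxtimes>\<^bsub>T\<^esub> H"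
    using F G H right_ten_assoc[OF f g h] f g h
    by (simp add: right_ten_obj_assoc ten_assoc right_objD right_arrD(1)[OF f] right_arrD(2)[OF f]
       right_arrD(1)[OF g] right_arrD(2)[OF g] right_arrD(1)[OF h] right_arrD(2)[OF h]
       right_objD(1)[OF right_arrD(1)[OF f]] right_objD(1)[OF right_arrD(2)[OF f]]
       right_objD(1)[OF right_arrD(1)[OF g]] right_objD(1)[OF right_arrD(2)[OF g]]
       right_objD(1)[OF right_arrD(1)[OF h]] right_objD(1)[OF right_arrD(2)[OF h]])
  fix K assume "K \<in> Ar T"
  then obtain W \<omega> k W' \<omega>' where K: "K = ((W, \<omega>), k, (W', \<omega>'))" and k: "right_arr W \<omega> W' \<omega>' k"
    by (rule right_transfer_ArE)
  show "(H \<cdot>\<^bsub>T\<^esub> F) \<boxtimes>\<^bsub>T\<^esub> (K \<cdot>\<^bsub>T\<^esub> G) = (H \<boxtimes>\<^bsub>T\<^esub> K) \<cdot>\<^bsub>T\<^esub> (F \<boxtimes>\<^bsub>T\<^esub> G)"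
    if "Dom T H = Cod T F \<and> Dom T K = Cod T G"
    using that F G H K f g h k right_ten_comp[of X \<psi> X' \<psi>' f Y \<phi> Y' \<phi>' g Z' \<chi>' h W' \<omega>' k] by simp
next
  fix F assume "F \<in> Ar T"
  then obtain X \<psi> f Y \<psi>' where F: "F = ((X, \<psi>), f, (Y, \<psi>'))" and f: "right_arr X \<psi> Y \<psi>' f"
    by (rule right_transfer_ArE)
  then have *: "right_obj X \<psi>" "right_obj Y \<psi>'" "f \<in> hom C X (A \<otimes> Y)" "X \<in> Ob C" "Y \<in> Ob C"
    by (auto dest: right_arrD right_objD)
  have u: "(m \<rhd> \<one> \<otimes> Y) \<cdot> (A \<lhd> Id C A \<rhd> Y) \<cdot> ((\<eta> \<rhd> \<one>) \<boxtimes> f) = f"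
    "(m \<rhd> Y \<otimes> \<one>) \<cdot> (A \<lhd> \<psi>' \<rhd> \<one>) \<cdot> (f \<boxtimes> (\<eta> \<rhd> \<one>)) = f"
    using * right_ten_Id_left[OF right_unit_obj *(3)] right_ten_Id_right[OF *(2,3), of \<one>] 
    by (simp_all add: lwhisker_def rwhisker_def tenA_unit Id_tenA Id_comp A_in_Ob)
  show "Id T \<one>\<^bsub>T\<^esub> \<boxtimes>\<^bsub>T\<^esub> F = F" "F \<boxtimes>\<^bsub>T\<^esub> Id T \<one>\<^bsub>T\<^esub> = F"
    using F * u by (simp_all add: right_ten_unit)
qed

text \<open>Whiskering in \<open>T\<close> is asymmetric. On the left, the factor \<open>A\<close>
  produced by \<open>f\<close> has to be carried across \<open>Z\<close> by \<open>\<zeta>\<close>;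
  on the right it is already in front.\<close>

lemma right_transfer_whisker:
  assumes "right_obj Z \<zeta>" "right_arr X \<psi> Y \<psi>' f"
  shows "(Z, \<zeta>) \<lhd>\<^bsub>T\<^esub> ((X, \<psi>), f, (Y, \<psi>')) =
      ((Z, \<zeta>) \<otimes>\<^bsub>T\<^esub> (X, \<psi>), (\<zeta> \<rhd> Y) \<cdot> (Z \<lhd> f), (Z, \<zeta>) \<otimes>\<^bsub>T\<^esub> (Y, \<psi>'))"
    "((X, \<psi>), f, (Y, \<psi>')) \<rhd>\<^bsub>T\<^esub> (Z, \<zeta>) =
      ((X, \<psi>) \<otimes>\<^bsub>T\<^esub> (Z, \<zeta>), f \<rhd> Z, (Y, \<psi>') \<otimes>\<^bsub>T\<^esub> (Z, \<zeta>))"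
  using assms right_arrD[OF assms(2)] right_objD(1)
  by (simp_all add: lwhisker_def[of T] rwhisker_def[of T] right_ten_Id_left right_ten_Id_right)

end

section \<open>Frobenius coalgebras and self-duality\<close>

context strict_monoidal
begin

text \<open>Uniqueness of inverses, needed because \<open>inverse_arrow\<close> is a definite
  description.\<close>

lemma inverse_arrow_eq:
  assumes "inverse_arrows C f g"
  shows "inverse_arrow C f = g"
  unfolding inverse_arrow_def
proof (rule the_equality[where P = "inverse_arrows C f", OF assms])
  fix h assume h: "inverse_arrows C f h"
  have "f \<in> hom C (Dom C f) (Cod C f)" and g: "g \<in> hom C (Cod C f) (Dom C f)" and h': "h \<in> hom C (Cod C f) (Dom C f)"
    using assms h by (auto simp: inverse_arrows_def hom_def)
  then have "h = (h \<cdot> f) \<cdot> g"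
    using assms comp_assoc[OF g _ h', of f] comp_Id[OF h'] by (simp add: inverse_arrows_def)
  then show "h = g" using h Id_comp[OF g] by (simp add: inverse_arrows_def)
qed

lemma inverse_arrow_Id: "X \<in> Ob C \<Longrightarrow> inverse_arrow C (Id C X) = Id C X"
  using Id_in_hom[of X] by (intro inverse_arrow_eq) (auto simp: inverse_arrows_def hom_def comp_Id[OF Id_in_hom])

text \<open>In the strict case the structural isomorphisms are identities and drop out; the same
  happens in the three equivalences that follow.\<close>

lemma coalgebra_iff:
  "coalgebra C D \<Delta> \<epsilon> \<longleftrightarrow> D \<in> Ob C \<and> \<Delta> \<in> hom C D (D \<otimes> D) \<and> \<epsilon> \<in> hom C D \<one> \<and>
     (\<Delta> \<rhd> D) \<cdot> \<Delta> = (D \<lhd> \<Delta>) \<cdot> \<Delta> \<and> (\<epsilon> \<rhd> D) \<cdot> \<Delta> = Id C D \<and> (D \<lhd> \<epsilon>) \<cdot> \<Delta> = Id C D"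
proof -
  have *: "Id C (D \<otimes> D \<otimes> D) \<cdot> (\<Delta> \<rhd> D) \<cdot> \<Delta> = (\<Delta> \<rhd> D) \<cdot> \<Delta> \<and> Id C D \<cdot> (\<epsilon> \<rhd> D) \<cdot> \<Delta> = (\<epsilon> \<rhd> D) \<cdot> \<Delta> \<and>
      Id C D \<cdot> (D \<lhd> \<epsilon>) \<cdot> \<Delta> = (D \<lhd> \<epsilon>) \<cdot> \<Delta>"
    if "D \<in> Ob C" "\<Delta> \<in> hom C D (D \<otimes> D)" "\<epsilon> \<in> hom C D \<one>"
  proof (intro conjI)
    show "Id C (D \<otimes> D \<otimes> D) \<cdot> (\<Delta> \<rhd> D) \<cdot> \<Delta> = (\<Delta> \<rhd> D) \<cdot> \<Delta>"
      by (rule diagram0[where S = "[]"], (rule reads arrows | fact)+, simp add: run_simps)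
    show "Id C D \<cdot> (\<epsilon> \<rhd> D) \<cdot> \<Delta> = (\<epsilon> \<rhd> D) \<cdot> \<Delta>"
      by (rule diagram0[where S = "[]"], (rule reads arrows | fact)+, simp add: run_simps)
    show "Id C D \<cdot> (D \<lhd> \<epsilon>) \<cdot> \<Delta> = (D \<lhd> \<epsilon>) \<cdot> \<Delta>"
      by (rule diagram0[where S = "[]"], (rule reads arrows | fact)+, simp add: run_simps)
  qed
  show ?thesis
    unfolding coalgebra_def using * by (auto simp: Assoc_eq Lun_eq Run_eq)
qed

lemma algebra_iff:
  "algebra C S m \<eta> \<longleftrightarrow> S \<in> Ob C \<and> m \<in> hom C (S \<otimes> S) S \<and> \<eta> \<in> hom C \<one> S \<and>
     m \<cdot> (m \<rhd> S) = m \<cdot> (S \<lhd> m) \<and> m \<cdot> (\<eta> \<rhd> S) = Id C S \<and> m \<cdot> (S \<lhd> \<eta>) = Id C S"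
proof -
  have *: "m \<cdot> (S \<lhd> m) \<cdot> Id C (S \<otimes> S \<otimes> S) = m \<cdot> (S \<lhd> m)" if "S \<in> Ob C" "m \<in> hom C (S \<otimes> S) S"
  proof -
    show "m \<cdot> (S \<lhd> m) \<cdot> Id C (S \<otimes> S \<otimes> S) = m \<cdot> (S \<lhd> m)"
      by (rule diagram0[where S = "[]"], (rule reads arrows | fact)+, simp add: run_simps)
  qed
  show ?thesis
    unfolding algebra_def using * by (auto simp: Assoc_eq Lun_eq Run_eq)
qed

lemma frobenius_coalgebra_iff:
  "frobenius_coalgebra C D \<Delta> \<epsilon> \<longleftrightarrow> coalgebra C D \<Delta> \<epsilon> \<and>
     (\<exists>t\<in>hom C \<one> D. \<exists>B\<in>hom C (D \<otimes> D) \<one>.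
        (D \<lhd> B) \<cdot> (\<Delta> \<rhd> D) = (B \<rhd> D) \<cdot> (D \<lhd> \<Delta>) \<and> B \<cdot> (t \<rhd> D) = \<epsilon> \<and> B \<cdot> (D \<lhd> t) = \<epsilon>)"
proof -
  have *: "Run C D \<cdot> (D \<lhd> B) \<cdot> Assoc C D D D \<cdot> (\<Delta> \<rhd> D) = (D \<lhd> B) \<cdot> (\<Delta> \<rhd> D) \<and>
      Lun C D \<cdot> (B \<rhd> D) \<cdot> inverse_arrow C (Assoc C D D D) \<cdot> (D \<lhd> \<Delta>) = (B \<rhd> D) \<cdot> (D \<lhd> \<Delta>) \<and>
      B \<cdot> (t \<rhd> D) \<cdot> inverse_arrow C (Lun C D) = B \<cdot> (t \<rhd> D) \<and>
      B \<cdot> (D \<lhd> t) \<cdot> inverse_arrow C (Run C D) = B \<cdot> (D \<lhd> t)"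
    if "coalgebra C D \<Delta> \<epsilon>" and t: "t \<in> hom C \<one> D" and B: "B \<in> hom C (D \<otimes> D) \<one>" for t B
  proof -
    have D: "D \<in> Ob C" and h: "\<Delta> \<in> hom C D (D \<otimes> D)"
      using that by (auto simp: coalgebra_def)
    have "Id C D \<cdot> (D \<lhd> B) \<cdot> Id C (D \<otimes> D \<otimes> D) \<cdot> (\<Delta> \<rhd> D) = (D \<lhd> B) \<cdot> (\<Delta> \<rhd> D)"
      by (rule diagram0[where S = "[]"], (rule reads arrows | fact)+, simp add: run_simps)
    moreover have "Id C D \<cdot> (B \<rhd> D) \<cdot> Id C (D \<otimes> D \<otimes> D) \<cdot> (D \<lhd> \<Delta>) = (B \<rhd> D) \<cdot> (D \<lhd> \<Delta>)"
      by (rule diagram0[where S = "[]"], (rule reads arrows | fact)+, simp add: run_simps)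
    moreover have "B \<cdot> (t \<rhd> D) \<cdot> Id C D = B \<cdot> (t \<rhd> D)"
      by (rule diagram0[where S = "[]"], (rule reads arrows | fact)+, simp add: run_simps)
    moreover have "B \<cdot> (D \<lhd> t) \<cdot> Id C D = B \<cdot> (D \<lhd> t)"
      by (rule diagram0[where S = "[]"], (rule reads arrows | fact)+, simp add: run_simps)
    ultimately show ?thesis
      using D by (simp add: Assoc_eq Lun_eq Run_eq inverse_arrow_Id)
  qed
  show ?thesis
    unfolding frobenius_coalgebra_def using * by (auto cong: conj_cong bex_cong)
qed

lemma frobenius_algebra_iff:
  "frobenius_algebra C S m \<eta> \<longleftrightarrow> algebra C S m \<eta> \<and>
     (\<exists>\<theta>\<in>hom C S \<one>. \<exists>e\<in>hom C \<one> (S \<otimes> S).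
        (S \<lhd> m) \<cdot> (e \<rhd> S) = (m \<rhd> S) \<cdot> (S \<lhd> e) \<and> (\<theta> \<rhd> S) \<cdot> e = \<eta> \<and> (S \<lhd> \<theta>) \<cdot> e = \<eta>)"
proof -
  have *: "(S \<lhd> m) \<cdot> Assoc C S S S \<cdot> (e \<rhd> S) \<cdot> inverse_arrow C (Lun C S) = (S \<lhd> m) \<cdot> (e \<rhd> S) \<and>
      (m \<rhd> S) \<cdot> inverse_arrow C (Assoc C S S S) \<cdot> (S \<lhd> e) \<cdot> inverse_arrow C (Run C S) = (m \<rhd> S) \<cdot> (S \<lhd> e) \<and>
      Lun C S \<cdot> (\<theta> \<rhd> S) \<cdot> e = (\<theta> \<rhd> S) \<cdot> e \<and> Run C S \<cdot> (S \<lhd> \<theta>) \<cdot> e = (S \<lhd> \<theta>) \<cdot> e"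
    if "algebra C S m \<eta>" and t: "\<theta> \<in> hom C S \<one>" and B: "e \<in> hom C \<one> (S \<otimes> S)" for \<theta> e
  proof -
    have S: "S \<in> Ob C" and h: "m \<in> hom C (S \<otimes> S) S"
      using that by (auto simp: algebra_def)
    have "(S \<lhd> m) \<cdot> Id C (S \<otimes> S \<otimes> S) \<cdot> (e \<rhd> S) \<cdot> Id C S = (S \<lhd> m) \<cdot> (e \<rhd> S)"
      by (rule diagram0[where S = "[]"], (rule reads arrows | fact)+, simp add: run_simps)
    moreover have "(m \<rhd> S) \<cdot> Id C (S \<otimes> S \<otimes> S) \<cdot> (S \<lhd> e) \<cdot> Id C S = (m \<rhd> S) \<cdot> (S \<lhd> e)"
      by (rule diagram0[where S = "[]"], (rule reads arrows | fact)+, simp add: run_simps)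
    moreover have "Id C S \<cdot> (\<theta> \<rhd> S) \<cdot> e = (\<theta> \<rhd> S) \<cdot> e"
      by (rule diagram0[where S = "[]"], (rule reads arrows | fact)+, simp add: run_simps)
    moreover have "Id C S \<cdot> (S \<lhd> \<theta>) \<cdot> e = (S \<lhd> \<theta>) \<cdot> e"
      by (rule diagram0[where S = "[]"], (rule reads arrows | fact)+, simp add: run_simps)
    ultimately show ?thesis
      using S by (simp add: Assoc_eq Lun_eq Run_eq inverse_arrow_Id)
  qed
  show ?thesis
    unfolding frobenius_algebra_def using * by (auto cong: conj_cong bex_cong)
qed

definition self_dual :: "'o \<Rightarrow> 'a \<Rightarrow> 'a \<Rightarrow> bool" where
  "self_dual D s B \<longleftrightarrow> (D \<lhd> B) \<cdot> (s \<rhd> D) = Id C D \<and> (B \<rhd> D) \<cdot> (D \<lhd> s) = Id C D"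

text \<open>In a Frobenius structure the common value of the two sides is the multiplication on
  \<open>D\<close>.\<close>

definition casimir :: "'o \<Rightarrow> 'a \<Rightarrow> 'a \<Rightarrow> bool" where
  "casimir D \<Delta> B \<longleftrightarrow> (D \<lhd> B) \<cdot> (\<Delta> \<rhd> D) = (B \<rhd> D) \<cdot> (D \<lhd> \<Delta>)"

text \<open>The Casimir law moves \<open>\<Delta>\<close> away from the strand of \<open>t\<close>;
  then \<open>B\<close> and \<open>t\<close> cancel to the counit, and a counit law remains.\<close>

lemma frobenius_imp_self_dual:
  assumes "coalgebra C D \<Delta> \<epsilon>" and t: "t \<in> hom C \<one> D" and B: "B \<in> hom C (D \<otimes> D) \<one>"
    and cas: "(D \<lhd> B) \<cdot> (\<Delta> \<rhd> D) = (B \<rhd> D) \<cdot> (D \<lhd> \<Delta>)"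
    and u1: "B \<cdot> (t \<rhd> D) = \<epsilon>" and u2: "B \<cdot> (D \<lhd> t) = \<epsilon>"
  shows "self_dual D (\<Delta> \<cdot> t) B"
proof -
  have h: "D \<in> Ob C" "\<Delta> \<in> hom C D (D \<otimes> D)" "\<epsilon> \<in> hom C D \<one>"
    and c1: "(\<epsilon> \<rhd> D) \<cdot> \<Delta> = Id C D" and c2: "(D \<lhd> \<epsilon>) \<cdot> \<Delta> = Id C D"
    using assms(1) by (simp_all add: coalgebra_iff)
  have "(D \<lhd> B) \<cdot> ((\<Delta> \<cdot> t) \<rhd> D) = Id C D"
    by (rule diagram3[OF cas u1 c1, where S = "[Apply 0 1 0, Right 0, Apply 1 1 0, Apply 2 0 0]"],
      (rule reads arrows | fact)+, simp add: run_simps)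
  moreover have "(B \<rhd> D) \<cdot> (D \<lhd> (\<Delta> \<cdot> t)) = Id C D"
    by (rule diagram3[OF cas u2 c2, where S = "[Undo 0 1 0, Left 0, Apply 1 1 1, Apply 2 0 0]"],
      (rule reads arrows | fact)+, simp add: run_simps)
  ultimately show ?thesis by (simp add: self_dual_def)
qed

text \<open>When the coevaluation is \<open>\<Delta> \<cdot> t\<close>, coassociativity links the
  two zigzags, and the Casimir law and both unit conditions follow from them.\<close>

lemma frobenius_coalgebra_iff_unit:
  assumes "coalgebra C D \<Delta> \<epsilon>"
  shows "frobenius_coalgebra C D \<Delta> \<epsilon> \<longleftrightarrow> (\<exists>t\<in>hom C \<one> D. \<exists>B\<in>hom C (D \<otimes> D) \<one>. self_dual D (\<Delta> \<cdot> t) B)"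
proof
  assume "frobenius_coalgebra C D \<Delta> \<epsilon>"
  then show "\<exists>t\<in>hom C \<one> D. \<exists>B\<in>hom C (D \<otimes> D) \<one>. self_dual D (\<Delta> \<cdot> t) B"
    using assms frobenius_imp_self_dual unfolding frobenius_coalgebra_iff by blast
next
  assume "\<exists>t\<in>hom C \<one> D. \<exists>B\<in>hom C (D \<otimes> D) \<one>. self_dual D (\<Delta> \<cdot> t) B"
  then obtain t B where t: "t \<in> hom C \<one> D" and B: "B \<in> hom C (D \<otimes> D) \<one>"
    and z1: "(D \<lhd> B) \<cdot> ((\<Delta> \<cdot> t) \<rhd> D) = Id C D" and z2: "(B \<rhd> D) \<cdot> (D \<lhd> (\<Delta> \<cdot> t)) = Id C D"
    by (auto simp: self_dual_def)
  have h: "D \<in> Ob C" "\<Delta> \<in> hom C D (D \<otimes> D)" "\<epsilon> \<in> hom C D \<one>"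
    and co: "(\<Delta> \<rhd> D) \<cdot> \<Delta> = (D \<lhd> \<Delta>) \<cdot> \<Delta>"
    and c1: "(\<epsilon> \<rhd> D) \<cdot> \<Delta> = Id C D" and c2: "(D \<lhd> \<epsilon>) \<cdot> \<Delta> = Id C D"
    using assms by (simp_all add: coalgebra_iff)
  \<comment> \<open>A zigzag is inserted on the first strand, coassociativity shifts the
    comultiplication across \<open>\<Delta> \<cdot> t\<close>, and the other zigzag is
    removed.\<close>
  have cas: "(D \<lhd> B) \<cdot> (\<Delta> \<rhd> D) = (B \<rhd> D) \<cdot> (D \<lhd> \<Delta>)"
    by (rule diagram3[OF z2 co z1, where S = "[Undo 0 0 0, Right 2, Right 3, Undo 1 1 1, Right 2, Apply 2 0 1]"],
      (rule reads arrows | fact)+, simp add: run_simps)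
  \<comment> \<open>Inserting a counit law creates the \<open>\<Delta>\<close> on which the Casimir
    law and then a zigzag can act; the mirrored argument gives the other unit condition.\<close>
  have "B \<cdot> (t \<rhd> D) = \<epsilon>"
    by (rule diagram3[OF c2 cas z1, where S = "[Undo 0 0 0, Left 1, Left 0, Left 2, Undo 1 1 0, Apply 2 0 0]"],
      (rule reads arrows | fact)+, simp add: run_simps)
  moreover have "B \<cdot> (D \<lhd> t) = \<epsilon>"
    by (rule diagram3[OF c1 cas z2, where S = "[Undo 0 0 0, Right 1, Right 0, Right 2, Apply 1 1 0, Apply 2 0 0]"],
      (rule reads arrows | fact)+, simp add: run_simps)
  ultimately show "frobenius_coalgebra C D \<Delta> \<epsilon>"
    using assms t B cas unfolding frobenius_coalgebra_iff by blast
qed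

text \<open>Now the coevaluation \<open>s\<close> is arbitrary and the Casimir law is given.
  Applying the counit to either leg of \<open>s\<close> gives two candidates for \<open>t\<close>,
  each satisfying one of the unit conditions, and the point is that they coincide.\<close>

lemma frobenius_coalgebra_iff_casimir:
  assumes "coalgebra C D \<Delta> \<epsilon>"
  shows "frobenius_coalgebra C D \<Delta> \<epsilon> \<longleftrightarrow>
    (\<exists>B\<in>hom C (D \<otimes> D) \<one>. casimir D \<Delta> B \<and> (\<exists>s\<in>hom C \<one> (D \<otimes> D). self_dual D s B))"
proof
  assume "frobenius_coalgebra C D \<Delta> \<epsilon>"
  then show "\<exists>B\<in>hom C (D \<otimes> D) \<one>. casimir D \<Delta> B \<and> (\<exists>s\<in>hom C \<one> (D \<otimes> D). self_dual D s B)"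
    using assms frobenius_imp_self_dual comp_in_hom[of _ _ D \<Delta> "D \<otimes> D"]
    unfolding frobenius_coalgebra_iff casimir_def coalgebra_iff by blast
next
  assume "\<exists>B\<in>hom C (D \<otimes> D) \<one>. casimir D \<Delta> B \<and> (\<exists>s\<in>hom C \<one> (D \<otimes> D). self_dual D s B)"
  then obtain s B where s: "s \<in> hom C \<one> (D \<otimes> D)" and B: "B \<in> hom C (D \<otimes> D) \<one>"
    and cas: "(D \<lhd> B) \<cdot> (\<Delta> \<rhd> D) = (B \<rhd> D) \<cdot> (D \<lhd> \<Delta>)"
    and z1: "(D \<lhd> B) \<cdot> (s \<rhd> D) = Id C D" and z2: "(B \<rhd> D) \<cdot> (D \<lhd> s) = Id C D"
    by (auto simp: self_dual_def casimir_def)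
  have h: "D \<in> Ob C" "\<Delta> \<in> hom C D (D \<otimes> D)" "\<epsilon> \<in> hom C D \<one>"
    and c1: "(\<epsilon> \<rhd> D) \<cdot> \<Delta> = Id C D" and c2: "(D \<lhd> \<epsilon>) \<cdot> \<Delta> = Id C D"
    using assms by (simp_all add: coalgebra_iff)
  \<comment> \<open>If \<open>s\<close> were \<open>\<Delta> \<cdot> t\<close>, the counit law would
    return \<open>t\<close> from this expression.\<close>
  have t: "(\<epsilon> \<rhd> D) \<cdot> s \<in> hom C \<one> D"
    by (rule in_hom, (rule reads arrows | fact)+)
  have u1: "B \<cdot> (((\<epsilon> \<rhd> D) \<cdot> s) \<rhd> D) = \<epsilon>"
    by (rule diagram1[OF z1, where S = "[Right 1, Apply 0 0 0]"], (rule reads arrows | fact)+, simp add: run_simps)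
  have u2: "B \<cdot> (D \<lhd> ((D \<lhd> \<epsilon>) \<cdot> s)) = \<epsilon>"
    by (rule diagram1[OF z2, where S = "[Left 1, Apply 0 0 0]"], (rule reads arrows | fact)+, simp add: run_simps)
  txt \<open>Both one-sided units of the product \<open>(D \<lhd> B) \<cdot> (\<Delta> \<rhd> D)\<close> agree.\<close>
  have eq: "(\<epsilon> \<rhd> D) \<cdot> s = (D \<lhd> \<epsilon>) \<cdot> s"
  proof -
    have "(D \<lhd> B) \<cdot> (\<Delta> \<rhd> D) \<cdot> (((\<epsilon> \<rhd> D) \<cdot> s) \<rhd> D) \<cdot> ((D \<lhd> \<epsilon>) \<cdot> s) = (\<epsilon> \<rhd> D) \<cdot> s"
      by (rule diagram2[OF u2 c2, where S = "[Left 1, Left 0, Left 2, Left 1, Left 3, Left 2, Apply 0 3 1,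
      Apply 1 2 0]"], (rule reads arrows | fact)+, simp add: run_simps)
    moreover have "(D \<lhd> B) \<cdot> (\<Delta> \<rhd> D) \<cdot> (((\<epsilon> \<rhd> D) \<cdot> s) \<rhd> D) \<cdot> ((D \<lhd> \<epsilon>) \<cdot> s) = (D \<lhd> \<epsilon>) \<cdot> s"
      by (rule diagram3[OF cas u1 c1, where S = "[Apply 0 4 0, Right 3, Right 2, Apply 1 3 0, Apply 2 2 0]"],
      (rule reads arrows | fact)+, simp add: run_simps)
    ultimately show ?thesis by simp
  qed
  show "frobenius_coalgebra C D \<Delta> \<epsilon>"
    using assms t B cas u1 u2 eq unfolding frobenius_coalgebra_iff by metis
qed

end

section \<open>The reversed tensor product\<close>

text \<open>\<open>Assoc\<close> is set to identities outright, which is correct for a strict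
  monoidal \<open>C\<close>.\<close>

definition mrev :: "('o, 'a) monoidal \<Rightarrow> ('o, 'a) monoidal" where
  "mrev C = C\<lparr>TenO := \<lambda>X Y. TenO C Y X, TenA := \<lambda>f g. TenA C g f,
     Assoc := \<lambda>X Y Z. Id C (TenO C (TenO C Z Y) X)\<rparr>"

lemma mrev_simps [simp]:
  "Ob (mrev C) = Ob C" "Ar (mrev C) = Ar C" "Dom (mrev C) = Dom C" "Cod (mrev C) = Cod C"
  "Id (mrev C) = Id C" "Comp (mrev C) = Comp C" "hom (mrev C) = hom C"
  "TenO (mrev C) X Y = TenO C Y X" "TenA (mrev C) f g = TenA C g f" "Unit (mrev C) = Unit C"
  "lwhisker (mrev C) X f = rwhisker C f X" "rwhisker (mrev C) f X = lwhisker C X f"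
  "Assoc (mrev C) X Y Z = Id C (TenO C (TenO C Z Y) X)" "Lun (mrev C) = Lun C" "Run (mrev C) = Run C"
  by (simp_all add: mrev_def hom_def fun_eq_iff lwhisker_def rwhisker_def)

lemma is_category_cong:
  assumes "is_category C" "Ob D = Ob C" "Ar D = Ar C" "Dom D = Dom C" "Cod D = Cod C" "Id D = Id C"
    "Comp D = Comp C"
  shows "is_category D"
proof -
  have "hom D = hom C" using assms by (simp add: hom_def fun_eq_iff)
  then show ?thesis using assms by (simp add: is_category_def)
qed

lemma strict_monoidal_mrev:
  assumes "strict_monoidal_category C"
  shows "strict_monoidal_category (mrev C)"
proof -
  have "is_category (mrev C)"
    by (rule is_category_cong[of C]) (use assms in \<open>simp_all add: strict_monoidal_category_def\<close>)
  then show ?thesis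
    using assms unfolding strict_monoidal_category_def mrev_simps by simp
qed

text \<open>Agreement of the tensor products is demanded on the carrier only: the left transfer
  category and the reversed right one bracket a double whiskering differently, and this is harmless
  only for genuine arrows.\<close>

lemma strict_monoidal_cong:
  assumes C: "strict_monoidal_category C"
    and eqs: "Ob D = Ob C" "Ar D = Ar C" "Dom D = Dom C" "Cod D = Cod C" "Id D = Id C" "Comp D = Comp C"
    "TenO D = TenO C" "Unit D = Unit C" "Lun D = Lun C" "Run D = Run C"
    and TenA: "\<And>f g. f \<in> Ar C \<Longrightarrow> g \<in> Ar C \<Longrightarrow> TenA D f g = TenA C f g"
    and Assoc: "\<And>X Y Z. X \<in> Ob C \<Longrightarrow> Y \<in> Ob C \<Longrightarrow> Z \<in> Ob C \<Longrightarrow> Assoc D X Y Z = Assoc C X Y Z"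
  shows "strict_monoidal_category D"
proof -
  have c: "is_category D"
    by (rule is_category_cong[of C]) (use C eqs in \<open>simp_all add: strict_monoidal_category_def\<close>)
  have h: "hom D = hom C" using eqs by (simp add: hom_def fun_eq_iff)
  interpret strict_monoidal C by unfold_locales (rule C)
  have i: "Id C X \<in> Ar C" if "X \<in> Ob C" for X using Id_in_hom[OF that] by (simp add: hom_def)
  have t: "TenA C f g \<in> Ar C" if "f \<in> Ar C" "g \<in> Ar C" for f g
    using C that by (simp add: strict_monoidal_category_def hom_def)
  have k: "Comp C g f \<in> Ar C" if "f \<in> Ar C" "g \<in> Ar C" "Dom C g = Cod C f" for f g
    using category that by (simp add: is_category_def hom_def)
  show ?thesis
    using C c unfolding strict_monoidal_category_def eqs h
    by (simp add: TenA Assoc i t k)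
qed

section \<open>The left transfer category as a mirror image\<close>

context algebra_in
begin

abbreviation T' where "T' \<equiv> left_transfer C A m \<eta>"
abbreviation left_obj where "left_obj X \<phi> \<equiv> is_left_transfer C A m \<eta> X \<phi>"

definition left_arr :: "'o \<Rightarrow> 'a \<Rightarrow> 'o \<Rightarrow> 'a \<Rightarrow> 'a \<Rightarrow> bool" where
  "left_arr X \<phi> Y \<phi>' f \<longleftrightarrow> left_obj X \<phi> \<and> left_obj Y \<phi>' \<and> f \<in> hom C X (Y \<otimes> A) \<and>
     (Y \<lhd> m) \<cdot> (f \<rhd> A) \<cdot> \<phi> = (Y \<lhd> m) \<cdot> (\<phi>' \<rhd> A) \<cdot> (A \<lhd> f)"

lemma left_objD:
  assumes "left_obj X \<phi>"
  shows "X \<in> Ob C" "\<phi> \<in> hom C (A \<otimes> X) (X \<otimes> A)"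
    "\<phi> \<cdot> (m \<rhd> X) = (X \<lhd> m) \<cdot> (\<phi> \<rhd> A) \<cdot> (A \<lhd> \<phi>)" "\<phi> \<cdot> (\<eta> \<rhd> X) = X \<lhd> \<eta>"
  using assms by (simp_all add: is_left_transfer_def)

lemma left_arrD:
  assumes "left_arr X \<phi> Y \<phi>' f"
  shows "left_obj X \<phi>" "left_obj Y \<phi>'" "f \<in> hom C X (Y \<otimes> A)"
    "(Y \<lhd> m) \<cdot> (f \<rhd> A) \<cdot> \<phi> = (Y \<lhd> m) \<cdot> (\<phi>' \<rhd> A) \<cdot> (A \<lhd> f)"
  using assms by (simp_all add: left_arr_def)

lemma left_transfer_Ar:
  "((X, \<phi>), f, (Y, \<phi>')) \<in> Ar T' \<longleftrightarrow> left_arr X \<phi> Y \<phi>' f"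
  by (auto simp: left_transfer_def left_arr_def Let_def)

lemma left_transfer_simps [simp]:
  "(X, \<phi>) \<in> Ob T' \<longleftrightarrow> left_obj X \<phi>"
  "Dom T' (P, f, Q) = P" "Cod T' (P, f, Q) = Q"
  "Id T' (X, \<phi>) = ((X, \<phi>), X \<lhd> \<eta>, (X, \<phi>))"
  "(R, g, (Z, \<phi>'')) \<cdot>\<^bsub>T'\<^esub> (P, f, Q) = (P, (Z \<lhd> m) \<cdot> (g \<rhd> A) \<cdot> f, (Z, \<phi>''))"
  "(X, \<phi>) \<otimes>\<^bsub>T'\<^esub> (Y, \<phi>') = (X \<otimes> Y, (X \<lhd> \<phi>') \<cdot> (\<phi> \<rhd> Y))"
  "(P, f, (X', \<phi>)) \<boxtimes>\<^bsub>T'\<^esub> (Q, g, (Y', \<phi>')) =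
     (P \<otimes>\<^bsub>T'\<^esub> Q, (X' \<otimes> Y' \<lhd> m) \<cdot> (X' \<lhd> \<phi>' \<rhd> A) \<cdot> (f \<boxtimes> g), (X' \<otimes> Y', (X' \<lhd> \<phi>') \<cdot> (\<phi> \<rhd> Y')))"
  "\<one>\<^bsub>T'\<^esub> = (\<one>, Id C A)"
  "Assoc T' P Q R = Id T' (P \<otimes>\<^bsub>T'\<^esub> Q \<otimes>\<^bsub>T'\<^esub> R)"
  "Lun T' P = Id T' P" "Run T' P = Id T' P"
  by (auto simp: left_transfer_def Let_def)

lemma left_transfer_hom:
  "F \<in> hom T' (X, \<phi>) (Y, \<phi>') \<longleftrightarrow> (\<exists>f. F = ((X, \<phi>), f, (Y, \<phi>')) \<and> left_arr X \<phi> Y \<phi>' f)"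
  by (cases F) (auto simp: hom_def left_transfer_Ar)

text \<open>The algebra axioms are invariant under reversal; the two unit laws trade places.\<close>

lemma algebra_mrev: "algebra_in (mrev C) A m \<eta>"
proof -
  interpret rev: strict_monoidal "mrev C"
    by unfold_locales (rule strict_monoidal_mrev[OF strict_monoidal])
  show ?thesis
    by unfold_locales (simp add: rev.algebra_iff A_in_Ob m_in_hom eta_in_hom m_assoc m_unit_left m_unit_right)
qed

lemma is_left_transfer_mrev: "is_left_transfer C A m \<eta> X \<phi> \<longleftrightarrow> is_right_transfer (mrev C) A m \<eta> X \<phi>"
  by (simp add: is_left_transfer_def is_right_transfer_def)

text \<open>Reversing \<open>C\<close>, forming its right transfer category and reversing the result
  gives \<open>T'\<close>, and strictness is preserved at each stage.\<close>

lemma left_transfer_strict: "strict_monoidal_category T'"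
proof (rule strict_monoidal_cong)
  interpret rev: algebra_in "mrev C" A m \<eta> by (rule algebra_mrev)
  show *: "strict_monoidal_category (mrev rev.T)"
    by (rule strict_monoidal_mrev[OF rev.right_transfer_strict])
  show ob: "Ob T' = Ob (mrev rev.T)"
    by (simp add: left_transfer_def right_transfer_def Let_def is_left_transfer_mrev)
  show "Ar T' = Ar (mrev rev.T)" "Dom T' = Dom (mrev rev.T)" "Cod T' = Cod (mrev rev.T)"
    "Id T' = Id (mrev rev.T)" "Comp T' = Comp (mrev rev.T)" "Unit T' = Unit (mrev rev.T)"
    "Lun T' = Lun (mrev rev.T)" "Run T' = Run (mrev rev.T)"
    by (simp_all add: left_transfer_def right_transfer_def Let_def is_left_transfer_mrev)
  show ten: "TenO T' = TenO (mrev rev.T)"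
    by (auto simp: fun_eq_iff left_transfer_def right_transfer_def Let_def)
  fix P Q R assume "P \<in> Ob (mrev rev.T)" "Q \<in> Ob (mrev rev.T)" "R \<in> Ob (mrev rev.T)"
  then show "Assoc T' P Q R = Assoc (mrev rev.T) P Q R"
    by (cases P; cases Q; cases R; simp)
next
  interpret rev: algebra_in "mrev C" A m \<eta> by (rule algebra_mrev)
  fix F G assume "F \<in> Ar (mrev rev.T)" "G \<in> Ar (mrev rev.T)"
  then have "F \<in> Ar rev.T" "G \<in> Ar rev.T" by simp_all
  then obtain X \<psi> f Y \<psi>' X' \<phi> g Y' \<phi>' where F: "F = ((X, \<psi>), f, (Y, \<psi>'))" "rev.right_arr X \<psi> Y \<psi>' f"
    and G: "G = ((X', \<phi>), g, (Y', \<phi>'))" "rev.right_arr X' \<phi> Y' \<phi>' g"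
    by (metis rev.right_transfer_ArE)
  have "Y \<in> Ob C" "Y' \<in> Ob C" "\<phi>' \<in> hom C (A \<otimes> Y') (Y' \<otimes> A)"
    using F G by (auto dest!: rev.right_arrD(2) simp: is_right_transfer_def)
  \<comment> \<open>The bracketing in which the two constructions differ; associativity of the
    tensor product of arrows reconciles them.\<close>
  then have "Y \<lhd> \<phi>' \<rhd> A = (Y \<lhd> \<phi>') \<rhd> A"
    by (simp add: lwhisker_def rwhisker_def tenA_assoc[OF Id_in_hom _ Id_in_hom] A_in_Ob)
  then show "F \<boxtimes>\<^bsub>T'\<^esub> G = F \<boxtimes>\<^bsub>mrev rev.T\<^esub> G"
    using F G by simp
qed

lemma left_transfer_whisker:
  assumes "left_obj Z \<zeta>" "left_arr X \<phi> Y \<phi>' f"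
  shows "(Z, \<zeta>) \<lhd>\<^bsub>T'\<^esub> ((X, \<phi>), f, (Y, \<phi>')) =
      ((Z, \<zeta>) \<otimes>\<^bsub>T'\<^esub> (X, \<phi>), Z \<lhd> f, (Z, \<zeta>) \<otimes>\<^bsub>T'\<^esub> (Y, \<phi>'))"
    "((X, \<phi>), f, (Y, \<phi>')) \<rhd>\<^bsub>T'\<^esub> (Z, \<zeta>) =
      ((X, \<phi>) \<otimes>\<^bsub>T'\<^esub> (Z, \<zeta>), (Y \<lhd> \<zeta>) \<cdot> (f \<rhd> Z), (Y, \<phi>') \<otimes>\<^bsub>T'\<^esub> (Z, \<zeta>))"
proof -
  have ob: "X \<in> Ob C" "Z \<in> Ob C" "Y \<in> Ob C"
    and t: "\<phi>' \<in> hom C (A \<otimes> Y) (Y \<otimes> A)" "\<zeta> \<in> hom C (A \<otimes> Z) (Z \<otimes> A)" "f \<in> hom C X (Y \<otimes> A)"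
    and e: "\<phi>' \<cdot> (\<eta> \<rhd> Y) = Y \<lhd> \<eta>"
    using left_objD[OF assms(1)] left_arrD[OF assms(2)] by (auto dest: left_objD)
  have "(Z \<otimes> Y \<lhd> m) \<cdot> (Z \<lhd> \<phi>' \<rhd> A) \<cdot> ((Z \<lhd> \<eta>) \<boxtimes> f) = Z \<lhd> f"
    by (rule diagram2[OF e m_unit_left, where S = "[Right 0, Apply 0 1 1, Apply 1 1 2]"],
      (rule reads arrows | fact)+, simp add: run_simps)
  then show "(Z, \<zeta>) \<lhd>\<^bsub>T'\<^esub> ((X, \<phi>), f, (Y, \<phi>')) =
      ((Z, \<zeta>) \<otimes>\<^bsub>T'\<^esub> (X, \<phi>), Z \<lhd> f, (Z, \<zeta>) \<otimes>\<^bsub>T'\<^esub> (Y, \<phi>'))"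
    by (simp add: lwhisker_def[of T'])
  have "(Y \<otimes> Z \<lhd> m) \<cdot> (Y \<lhd> \<zeta> \<rhd> A) \<cdot> (f \<boxtimes> (Z \<lhd> \<eta>)) = (Y \<lhd> \<zeta>) \<cdot> (f \<rhd> Z)"
    by (rule diagram1[OF m_unit_right, where S = "[Left 1, Apply 0 2 2]"], (rule reads arrows | fact)+,
      simp add: run_simps)
  then show "((X, \<phi>), f, (Y, \<phi>')) \<rhd>\<^bsub>T'\<^esub> (Z, \<zeta>) =
      ((X, \<phi>) \<otimes>\<^bsub>T'\<^esub> (Z, \<zeta>), (Y \<lhd> \<zeta>) \<cdot> (f \<rhd> Z), (Y, \<phi>') \<otimes>\<^bsub>T'\<^esub> (Z, \<zeta>))"
    by (simp add: rwhisker_def[of T'])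
qed

end

section \<open>Transposition along adjoint objects\<close>

context strict_monoidal
begin

lemma adjointD:
  assumes "adjoint_objects C X Y b d"
  shows "X \<in> Ob C" "Y \<in> Ob C" "b \<in> hom C \<one> (Y \<otimes> X)" "d \<in> hom C (X \<otimes> Y) \<one>"
    "(Y \<lhd> d) \<cdot> (b \<rhd> Y) = Id C Y" "(d \<rhd> X) \<cdot> (X \<lhd> b) = Id C X"
  using assms by (simp_all add: adjoint_objects_def)

lemma adjoint_unit: "adjoint_objects C \<one> \<one> (Id C \<one>) (Id C \<one>)"
proof -
  have "(\<one> \<lhd> Id C \<one>) \<cdot> (Id C \<one> \<rhd> \<one>) = Id C \<one>"
    by (rule diagram0[where S = "[]"], (rule reads arrows | fact)+, simp add: run_simps)
  moreover have "(Id C \<one> \<rhd> \<one>) \<cdot> (\<one> \<lhd> Id C \<one>) = Id C \<one>"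
    by (rule diagram0[where S = "[]"], (rule reads arrows | fact)+, simp add: run_simps)
  ultimately show ?thesis by (simp add: adjoint_objects_def Id_in_hom)
qed

text \<open>The cups and caps are nested, hence the reversed order \<open>Y' \<otimes> Y\<close> of
  the adjoints; the inner zigzag is cancelled before the outer one.\<close>

lemma adjoint_ten:
  assumes "adjoint_objects C X Y b d" and "adjoint_objects C X' Y' b' d'"
  shows "adjoint_objects C (X \<otimes> X') (Y' \<otimes> Y) ((Y' \<lhd> b \<rhd> X') \<cdot> b') (d \<cdot> (X \<lhd> d' \<rhd> Y))"
proof -
  have h: "X \<in> Ob C" "Y \<in> Ob C" "b \<in> hom C \<one> (Y \<otimes> X)" "d \<in> hom C (X \<otimes> Y) \<one>"
    and h': "X' \<in> Ob C" "Y' \<in> Ob C" "b' \<in> hom C \<one> (Y' \<otimes> X')" "d' \<in> hom C (X' \<otimes> Y') \<one>"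
    and z1: "(Y \<lhd> d) \<cdot> (b \<rhd> Y) = Id C Y" and z2: "(d \<rhd> X) \<cdot> (X \<lhd> b) = Id C X"
    and z1': "(Y' \<lhd> d') \<cdot> (b' \<rhd> Y') = Id C Y'" and z2': "(d' \<rhd> X') \<cdot> (X' \<lhd> b') = Id C X'"
    using adjointD[OF assms(1)] adjointD[OF assms(2)] by auto
  have "(Y' \<otimes> Y \<lhd> (d \<cdot> (X \<lhd> d' \<rhd> Y))) \<cdot> (((Y' \<lhd> b \<rhd> X') \<cdot> b') \<rhd> Y' \<otimes> Y) = Id C (Y' \<otimes> Y)"
    by (rule diagram2[OF z1 z1', where S = "[Right 1, Apply 0 2 1, Apply 1 0 0]"], (rule reads arrows | fact)+,
      simp add: run_simps)
  moreover have "((d \<cdot> (X \<lhd> d' \<rhd> Y)) \<rhd> X \<otimes> X') \<cdot> (X \<otimes> X' \<lhd> ((Y' \<lhd> b \<rhd> X') \<cdot> b')) = Id C (X \<otimes> X')"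
    by (rule diagram2[OF z2 z2', where S = "[Left 1, Apply 0 2 0, Apply 1 0 1]"], (rule reads arrows | fact)+,
      simp add: run_simps)
  moreover have "(Y' \<lhd> b \<rhd> X') \<cdot> b' \<in> hom C \<one> ((Y' \<otimes> Y) \<otimes> (X \<otimes> X'))"
    by (rule in_hom, (rule reads arrows | fact)+)
  moreover have "d \<cdot> (X \<lhd> d' \<rhd> Y) \<in> hom C ((X \<otimes> X') \<otimes> (Y' \<otimes> Y)) \<one>"
    by (rule in_hom, (rule reads arrows | fact)+)
  ultimately show ?thesis using h h' by (simp add: adjoint_objects_def)
qed

end

context algebra_in
begin

text \<open>The map is the mate of \<open>\<psi>\<close>. When two mates are composed, the cap of
  one meets the cup of the other and both cancel, which leaves the multiplicativity of
  \<open>\<psi>\<close>.\<close>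

lemma dual_transfer_left_obj:
  assumes "adjoint_objects C X Y b d" and "right_obj X \<psi>"
  shows "left_obj Y (dual_transfer C A X \<psi> Y b d)"
proof -
  have h: "X \<in> Ob C" "Y \<in> Ob C" "b \<in> hom C \<one> (Y \<otimes> X)" "d \<in> hom C (X \<otimes> Y) \<one>"
    and t: "\<psi> \<in> hom C (X \<otimes> A) (A \<otimes> X)"
    and z1: "(Y \<lhd> d) \<cdot> (b \<rhd> Y) = Id C Y" and z2: "(d \<rhd> X) \<cdot> (X \<lhd> b) = Id C X"
    and mx: "\<psi> \<cdot> (X \<lhd> m) = (m \<rhd> X) \<cdot> (A \<lhd> \<psi>) \<cdot> (\<psi> \<rhd> A)" and ex: "\<psi> \<cdot> (X \<lhd> \<eta>) = \<eta> \<rhd> X"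
    using adjointD[OF assms(1)] right_objD[OF assms(2)] by auto
  have "(Y \<otimes> A \<lhd> d) \<cdot> (Y \<lhd> \<psi> \<rhd> Y) \<cdot> (b \<rhd> A \<otimes> Y) \<cdot> (m \<rhd> Y) =
      (Y \<lhd> m) \<cdot> (((Y \<otimes> A \<lhd> d) \<cdot> (Y \<lhd> \<psi> \<rhd> Y) \<cdot> (b \<rhd> A \<otimes> Y)) \<rhd> A) \<cdot>
      (A \<lhd> ((Y \<otimes> A \<lhd> d) \<cdot> (Y \<lhd> \<psi> \<rhd> Y) \<cdot> (b \<rhd> A \<otimes> Y)))"
    by (rule diagram2[OF mx z2, where S = "[Left 0, Apply 0 1 1, Right 3, Undo 1 2 2, Right 3, Right 4, Right 1,
      Right 2, Right 3, Right 0, Right 1, Right 2]"], (rule reads arrows | fact)+, simp add: run_simps)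
  moreover have "(Y \<otimes> A \<lhd> d) \<cdot> (Y \<lhd> \<psi> \<rhd> Y) \<cdot> (b \<rhd> A \<otimes> Y) \<cdot> (\<eta> \<rhd> Y) = Y \<lhd> \<eta>"
    by (rule diagram2[OF ex z1, where S = "[Left 0, Apply 0 1 1, Right 1, Apply 1 0 0]"],
      (rule reads arrows | fact)+, simp add: run_simps)
  moreover have "(Y \<otimes> A \<lhd> d) \<cdot> (Y \<lhd> \<psi> \<rhd> Y) \<cdot> (b \<rhd> A \<otimes> Y) \<in> hom C (A \<otimes> Y) (Y \<otimes> A)"
    by (rule in_hom, (rule reads arrows | fact)+)
  ultimately show ?thesis using h by (simp add: is_left_transfer_def dual_transfer_def)
qed

lemma dual_transfer_unit: "dual_transfer C A \<one> (Id C A) \<one> (Id C \<one>) (Id C \<one>) = Id C A"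
proof -
  have "(\<one> \<otimes> A \<lhd> Id C \<one>) \<cdot> (\<one> \<lhd> Id C A \<rhd> \<one>) \<cdot> (Id C \<one> \<rhd> A \<otimes> \<one>) = Id C A"
    by (rule diagram0[where S = "[]"], (rule reads arrows | fact)+, simp add: run_simps)
  then show ?thesis by (simp add: dual_transfer_def)
qed

text \<open>Forming the mate reverses tensor products; with the nested cups and caps of
  \<open>adjoint_ten\<close> only interchanges are needed.\<close>

lemma dual_transfer_ten:
  assumes "adjoint_objects C X Y b d" "right_obj X \<psi>" and "adjoint_objects C X' Y' b' d'" "right_obj X' \<psi>'"
  shows "dual_transfer C A (X \<otimes> X') ((\<psi> \<rhd> X') \<cdot> (X \<lhd> \<psi>')) (Y' \<otimes> Y) ((Y' \<lhd> b \<rhd> X') \<cdot> b') (d \<cdot> (X \<lhd> d' \<rhd> Y)) =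
    (Y' \<lhd> dual_transfer C A X \<psi> Y b d) \<cdot> (dual_transfer C A X' \<psi>' Y' b' d' \<rhd> Y)"
proof -
  have h: "X \<in> Ob C" "Y \<in> Ob C" "b \<in> hom C \<one> (Y \<otimes> X)" "d \<in> hom C (X \<otimes> Y) \<one>"
    and h': "X' \<in> Ob C" "Y' \<in> Ob C" "b' \<in> hom C \<one> (Y' \<otimes> X')" "d' \<in> hom C (X' \<otimes> Y') \<one>"
    and t: "\<psi> \<in> hom C (X \<otimes> A) (A \<otimes> X)" "\<psi>' \<in> hom C (X' \<otimes> A) (A \<otimes> X')"
    using adjointD[OF assms(1)] adjointD[OF assms(3)] right_objD[OF assms(2)] right_objD[OF assms(4)] by auto
  have "((Y' \<otimes> Y) \<otimes> A \<lhd> (d \<cdot> (X \<lhd> d' \<rhd> Y))) \<cdot> (Y' \<otimes> Y \<lhd> ((\<psi> \<rhd> X') \<cdot> (X \<lhd> \<psi>')) \<rhd> Y' \<otimes> Y) \<cdot> (((Y' \<lhd> b \<rhd> X') \<cdot> b') \<rhd> A \<otimes> Y' \<otimes> Y) =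
    (Y' \<lhd> ((Y \<otimes> A \<lhd> d) \<cdot> (Y \<lhd> \<psi> \<rhd> Y) \<cdot> (b \<rhd> A \<otimes> Y))) \<cdot> (((Y' \<otimes> A \<lhd> d') \<cdot> (Y' \<lhd> \<psi>' \<rhd> Y') \<cdot> (b' \<rhd> A \<otimes> Y')) \<rhd> Y)"
    by (rule diagram0[where S = "[Right 1, Right 3, Right 2]"], (rule reads arrows | fact)+, simp add: run_simps)
  then show ?thesis using h h' by (simp add: dual_transfer_def ten_assoc A_in_Ob)
qed

text \<open>The mate of \<open>f : X \<rightarrow> A X'\<close> under the two adjunctions. It runs
  from \<open>Y'\<close> to \<open>Y A\<close>, so transposition is contravariant;
  \<open>undual\<close> below is its inverse.\<close>

definition dual :: "'o \<Rightarrow> 'a \<Rightarrow> 'o \<Rightarrow> 'a \<Rightarrow> 'a \<Rightarrow> 'a" where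
  "dual Y b Y' d' f = (Y \<otimes> A \<lhd> d') \<cdot> (Y \<lhd> f \<rhd> Y') \<cdot> (b \<rhd> Y')"

definition undual :: "'o \<Rightarrow> 'a \<Rightarrow> 'o \<Rightarrow> 'a \<Rightarrow> 'a \<Rightarrow> 'a" where
  "undual X d X' b' g = (d \<rhd> A \<otimes> X') \<cdot> (X \<lhd> g \<rhd> X') \<cdot> (X \<lhd> b')"

text \<open>On one side of the square a cap meets a cup and both vanish, which exposes the square of
  \<open>f\<close>; on the other side a cap and a cup are created to form the mate of
  \<open>\<psi>\<close>.\<close>

lemma dual_left_arr:
  assumes "adjoint_objects C X Y b d" "adjoint_objects C X' Y' b' d'" and f: "right_arr X \<psi> X' \<psi>' f"
  shows "left_arr Y' (dual_transfer C A X' \<psi>' Y' b' d') Y (dual_transfer C A X \<psi> Y b d) (dual Y b Y' d' f)"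
proof -
  have h: "X \<in> Ob C" "Y \<in> Ob C" "b \<in> hom C \<one> (Y \<otimes> X)" "d \<in> hom C (X \<otimes> Y) \<one>"
    and h': "X' \<in> Ob C" "Y' \<in> Ob C" "b' \<in> hom C \<one> (Y' \<otimes> X')" "d' \<in> hom C (X' \<otimes> Y') \<one>"
    and t: "\<psi> \<in> hom C (X \<otimes> A) (A \<otimes> X)" "\<psi>' \<in> hom C (X' \<otimes> A) (A \<otimes> X')" "f \<in> hom C X (A \<otimes> X')"
    and z1: "(Y \<lhd> d) \<cdot> (b \<rhd> Y) = Id C Y" and z2: "(d \<rhd> X) \<cdot> (X \<lhd> b) = Id C X"
    and z1': "(Y' \<lhd> d') \<cdot> (b' \<rhd> Y') = Id C Y'" and z2': "(d' \<rhd> X') \<cdot> (X' \<lhd> b') = Id C X'"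
    and cf: "(m \<rhd> X') \<cdot> (A \<lhd> f) \<cdot> \<psi> = (m \<rhd> X') \<cdot> (A \<lhd> \<psi>') \<cdot> (f \<rhd> A)"
    using adjointD[OF assms(1)] adjointD[OF assms(2)] right_arrD[OF f] by (auto dest: right_objD)
  have "(Y \<lhd> m) \<cdot> (((Y \<otimes> A \<lhd> d') \<cdot> (Y \<lhd> f \<rhd> Y') \<cdot> (b \<rhd> Y')) \<rhd> A) \<cdot> ((Y' \<otimes> A \<lhd> d') \<cdot> (Y' \<lhd> \<psi>' \<rhd> Y') \<cdot> (b' \<rhd> A \<otimes> Y')) =
     (Y \<lhd> m) \<cdot> (((Y \<otimes> A \<lhd> d) \<cdot> (Y \<lhd> \<psi> \<rhd> Y) \<cdot> (b \<rhd> A \<otimes> Y)) \<rhd> A) \<cdot> (A \<lhd> ((Y \<otimes> A \<lhd> d') \<cdot> (Y \<lhd> f \<rhd> Y') \<cdot> (b \<rhd> Y')))"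
    by (rule diagram3[OF z2' cf z2, where S = "[Left 2, Left 1, Left 0, Left 3, Left 2, Left 1, Left 4, Left 3,
      Apply 0 2 2, Left 3, Undo 1 1 1, Right 3, Undo 2 2 2, Right 3, Right 4, Right 1, Right 2, Right 3, Right 0,
      Right 1, Right 2]"], (rule reads arrows | fact)+, simp add: run_simps)
  moreover have "(Y \<otimes> A \<lhd> d') \<cdot> (Y \<lhd> f \<rhd> Y') \<cdot> (b \<rhd> Y') \<in> hom C Y' (Y \<otimes> A)"
    by (rule in_hom, (rule reads arrows | fact)+)
  ultimately show ?thesis
    using assms right_arrD[OF f] dual_transfer_left_obj by (simp add: left_arr_def dual_def dual_transfer_def)
qed

text \<open>The converse direction: the square of \<open>g\<close> is bent back by zigzags, so
  transposition is a bijection on morphisms and not only on arrows of \<open>C\<close>.\<close>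

lemma undual_right_arr:
  assumes "adjoint_objects C X Y b d" "adjoint_objects C X' Y' b' d'" and o: "right_obj X \<psi>" "right_obj X' \<psi>'"
    and g: "left_arr Y' (dual_transfer C A X' \<psi>' Y' b' d') Y (dual_transfer C A X \<psi> Y b d) g"
  shows "right_arr X \<psi> X' \<psi>' (undual X d X' b' g)"
proof -
  have h: "X \<in> Ob C" "Y \<in> Ob C" "b \<in> hom C \<one> (Y \<otimes> X)" "d \<in> hom C (X \<otimes> Y) \<one>"
    and h': "X' \<in> Ob C" "Y' \<in> Ob C" "b' \<in> hom C \<one> (Y' \<otimes> X')" "d' \<in> hom C (X' \<otimes> Y') \<one>"
    and t: "\<psi> \<in> hom C (X \<otimes> A) (A \<otimes> X)" "\<psi>' \<in> hom C (X' \<otimes> A) (A \<otimes> X')" "g \<in> hom C Y' (Y \<otimes> A)"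
    and z1: "(Y \<lhd> d) \<cdot> (b \<rhd> Y) = Id C Y" and z2: "(d \<rhd> X) \<cdot> (X \<lhd> b) = Id C X"
    and z1': "(Y' \<lhd> d') \<cdot> (b' \<rhd> Y') = Id C Y'" and z2': "(d' \<rhd> X') \<cdot> (X' \<lhd> b') = Id C X'"
    and cg: "(Y \<lhd> m) \<cdot> (g \<rhd> A) \<cdot> ((Y' \<otimes> A \<lhd> d') \<cdot> (Y' \<lhd> \<psi>' \<rhd> Y') \<cdot> (b' \<rhd> A \<otimes> Y')) =
     (Y \<lhd> m) \<cdot> (((Y \<otimes> A \<lhd> d) \<cdot> (Y \<lhd> \<psi> \<rhd> Y) \<cdot> (b \<rhd> A \<otimes> Y)) \<rhd> A) \<cdot> (A \<lhd> g)"
    using adjointD[OF assms(1)] adjointD[OF assms(2)] right_objD[OF o(1)] right_objD[OF o(2)] left_arrD[OF g]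
    by (auto simp: dual_transfer_def)
  have "(m \<rhd> X') \<cdot> (A \<lhd> ((d \<rhd> A \<otimes> X') \<cdot> (X \<lhd> g \<rhd> X') \<cdot> (X \<lhd> b'))) \<cdot> \<psi> =
    (m \<rhd> X') \<cdot> (A \<lhd> \<psi>') \<cdot> (((d \<rhd> A \<otimes> X') \<cdot> (X \<lhd> g \<rhd> X') \<cdot> (X \<lhd> b')) \<rhd> A)"
    by (rule diagram3[OF z2 cg z2', where S = "[Undo 0 0 0, Right 2, Right 1, Right 0, Right 2, Right 3, Right 4,
      Right 5, Right 2, Right 1, Undo 1 1 1, Left 0, Left 3, Left 2, Left 1, Left 5, Left 4, Left 3, Left 2, Left 3,
      Apply 2 4 2]"], (rule reads arrows | fact)+, simp add: run_simps)
  moreover have "(d \<rhd> A \<otimes> X') \<cdot> (X \<lhd> g \<rhd> X') \<cdot> (X \<lhd> b') \<in> hom C X (A \<otimes> X')"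
    by (rule in_hom, (rule reads arrows | fact)+)
  ultimately show ?thesis
    using o by (simp add: right_arr_def undual_def)
qed

lemma undual_dual:
  assumes "adjoint_objects C X Y b d" "adjoint_objects C X' Y' b' d'" and "f \<in> hom C X (A \<otimes> X')"
  shows "undual X d X' b' (dual Y b Y' d' f) = f"
proof -
  have h: "X \<in> Ob C" "Y \<in> Ob C" "b \<in> hom C \<one> (Y \<otimes> X)" "d \<in> hom C (X \<otimes> Y) \<one>"
    and h': "X' \<in> Ob C" "Y' \<in> Ob C" "b' \<in> hom C \<one> (Y' \<otimes> X')" "d' \<in> hom C (X' \<otimes> Y') \<one>"
    and z2: "(d \<rhd> X) \<cdot> (X \<lhd> b) = Id C X" and z2': "(d' \<rhd> X') \<cdot> (X' \<lhd> b') = Id C X'"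
    and t: "f \<in> hom C X (A \<otimes> X')"
    using adjointD[OF assms(1)] adjointD[OF assms(2)] assms by auto
  have "(d \<rhd> A \<otimes> X') \<cdot> (X \<lhd> ((Y \<otimes> A \<lhd> d') \<cdot> (Y \<lhd> f \<rhd> Y') \<cdot> (b \<rhd> Y')) \<rhd> X') \<cdot> (X \<lhd> b') = f"
    by (rule diagram2[OF z2 z2', where S = "[Left 3, Left 2, Apply 0 1 0, Left 0, Apply 1 1 1]"],
      (rule reads arrows | fact)+, simp add: run_simps)
  then show ?thesis by (simp add: undual_def dual_def)
qed

lemma dual_undual:
  assumes "adjoint_objects C X Y b d" "adjoint_objects C X' Y' b' d'" and "g \<in> hom C Y' (Y \<otimes> A)"
  shows "dual Y b Y' d' (undual X d X' b' g) = g"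
proof -
  have h: "X \<in> Ob C" "Y \<in> Ob C" "b \<in> hom C \<one> (Y \<otimes> X)" "d \<in> hom C (X \<otimes> Y) \<one>"
    and h': "X' \<in> Ob C" "Y' \<in> Ob C" "b' \<in> hom C \<one> (Y' \<otimes> X')" "d' \<in> hom C (X' \<otimes> Y') \<one>"
    and z1: "(Y \<lhd> d) \<cdot> (b \<rhd> Y) = Id C Y" and z1': "(Y' \<lhd> d') \<cdot> (b' \<rhd> Y') = Id C Y'"
    and t: "g \<in> hom C Y' (Y \<otimes> A)"
    using adjointD[OF assms(1)] adjointD[OF assms(2)] assms by auto
  have "(Y \<otimes> A \<lhd> d') \<cdot> (Y \<lhd> ((d \<rhd> A \<otimes> X') \<cdot> (X \<lhd> g \<rhd> X') \<cdot> (X \<lhd> b')) \<rhd> Y') \<cdot> (b \<rhd> Y') = g"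
    by (rule diagram2[OF z1 z1', where S = "[Right 0, Right 1, Apply 0 2 0, Right 1, Apply 1 0 0]"],
      (rule reads arrows | fact)+, simp add: run_simps)
  then show ?thesis by (simp add: undual_def dual_def)
qed

section \<open>Cowreaths with an adjoint object\<close>

lemma right_moduleD:
  assumes "right_module C A m \<eta> M \<mu>"
  shows "M \<in> Ob C" "\<mu> \<in> hom C (M \<otimes> A) M" "\<mu> \<cdot> (\<mu> \<rhd> A) = \<mu> \<cdot> (M \<lhd> m)" "\<mu> \<cdot> (M \<lhd> \<eta>) = Id C M"
  using assms by (simp_all add: right_module_def)

lemma right_module_A: "right_module C A m \<eta> A m"
  by (simp add: right_module_def A_in_Ob m_in_hom m_assoc m_unit_right)

lemma right_arr_from_unit:
  "right_arr \<one> (Id C A) Z \<zeta> t \<longleftrightarrow> right_obj Z \<zeta> \<and> t \<in> hom C \<one> (A \<otimes> Z) \<and>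
     (m \<rhd> Z) \<cdot> (A \<lhd> t) = (m \<rhd> Z) \<cdot> (A \<lhd> \<zeta>) \<cdot> (t \<rhd> A)"
proof -
  have "(m \<rhd> Z) \<cdot> (A \<lhd> t) \<cdot> Id C A = (m \<rhd> Z) \<cdot> (A \<lhd> t)"
    if "right_obj Z \<zeta>" and t: "t \<in> hom C \<one> (A \<otimes> Z)"
  proof -
    have Z: "Z \<in> Ob C" using right_objD[OF that(1)] by simp
    show "(m \<rhd> Z) \<cdot> (A \<lhd> t) \<cdot> Id C A = (m \<rhd> Z) \<cdot> (A \<lhd> t)"
      by (rule diagram0[where S = "[]"], (rule reads arrows | fact)+, simp add: run_simps)
  qed
  then show ?thesis by (auto simp: right_arr_def right_unit_obj)
qed

lemma right_arr_to_unit: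
  "right_arr Z \<zeta> \<one> (Id C A) B \<longleftrightarrow> right_obj Z \<zeta> \<and> B \<in> hom C Z A \<and>
     m \<cdot> (A \<lhd> B) \<cdot> \<zeta> = m \<cdot> (B \<rhd> A)"
proof -
  have "(m \<rhd> \<one>) \<cdot> (A \<lhd> B) \<cdot> \<zeta> = m \<cdot> (A \<lhd> B) \<cdot> \<zeta> \<and> (m \<rhd> \<one>) \<cdot> (A \<lhd> Id C A) \<cdot> (B \<rhd> A) = m \<cdot> (B \<rhd> A)"
    if "right_obj Z \<zeta>" and t: "B \<in> hom C Z A"
  proof
    have Z: "Z \<in> Ob C" "\<zeta> \<in> hom C (Z \<otimes> A) (A \<otimes> Z)" using right_objD[OF that(1)] by simp_all
    show "(m \<rhd> \<one>) \<cdot> (A \<lhd> B) \<cdot> \<zeta> = m \<cdot> (A \<lhd> B) \<cdot> \<zeta>"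
      by (rule diagram0[where S = "[]"], (rule reads arrows | fact)+, simp add: run_simps)
    show "(m \<rhd> \<one>) \<cdot> (A \<lhd> Id C A) \<cdot> (B \<rhd> A) = m \<cdot> (B \<rhd> A)"
      by (rule diagram0[where S = "[]"], (rule reads arrows | fact)+, simp add: run_simps)
  qed
  then show ?thesis by (auto simp: right_arr_def right_unit_obj A_in_Ob)
qed

lemma left_unit_obj: "left_obj \<one> (Id C A)"
proof -
  have "Id C A \<cdot> (m \<rhd> \<one>) = (\<one> \<lhd> m) \<cdot> (Id C A \<rhd> A) \<cdot> (A \<lhd> Id C A)"
    by (rule diagram0[where S = "[]"], (rule reads arrows | fact)+, simp add: run_simps)
  moreover have "Id C A \<cdot> (\<eta> \<rhd> \<one>) = \<one> \<lhd> \<eta>"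
    by (rule diagram0[where S = "[]"], (rule reads arrows | fact)+, simp add: run_simps)
  moreover have "Id C A \<in> hom C (A \<otimes> \<one>) (\<one> \<otimes> A)"
    by (rule in_hom, (rule reads arrows | fact)+)
  ultimately show ?thesis by (simp add: is_left_transfer_def)
qed

lemma left_arr_from_unit:
  "left_arr \<one> (Id C A) Z \<zeta> t \<longleftrightarrow> left_obj Z \<zeta> \<and> t \<in> hom C \<one> (Z \<otimes> A) \<and>
     (Z \<lhd> m) \<cdot> (t \<rhd> A) = (Z \<lhd> m) \<cdot> (\<zeta> \<rhd> A) \<cdot> (A \<lhd> t)"
proof -
  have "(Z \<lhd> m) \<cdot> (t \<rhd> A) \<cdot> Id C A = (Z \<lhd> m) \<cdot> (t \<rhd> A)"
    if "left_obj Z \<zeta>" and t: "t \<in> hom C \<one> (Z \<otimes> A)"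
  proof -
    have Z: "Z \<in> Ob C" using left_objD[OF that(1)] by simp
    show "(Z \<lhd> m) \<cdot> (t \<rhd> A) \<cdot> Id C A = (Z \<lhd> m) \<cdot> (t \<rhd> A)"
      by (rule diagram0[where S = "[]"], (rule reads arrows | fact)+, simp add: run_simps)
  qed
  then show ?thesis by (auto simp: left_arr_def left_unit_obj)
qed

lemma left_arr_to_unit:
  "left_arr Z \<zeta> \<one> (Id C A) B \<longleftrightarrow> left_obj Z \<zeta> \<and> B \<in> hom C Z A \<and>
     m \<cdot> (B \<rhd> A) \<cdot> \<zeta> = m \<cdot> (A \<lhd> B)"
proof -
  have "(\<one> \<lhd> m) \<cdot> (B \<rhd> A) \<cdot> \<zeta> = m \<cdot> (B \<rhd> A) \<cdot> \<zeta> \<and> (\<one> \<lhd> m) \<cdot> (Id C A \<rhd> A) \<cdot> (A \<lhd> B) = m \<cdot> (A \<lhd> B)"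
    if "left_obj Z \<zeta>" and t: "B \<in> hom C Z A"
  proof
    have Z: "Z \<in> Ob C" "\<zeta> \<in> hom C (A \<otimes> Z) (Z \<otimes> A)" using left_objD[OF that(1)] by simp_all
    show "(\<one> \<lhd> m) \<cdot> (B \<rhd> A) \<cdot> \<zeta> = m \<cdot> (B \<rhd> A) \<cdot> \<zeta>"
      by (rule diagram0[where S = "[]"], (rule reads arrows | fact)+, simp add: run_simps)
    show "(\<one> \<lhd> m) \<cdot> (Id C A \<rhd> A) \<cdot> (A \<lhd> B) = m \<cdot> (A \<lhd> B)"
      by (rule diagram0[where S = "[]"], (rule reads arrows | fact)+, simp add: run_simps)
  qed
  then show ?thesis by (auto simp: left_arr_def left_unit_obj A_in_Ob)
qed

end

section \<open>A cowreath, read as a coalgebra in the transfer category\<close>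

locale dual_cowreath = algebra_in C A m \<eta> for C :: "('o, 'a) monoidal" (structure) and A m \<eta> +
  fixes X Y :: 'o and \<psi> \<delta> \<epsilon> b d :: 'a
  assumes cowreath: "cowreath C A m \<eta> X \<psi> \<delta> \<epsilon>"
    and adjoint: "adjoint_objects C X Y b d"
begin

sublocale T: strict_monoidal T
  by unfold_locales (rule right_transfer_strict)

sublocale T': strict_monoidal T'
  by unfold_locales (rule left_transfer_strict)

lemma X_in_Ob [arrows]: "X \<in> Ob C"
  and Y_in_Ob [arrows]: "Y \<in> Ob C"
  and b_in_hom [arrows]: "b \<in> hom C \<one> (Y \<otimes> X)"
  and d_in_hom [arrows]: "d \<in> hom C (X \<otimes> Y) \<one>"
  and zigzag_Y: "(Y \<lhd> d) \<cdot> (b \<rhd> Y) = Id C Y"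
  and zigzag_X: "(d \<rhd> X) \<cdot> (X \<lhd> b) = Id C X"
  using adjointD[OF adjoint] by simp_all

abbreviation "\<psi>\<psi> \<equiv> (\<psi> \<rhd> X) \<cdot> (X \<lhd> \<psi>)"
abbreviation "\<Delta> \<equiv> cowreath_comult C A m \<eta> X \<psi> \<delta>"
abbreviation "\<E> \<equiv> cowreath_counit C A m \<eta> X \<psi> \<epsilon>"

lemma coalgebra_T: "coalgebra T (X, \<psi>) \<Delta> \<E>"
  using cowreath by (simp add: cowreath_def)

lemma cowreath_comult_eq: "\<Delta> = ((X, \<psi>), \<delta>, (X \<otimes> X, \<psi>\<psi>))"
  by (simp add: cowreath_comult_def)

lemma cowreath_counit_eq: "\<E> = ((X, \<psi>), \<epsilon>, (\<one>, Id C A))"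
  by (simp add: cowreath_counit_def)

lemma right_obj_X: "right_obj X \<psi>"
  using coalgebra_T by (simp add: T.coalgebra_iff)

lemma right_obj_XX: "right_obj (X \<otimes> X) \<psi>\<psi>"
  by (rule right_ten_obj[OF right_obj_X right_obj_X])

lemma right_arr_comult: "right_arr X \<psi> (X \<otimes> X) \<psi>\<psi> \<delta>"
  using coalgebra_T by (simp add: T.coalgebra_iff cowreath_comult_eq right_transfer_hom)

lemma right_arr_counit: "right_arr X \<psi> \<one> (Id C A) \<epsilon>"
  using coalgebra_T by (simp add: T.coalgebra_iff cowreath_counit_eq right_transfer_hom)

lemma psi_in_hom [arrows]: "\<psi> \<in> hom C (X \<otimes> A) (A \<otimes> X)"
  and psi_m: "\<psi> \<cdot> (X \<lhd> m) = (m \<rhd> X) \<cdot> (A \<lhd> \<psi>) \<cdot> (\<psi> \<rhd> A)"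
  and psi_eta: "\<psi> \<cdot> (X \<lhd> \<eta>) = \<eta> \<rhd> X"
  using right_objD[OF right_obj_X] by simp_all

lemma delta_in_hom [arrows]: "\<delta> \<in> hom C X (A \<otimes> X \<otimes> X)"
  and delta_central: "(m \<rhd> X \<otimes> X) \<cdot> (A \<lhd> \<delta>) \<cdot> \<psi> = (m \<rhd> X \<otimes> X) \<cdot> (A \<lhd> ((\<psi> \<rhd> X) \<cdot> (X \<lhd> \<psi>))) \<cdot> (\<delta> \<rhd> A)"
  using right_arr_comult by (simp_all add: right_arr_def)

lemma epsilon_in_hom [arrows]: "\<epsilon> \<in> hom C X A"
  and epsilon_central: "m \<cdot> (A \<lhd> \<epsilon>) \<cdot> \<psi> = m \<cdot> (\<epsilon> \<rhd> A)"
  using right_arr_counit by (simp_all add: right_arr_to_unit)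

text \<open>The coalgebra axioms of \<open>T\<close> after its whiskerings are expanded; the
  structure map \<open>\<psi>\<close> enters exactly where \<open>X\<close> is whiskered on the
  left.\<close>

lemma coassoc: "(m \<rhd> X \<otimes> X \<otimes> X) \<cdot> (A \<lhd> \<delta> \<rhd> X) \<cdot> \<delta> =
    (m \<rhd> X \<otimes> X \<otimes> X) \<cdot> (A \<lhd> ((\<psi> \<rhd> X \<otimes> X) \<cdot> (X \<lhd> \<delta>))) \<cdot> \<delta>"
  and counit_left: "(m \<rhd> X) \<cdot> (A \<lhd> \<epsilon> \<rhd> X) \<cdot> \<delta> = \<eta> \<rhd> X"
  and counit_right_tensor: "(m \<rhd> X) \<cdot> (A \<lhd> ((\<psi> \<rhd> \<one>) \<cdot> (X \<lhd> \<epsilon>))) \<cdot> \<delta> = \<eta> \<rhd> X"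
proof -
  have "(\<Delta> \<rhd>\<^bsub>T\<^esub> (X, \<psi>)) \<cdot>\<^bsub>T\<^esub> \<Delta> = ((X, \<psi>) \<lhd>\<^bsub>T\<^esub> \<Delta>) \<cdot>\<^bsub>T\<^esub> \<Delta>"
    "(\<E> \<rhd>\<^bsub>T\<^esub> (X, \<psi>)) \<cdot>\<^bsub>T\<^esub> \<Delta> = Id T (X, \<psi>)" "((X, \<psi>) \<lhd>\<^bsub>T\<^esub> \<E>) \<cdot>\<^bsub>T\<^esub> \<Delta> = Id T (X, \<psi>)"
    using coalgebra_T by (simp_all add: T.coalgebra_iff)
  then show "(m \<rhd> X \<otimes> X \<otimes> X) \<cdot> (A \<lhd> \<delta> \<rhd> X) \<cdot> \<delta> =
    (m \<rhd> X \<otimes> X \<otimes> X) \<cdot> (A \<lhd> ((\<psi> \<rhd> X \<otimes> X) \<cdot> (X \<lhd> \<delta>))) \<cdot> \<delta>"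
    "(m \<rhd> X) \<cdot> (A \<lhd> \<epsilon> \<rhd> X) \<cdot> \<delta> = \<eta> \<rhd> X" "(m \<rhd> X) \<cdot> (A \<lhd> ((\<psi> \<rhd> \<one>) \<cdot> (X \<lhd> \<epsilon>))) \<cdot> \<delta> = \<eta> \<rhd> X"
    by (simp_all add: cowreath_comult_eq cowreath_counit_eq right_transfer_whisker right_obj_X right_arr_comult
        right_arr_counit X_in_Ob ten_assoc)
qed

lemma counit_right: "(m \<rhd> X) \<cdot> (A \<lhd> \<psi>) \<cdot> (A \<otimes> X \<lhd> \<epsilon>) \<cdot> \<delta> = \<eta> \<rhd> X"
proof -
  have "(m \<rhd> X) \<cdot> (A \<lhd> \<psi>) \<cdot> (A \<otimes> X \<lhd> \<epsilon>) \<cdot> \<delta> = (m \<rhd> X) \<cdot> (A \<lhd> ((\<psi> \<rhd> \<one>) \<cdot> (X \<lhd> \<epsilon>))) \<cdot> \<delta>"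
    by (rule diagram0[where S = "[]"], (rule reads arrows | fact)+, simp add: run_simps)
  then show ?thesis by (simp add: counit_right_tensor)
qed

text \<open>This and the next two definitions are the kinds of morphisms of \<open>T\<close> from
  which self-dualities are built; being a morphism means commuting with \<open>A\<close>, whence the
  names.\<close>

definition central_element :: "'a \<Rightarrow> bool" where
  "central_element t \<longleftrightarrow> right_arr \<one> (Id C A) X \<psi> t"

definition central_form :: "'a \<Rightarrow> bool" where
  "central_form B \<longleftrightarrow> right_arr (X \<otimes> X) \<psi>\<psi> \<one> (Id C A) B"

definition central_tensor :: "'a \<Rightarrow> bool" where
  "central_tensor s \<longleftrightarrow> right_arr \<one> (Id C A) (X \<otimes> X) \<psi>\<psi> s"

lemma central_element_iff:
  "central_element t \<longleftrightarrow> t \<in> hom C \<one> (A \<otimes> X) \<and> (m \<rhd> X) \<cdot> (A \<lhd> t) = (m \<rhd> X) \<cdot> (A \<lhd> \<psi>) \<cdot> (t \<rhd> A)"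
  by (simp add: central_element_def right_arr_from_unit right_obj_X)

lemma central_tensor_iff:
  "central_tensor s \<longleftrightarrow> s \<in> hom C \<one> (A \<otimes> X \<otimes> X) \<and>
     (m \<rhd> X \<otimes> X) \<cdot> (A \<lhd> s) = (m \<rhd> X \<otimes> X) \<cdot> (A \<lhd> ((\<psi> \<rhd> X) \<cdot> (X \<lhd> \<psi>))) \<cdot> (s \<rhd> A)"
  by (simp add: central_tensor_def right_arr_from_unit right_obj_XX)

lemma central_form_iff:
  "central_form B \<longleftrightarrow> B \<in> hom C (X \<otimes> X) A \<and> m \<cdot> (A \<lhd> B) \<cdot> ((\<psi> \<rhd> X) \<cdot> (X \<lhd> \<psi>)) = m \<cdot> (B \<rhd> A)"
  by (simp add: central_form_def right_arr_to_unit right_obj_XX)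

text \<open>The two self-duality conditions in \<open>T\<close>, written for underlying arrows and
  bracketed as the whiskerings of \<open>T\<close> produce them; see
  \<open>self_dual_T\<close>.\<close>

definition zigzag :: "'a \<Rightarrow> 'a \<Rightarrow> bool" where
  "zigzag s B \<longleftrightarrow> (m \<rhd> X) \<cdot> (A \<lhd> ((\<psi> \<rhd> \<one>) \<cdot> (X \<lhd> B))) \<cdot> (s \<rhd> X) = \<eta> \<rhd> X \<and>
     (m \<rhd> X) \<cdot> (A \<lhd> B \<rhd> X) \<cdot> ((\<psi> \<rhd> X \<otimes> X) \<cdot> (X \<lhd> s)) = \<eta> \<rhd> X"

definition casimir_form :: "'a \<Rightarrow> bool" where
  "casimir_form B \<longleftrightarrow> (m \<rhd> X) \<cdot> (A \<lhd> \<psi>) \<cdot> (A \<otimes> X \<lhd> B) \<cdot> (\<delta> \<rhd> X) =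
     (m \<rhd> X) \<cdot> (A \<lhd> B \<rhd> X) \<cdot> (\<psi> \<rhd> X \<otimes> X) \<cdot> (X \<lhd> \<delta>)"

lemma self_dual_T:
  assumes "central_tensor s" "central_form B"
  shows "T.self_dual (X, \<psi>) ((\<one>, Id C A), s, (X \<otimes> X, \<psi>\<psi>)) ((X \<otimes> X, \<psi>\<psi>), B, (\<one>, Id C A)) \<longleftrightarrow> zigzag s B"
  using assms
  by (simp add: T.self_dual_def zigzag_def central_tensor_def central_form_def right_transfer_whisker right_obj_X
      X_in_Ob ten_assoc right_ten_unit)

lemma casimir_T:
  assumes "central_form B"
  shows "T.casimir (X, \<psi>) \<Delta> ((X \<otimes> X, \<psi>\<psi>), B, (\<one>, Id C A)) \<longleftrightarrow> casimir_form B"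
proof -
  have B: "B \<in> hom C (X \<otimes> X) A" using assms by (simp add: central_form_iff)
  have "(m \<rhd> X) \<cdot> (A \<lhd> \<psi>) \<cdot> (A \<otimes> X \<lhd> B) \<cdot> (\<delta> \<rhd> X) = (m \<rhd> X) \<cdot> (A \<lhd> ((\<psi> \<rhd> \<one>) \<cdot> (X \<lhd> B))) \<cdot> (\<delta> \<rhd> X)"
    by (rule diagram0[where S = "[]"], (rule reads arrows | fact)+, simp add: run_simps)
  moreover have "(m \<rhd> X) \<cdot> (A \<lhd> B \<rhd> X) \<cdot> (\<psi> \<rhd> X \<otimes> X) \<cdot> (X \<lhd> \<delta>) = (m \<rhd> X) \<cdot> (A \<lhd> B \<rhd> X) \<cdot> ((\<psi> \<rhd> X \<otimes> X) \<cdot> (X \<lhd> \<delta>))"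
    by (rule diagram0[where S = "[]"], (rule reads arrows | fact)+, simp add: run_simps)
  ultimately show ?thesis
    using assms by (simp add: T.casimir_def casimir_form_def central_form_def right_transfer_whisker right_obj_X
      cowreath_comult_eq right_arr_comult X_in_Ob ten_assoc right_ten_unit right_ten_obj_assoc)
qed

lemma T_hom_from_unit: "F \<in> hom T \<one>\<^bsub>T\<^esub> (X, \<psi>) \<longleftrightarrow> (\<exists>t. F = ((\<one>, Id C A), t, (X, \<psi>)) \<and> central_element t)"
  by (simp add: right_transfer_hom central_element_def)

lemma T_hom_tensor: "F \<in> hom T \<one>\<^bsub>T\<^esub> ((X, \<psi>) \<otimes>\<^bsub>T\<^esub> (X, \<psi>)) \<longleftrightarrow>
    (\<exists>s. F = ((\<one>, Id C A), s, (X \<otimes> X, \<psi>\<psi>)) \<and> central_tensor s)"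
  by (simp add: right_transfer_hom central_tensor_def)

lemma T_hom_form: "F \<in> hom T ((X, \<psi>) \<otimes>\<^bsub>T\<^esub> (X, \<psi>)) \<one>\<^bsub>T\<^esub> \<longleftrightarrow>
    (\<exists>B. F = ((X \<otimes> X, \<psi>\<psi>), B, (\<one>, Id C A)) \<and> central_form B)"
  by (simp add: right_transfer_hom central_form_def)

abbreviation "P1 \<equiv> frobenius_coalgebra T (X, \<psi>) \<Delta> \<E>"

abbreviation comult_at :: "'a \<Rightarrow> 'a" where
  "comult_at t \<equiv> (m \<rhd> X \<otimes> X) \<cdot> (A \<lhd> \<delta>) \<cdot> t"

lemma central_comult_at:
  assumes "central_element t"
  shows "central_tensor (comult_at t)"
  using right_comp_arr[of \<one> "Id C A" X \<psi> t "X \<otimes> X" \<psi>\<psi> \<delta>] assms right_arr_comult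
  by (simp add: central_element_def central_tensor_def)

text \<open>The form suited to (vii), whose datum is \<open>t\<close>. \<open>P1_iff_casimir\<close>
  is suited to (viii), and \<open>P1_iff_frobenius_system\<close> to (iii) and (ix), where a
  complete pair \<open>t\<close>, \<open>B\<close> is needed.\<close>

lemma P1_iff_unit: "P1 \<longleftrightarrow> (\<exists>t B. central_element t \<and> central_form B \<and> zigzag (comult_at t) B)"
  unfolding T.frobenius_coalgebra_iff_unit[OF coalgebra_T] Bex_def T_hom_from_unit T_hom_form
  using self_dual_T[OF central_comult_at] by (auto simp: cowreath_comult_eq)

lemma P1_iff_casimir:
  "P1 \<longleftrightarrow> (\<exists>B. central_form B \<and> casimir_form B \<and> (\<exists>s. central_tensor s \<and> zigzag s B))"
  unfolding T.frobenius_coalgebra_iff_casimir[OF coalgebra_T] Bex_def T_hom_tensor T_hom_form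
  using self_dual_T casimir_T by auto

lemma P1_iff_frobenius_system:
  "P1 \<longleftrightarrow> (\<exists>t B. central_element t \<and> central_form B \<and> casimir_form B \<and>
     m \<cdot> (A \<lhd> B) \<cdot> (t \<rhd> X) = \<epsilon> \<and> m \<cdot> (A \<lhd> B) \<cdot> ((\<psi> \<rhd> X) \<cdot> (X \<lhd> t)) = \<epsilon>)"
proof -
  have *: "(F \<cdot>\<^bsub>T\<^esub> (G \<rhd>\<^bsub>T\<^esub> (X, \<psi>)) = \<E> \<longleftrightarrow> m \<cdot> (A \<lhd> B) \<cdot> (t \<rhd> X) = \<epsilon>) \<and>
      (F \<cdot>\<^bsub>T\<^esub> ((X, \<psi>) \<lhd>\<^bsub>T\<^esub> G) = \<E> \<longleftrightarrow> m \<cdot> (A \<lhd> B) \<cdot> ((\<psi> \<rhd> X) \<cdot> (X \<lhd> t)) = \<epsilon>)"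
    if "central_element t" "central_form B" and F: "F = ((X \<otimes> X, \<psi>\<psi>), B, (\<one>, Id C A))"
      and G: "G = ((\<one>, Id C A), t, (X, \<psi>))" for t B F G
  proof -
    have "m \<rhd> \<one> = m" by (simp add: rwhisker_def tenA_unit[OF m_in_hom])
    then show ?thesis
      using that by (simp add: cowreath_counit_eq right_transfer_whisker central_element_def central_form_def
          right_obj_X X_in_Ob right_ten_unit)
  qed
  have c: "(((X, \<psi>) \<lhd>\<^bsub>T\<^esub> F) \<cdot>\<^bsub>T\<^esub> (\<Delta> \<rhd>\<^bsub>T\<^esub> (X, \<psi>)) = (F \<rhd>\<^bsub>T\<^esub> (X, \<psi>)) \<cdot>\<^bsub>T\<^esub> ((X, \<psi>) \<lhd>\<^bsub>T\<^esub> \<Delta>)) \<longleftrightarrow> casimir_form B"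
    if "central_form B" and F: "F = ((X \<otimes> X, \<psi>\<psi>), B, (\<one>, Id C A))" for F B
    using casimir_T[OF that(1)] F by (simp add: T.casimir_def)
  show ?thesis
    unfolding T.frobenius_coalgebra_iff Bex_def T_hom_from_unit T_hom_form
    using * c coalgebra_T by metis
qed

section \<open>Bimodule morphisms between \<open>AX\<close> and \<open>YA\<close>\<close>

definition phi :: 'a where
  "phi = dual_transfer C A X \<psi> Y b d"

lemma phi_eq: "phi = (Y \<otimes> A \<lhd> d) \<cdot> (Y \<lhd> \<psi> \<rhd> Y) \<cdot> (b \<rhd> A \<otimes> Y)"
  by (simp add: phi_def dual_transfer_def)

lemma left_obj_Y: "left_obj Y phi"
  unfolding phi_def by (rule dual_transfer_left_obj[OF adjoint right_obj_X])

lemma phi_in_hom [arrows]: "phi \<in> hom C (A \<otimes> Y) (Y \<otimes> A)"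
  and phi_m: "phi \<cdot> (m \<rhd> Y) = (Y \<lhd> m) \<cdot> (phi \<rhd> A) \<cdot> (A \<lhd> phi)"
  and phi_eta: "phi \<cdot> (\<eta> \<rhd> Y) = Y \<lhd> \<eta>"
  using left_objD[OF left_obj_Y] by simp_all

definition nu :: 'a where
  "nu = (Y \<lhd> m) \<cdot> (phi \<rhd> A)"

lemma nu_in_hom [arrows]: "nu \<in> hom C (A \<otimes> Y \<otimes> A) (Y \<otimes> A)"
  unfolding nu_def by (rule in_hom, (rule reads arrows | fact)+)

lemma wreath_left_action_eq: "wreath_left_action C A m X \<psi> Y b d = nu"
  by (simp add: wreath_left_action_def nu_def phi_def)

text \<open>The second leg of \<open>s\<close> is paired with \<open>Y\<close>, and the first one is
  moved past \<open>A\<close>. For \<open>s = comult_at t\<close> this is the arrow of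
  (vii).\<close>

definition Phi :: "'a \<Rightarrow> 'a" where
  "Phi s = (m \<rhd> X) \<cdot> (A \<lhd> \<psi>) \<cdot> (A \<otimes> X \<lhd> d \<rhd> A) \<cdot> (s \<rhd> Y \<otimes> A)"

definition Psi :: "'a \<Rightarrow> 'a" where
  "Psi B = (Y \<lhd> m) \<cdot> (Y \<otimes> A \<lhd> B) \<cdot> (Y \<lhd> \<psi> \<rhd> X) \<cdot> (b \<rhd> A \<otimes> X)"

definition AX_to_YA :: "'a \<Rightarrow> bool" where
  "AX_to_YA g \<longleftrightarrow> g \<in> hom C (A \<otimes> X) (Y \<otimes> A) \<and> g \<cdot> (m \<rhd> X) = nu \<cdot> (A \<lhd> g) \<and>
     g \<cdot> ((m \<rhd> X) \<cdot> (A \<lhd> \<psi>)) = (Y \<lhd> m) \<cdot> (g \<rhd> A)"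

definition YA_to_AX :: "'a \<Rightarrow> bool" where
  "YA_to_AX f \<longleftrightarrow> f \<in> hom C (Y \<otimes> A) (A \<otimes> X) \<and> f \<cdot> nu = (m \<rhd> X) \<cdot> (A \<lhd> f) \<and>
     f \<cdot> (Y \<lhd> m) = (m \<rhd> X) \<cdot> (A \<lhd> \<psi>) \<cdot> (f \<rhd> A)"

text \<open>Right linearity comes from the multiplicativity of \<open>\<psi>\<close>. Left linearity
  is where centrality of \<open>s\<close> enters, once \<open>phi\<close> is unfolded and a zigzag
  is cancelled.\<close>

lemma Phi_bimodule:
  assumes "central_tensor s"
  shows "YA_to_AX (Phi s)"
proof -
  have s: "s \<in> hom C \<one> (A \<otimes> X \<otimes> X)"
    and cs: "(m \<rhd> X \<otimes> X) \<cdot> (A \<lhd> s) = (m \<rhd> X \<otimes> X) \<cdot> (A \<lhd> ((\<psi> \<rhd> X) \<cdot> (X \<lhd> \<psi>))) \<cdot> (s \<rhd> A)"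
    using assms by (simp_all add: central_tensor_iff)
  have "(m \<rhd> X) \<cdot> (A \<lhd> \<psi>) \<cdot> (A \<otimes> X \<lhd> d \<rhd> A) \<cdot> (s \<rhd> Y \<otimes> A) \<cdot> nu =
      (m \<rhd> X) \<cdot> (A \<lhd> ((m \<rhd> X) \<cdot> (A \<lhd> \<psi>) \<cdot> (A \<otimes> X \<lhd> d \<rhd> A) \<cdot> (s \<rhd> Y \<otimes> A)))"
    by (rule diagram6[OF nu_def phi_eq zigzag_X psi_m m_assoc cs, where S = "[Apply 0 0 0, Apply 1 0 0, Left 3,
      Left 2, Left 1, Left 0, Left 4, Left 3, Left 2, Apply 2 1 2, Apply 3 3 1, Left 2, Undo 4 5 0, Left 4, Left 3,
      Undo 5 0 0, Right 1, Right 2, Apply 4 3 0]"], (rule reads arrows | fact)+, simp add: run_simps)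
  moreover have "(m \<rhd> X) \<cdot> (A \<lhd> \<psi>) \<cdot> (A \<otimes> X \<lhd> d \<rhd> A) \<cdot> (s \<rhd> Y \<otimes> A) \<cdot> (Y \<lhd> m) =
      (m \<rhd> X) \<cdot> (A \<lhd> \<psi>) \<cdot> (((m \<rhd> X) \<cdot> (A \<lhd> \<psi>) \<cdot> (A \<otimes> X \<lhd> d \<rhd> A) \<cdot> (s \<rhd> Y \<otimes> A)) \<rhd> A)"
    by (rule diagram2[OF psi_m m_assoc, where S = "[Left 0, Left 1, Apply 0 2 1, Undo 1 4 0, Left 3]"],
      (rule reads arrows | fact)+, simp add: run_simps)
  moreover have "(m \<rhd> X) \<cdot> (A \<lhd> \<psi>) \<cdot> (A \<otimes> X \<lhd> d \<rhd> A) \<cdot> (s \<rhd> Y \<otimes> A) \<in> hom C (Y \<otimes> A) (A \<otimes> X)"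
    by (rule in_hom, (rule reads arrows | fact)+)
  ultimately show ?thesis by (simp add: YA_to_AX_def Phi_def)
qed

text \<open>Compared with \<open>Phi\<close> the roles are exchanged: left linearity comes from the
  multiplicativity of \<open>\<psi>\<close>, and centrality of \<open>B\<close> gives right
  linearity.\<close>

lemma Psi_bimodule:
  assumes "central_form B"
  shows "AX_to_YA (Psi B)"
proof -
  have s: "B \<in> hom C (X \<otimes> X) A"
    and cB: "m \<cdot> (A \<lhd> B) \<cdot> ((\<psi> \<rhd> X) \<cdot> (X \<lhd> \<psi>)) = m \<cdot> (B \<rhd> A)"
    using assms by (simp_all add: central_form_iff)
  have "(Y \<lhd> m) \<cdot> (Y \<otimes> A \<lhd> B) \<cdot> (Y \<lhd> \<psi> \<rhd> X) \<cdot> (b \<rhd> A \<otimes> X) \<cdot> (m \<rhd> X) =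
      nu \<cdot> (A \<lhd> ((Y \<lhd> m) \<cdot> (Y \<otimes> A \<lhd> B) \<cdot> (Y \<lhd> \<psi> \<rhd> X) \<cdot> (b \<rhd> A \<otimes> X)))"
    by (rule diagram5[OF psi_m m_assoc zigzag_X phi_eq nu_def, where S = "[Left 0, Apply 0 1 1, Right 3,
      Apply 1 4 1, Undo 2 2 2, Right 3, Right 4, Right 5, Right 1, Right 2, Right 3, Right 4, Right 0, Right 1,
      Right 2, Right 3, Undo 3 4 0, Undo 4 4 0]"], (rule reads arrows | fact)+, simp add: run_simps)
  moreover have "(Y \<lhd> m) \<cdot> (Y \<otimes> A \<lhd> B) \<cdot> (Y \<lhd> \<psi> \<rhd> X) \<cdot> (b \<rhd> A \<otimes> X) \<cdot> ((m \<rhd> X) \<cdot> (A \<lhd> \<psi>)) =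
      (Y \<lhd> m) \<cdot> (((Y \<lhd> m) \<cdot> (Y \<otimes> A \<lhd> B) \<cdot> (Y \<lhd> \<psi> \<rhd> X) \<cdot> (b \<rhd> A \<otimes> X)) \<rhd> A)"
    by (rule diagram3[OF psi_m m_assoc cB, where S = "[Left 1, Apply 0 2 1, Right 4, Apply 1 5 1, Left 0, Left 1,
      Apply 2 2 2, Undo 1 3 1]"], (rule reads arrows | fact)+, simp add: run_simps)
  moreover have "(Y \<lhd> m) \<cdot> (Y \<otimes> A \<lhd> B) \<cdot> (Y \<lhd> \<psi> \<rhd> X) \<cdot> (b \<rhd> A \<otimes> X) \<in> hom C (A \<otimes> X) (Y \<otimes> A)"
    by (rule in_hom, (rule reads arrows | fact)+)
  ultimately show ?thesis by (simp add: AX_to_YA_def Psi_def)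
qed

text \<open>The tensor \<open>s\<close> is the value of \<open>f\<close> on the canonical element
  \<open>b\<close>, with the unit of \<open>A\<close> inserted. Left and right linearity together
  make it central; right linearity and a zigzag recover \<open>f\<close> from it.\<close>

lemma YA_to_AX_imp_Phi:
  assumes "YA_to_AX f"
  obtains s where "central_tensor s" "f = Phi s"
proof
  have f: "f \<in> hom C (Y \<otimes> A) (A \<otimes> X)" and fl: "f \<cdot> nu = (m \<rhd> X) \<cdot> (A \<lhd> f)"
    and fr: "f \<cdot> (Y \<lhd> m) = (m \<rhd> X) \<cdot> (A \<lhd> \<psi>) \<cdot> (f \<rhd> A)"
    using assms by (simp_all add: YA_to_AX_def)
  have "(m \<rhd> X \<otimes> X) \<cdot> (A \<lhd> ((f \<rhd> X) \<cdot> (Y \<lhd> \<eta> \<rhd> X) \<cdot> b)) = (f \<rhd> X) \<cdot> (nu \<rhd> X) \<cdot> (A \<lhd> ((Y \<lhd> \<eta> \<rhd> X) \<cdot> b))"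
    by (rule diagram1[OF fl, where S = "[Undo 0 2 0]"], (rule reads arrows | fact)+, simp add: run_simps)
  \<comment> \<open>Since \<open>phi\<close> is the mate of \<open>\<psi>\<close>, acting from the
    left on the canonical element amounts to moving \<open>A\<close> across its leg in
    \<open>X\<close>.\<close>
  moreover have "(nu \<rhd> X) \<cdot> (A \<lhd> ((Y \<lhd> \<eta> \<rhd> X) \<cdot> b)) = (Y \<lhd> \<psi>) \<cdot> (b \<rhd> A)"
    by (rule diagram4[OF nu_def m_unit_right phi_eq zigzag_X, where S = "[Apply 0 2 0, Left 1, Apply 1 2 1,
      Apply 2 1 0, Left 0, Left 1, Apply 3 2 2]"], (rule reads arrows | fact)+, simp add: run_simps)
  moreover have "(f \<rhd> X) \<cdot> ((Y \<lhd> \<psi>) \<cdot> (b \<rhd> A)) =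
      (m \<rhd> X \<otimes> X) \<cdot> (A \<lhd> ((\<psi> \<rhd> X) \<cdot> (X \<lhd> \<psi>))) \<cdot> (((f \<rhd> X) \<cdot> (Y \<lhd> \<eta> \<rhd> X) \<cdot> b) \<rhd> A)"
    by (rule diagram2[OF m_unit_left fr, where S = "[Undo 0 2 1, Left 1, Apply 1 3 0, Left 2]"],
      (rule reads arrows | fact)+, simp add: run_simps)
  moreover have "(f \<rhd> X) \<cdot> (nu \<rhd> X) \<cdot> (A \<lhd> ((Y \<lhd> \<eta> \<rhd> X) \<cdot> b)) = (f \<rhd> X) \<cdot> ((nu \<rhd> X) \<cdot> (A \<lhd> ((Y \<lhd> \<eta> \<rhd> X) \<cdot> b)))"
    by (rule diagram0[where S = "[]"], (rule reads arrows | fact)+, simp add: run_simps)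
  moreover have "(f \<rhd> X) \<cdot> (Y \<lhd> \<eta> \<rhd> X) \<cdot> b \<in> hom C \<one> (A \<otimes> X \<otimes> X)"
    by (rule in_hom, (rule reads arrows | fact)+)
  ultimately show "central_tensor ((f \<rhd> X) \<cdot> (Y \<lhd> \<eta> \<rhd> X) \<cdot> b)"
    by (simp add: central_tensor_iff)
  have "f = (m \<rhd> X) \<cdot> (A \<lhd> \<psi>) \<cdot> (A \<otimes> X \<lhd> d \<rhd> A) \<cdot> (((f \<rhd> X) \<cdot> (Y \<lhd> \<eta> \<rhd> X) \<cdot> b) \<rhd> Y \<otimes> A)"
    by (rule diagram3[OF m_unit_left fr zigzag_Y, where S = "[Undo 0 0 1, Apply 1 1 0, Undo 2 0 0, Left 1,
      Left 2]"], (rule reads arrows | fact)+, simp add: run_simps)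
  then show "f = Phi ((f \<rhd> X) \<cdot> (Y \<lhd> \<eta> \<rhd> X) \<cdot> b)"
    by (simp add: Phi_def)
qed

text \<open>The form \<open>B\<close> restricts \<open>g\<close> along the unit of \<open>A\<close>
  and pairs the result with \<open>X\<close>. Left linearity recovers \<open>g\<close> from it
  (\<open>dg\<close>), and right linearity brings a scalar out on the right (\<open>dr\<close>);
  comparing the two gives centrality.\<close>

lemma AX_to_YA_imp_Psi:
  assumes "AX_to_YA g"
  obtains B where "central_form B" "g = Psi B"
proof
  have g: "g \<in> hom C (A \<otimes> X) (Y \<otimes> A)" and gl: "g \<cdot> (m \<rhd> X) = nu \<cdot> (A \<lhd> g)"
    and gr: "g \<cdot> ((m \<rhd> X) \<cdot> (A \<lhd> \<psi>)) = (Y \<lhd> m) \<cdot> (g \<rhd> A)"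
    using assms by (simp_all add: AX_to_YA_def)
  have dg: "(d \<rhd> A) \<cdot> (X \<lhd> g) = m \<cdot> (A \<lhd> ((d \<rhd> A) \<cdot> (X \<lhd> g) \<cdot> (X \<lhd> \<eta> \<rhd> X))) \<cdot> (\<psi> \<rhd> X)"
    by (rule diagram5[OF m_unit_right gl nu_def phi_eq zigzag_X, where S = "[Undo 0 0 1, Apply 1 1 1, Apply 2 2 1,
      Apply 3 2 1, Left 5, Left 4, Left 3, Apply 4 2 0, Left 1, Left 0]"], (rule reads arrows | fact)+,
      simp add: run_simps)
  have dr: "m \<cdot> (((d \<rhd> A) \<cdot> (X \<lhd> g) \<cdot> (X \<lhd> \<eta> \<rhd> X)) \<rhd> A) = (d \<rhd> A) \<cdot> (X \<lhd> g) \<cdot> (X \<lhd> \<psi>)"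
    by (rule diagram2[OF gr m_unit_left, where S = "[Right 2, Undo 0 1 1, Right 0, Apply 1 1 1]"],
      (rule reads arrows | fact)+, simp add: run_simps)
  have "m \<cdot> (A \<lhd> ((d \<rhd> A) \<cdot> (X \<lhd> g) \<cdot> (X \<lhd> \<eta> \<rhd> X))) \<cdot> ((\<psi> \<rhd> X) \<cdot> (X \<lhd> \<psi>)) =
      m \<cdot> (((d \<rhd> A) \<cdot> (X \<lhd> g) \<cdot> (X \<lhd> \<eta> \<rhd> X)) \<rhd> A)"
    by (rule diagram2[OF dg dr, where S = "[Undo 0 1 0, Undo 1 0 0]"], (rule reads arrows | fact)+,
      simp add: run_simps)
  moreover have "(d \<rhd> A) \<cdot> (X \<lhd> g) \<cdot> (X \<lhd> \<eta> \<rhd> X) \<in> hom C (X \<otimes> X) A"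
    by (rule in_hom, (rule reads arrows | fact)+)
  ultimately show "central_form ((d \<rhd> A) \<cdot> (X \<lhd> g) \<cdot> (X \<lhd> \<eta> \<rhd> X))"
    by (simp add: central_form_iff)
  have "g = (Y \<lhd> m) \<cdot> (Y \<otimes> A \<lhd> ((d \<rhd> A) \<cdot> (X \<lhd> g) \<cdot> (X \<lhd> \<eta> \<rhd> X))) \<cdot> (Y \<lhd> \<psi> \<rhd> X) \<cdot> (b \<rhd> A \<otimes> X)"
    by (rule diagram2[OF zigzag_Y dg, where S = "[Undo 0 1 0, Left 0, Apply 1 1 1]"], (rule reads arrows | fact)+,
      simp add: run_simps)
  then show "g = Psi ((d \<rhd> A) \<cdot> (X \<lhd> g) \<cdot> (X \<lhd> \<eta> \<rhd> X))"
    by (simp add: Psi_def)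
qed

text \<open>The composite on \<open>A X\<close> is left linear, hence determined by its restriction
  along the unit, which is the first zigzag. The composite on \<open>Y A\<close> is right linear,
  hence determined on \<open>Y\<close>, and its transpose there is the second zigzag.\<close>

lemma Phi_Psi_inverse_iff:
  assumes s: "central_tensor s" and B: "central_form B"
  shows "inverse_arrows C (Phi s) (Psi B) \<longleftrightarrow> zigzag s B"
proof -
  have h: "s \<in> hom C \<one> (A \<otimes> X \<otimes> X)" "B \<in> hom C (X \<otimes> X) A"
    and f: "Phi s \<in> hom C (Y \<otimes> A) (A \<otimes> X)" and g: "Psi B \<in> hom C (A \<otimes> X) (Y \<otimes> A)"
    using assms Phi_bimodule[OF s] Psi_bimodule[OF B]
    by (simp_all add: central_tensor_iff central_form_iff YA_to_AX_def AX_to_YA_def)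
  have "(m \<rhd> X) \<cdot> (A \<lhd> \<psi>) \<cdot> (A \<otimes> X \<lhd> d \<rhd> A) \<cdot> (s \<rhd> Y \<otimes> A) \<cdot>
      ((Y \<lhd> m) \<cdot> (Y \<otimes> A \<lhd> B) \<cdot> (Y \<lhd> \<psi> \<rhd> X) \<cdot> (b \<rhd> A \<otimes> X)) \<cdot> (\<eta> \<rhd> X) =
    (m \<rhd> X) \<cdot> (A \<lhd> ((\<psi> \<rhd> \<one>) \<cdot> (X \<lhd> B))) \<cdot> (s \<rhd> X)"
    by (rule diagram3[OF zigzag_X psi_eta m_unit_left, where S = "[Left 4, Left 3, Left 2, Left 1, Left 5, Left 4,
      Left 3, Apply 0 2 2, Left 0, Apply 1 1 2, Right 1, Apply 2 2 2]"], (rule reads arrows | fact)+,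
      simp add: run_simps)
  then have 1: "(m \<rhd> X) \<cdot> (A \<lhd> ((\<psi> \<rhd> \<one>) \<cdot> (X \<lhd> B))) \<cdot> (s \<rhd> X) = Phi s \<cdot> Psi B \<cdot> (\<eta> \<rhd> X)"
    by (simp add: Phi_def Psi_def)
  \<comment> \<open>The second composite starts from \<open>Y\<close>, whereas its zigzag condition
    concerns \<open>X\<close>; pairing with \<open>X\<close> makes them comparable.\<close>
  have "(d \<rhd> A) \<cdot> (X \<lhd> ((Y \<lhd> m) \<cdot> (Y \<otimes> A \<lhd> B) \<cdot> (Y \<lhd> \<psi> \<rhd> X) \<cdot> (b \<rhd> A \<otimes> X) \<cdot>
      ((m \<rhd> X) \<cdot> (A \<lhd> \<psi>) \<cdot> (A \<otimes> X \<lhd> d \<rhd> A) \<cdot> (s \<rhd> Y \<otimes> A)) \<cdot> (Y \<lhd> \<eta>))) =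
    (A \<lhd> d) \<cdot> (((m \<rhd> X) \<cdot> (A \<lhd> B \<rhd> X) \<cdot> ((\<psi> \<rhd> X \<otimes> X) \<cdot> (X \<lhd> s))) \<rhd> Y)"
    by (rule diagram3[OF zigzag_X psi_eta m_unit_right, where S = "[Left 8, Left 7, Left 6, Apply 0 5 0, Left 0,
      Left 1, Apply 1 2 2, Apply 2 2 1, Left 1, Left 2, Left 3]"], (rule reads arrows | fact)+, simp add: run_simps)
  then have 2: "(d \<rhd> A) \<cdot> (X \<lhd> (Psi B \<cdot> Phi s \<cdot> (Y \<lhd> \<eta>))) =
      (A \<lhd> d) \<cdot> (((m \<rhd> X) \<cdot> (A \<lhd> B \<rhd> X) \<cdot> ((\<psi> \<rhd> X \<otimes> X) \<cdot> (X \<lhd> s))) \<rhd> Y)"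
    by (simp add: Phi_def Psi_def)
  define p where "p = Phi s"
  define q where "q = Psi B"
  define z where "z = (m \<rhd> X) \<cdot> (A \<lhd> B \<rhd> X) \<cdot> ((\<psi> \<rhd> X \<otimes> X) \<cdot> (X \<lhd> s))"
  have p: "p \<in> hom C (Y \<otimes> A) (A \<otimes> X)" and q: "q \<in> hom C (A \<otimes> X) (Y \<otimes> A)"
    using f g by (simp_all add: p_def q_def)
  have z: "z \<in> hom C X (A \<otimes> X)"
    unfolding z_def by (rule in_hom, (rule reads arrows | fact)+)
  have pl: "p \<cdot> nu = (m \<rhd> X) \<cdot> (A \<lhd> p)" and ql: "q \<cdot> (m \<rhd> X) = nu \<cdot> (A \<lhd> q)"
    and pr: "p \<cdot> (Y \<lhd> m) = (m \<rhd> X) \<cdot> (A \<lhd> \<psi>) \<cdot> (p \<rhd> A)"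
    and qr: "q \<cdot> ((m \<rhd> X) \<cdot> (A \<lhd> \<psi>)) = (Y \<lhd> m) \<cdot> (q \<rhd> A)"
    using Phi_bimodule[OF s] Psi_bimodule[OF B] by (simp_all add: p_def q_def YA_to_AX_def AX_to_YA_def)
  have dz: "(d \<rhd> A) \<cdot> (X \<lhd> (q \<cdot> p \<cdot> (Y \<lhd> \<eta>))) = (A \<lhd> d) \<cdot> (z \<rhd> Y)"
    using 2 by (simp add: p_def q_def z_def)
  have pq: "p \<cdot> q = Id C (A \<otimes> X) \<longleftrightarrow> p \<cdot> q \<cdot> (\<eta> \<rhd> X) = \<eta> \<rhd> X"
  proof
    assume pq: "p \<cdot> q = Id C (A \<otimes> X)"
    show "p \<cdot> q \<cdot> (\<eta> \<rhd> X) = \<eta> \<rhd> X"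
      by (rule diagram1[OF pq, where S = "[Apply 0 1 0]"], (rule reads arrows | fact)+, simp add: run_simps)
  next
    assume pq: "p \<cdot> q \<cdot> (\<eta> \<rhd> X) = \<eta> \<rhd> X"
    show "p \<cdot> q = Id C (A \<otimes> X)"
      by (rule diagram4[OF m_unit_right ql pl pq, where S = "[Undo 0 0 0, Apply 1 1 0, Apply 2 2 0, Apply 3 0 1,
      Apply 0 0 0]"], (rule reads arrows | fact)+, simp add: run_simps)
  qed
  have qp: "q \<cdot> p = Id C (Y \<otimes> A) \<longleftrightarrow> z = \<eta> \<rhd> X"
  proof
    assume qp: "q \<cdot> p = Id C (Y \<otimes> A)"
    have dz': "(A \<lhd> d) \<cdot> (z \<rhd> Y) = (d \<rhd> A) \<cdot> (X \<otimes> Y \<lhd> \<eta>)"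
      by (rule diagram2[OF dz qp, where S = "[Undo 0 0 0, Apply 1 1 1]"], (rule reads arrows | fact)+,
      simp add: run_simps)
    show "z = \<eta> \<rhd> X"
      by (rule diagram2[OF zigzag_X dz', where S = "[Undo 0 1 1, Right 0, Apply 1 1 0, Left 1, Apply 0 0 0]"],
      (rule reads arrows | fact)+, simp add: run_simps)
  next
    assume zeta: "z = \<eta> \<rhd> X"
    have unit: "q \<cdot> p \<cdot> (Y \<lhd> \<eta>) = Y \<lhd> \<eta>"
      by (rule diagram3[OF zigzag_Y dz zeta, where S = "[Undo 0 3 0, Left 2, Left 1, Left 0, Apply 1 1 1, Apply 2 1 1,
      Right 1, Apply 0 0 0]"], (rule reads arrows | fact)+, simp add: run_simps)
    show "q \<cdot> p = Id C (Y \<otimes> A)"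
      by (rule diagram4[OF m_unit_left pr qr unit, where S = "[Undo 0 0 1, Apply 1 1 0, Apply 2 2 0, Apply 3 0 0,
      Apply 0 0 1]"], (rule reads arrows | fact)+, simp add: run_simps)
  qed
  have "inverse_arrows C p q \<longleftrightarrow> p \<cdot> q = Id C (A \<otimes> X) \<and> q \<cdot> p = Id C (Y \<otimes> A)"
    using homD[OF p] q by (auto simp: inverse_arrows_def)
  then show ?thesis
    using pq qp 1 by (simp add: zigzag_def p_def q_def z_def)
qed

lemma inverse_arrows_sym: "inverse_arrows C f g \<Longrightarrow> inverse_arrows C g f"
  by (auto simp: inverse_arrows_def hom_def)

text \<open>The inverse of a bimodule morphism is again one, hence of the form \<open>Psi B\<close>,
  so that \<open>Phi_Psi_inverse_iff\<close> applies. For \<open>Psi\<close> the argument is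
  symmetric.\<close>

lemma is_iso_Phi_iff:
  assumes s: "central_tensor s"
  shows "is_iso C (Phi s) \<longleftrightarrow> (\<exists>B. central_form B \<and> zigzag s B)"
proof
  assume "is_iso C (Phi s)"
  then obtain q where pq: "inverse_arrows C (Phi s) q" by (auto simp: is_iso_def)
  define p where "p = Phi s"
  have p: "p \<in> hom C (Y \<otimes> A) (A \<otimes> X)" and pl: "p \<cdot> nu = (m \<rhd> X) \<cdot> (A \<lhd> p)"
    and pr: "p \<cdot> (Y \<lhd> m) = (m \<rhd> X) \<cdot> (A \<lhd> \<psi>) \<cdot> (p \<rhd> A)"
    using Phi_bimodule[OF s] by (simp_all add: p_def YA_to_AX_def)
  have q: "q \<in> hom C (A \<otimes> X) (Y \<otimes> A)" and i1: "p \<cdot> q = Id C (A \<otimes> X)" and i2: "q \<cdot> p = Id C (Y \<otimes> A)"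
    using pq homD[OF p] by (auto simp: inverse_arrows_def p_def)
  have "q \<cdot> (m \<rhd> X) = nu \<cdot> (A \<lhd> q)"
    by (rule diagram3[OF i1 pl i2, where S = "[Undo 0 0 1, Undo 1 1 0, Apply 2 2 0]"], (rule reads arrows | fact)+,
      simp add: run_simps)
  moreover have "q \<cdot> ((m \<rhd> X) \<cdot> (A \<lhd> \<psi>)) = (Y \<lhd> m) \<cdot> (q \<rhd> A)"
    by (rule diagram3[OF i1 pr i2, where S = "[Undo 0 0 0, Undo 1 1 0, Apply 2 2 0]"], (rule reads arrows | fact)+,
      simp add: run_simps)
  ultimately have "AX_to_YA q" using q by (simp add: AX_to_YA_def)
  then obtain B where "central_form B" "q = Psi B" by (rule AX_to_YA_imp_Psi)
  then show "\<exists>B. central_form B \<and> zigzag s B"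
    using pq Phi_Psi_inverse_iff[OF s] by auto
next
  assume "\<exists>B. central_form B \<and> zigzag s B"
  then show "is_iso C (Phi s)" using Phi_Psi_inverse_iff[OF s] by (auto simp: is_iso_def)
qed

lemma is_iso_Psi_iff:
  assumes B: "central_form B"
  shows "is_iso C (Psi B) \<longleftrightarrow> (\<exists>s. central_tensor s \<and> zigzag s B)"
proof
  assume "is_iso C (Psi B)"
  then obtain p where pq: "inverse_arrows C p (Psi B)" using inverse_arrows_sym by (auto simp: is_iso_def)
  define q where "q = Psi B"
  have q: "q \<in> hom C (A \<otimes> X) (Y \<otimes> A)" and ql: "q \<cdot> (m \<rhd> X) = nu \<cdot> (A \<lhd> q)"
    and qr: "q \<cdot> ((m \<rhd> X) \<cdot> (A \<lhd> \<psi>)) = (Y \<lhd> m) \<cdot> (q \<rhd> A)"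
    using Psi_bimodule[OF B] by (simp_all add: q_def AX_to_YA_def)
  have p: "p \<in> hom C (Y \<otimes> A) (A \<otimes> X)" and i1: "p \<cdot> q = Id C (A \<otimes> X)" and i2: "q \<cdot> p = Id C (Y \<otimes> A)"
    using inverse_arrows_sym[OF pq] homD[OF q] by (auto simp: inverse_arrows_def q_def)
  have "p \<cdot> nu = (m \<rhd> X) \<cdot> (A \<lhd> p)"
    by (rule diagram3[OF i2 ql i1, where S = "[Undo 0 0 1, Undo 1 1 0, Apply 2 2 0]"], (rule reads arrows | fact)+,
      simp add: run_simps)
  moreover have "p \<cdot> (Y \<lhd> m) = (m \<rhd> X) \<cdot> (A \<lhd> \<psi>) \<cdot> (p \<rhd> A)"
    by (rule diagram3[OF i2 qr i1, where S = "[Undo 0 0 0, Undo 1 1 0, Apply 2 3 0]"], (rule reads arrows | fact)+,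
      simp add: run_simps)
  ultimately have "YA_to_AX p" using p by (simp add: YA_to_AX_def)
  then obtain s where "central_tensor s" "p = Phi s" by (rule YA_to_AX_imp_Phi)
  then show "\<exists>s. central_tensor s \<and> zigzag s B"
    using pq Phi_Psi_inverse_iff[OF _ B] by auto
next
  assume "\<exists>s. central_tensor s \<and> zigzag s B"
  then show "is_iso C (Psi B)"
    using Phi_Psi_inverse_iff[OF _ B] inverse_arrows_sym by (auto simp: is_iso_def)
qed

abbreviation "P7 \<equiv> (\<exists>t. (\<one>\<^bsub>T\<^esub>, t, (X, \<psi>)) \<in> Ar T \<and>
   is_iso C (((m \<cdot> (m \<rhd> A)) \<rhd> X) \<cdot> (A \<otimes> A \<lhd> \<psi>) \<cdot> (A \<otimes> A \<otimes> X \<lhd> d \<rhd> A) \<cdot>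
     (A \<lhd> \<delta> \<rhd> Y \<otimes> A) \<cdot> (t \<rhd> Y \<otimes> A)))"

abbreviation "P8 \<equiv> (\<exists>B. ((X, \<psi>) \<otimes>\<^bsub>T\<^esub> (X, \<psi>), B, \<one>\<^bsub>T\<^esub>) \<in> Ar T \<and>
   (m \<rhd> X) \<cdot> (A \<lhd> \<psi>) \<cdot> (A \<otimes> X \<lhd> B) \<cdot> (\<delta> \<rhd> X) =
   (m \<rhd> X) \<cdot> (A \<lhd> B \<rhd> X) \<cdot> (\<psi> \<rhd> X \<otimes> X) \<cdot> (X \<lhd> \<delta>) \<and>
   is_iso C ((Y \<lhd> m) \<cdot> (Y \<otimes> A \<lhd> B) \<cdot> (Y \<lhd> \<psi> \<rhd> X) \<cdot> (b \<rhd> A \<otimes> X)))"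

lemma P1_iff_P7: "P1 \<longleftrightarrow> P7"
proof -
  \<comment> \<open>The arrow of (vii) postpones one multiplication to the end; the two differ by
    interchange.\<close>
  have "Phi (comult_at t) = ((m \<cdot> (m \<rhd> A)) \<rhd> X) \<cdot> (A \<otimes> A \<lhd> \<psi>) \<cdot> (A \<otimes> A \<otimes> X \<lhd> d \<rhd> A) \<cdot>
     (A \<lhd> \<delta> \<rhd> Y \<otimes> A) \<cdot> (t \<rhd> Y \<otimes> A)" if "central_element t" for t
  proof -
    have t: "t \<in> hom C \<one> (A \<otimes> X)" using that by (simp add: central_element_iff)
    have "(m \<rhd> X) \<cdot> (A \<lhd> \<psi>) \<cdot> (A \<otimes> X \<lhd> d \<rhd> A) \<cdot> (((m \<rhd> X \<otimes> X) \<cdot> (A \<lhd> \<delta>) \<cdot> t) \<rhd> Y \<otimes> A) =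
      ((m \<cdot> (m \<rhd> A)) \<rhd> X) \<cdot> (A \<otimes> A \<lhd> \<psi>) \<cdot> (A \<otimes> A \<otimes> X \<lhd> d \<rhd> A) \<cdot> (A \<lhd> \<delta> \<rhd> Y \<otimes> A) \<cdot> (t \<rhd> Y \<otimes> A)"
      by (rule diagram0[where S = "[Right 2, Right 3]"], (rule reads arrows | fact)+, simp add: run_simps)
    then show ?thesis by (simp add: Phi_def)
  qed
  moreover have "(\<one>\<^bsub>T\<^esub>, t, (X, \<psi>)) \<in> Ar T \<longleftrightarrow> central_element t" for t
    by (simp add: right_transfer_Ar central_element_def)
  ultimately show ?thesis
    using is_iso_Phi_iff[OF central_comult_at] unfolding P1_iff_unit by metis
qed

lemma P1_iff_P8: "P1 \<longleftrightarrow> P8"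
proof -
  have "((X, \<psi>) \<otimes>\<^bsub>T\<^esub> (X, \<psi>), B, \<one>\<^bsub>T\<^esub>) \<in> Ar T \<longleftrightarrow> central_form B" for B
    by (simp add: right_transfer_Ar central_form_def)
  then show ?thesis
    using is_iso_Psi_iff unfolding P1_iff_casimir Psi_def casimir_form_def by metis
qed

end

section \<open>The dual algebra and the wreath product\<close>

context algebra_in
begin

lemma dual_inject:
  assumes "adjoint_objects C X Y b d" "adjoint_objects C X' Y' b' d'" "f \<in> hom C X (A \<otimes> X')" "g \<in> hom C X (A \<otimes> X')"
  shows "dual Y b Y' d' f = dual Y b Y' d' g \<longleftrightarrow> f = g"
  using undual_dual[OF assms(1,2)] assms(3,4) by metis

end

context dual_cowreath
begin

abbreviation "bb \<equiv> (Y \<lhd> b \<rhd> X) \<cdot> b"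
abbreviation "dd \<equiv> d \<cdot> (X \<lhd> d \<rhd> Y)"
abbreviation "phi2 \<equiv> (Y \<lhd> phi) \<cdot> (phi \<rhd> Y)"

lemmas adjoint2 = adjoint_ten[OF adjoint adjoint]

lemma dual_transfer_XX: "dual_transfer C A (X \<otimes> X) \<psi>\<psi> (Y \<otimes> Y) bb dd = phi2"
  using dual_transfer_ten[OF adjoint right_obj_X adjoint right_obj_X] by (simp add: phi_def)

text \<open>This and \<open>unt\<close> are the transposes of \<open>\<delta>\<close> and
  \<open>\<epsilon>\<close>: contravariance turns the coalgebra on \<open>X\<close> into an algebra
  on \<open>Y\<close>.\<close>

definition mul :: 'a where
  "mul = dual Y b (Y \<otimes> Y) dd \<delta>"

definition unt :: 'a where
  "unt = dual Y b \<one> (Id C \<one>) \<epsilon>"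

lemma mul_eq: "mul = (Y \<otimes> A \<lhd> (d \<cdot> (X \<lhd> d \<rhd> Y))) \<cdot> (Y \<lhd> \<delta> \<rhd> Y \<otimes> Y) \<cdot> (b \<rhd> Y \<otimes> Y)"
  by (simp add: mul_def dual_def)

lemma unt_eq: "unt = (Y \<lhd> \<epsilon>) \<cdot> b"
proof -
  have "(Y \<otimes> A \<lhd> Id C \<one>) \<cdot> (Y \<lhd> \<epsilon> \<rhd> \<one>) \<cdot> (b \<rhd> \<one>) = (Y \<lhd> \<epsilon>) \<cdot> b"
    by (rule diagram0[where S = "[]"], (rule reads arrows | fact)+, simp add: run_simps)
  then show ?thesis by (simp add: unt_def dual_def)
qed

lemma left_arr_mul: "left_arr (Y \<otimes> Y) phi2 Y phi mul"
  using dual_left_arr[OF adjoint adjoint2 right_arr_comult] by (simp add: dual_transfer_XX phi_def mul_def)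

lemma left_arr_unt: "left_arr \<one> (Id C A) Y phi unt"
  using dual_left_arr[OF adjoint adjoint_unit right_arr_counit] by (simp add: dual_transfer_unit phi_def unt_def)

lemma left_obj_YY: "left_obj (Y \<otimes> Y) phi2"
  using left_arr_mul by (simp add: left_arr_def)

lemma mul_in_hom [arrows]: "mul \<in> hom C (Y \<otimes> Y) (Y \<otimes> A)"
  and mul_central: "(Y \<lhd> m) \<cdot> (mul \<rhd> A) \<cdot> ((Y \<lhd> phi) \<cdot> (phi \<rhd> Y)) = (Y \<lhd> m) \<cdot> (phi \<rhd> A) \<cdot> (A \<lhd> mul)"
  using left_arr_mul by (simp_all add: left_arr_def)

lemma unt_in_hom [arrows]: "unt \<in> hom C \<one> (Y \<otimes> A)"
  and unt_central: "(Y \<lhd> m) \<cdot> (unt \<rhd> A) = (Y \<lhd> m) \<cdot> (phi \<rhd> A) \<cdot> (A \<lhd> unt)"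
  using left_arr_unt by (simp_all add: left_arr_from_unit)

text \<open>Caps and cups are cancelled until the iterated \<open>\<delta>\<close> appears,
  coassociativity is applied, and they are created again for the other bracketing.\<close>

lemma mul_assoc: "(Y \<lhd> m) \<cdot> (mul \<rhd> A) \<cdot> ((Y \<lhd> phi) \<cdot> (mul \<rhd> Y)) = (Y \<lhd> m) \<cdot> (mul \<rhd> A) \<cdot> (Y \<lhd> mul)"
  by (rule diagram4[OF phi_eq mul_eq zigzag_X coassoc, where S = "[Apply 0 1 1, Apply 1 4 0, Left 3, Left 2,
      Left 1, Left 4, Left 3, Left 2, Left 5, Left 4, Left 3, Left 6, Left 5, Apply 2 4 2, Apply 1 0 0, Left 3,
      Left 2, Left 1, Left 0, Left 4, Left 3, Left 2, Left 1, Left 5, Left 4, Left 3, Apply 2 2 3, Left 4, Left 3,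
      Left 6, Left 5, Left 4, Undo 3 1 1, Right 3, Right 2, Right 4, Right 5, Undo 2 3 2, Right 4, Right 5, Right 6,
      Right 2, Right 3, Right 4, Right 5, Right 1, Right 2, Right 3, Right 4, Right 0, Right 1, Right 2, Right 3,
      Undo 1 4 0, Undo 1 0 1]"], (rule reads arrows | fact)+, simp add: run_simps)

text \<open>Transposition reverses the order of tensor factors, so the left unit law comes from the
  right counit law; for \<open>mul_unt_right\<close> it is the other way round.\<close>

lemma mul_unt_left: "(Y \<lhd> m) \<cdot> (mul \<rhd> A) \<cdot> ((Y \<lhd> phi) \<cdot> (unt \<rhd> Y)) = Y \<lhd> \<eta>"
  by (rule diagram6[OF unt_eq mul_eq zigzag_X phi_eq counit_right zigzag_Y, where S = "[Apply 0 0 0, Apply 1 3 0,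
      Left 2, Left 1, Left 0, Left 3, Left 2, Left 1, Left 4, Left 3, Apply 2 2 3, Apply 3 3 3, Left 5, Left 4,
      Apply 2 3 2, Left 4, Apply 4 1 1, Right 1, Apply 5 0 0]"], (rule reads arrows | fact)+, simp add: run_simps)

lemma mul_unt_right: "(Y \<lhd> m) \<cdot> (mul \<rhd> A) \<cdot> (Y \<lhd> unt) = Y \<lhd> \<eta>"
  by (rule diagram5[OF unt_eq mul_eq zigzag_X counit_left zigzag_Y, where S = "[Apply 0 0 1, Apply 1 2 0, Left 1,
      Left 0, Left 2, Left 1, Left 3, Left 2, Left 4, Apply 2 3 2, Left 2, Left 3, Apply 3 1 1, Right 1,
      Apply 4 0 0]"], (rule reads arrows | fact)+, simp add: run_simps)

abbreviation "\<M> \<equiv> dual_mult C A m \<eta> X \<psi> \<delta> Y b d"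
abbreviation "\<U> \<equiv> dual_unit C A m \<eta> X \<psi> \<epsilon> Y b d"
abbreviation "P3 \<equiv> frobenius_algebra T' (Y, dual_transfer C A X \<psi> Y b d) \<M> \<U>"

lemma dual_mult_eq: "\<M> = ((Y \<otimes> Y, phi2), mul, (Y, phi))"
  by (simp add: dual_mult_def mul_eq Let_def phi_def)

lemma dual_unit_eq: "\<U> = ((\<one>, Id C A), unt, (Y, phi))"
  by (simp add: dual_unit_def unt_eq phi_def)

lemma algebra_T': "algebra T' (Y, phi) \<M> \<U>"
proof -
  have "(\<one> \<lhd> phi) \<cdot> (Id C A \<rhd> Y) = phi" "(Y \<lhd> Id C A) \<cdot> (phi \<rhd> \<one>) = phi"
  proof -
    show "(\<one> \<lhd> phi) \<cdot> (Id C A \<rhd> Y) = phi"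
      by (rule diagram0[where S = "[]"], (rule reads arrows | fact)+, simp add: run_simps)
    show "(Y \<lhd> Id C A) \<cdot> (phi \<rhd> \<one>) = phi"
      by (rule diagram0[where S = "[]"], (rule reads arrows | fact)+, simp add: run_simps)
  qed
  moreover have "(Y \<otimes> Y \<lhd> phi) \<cdot> (((Y \<lhd> phi) \<cdot> (phi \<rhd> Y)) \<rhd> Y) = (Y \<lhd> ((Y \<lhd> phi) \<cdot> (phi \<rhd> Y))) \<cdot> (phi \<rhd> Y \<otimes> Y)"
    by (rule diagram0[where S = "[]"], (rule reads arrows | fact)+, simp add: run_simps)
  ultimately show ?thesis
    using mul_assoc mul_unt_left mul_unt_right left_obj_Y left_arr_mul left_arr_unt
    by (simp add: T'.algebra_iff dual_mult_eq dual_unit_eq left_transfer_hom left_transfer_whisker ten_assoc Y_in_Ob)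
qed

text \<open>The Frobenius conditions of \<open>(Y, phi)\<close> in \<open>T'\<close> for underlying
  arrows, in exactly the bracketing that the whiskerings of \<open>T'\<close> produce. The same
  predicate later describes the Frobenius systems of the bimodule algebra.\<close>

definition frobenius_system' :: "'a \<Rightarrow> 'a \<Rightarrow> bool" where
  "frobenius_system' \<theta> e \<longleftrightarrow> left_arr Y phi \<one> (Id C A) \<theta> \<and> left_arr \<one> (Id C A) (Y \<otimes> Y) phi2 e \<and>
     (Y \<otimes> Y \<lhd> m) \<cdot> ((Y \<lhd> mul) \<rhd> A) \<cdot> ((Y \<otimes> Y \<lhd> phi) \<cdot> (e \<rhd> Y)) =
     (Y \<otimes> Y \<lhd> m) \<cdot> (((Y \<lhd> phi) \<cdot> (mul \<rhd> Y)) \<rhd> A) \<cdot> (Y \<lhd> e) \<and>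
     (Y \<lhd> m) \<cdot> (((\<one> \<lhd> phi) \<cdot> (\<theta> \<rhd> Y)) \<rhd> A) \<cdot> e = unt \<and>
     (Y \<lhd> m) \<cdot> ((Y \<lhd> \<theta>) \<rhd> A) \<cdot> e = unt"

lemma P3_iff: "P3 \<longleftrightarrow> (\<exists>\<theta> e. frobenius_system' \<theta> e)"
proof -
  have hom: "F \<in> hom T' (Y, phi) \<one>\<^bsub>T'\<^esub> \<longleftrightarrow> (\<exists>\<theta>. F = ((Y, phi), \<theta>, (\<one>, Id C A)) \<and> left_arr Y phi \<one> (Id C A) \<theta>)"
    "F \<in> hom T' \<one>\<^bsub>T'\<^esub> ((Y, phi) \<otimes>\<^bsub>T'\<^esub> (Y, phi)) \<longleftrightarrow>
      (\<exists>e. F = ((\<one>, Id C A), e, (Y \<otimes> Y, phi2)) \<and> left_arr \<one> (Id C A) (Y \<otimes> Y) phi2 e)" for F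
    by (simp_all add: left_transfer_hom)
  have u1: "(\<one> \<lhd> phi) \<cdot> (Id C A \<rhd> Y) = phi"
    by (rule diagram0[where S = "[]"], (rule reads arrows | fact)+, simp add: run_simps)
  have u2: "(Y \<lhd> Id C A) \<cdot> (phi \<rhd> \<one>) = phi"
    by (rule diagram0[where S = "[]"], (rule reads arrows | fact)+, simp add: run_simps)
  have "(Y \<otimes> Y \<lhd> phi) \<cdot> (((Y \<lhd> phi) \<cdot> (phi \<rhd> Y)) \<rhd> Y) = (Y \<lhd> ((Y \<lhd> phi) \<cdot> (phi \<rhd> Y))) \<cdot> (phi \<rhd> Y \<otimes> Y)"
    by (rule diagram0[where S = "[]"], (rule reads arrows | fact)+, simp add: run_simps)
  then have *: "(((Y, phi) \<lhd>\<^bsub>T'\<^esub> \<M>) \<cdot>\<^bsub>T'\<^esub> (E \<rhd>\<^bsub>T'\<^esub> (Y, phi)) = (\<M> \<rhd>\<^bsub>T'\<^esub> (Y, phi)) \<cdot>\<^bsub>T'\<^esub> ((Y, phi) \<lhd>\<^bsub>T'\<^esub> E) \<and>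
      (F \<rhd>\<^bsub>T'\<^esub> (Y, phi)) \<cdot>\<^bsub>T'\<^esub> E = \<U> \<and> ((Y, phi) \<lhd>\<^bsub>T'\<^esub> F) \<cdot>\<^bsub>T'\<^esub> E = \<U>) \<longleftrightarrow> frobenius_system' \<theta> e"
    if "left_arr Y phi \<one> (Id C A) \<theta>" "left_arr \<one> (Id C A) (Y \<otimes> Y) phi2 e"
      "F = ((Y, phi), \<theta>, (\<one>, Id C A))" "E = ((\<one>, Id C A), e, (Y \<otimes> Y, phi2))" for \<theta> e F E
    using that u1 u2 left_obj_Y left_arr_mul
    by (simp add: frobenius_system'_def dual_mult_eq dual_unit_eq left_transfer_whisker ten_assoc Y_in_Ob)
  have la: "frobenius_system' \<theta> e \<Longrightarrow> left_arr Y phi \<one> (Id C A) \<theta> \<and> left_arr \<one> (Id C A) (Y \<otimes> Y) phi2 e" for \<theta> e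
    by (simp add: frobenius_system'_def)
  show ?thesis
    unfolding T'.frobenius_algebra_iff phi_def[symmetric] Bex_def hom
    using algebra_T' * la by metis
qed

text \<open>Each equation is the transpose of one on the other side, and transposition is injective
  by \<open>dual_inject\<close>. The two unit conditions change places because the order of factors
  is reversed.\<close>

lemma frobenius_system_dual:
  assumes t: "central_element t" and B: "central_form B"
    and theta: "\<theta> = dual \<one> (Id C \<one>) Y d t" and e: "e = dual (Y \<otimes> Y) bb \<one> (Id C \<one>) B"
  shows "frobenius_system' \<theta> e \<longleftrightarrow> casimir_form B \<and>
     m \<cdot> (A \<lhd> B) \<cdot> (t \<rhd> X) = \<epsilon> \<and> m \<cdot> (A \<lhd> B) \<cdot> ((\<psi> \<rhd> X) \<cdot> (X \<lhd> t)) = \<epsilon>"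
proof -
  have h: "t \<in> hom C \<one> (A \<otimes> X)" "B \<in> hom C (X \<otimes> X) A"
    and ct: "(m \<rhd> X) \<cdot> (A \<lhd> t) = (m \<rhd> X) \<cdot> (A \<lhd> \<psi>) \<cdot> (t \<rhd> A)"
    and cB: "m \<cdot> (A \<lhd> B) \<cdot> ((\<psi> \<rhd> X) \<cdot> (X \<lhd> \<psi>)) = m \<cdot> (B \<rhd> A)"
    using t B by (simp_all add: central_element_iff central_form_iff)
  have la: "left_arr Y phi \<one> (Id C A) \<theta>"
    using dual_left_arr[OF adjoint_unit adjoint, of "Id C A" \<psi> t] t
    by (simp add: theta central_element_def dual_transfer_unit phi_def)
  have lb: "left_arr \<one> (Id C A) (Y \<otimes> Y) phi2 e"
    using dual_left_arr[OF adjoint2 adjoint_unit, of \<psi>\<psi> "Id C A" B] B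
    by (simp add: e central_form_def dual_transfer_unit dual_transfer_XX)
  have th: "\<theta> \<in> hom C Y A" and eh: "e \<in> hom C \<one> (Y \<otimes> Y \<otimes> A)"
    using la lb by (simp_all add: left_arr_to_unit left_arr_from_unit ten_assoc Y_in_Ob A_in_Ob)
  have theta_eq: "\<theta> = (A \<lhd> d) \<cdot> (t \<rhd> Y)"
  proof -
    have "(\<one> \<otimes> A \<lhd> d) \<cdot> (\<one> \<lhd> t \<rhd> Y) \<cdot> (Id C \<one> \<rhd> Y) = (A \<lhd> d) \<cdot> (t \<rhd> Y)"
      by (rule diagram0[where S = "[]"], (rule reads arrows | fact)+, simp add: run_simps)
    then show ?thesis by (simp add: theta dual_def)
  qed
  have e_eq: "e = (Y \<otimes> Y \<lhd> B) \<cdot> ((Y \<lhd> b \<rhd> X) \<cdot> b)"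
  proof -
    have "((Y \<otimes> Y) \<otimes> A \<lhd> Id C \<one>) \<cdot> (Y \<otimes> Y \<lhd> B \<rhd> \<one>) \<cdot> (((Y \<lhd> b \<rhd> X) \<cdot> b) \<rhd> \<one>) = (Y \<otimes> Y \<lhd> B) \<cdot> ((Y \<lhd> b \<rhd> X) \<cdot> b)"
      by (rule diagram0[where S = "[]"], (rule reads arrows | fact)+, simp add: run_simps)
    then show ?thesis by (simp add: e dual_def)
  qed
  have "(Y \<otimes> Y \<lhd> m) \<cdot> ((Y \<lhd> mul) \<rhd> A) \<cdot> ((Y \<otimes> Y \<lhd> phi) \<cdot> (e \<rhd> Y)) =
     ((Y \<otimes> Y) \<otimes> A \<lhd> d) \<cdot> (Y \<otimes> Y \<lhd> ((m \<rhd> X) \<cdot> (A \<lhd> \<psi>) \<cdot> (A \<otimes> X \<lhd> B) \<cdot> (\<delta> \<rhd> X)) \<rhd> Y) \<cdot> (((Y \<lhd> b \<rhd> X) \<cdot> b) \<rhd> Y)"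
    by (rule diagram4[OF e_eq mul_eq zigzag_X phi_eq, where S = "[Apply 0 0 0, Apply 1 4 1, Left 3, Left 2, Left 1,
      Left 4, Left 3, Left 2, Left 5, Left 4, Apply 2 3 4, Apply 3 4 4, Left 6, Left 5, Apply 2 4 3, Left 5]"],
      (rule reads arrows | fact)+, simp add: run_simps)
  moreover have "(Y \<otimes> Y \<lhd> m) \<cdot> (((Y \<lhd> phi) \<cdot> (mul \<rhd> Y)) \<rhd> A) \<cdot> (Y \<lhd> e) =
     ((Y \<otimes> Y) \<otimes> A \<lhd> d) \<cdot> (Y \<otimes> Y \<lhd> ((m \<rhd> X) \<cdot> (A \<lhd> B \<rhd> X) \<cdot> (\<psi> \<rhd> X \<otimes> X) \<cdot> (X \<lhd> \<delta>)) \<rhd> Y) \<cdot> (((Y \<lhd> b \<rhd> X) \<cdot> b) \<rhd> Y)"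
    by (rule diagram4[OF e_eq phi_eq zigzag_X mul_eq, where S = "[Apply 0 0 1, Apply 1 4 1, Left 2, Left 1, Left 3,
      Left 2, Left 4, Left 3, Left 5, Apply 2 4 3, Apply 3 1 0, Left 0, Left 1, Left 2, Apply 2 3 2, Left 2, Left 1,
      Left 3, Left 4, Left 5]"], (rule reads arrows | fact)+, simp add: run_simps)
  moreover have "(m \<rhd> X) \<cdot> (A \<lhd> \<psi>) \<cdot> (A \<otimes> X \<lhd> B) \<cdot> (\<delta> \<rhd> X) \<in> hom C (X \<otimes> X) (A \<otimes> X)"
    by (rule in_hom, (rule reads arrows | fact)+)
  moreover have "(m \<rhd> X) \<cdot> (A \<lhd> B \<rhd> X) \<cdot> (\<psi> \<rhd> X \<otimes> X) \<cdot> (X \<lhd> \<delta>) \<in> hom C (X \<otimes> X) (A \<otimes> X)"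
    by (rule in_hom, (rule reads arrows | fact)+)
  ultimately have E1: "(Y \<otimes> Y \<lhd> m) \<cdot> ((Y \<lhd> mul) \<rhd> A) \<cdot> ((Y \<otimes> Y \<lhd> phi) \<cdot> (e \<rhd> Y)) =
     (Y \<otimes> Y \<lhd> m) \<cdot> (((Y \<lhd> phi) \<cdot> (mul \<rhd> Y)) \<rhd> A) \<cdot> (Y \<lhd> e) \<longleftrightarrow> casimir_form B"
    using dual_inject[OF adjoint2 adjoint] by (simp add: casimir_form_def dual_def)
  have "(Y \<lhd> m) \<cdot> (((\<one> \<lhd> phi) \<cdot> (\<theta> \<rhd> Y)) \<rhd> A) \<cdot> e =
      (Y \<otimes> A \<lhd> Id C \<one>) \<cdot> (Y \<lhd> (m \<cdot> (A \<lhd> B) \<cdot> ((\<psi> \<rhd> X) \<cdot> (X \<lhd> t))) \<rhd> \<one>) \<cdot> (b \<rhd> \<one>)"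
    by (rule diagram4[OF theta_eq e_eq zigzag_X phi_eq, where S = "[Apply 0 1 0, Apply 1 0 0, Left 2, Left 1,
      Left 0, Left 3, Left 2, Apply 2 1 1, Apply 3 3 0, Left 2, Left 1, Left 3, Left 2, Left 4, Apply 2 3 2,
      Left 0]"], (rule reads arrows | fact)+, simp add: run_simps)
  moreover have "m \<cdot> (A \<lhd> B) \<cdot> ((\<psi> \<rhd> X) \<cdot> (X \<lhd> t)) \<in> hom C X (A \<otimes> \<one>)"
    by (rule in_hom, (rule reads arrows | fact)+)
  moreover have eps: "\<epsilon> \<in> hom C X (A \<otimes> \<one>)"
    by (rule in_hom, (rule reads arrows | fact)+)
  ultimately have E2: "(Y \<lhd> m) \<cdot> (((\<one> \<lhd> phi) \<cdot> (\<theta> \<rhd> Y)) \<rhd> A) \<cdot> e = unt \<longleftrightarrow> m \<cdot> (A \<lhd> B) \<cdot> ((\<psi> \<rhd> X) \<cdot> (X \<lhd> t)) = \<epsilon>"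
    using dual_inject[OF adjoint adjoint_unit] by (simp add: dual_def unt_def)
  have "(Y \<lhd> m) \<cdot> ((Y \<lhd> \<theta>) \<rhd> A) \<cdot> e =
      (Y \<otimes> A \<lhd> Id C \<one>) \<cdot> (Y \<lhd> (m \<cdot> (A \<lhd> B) \<cdot> (t \<rhd> X)) \<rhd> \<one>) \<cdot> (b \<rhd> \<one>)"
    by (rule diagram3[OF theta_eq e_eq zigzag_X, where S = "[Apply 0 1 1, Apply 1 0 0, Left 2, Left 1, Left 3,
      Apply 2 2 2]"], (rule reads arrows | fact)+, simp add: run_simps)
  moreover have "m \<cdot> (A \<lhd> B) \<cdot> (t \<rhd> X) \<in> hom C X (A \<otimes> \<one>)"
    by (rule in_hom, (rule reads arrows | fact)+)
  ultimately have E3: "(Y \<lhd> m) \<cdot> ((Y \<lhd> \<theta>) \<rhd> A) \<cdot> e = unt \<longleftrightarrow> m \<cdot> (A \<lhd> B) \<cdot> (t \<rhd> X) = \<epsilon>"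
    using dual_inject[OF adjoint adjoint_unit _ eps] by (simp add: dual_def unt_def)
  show ?thesis
    using la lb by (auto simp: frobenius_system'_def E1 E2 E3)
qed

lemma P1_iff_P3: "P1 \<longleftrightarrow> P3"
proof
  assume "P1"
  then show "P3" unfolding P1_iff_frobenius_system P3_iff using frobenius_system_dual by blast
next
  assume "P3"
  then obtain \<theta> e where fs: "frobenius_system' \<theta> e" unfolding P3_iff by blast
  then have la: "left_arr Y phi \<one> (Id C A) \<theta>" "left_arr \<one> (Id C A) (Y \<otimes> Y) phi2 e"
    by (simp_all add: frobenius_system'_def)
  define t where "t = undual \<one> (Id C \<one>) X b \<theta>"
  define B where "B = undual (X \<otimes> X) dd \<one> (Id C \<one>) e"
  have "central_element t"
    using undual_right_arr[OF adjoint_unit adjoint right_unit_obj right_obj_X] la(1)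
    by (simp add: central_element_def t_def dual_transfer_unit phi_def)
  moreover have "central_form B"
    using undual_right_arr[OF adjoint2 adjoint_unit right_obj_XX right_unit_obj] la(2)
    by (simp add: central_form_def B_def dual_transfer_unit dual_transfer_XX)
  moreover have "\<theta> = dual \<one> (Id C \<one>) Y d t"
    using dual_undual[OF adjoint_unit adjoint, of \<theta>] la(1) by (simp add: t_def left_arr_def)
  moreover have "e = dual (Y \<otimes> Y) bb \<one> (Id C \<one>) B"
    using dual_undual[OF adjoint2 adjoint_unit, of e] la(2) by (simp add: B_def left_arr_def)
  ultimately show "P1"
    using fs frobenius_system_dual unfolding P1_iff_frobenius_system by blast
qed

section \<open>The wreath product as an algebra in \<open>C\<close>\<close>

definition wr :: 'a where
  "wr = wreath_mult C A m X \<psi> \<delta> Y b d"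

definition ext :: 'a where
  "ext = wreath_extension C A m \<epsilon> Y b"

lemma wreath_unit_eq: "wreath_unit C \<epsilon> Y b = unt"
  by (simp add: wreath_unit_def unt_eq)

lemma ext_eq: "ext = (Y \<lhd> m) \<cdot> (unt \<rhd> A)"
  by (simp add: ext_def wreath_extension_def wreath_unit_eq)

lemma ext_in_hom [arrows]: "ext \<in> hom C A (Y \<otimes> A)"
  unfolding ext_eq by (rule in_hom, (rule reads arrows | fact)+)

text \<open>The scalars in the middle are first moved past the second \<open>Y\<close>, and then the
  two factors in \<open>Y\<close> are multiplied. In this form \<open>b\<close> and \<open>d\<close>
  are hidden inside \<open>mul\<close> and \<open>nu\<close>, and the algebra laws follow from those
  of \<open>mul\<close> and \<open>phi\<close>.\<close>

lemma wr_eq: "wr = (Y \<lhd> m) \<cdot> (mul \<rhd> A) \<cdot> (Y \<lhd> nu)"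
proof -
  have "(Y \<lhd> m) \<cdot> (Y \<lhd> m \<rhd> A) \<cdot> (Y \<otimes> A \<otimes> A \<lhd> d \<rhd> A) \<cdot> (Y \<otimes> A \<lhd> \<psi> \<rhd> Y \<otimes> A) \<cdot>
     (Y \<otimes> A \<otimes> X \<lhd> d \<rhd> A \<otimes> Y \<otimes> A) \<cdot> (Y \<lhd> \<delta> \<rhd> Y \<otimes> A \<otimes> Y \<otimes> A) \<cdot> (b \<rhd> Y \<otimes> A \<otimes> Y \<otimes> A) =
    (Y \<lhd> m) \<cdot> (mul \<rhd> A) \<cdot> (Y \<lhd> nu)"
    by (rule diagram5[OF m_assoc zigzag_X mul_eq phi_eq nu_def, where S = "[Apply 0 5 1, Undo 1 3 2, Right 4,
      Right 5, Right 6, Right 2, Right 3, Right 4, Right 5, Right 1, Right 2, Right 3, Right 4, Right 0, Right 1,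
      Right 2, Right 3, Undo 2 4 0, Undo 3 0 1, Undo 4 0 1]"], (rule reads arrows | fact)+, simp add: run_simps)
  then show ?thesis by (simp add: wr_def wreath_mult_def)
qed

lemma wr_in_hom [arrows]: "wr \<in> hom C ((Y \<otimes> A) \<otimes> Y \<otimes> A) (Y \<otimes> A)"
  unfolding wr_eq by (rule in_hom, (rule reads arrows | fact)+)

lemma nu_left_module: "nu \<cdot> (A \<lhd> nu) = nu \<cdot> (m \<rhd> Y \<otimes> A)" "nu \<cdot> (\<eta> \<rhd> Y \<otimes> A) = Id C (Y \<otimes> A)"
proof -
  show "nu \<cdot> (A \<lhd> nu) = nu \<cdot> (m \<rhd> Y \<otimes> A)"
    by (rule diagram3[OF nu_def m_assoc phi_m, where S = "[Apply 0 0 1, Apply 0 2 0, Left 1, Undo 1 2 1, Undo 2 0 0,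
      Undo 0 1 0]"], (rule reads arrows | fact)+, simp add: run_simps)
  show "nu \<cdot> (\<eta> \<rhd> Y \<otimes> A) = Id C (Y \<otimes> A)"
    by (rule diagram3[OF nu_def phi_eta m_unit_left, where S = "[Apply 0 1 0, Apply 1 0 0, Apply 2 0 1]"],
      (rule reads arrows | fact)+, simp add: run_simps)
qed

lemma nu_right_linear: "nu \<cdot> (A \<otimes> Y \<lhd> m) = (Y \<lhd> m) \<cdot> (nu \<rhd> A)"
  by (rule diagram2[OF nu_def m_assoc, where S = "[Apply 0 1 0, Left 0, Undo 1 1 1, Undo 0 0 0]"],
      (rule reads arrows | fact)+, simp add: run_simps)

lemma wr_nu: "wr \<cdot> (nu \<rhd> Y \<otimes> A) = nu \<cdot> (A \<lhd> wr)"
  by (rule diagram5[OF nu_def wr_eq phi_m m_assoc mul_central, where S = "[Apply 0 0 0, Apply 1 2 0, Apply 0 2 1,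
      Apply 2 1 1, Apply 3 3 2, Right 2, Undo 0 1 2, Right 0, Left 3, Undo 3 4 1, Apply 4 1 0, Apply 3 3 1, Right 2,
      Undo 1 0 1, Undo 0 1 0]"], (rule reads arrows | fact)+, simp add: run_simps)

text \<open>The product \<open>mul\<close> leaves a scalar behind, which has to be moved past the
  next factor in \<open>Y\<close>: \<open>mul_assoc\<close> takes this into account, and
  \<open>mul_central\<close> carries the remaining scalars across a product.\<close>

lemma wr_assoc: "wr \<cdot> (wr \<rhd> Y \<otimes> A) = wr \<cdot> (Y \<otimes> A \<lhd> wr)"
  by (rule diagram6[OF wr_eq nu_def phi_m m_assoc mul_assoc mul_central, where S = "[Apply 0 1 0, Apply 1 1 1,
      Apply 0 0 0, Apply 2 2 1, Apply 3 4 2, Right 3, Undo 1 4 1, Undo 0 4 0, Apply 1 0 1, Left 1, Apply 2 2 2,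
      Apply 3 4 3, Right 3, Undo 1 2 3, Right 1, Right 0, Right 2, Right 3, Undo 1 2 2, Apply 0 4 0, Apply 1 4 1,
      Left 5, Undo 3 6 1, Apply 4 3 0, Apply 3 5 1, Right 4, Apply 1 2 2, Left 3, Undo 3 4 2, Apply 5 1 1,
      Apply 3 3 2, Right 2, Undo 0 0 2, Undo 1 1 1, Undo 0 1 0]"], (rule reads arrows | fact)+, simp add: run_simps)

lemma wr_unit_left: "wr \<cdot> (unt \<rhd> Y \<otimes> A) = Id C (Y \<otimes> A)"
  by (rule diagram5[OF wr_eq nu_def m_assoc mul_unt_left m_unit_left, where S = "[Apply 0 1 0, Apply 1 1 1,
      Left 2, Undo 2 3 1, Apply 3 0 0, Apply 4 0 1]"], (rule reads arrows | fact)+, simp add: run_simps)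

lemma wr_unit_right: "wr \<cdot> (Y \<otimes> A \<lhd> unt) = Id C (Y \<otimes> A)"
  by (rule diagram6[OF wr_eq nu_def unt_central m_assoc mul_unt_right m_unit_left, where S = "[Apply 0 1 0,
      Apply 1 1 1, Undo 2 0 1, Left 1, Undo 3 2 1, Apply 4 0 0, Apply 5 0 1]"], (rule reads arrows | fact)+,
      simp add: run_simps)

text \<open>Restriction along \<open>ext\<close> gives \<open>nu\<close> on the left and, by
  \<open>wr_ext_right\<close>, the free action on the right; together they identify the bimodule
  underlying the \<open>A\<close>-ring.\<close>

lemma wr_ext_left: "wr \<cdot> (ext \<rhd> Y \<otimes> A) = nu"
  by (rule diagram7[OF wr_eq nu_def m_assoc ext_eq phi_m mul_unt_left m_unit_left, where S = "[Apply 0 1 0,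
      Apply 1 1 1, Left 2, Undo 2 3 1, Apply 3 0 0, Apply 4 1 1, Left 3, Undo 2 4 1, Right 0, Apply 5 1 0,
      Apply 6 1 1, Undo 1 0 0]"], (rule reads arrows | fact)+, simp add: run_simps)

lemma wr_ext_right: "wr \<cdot> (Y \<otimes> A \<lhd> ext) = Y \<lhd> m"
  by (rule diagram7[OF ext_eq wr_eq nu_def m_assoc unt_central mul_unt_right m_unit_left, where S = "[Apply 0 0 2,
      Apply 1 2 0, Apply 2 2 1, Left 1, Undo 3 2 2, Undo 4 0 1, Apply 3 1 2, Left 2, Undo 3 3 1, Right 0, Apply 5 1 0,
      Apply 6 1 1]"], (rule reads arrows | fact)+, simp add: run_simps)

lemma algebra_wreath: "algebra C (Y \<otimes> A) wr unt"
  using wr_assoc wr_unit_left wr_unit_right wr_in_hom unt_in_hom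
  by (simp add: algebra_iff Y_in_Ob A_in_Ob)

lemma algebra_morphism_ext: "algebra_morphism C A m \<eta> (Y \<otimes> A) wr unt ext"
proof -
  have "ext \<cdot> m = wr \<cdot> (ext \<boxtimes> ext)"
    by (rule diagram3[OF ext_eq m_assoc wr_ext_right, where S = "[Apply 0 1 0, Left 0, Undo 1 1 1, Undo 0 0 0,
      Undo 2 1 0]"], (rule reads arrows | fact)+, simp add: run_simps)
  moreover have "ext \<cdot> \<eta> = unt"
    by (rule diagram2[OF ext_eq m_unit_right, where S = "[Apply 0 1 0, Left 0, Apply 1 1 1]"],
      (rule reads arrows | fact)+, simp add: run_simps)
  ultimately show ?thesis by (simp add: algebra_morphism_def ext_in_hom)
qed

section \<open>Entwined modules\<close>

abbreviation "entwined \<equiv> entwined_module C A m \<eta> X \<psi> \<delta> \<epsilon>"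

text \<open>Right multiplication by the canonical element \<open>b\<close>, that is, the coaction
  that belongs to the regular module structure; see \<open>YA_entwined_eq\<close>.\<close>

definition rho :: 'a where
  "rho = (((Y \<lhd> m) \<cdot> (mul \<rhd> A) \<cdot> (Y \<lhd> phi)) \<rhd> X) \<cdot> (Y \<otimes> A \<lhd> b)"

lemma rho_in_hom [arrows]: "rho \<in> hom C (Y \<otimes> A) ((Y \<otimes> A) \<otimes> X)"
  unfolding rho_def by (rule in_hom, (rule reads arrows | fact)+)

lemma YA_entwined_eq: "YA_entwined C A m \<eta> X \<psi> \<delta> \<epsilon> Y b d = (Y \<otimes> A, Y \<lhd> m, rho)"
proof -
  have "wr \<cdot> ((Y \<otimes> A) \<otimes> Y \<lhd> m) \<cdot> ((Y \<otimes> A) \<otimes> Y \<lhd> \<epsilon> \<rhd> A) \<cdot> (Y \<otimes> A \<lhd> b \<rhd> A) = Y \<lhd> m"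
    by (rule diagram3[OF unt_eq ext_eq wr_ext_right, where S = "[Undo 0 0 2, Undo 1 0 2, Apply 2 0 0]"],
      (rule reads arrows | fact)+, simp add: run_simps)
  moreover have "(wr \<rhd> X) \<cdot> ((Y \<otimes> A) \<otimes> Y \<lhd> \<eta> \<rhd> X) \<cdot> (Y \<otimes> A \<lhd> b) = rho"
    by (rule diagram4[OF wr_eq nu_def m_unit_right rho_def, where S = "[Apply 0 2 0, Apply 1 2 1, Left 1,
      Apply 2 2 2, Undo 3 0 0]"], (rule reads arrows | fact)+, simp add: run_simps)
  ultimately show ?thesis
    by (simp add: YA_entwined_def wreath_to_entwined_def wr_def[symmetric])
qed

text \<open>The coaction after pairing with \<open>X\<close>: the product \<open>mul\<close> inside
  \<open>rho\<close> unfolds to \<open>\<delta>\<close>. It serves to compare colinearity with the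
  Casimir law.\<close>

lemma d_rho: "(d \<rhd> A \<otimes> X) \<cdot> (X \<lhd> rho) = (m \<rhd> X) \<cdot> (A \<lhd> \<psi>) \<cdot> (A \<otimes> X \<lhd> d \<rhd> A) \<cdot> (\<delta> \<rhd> Y \<otimes> A)"
  by (rule diagram4[OF rho_def phi_eq zigzag_X mul_eq, where S = "[Apply 0 0 1, Apply 1 1 2, Left 0, Left 1,
      Apply 2 2 4, Apply 3 2 1, Left 1, Left 0, Left 2, Left 1, Left 3, Left 2, Left 4, Apply 2 3 3, Left 4, Left 3,
      Left 2, Left 1, Apply 2 0 0]"], (rule reads arrows | fact)+, simp add: run_simps)

text \<open>The action induced by \<open>rho\<close> is the regular one, so the general comparison
  of linearity and colinearity applies to \<open>Y A\<close>.\<close>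

lemma wr_rho: "wr = (Y \<lhd> m) \<cdot> (Y \<otimes> A \<lhd> d \<rhd> A) \<cdot> (rho \<rhd> Y \<otimes> A)"
  by (rule diagram5[OF wr_eq nu_def m_assoc zigzag_Y rho_def, where S = "[Apply 0 0 0, Apply 1 0 1, Left 1,
      Undo 2 2 1, Undo 3 0 2, Left 1, Left 2, Left 3, Undo 4 0 0]"], (rule reads arrows | fact)+, simp add: run_simps)

lemma entwined_module_YA: "entwined (Y \<otimes> A) (Y \<lhd> m) rho"
proof -
  have "(Y \<lhd> m) \<cdot> ((Y \<lhd> m) \<rhd> A) = (Y \<lhd> m) \<cdot> (Y \<otimes> A \<lhd> m)"
    by (rule diagram1[OF m_assoc, where S = "[Apply 0 0 1]"], (rule reads arrows | fact)+, simp add: run_simps)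
  moreover have "(Y \<lhd> m) \<cdot> (Y \<otimes> A \<lhd> \<eta>) = Id C (Y \<otimes> A)"
    by (rule diagram1[OF m_unit_right, where S = "[Apply 0 0 1]"], (rule reads arrows | fact)+, simp add: run_simps)
  moreover have "Y \<lhd> m \<in> hom C ((Y \<otimes> A) \<otimes> A) (Y \<otimes> A)"
    by (rule in_hom, (rule reads arrows | fact)+)
  moreover have "rho \<cdot> (Y \<lhd> m) = ((Y \<lhd> m) \<rhd> X) \<cdot> (Y \<otimes> A \<lhd> \<psi>) \<cdot> (rho \<rhd> A)"
    by (rule diagram5[OF rho_def phi_m phi_eq zigzag_X m_assoc, where S = "[Apply 0 1 0, Right 0, Apply 1 1 1,
      Apply 2 1 2, Left 0, Left 3, Left 2, Left 1, Left 5, Left 4, Left 3, Left 2, Left 3, Apply 3 4 4, Undo 4 4 1,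
      Left 3, Undo 0 0 0]"], (rule reads arrows | fact)+, simp add: run_simps)
  moreover have "(rho \<rhd> X) \<cdot> rho = ((Y \<lhd> m) \<rhd> X \<otimes> X) \<cdot> (Y \<otimes> A \<lhd> \<delta>) \<cdot> rho"
  proof -
    have "(rho \<rhd> X) \<cdot> rho = (((Y \<lhd> m) \<cdot> (mul \<rhd> A) \<cdot> (Y \<lhd> phi)) \<rhd> X \<otimes> X) \<cdot> (Y \<otimes> A \<lhd> b \<rhd> X) \<cdot> rho"
      by (rule diagram1[OF rho_def, where S = "[Apply 0 1 0]"], (rule reads arrows | fact)+, simp add: run_simps)
    moreover have "(((Y \<lhd> m) \<cdot> (mul \<rhd> A) \<cdot> (Y \<lhd> phi)) \<rhd> X \<otimes> X) \<cdot> (Y \<otimes> A \<lhd> b \<rhd> X) \<cdot> rho =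
        ((Y \<lhd> m) \<rhd> X \<otimes> X) \<cdot> (((Y \<lhd> m) \<cdot> (mul \<rhd> A) \<cdot> (Y \<lhd> phi)) \<rhd> A \<otimes> X \<otimes> X) \<cdot>
        (Y \<otimes> A \<lhd> mul \<rhd> X \<otimes> X) \<cdot> (Y \<otimes> A \<lhd> ((Y \<lhd> b \<rhd> X) \<cdot> b))"
      by (rule diagram5[OF rho_def phi_m m_assoc mul_assoc mul_central, where S = "[Apply 0 0 0, Right 3, Apply 1 4 1,
      Left 6, Undo 2 7 1, Right 2, Right 1, Right 3, Apply 3 4 0, Apply 2 6 1, Right 5, Apply 4 2 1, Left 4,
      Undo 2 5 1]"], (rule reads arrows | fact)+, simp add: run_simps)
    moreover have "((Y \<lhd> m) \<rhd> X \<otimes> X) \<cdot> (((Y \<lhd> m) \<cdot> (mul \<rhd> A) \<cdot> (Y \<lhd> phi)) \<rhd> A \<otimes> X \<otimes> X) \<cdot>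
        (Y \<otimes> A \<lhd> mul \<rhd> X \<otimes> X) \<cdot> (Y \<otimes> A \<lhd> ((Y \<lhd> b \<rhd> X) \<cdot> b)) =
        ((Y \<lhd> m) \<rhd> X \<otimes> X) \<cdot> (Y \<otimes> A \<lhd> \<delta>) \<cdot> rho"
    proof -
      \<comment> \<open>Multiplying the two legs in \<open>Y\<close> of the nested canonical element
        is the same as applying \<open>\<delta>\<close> to its leg in \<open>X\<close>: the
        characteristic property of a transpose.\<close>
      have mul_bb: "(mul \<rhd> X \<otimes> X) \<cdot> ((Y \<lhd> b \<rhd> X) \<cdot> b) = (Y \<lhd> \<delta>) \<cdot> b"
        by (rule diagram2[OF mul_eq zigzag_X, where S = "[Apply 0 2 0, Left 1, Left 0, Left 2, Left 1, Left 3,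
      Apply 1 2 3, Apply 1 2 2]"], (rule reads arrows | fact)+, simp add: run_simps)
      show "((Y \<lhd> m) \<rhd> X \<otimes> X) \<cdot> (((Y \<lhd> m) \<cdot> (mul \<rhd> A) \<cdot> (Y \<lhd> phi)) \<rhd> A \<otimes> X \<otimes> X) \<cdot>
        (Y \<otimes> A \<lhd> mul \<rhd> X \<otimes> X) \<cdot> (Y \<otimes> A \<lhd> ((Y \<lhd> b \<rhd> X) \<cdot> b)) =
        ((Y \<lhd> m) \<rhd> X \<otimes> X) \<cdot> (Y \<otimes> A \<lhd> \<delta>) \<cdot> rho"
        by (rule diagram2[OF mul_bb rho_def, where S = "[Apply 0 0 2, Left 1, Left 2, Left 3, Undo 1 0 0]"],
      (rule reads arrows | fact)+, simp add: run_simps)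
    qed
    ultimately show ?thesis by simp
  qed
  moreover have "(Y \<lhd> m) \<cdot> (Y \<otimes> A \<lhd> \<epsilon>) \<cdot> rho = Id C (Y \<otimes> A)"
    by (rule diagram6[OF rho_def m_assoc nu_def wr_eq unt_eq wr_unit_right, where S = "[Apply 0 0 0, Right 3,
      Apply 1 4 1, Right 2, Right 1, Right 3, Undo 2 2 1, Undo 3 2 0, Undo 4 0 2, Apply 5 0 0]"],
      (rule reads arrows | fact)+, simp add: run_simps)
  ultimately show ?thesis
    using rho_in_hom ten_in_Ob[OF Y_in_Ob A_in_Ob] unfolding entwined_module_def right_module_def by blast
qed

abbreviation "mu_AX \<equiv> (m \<rhd> X) \<cdot> (A \<lhd> \<psi>)"
abbreviation "rho_AX \<equiv> (m \<rhd> X \<otimes> X) \<cdot> (A \<lhd> \<delta>)"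

text \<open>For \<open>M = A\<close> this is the entwined module \<open>A X\<close>; in general it
  is the value at \<open>M\<close> of the right adjoint of the forgetful functor.\<close>

lemma entwined_module_cofree:
  assumes "right_module C A m \<eta> M \<mu>"
  shows "entwined (M \<otimes> X) ((\<mu> \<rhd> X) \<cdot> (M \<lhd> \<psi>)) ((\<mu> \<rhd> X \<otimes> X) \<cdot> (M \<lhd> \<delta>))"
proof -
  have ob: "M \<in> Ob C" and h: "\<mu> \<in> hom C (M \<otimes> A) M"
    and mu_assoc: "\<mu> \<cdot> (\<mu> \<rhd> A) = \<mu> \<cdot> (M \<lhd> m)" and mu_unit: "\<mu> \<cdot> (M \<lhd> \<eta>) = Id C M"
    using right_moduleD[OF assms] by simp_all
  have "(\<mu> \<rhd> X) \<cdot> (M \<lhd> \<psi>) \<cdot> (((\<mu> \<rhd> X) \<cdot> (M \<lhd> \<psi>)) \<rhd> A) = (\<mu> \<rhd> X) \<cdot> (M \<lhd> \<psi>) \<cdot> (M \<otimes> X \<lhd> m)"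
    by (rule diagram2[OF mu_assoc psi_m, where S = "[Right 1, Apply 0 2 0, Undo 1 0 1]"],
      (rule reads arrows | fact)+, simp add: run_simps)
  moreover have "(\<mu> \<rhd> X) \<cdot> (M \<lhd> \<psi>) \<cdot> (M \<otimes> X \<lhd> \<eta>) = Id C (M \<otimes> X)"
    by (rule diagram2[OF psi_eta mu_unit, where S = "[Apply 0 0 1, Apply 1 0 0]"], (rule reads arrows | fact)+,
      simp add: run_simps)
  moreover have "(\<mu> \<rhd> X) \<cdot> (M \<lhd> \<psi>) \<in> hom C ((M \<otimes> X) \<otimes> A) (M \<otimes> X)"
    by (rule in_hom, (rule reads arrows | fact)+)
  moreover have "(\<mu> \<rhd> X \<otimes> X) \<cdot> (M \<lhd> \<delta>) \<in> hom C (M \<otimes> X) ((M \<otimes> X) \<otimes> X)"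
    by (rule in_hom, (rule reads arrows | fact)+)
  moreover have "(\<mu> \<rhd> X \<otimes> X) \<cdot> (M \<lhd> \<delta>) \<cdot> ((\<mu> \<rhd> X) \<cdot> (M \<lhd> \<psi>)) =
      (((\<mu> \<rhd> X) \<cdot> (M \<lhd> \<psi>)) \<rhd> X) \<cdot> (M \<otimes> X \<lhd> \<psi>) \<cdot> (((\<mu> \<rhd> X \<otimes> X) \<cdot> (M \<lhd> \<delta>)) \<rhd> A)"
    by (rule diagram2[OF mu_assoc delta_central, where S = "[Right 1, Apply 0 2 0, Apply 1 0 1, Undo 0 3 0, Left 2,
      Left 1]"], (rule reads arrows | fact)+, simp add: run_simps)
  moreover have "(((\<mu> \<rhd> X \<otimes> X) \<cdot> (M \<lhd> \<delta>)) \<rhd> X) \<cdot> ((\<mu> \<rhd> X \<otimes> X) \<cdot> (M \<lhd> \<delta>)) =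
      (((\<mu> \<rhd> X) \<cdot> (M \<lhd> \<psi>)) \<rhd> X \<otimes> X) \<cdot> (M \<otimes> X \<lhd> \<delta>) \<cdot> ((\<mu> \<rhd> X \<otimes> X) \<cdot> (M \<lhd> \<delta>))"
    by (rule diagram2[OF mu_assoc coassoc, where S = "[Right 1, Apply 0 2 0, Apply 1 0 1, Undo 0 3 0, Left 2,
      Left 1]"], (rule reads arrows | fact)+, simp add: run_simps)
  moreover have "(\<mu> \<rhd> X) \<cdot> (M \<lhd> \<psi>) \<cdot> (M \<otimes> X \<lhd> \<epsilon>) \<cdot> ((\<mu> \<rhd> X \<otimes> X) \<cdot> (M \<lhd> \<delta>)) = Id C (M \<otimes> X)"
    by (rule diagram3[OF mu_assoc counit_right mu_unit, where S = "[Right 1, Right 2, Apply 0 3 0, Apply 1 0 1,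
      Apply 2 0 0]"], (rule reads arrows | fact)+, simp add: run_simps)
  ultimately show ?thesis
    using ten_in_Ob[OF ob X_in_Ob] unfolding entwined_module_def right_module_def by blast
qed

lemma entwined_module_AX: "entwined (A \<otimes> X) mu_AX rho_AX"
  by (rule entwined_module_cofree[OF right_module_A])

lemma AX_entwined_eq: "AX_entwined C A m X \<psi> \<delta> = (A \<otimes> X, mu_AX, rho_AX)"
  by (simp add: AX_entwined_def)

lemma entwined_moduleD:
  assumes "entwined M \<mu> \<rho>"
  shows "M \<in> Ob C" "\<mu> \<in> hom C (M \<otimes> A) M" "\<rho> \<in> hom C M (M \<otimes> X)"
    "\<mu> \<cdot> (\<mu> \<rhd> A) = \<mu> \<cdot> (M \<lhd> m)" "\<mu> \<cdot> (M \<lhd> \<eta>) = Id C M"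
    "\<rho> \<cdot> \<mu> = (\<mu> \<rhd> X) \<cdot> (M \<lhd> \<psi>) \<cdot> (\<rho> \<rhd> A)"
    "(\<rho> \<rhd> X) \<cdot> \<rho> = (\<mu> \<rhd> X \<otimes> X) \<cdot> (M \<lhd> \<delta>) \<cdot> \<rho>" "\<mu> \<cdot> (M \<lhd> \<epsilon>) \<cdot> \<rho> = Id C M"
  using assms by (simp_all add: entwined_module_def right_module_def)

text \<open>The counit axiom of the coaction gives the unit law of the action; associativity
  combines \<open>rho_mu\<close>, \<open>mu_assoc\<close> and \<open>rho_rho\<close>, since a
  product in \<open>Y A\<close> unfolds to \<open>\<delta>\<close> and
  \<open>\<psi>\<close>.\<close>

lemma entwined_to_wreath_module:
  assumes "entwined M \<mu> \<rho>"
  shows "right_module C (Y \<otimes> A) wr unt M (\<mu> \<cdot> (M \<lhd> d \<rhd> A) \<cdot> (\<rho> \<rhd> Y \<otimes> A))"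
proof -
  have h: "M \<in> Ob C" "\<mu> \<in> hom C (M \<otimes> A) M" "\<rho> \<in> hom C M (M \<otimes> X)"
    and mu_assoc: "\<mu> \<cdot> (\<mu> \<rhd> A) = \<mu> \<cdot> (M \<lhd> m)"
    and rho_mu: "\<rho> \<cdot> \<mu> = (\<mu> \<rhd> X) \<cdot> (M \<lhd> \<psi>) \<cdot> (\<rho> \<rhd> A)"
    and rho_rho: "(\<rho> \<rhd> X) \<cdot> \<rho> = (\<mu> \<rhd> X \<otimes> X) \<cdot> (M \<lhd> \<delta>) \<cdot> \<rho>"
    and mu_eps: "\<mu> \<cdot> (M \<lhd> \<epsilon>) \<cdot> \<rho> = Id C M"
    using entwined_moduleD[OF assms] by simp_all
  have "\<mu> \<cdot> (M \<lhd> d \<rhd> A) \<cdot> (\<rho> \<rhd> Y \<otimes> A) \<cdot> ((\<mu> \<cdot> (M \<lhd> d \<rhd> A) \<cdot> (\<rho> \<rhd> Y \<otimes> A)) \<rhd> Y \<otimes> A) =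
      \<mu> \<cdot> (M \<lhd> d \<rhd> A) \<cdot> (\<rho> \<rhd> Y \<otimes> A) \<cdot> (M \<lhd> wr)"
    by (rule diagram8[OF rho_mu mu_assoc rho_rho zigzag_X phi_eq nu_def mul_eq wr_eq, where S = "[Apply 0 2 0,
      Right 4, Apply 1 5 0, Left 1, Apply 2 0 0, Right 2, Right 3, Right 4, Right 5, Apply 1 6 0, Undo 3 3 2, Right 4,
      Right 5, Right 6, Right 2, Right 3, Right 4, Right 5, Right 1, Right 2, Right 3, Right 4, Right 0, Right 1,
      Right 2, Right 3, Undo 4 0 2, Undo 5 0 2, Undo 3 2 1, Right 3, Right 4, Right 5, Right 6, Right 1, Right 2,
      Right 3, Right 4, Right 5, Undo 6 1 1, Undo 7 0 1]"], (rule reads arrows | fact)+, simp add: run_simps)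
  moreover have "\<mu> \<cdot> (M \<lhd> d \<rhd> A) \<cdot> (\<rho> \<rhd> Y \<otimes> A) \<cdot> (M \<lhd> unt) = Id C M"
    by (rule diagram3[OF unt_eq zigzag_X mu_eps, where S = "[Apply 0 0 1, Left 1, Left 0, Left 2, Apply 1 1 1,
      Apply 2 0 0]"], (rule reads arrows | fact)+, simp add: run_simps)
  moreover have "\<mu> \<cdot> (M \<lhd> d \<rhd> A) \<cdot> (\<rho> \<rhd> Y \<otimes> A) \<in> hom C (M \<otimes> Y \<otimes> A) M"
    by (rule in_hom, (rule reads arrows | fact)+)
  ultimately show ?thesis using h by (simp add: right_module_def)
qed

text \<open>No information is lost: restriction along \<open>ext\<close> returns
  \<open>\<mu>\<close>, and acting with the canonical element returns \<open>\<rho>\<close>. This is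
  what makes linearity over the wreath product imply both linearity over \<open>A\<close> and
  colinearity.\<close>

lemma entwined_to_wreath_restrict:
  assumes "entwined M \<mu> \<rho>"
  shows "\<mu> = (\<mu> \<cdot> (M \<lhd> d \<rhd> A) \<cdot> (\<rho> \<rhd> Y \<otimes> A)) \<cdot> (M \<lhd> ext)"
    "\<rho> = ((\<mu> \<cdot> (M \<lhd> d \<rhd> A) \<cdot> (\<rho> \<rhd> Y \<otimes> A)) \<rhd> X) \<cdot> (M \<otimes> Y \<lhd> \<eta> \<rhd> X) \<cdot> (M \<lhd> b)"
proof -
  have h: "M \<in> Ob C" "\<mu> \<in> hom C (M \<otimes> A) M" "\<rho> \<in> hom C M (M \<otimes> X)"
    and mu_assoc: "\<mu> \<cdot> (\<mu> \<rhd> A) = \<mu> \<cdot> (M \<lhd> m)"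
    and mu_unit: "\<mu> \<cdot> (M \<lhd> \<eta>) = Id C M"
    and mu_eps: "\<mu> \<cdot> (M \<lhd> \<epsilon>) \<cdot> \<rho> = Id C M"
    using entwined_moduleD[OF assms] by simp_all
  show "\<mu> = (\<mu> \<cdot> (M \<lhd> d \<rhd> A) \<cdot> (\<rho> \<rhd> Y \<otimes> A)) \<cdot> (M \<lhd> ext)"
    by (rule diagram5[OF mu_eps mu_assoc zigzag_X unt_eq ext_eq, where S = "[Undo 0 0 0, Apply 1 2 0, Undo 2 1 1,
      Right 2, Right 3, Right 0, Right 1, Right 2, Undo 3 0 1, Undo 4 0 1]"], (rule reads arrows | fact)+,
      simp add: run_simps)
  show "\<rho> = ((\<mu> \<cdot> (M \<lhd> d \<rhd> A) \<cdot> (\<rho> \<rhd> Y \<otimes> A)) \<rhd> X) \<cdot> (M \<otimes> Y \<lhd> \<eta> \<rhd> X) \<cdot> (M \<lhd> b)"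
    by (rule diagram2[OF zigzag_X mu_unit, where S = "[Undo 0 1 1, Right 0, Undo 1 3 0, Right 2, Right 1]"],
      (rule reads arrows | fact)+, simp add: run_simps)
qed

lemma entwined_linear_iff_wreath_linear:
  assumes M: "entwined M \<mu> \<rho>" and N: "entwined N \<mu>' \<rho>'"
    and f: "f \<in> hom C M N"
  shows "f \<cdot> \<mu> = \<mu>' \<cdot> (f \<rhd> A) \<and> (f \<rhd> X) \<cdot> \<rho> = \<rho>' \<cdot> f \<longleftrightarrow>
    f \<cdot> (\<mu> \<cdot> (M \<lhd> d \<rhd> A) \<cdot> (\<rho> \<rhd> Y \<otimes> A)) = (\<mu>' \<cdot> (N \<lhd> d \<rhd> A) \<cdot> (\<rho>' \<rhd> Y \<otimes> A)) \<cdot> (f \<rhd> Y \<otimes> A)"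
proof
  have h: "M \<in> Ob C" "\<mu> \<in> hom C (M \<otimes> A) M" "\<rho> \<in> hom C M (M \<otimes> X)"
    and h': "N \<in> Ob C" "\<mu>' \<in> hom C (N \<otimes> A) N" "\<rho>' \<in> hom C N (N \<otimes> X)"
    using entwined_moduleD[OF M] entwined_moduleD[OF N] by simp_all
  have hf: "f \<in> hom C M N" by (rule f)
  {
    assume "f \<cdot> \<mu> = \<mu>' \<cdot> (f \<rhd> A) \<and> (f \<rhd> X) \<cdot> \<rho> = \<rho>' \<cdot> f"
    then have f1: "f \<cdot> \<mu> = \<mu>' \<cdot> (f \<rhd> A)" and f2: "(f \<rhd> X) \<cdot> \<rho> = \<rho>' \<cdot> f" by simp_all
    show "f \<cdot> (\<mu> \<cdot> (M \<lhd> d \<rhd> A) \<cdot> (\<rho> \<rhd> Y \<otimes> A)) = (\<mu>' \<cdot> (N \<lhd> d \<rhd> A) \<cdot> (\<rho>' \<rhd> Y \<otimes> A)) \<cdot> (f \<rhd> Y \<otimes> A)"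
      by (rule diagram2[OF f1 f2, where S = "[Apply 0 2 0, Left 1, Apply 1 0 0]"], (rule reads arrows | fact)+,
      simp add: run_simps)
  next
    assume f1: "f \<cdot> (\<mu> \<cdot> (M \<lhd> d \<rhd> A) \<cdot> (\<rho> \<rhd> Y \<otimes> A)) = (\<mu>' \<cdot> (N \<lhd> d \<rhd> A) \<cdot> (\<rho>' \<rhd> Y \<otimes> A)) \<cdot> (f \<rhd> Y \<otimes> A)"
    have m1: "\<mu> = (\<mu> \<cdot> (M \<lhd> d \<rhd> A) \<cdot> (\<rho> \<rhd> Y \<otimes> A)) \<cdot> (M \<lhd> ext)"
      and r1: "\<rho> = ((\<mu> \<cdot> (M \<lhd> d \<rhd> A) \<cdot> (\<rho> \<rhd> Y \<otimes> A)) \<rhd> X) \<cdot> (M \<otimes> Y \<lhd> \<eta> \<rhd> X) \<cdot> (M \<lhd> b)"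
      by (rule entwined_to_wreath_restrict[OF M])+
    have m2: "\<mu>' = (\<mu>' \<cdot> (N \<lhd> d \<rhd> A) \<cdot> (\<rho>' \<rhd> Y \<otimes> A)) \<cdot> (N \<lhd> ext)"
      and r2: "\<rho>' = ((\<mu>' \<cdot> (N \<lhd> d \<rhd> A) \<cdot> (\<rho>' \<rhd> Y \<otimes> A)) \<rhd> X) \<cdot> (N \<otimes> Y \<lhd> \<eta> \<rhd> X) \<cdot> (N \<lhd> b)"
      by (rule entwined_to_wreath_restrict[OF N])+
    have "f \<cdot> \<mu> = \<mu>' \<cdot> (f \<rhd> A)"
      by (rule diagram3[OF m1 f1 m2, where S = "[Apply 0 0 0, Apply 1 1 0, Left 0, Undo 2 1 0]"],
      (rule reads arrows | fact)+, simp add: run_simps)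
    moreover have "(f \<rhd> X) \<cdot> \<rho> = \<rho>' \<cdot> f"
      by (rule diagram3[OF r1 f1 r2, where S = "[Apply 0 0 0, Apply 1 2 0, Left 1, Left 0, Undo 2 1 0]"],
      (rule reads arrows | fact)+, simp add: run_simps)
    ultimately show "f \<cdot> \<mu> = \<mu>' \<cdot> (f \<rhd> A) \<and> (f \<rhd> X) \<cdot> \<rho> = \<rho>' \<cdot> f" by simp
  }
qed

text \<open>Paired with \<open>X\<close>, the two composites become the same expression in
  \<open>z'\<close> and in \<open>z\<close>, the two sides of the Casimir law. Restriction along the
  unit of \<open>A\<close> recovers these, and a zigzag undoes the pairing.\<close>

lemma Psi_colinear_iff:
  assumes B: "central_form B"
  shows "(Psi B \<rhd> X) \<cdot> rho_AX = rho \<cdot> Psi B \<longleftrightarrow> casimir_form B"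
proof -
  define q where "q = Psi B"
  have h: "B \<in> hom C (X \<otimes> X) A"
    using B by (simp add: central_form_iff)
  have q: "q \<in> hom C (A \<otimes> X) (Y \<otimes> A)"
    using Psi_bimodule[OF B] by (simp add: q_def AX_to_YA_def)
  have q_eq: "q = (Y \<lhd> m) \<cdot> (Y \<otimes> A \<lhd> B) \<cdot> (Y \<lhd> \<psi> \<rhd> X) \<cdot> (b \<rhd> A \<otimes> X)"
    by (simp add: q_def Psi_def)
  have dq: "(d \<rhd> A) \<cdot> (X \<lhd> q) = m \<cdot> (A \<lhd> B) \<cdot> (\<psi> \<rhd> X)"
    by (rule diagram2[OF q_eq zigzag_X, where S = "[Apply 0 0 1, Left 3, Left 2, Left 1, Apply 1 0 0]"],
      (rule reads arrows | fact)+, simp add: run_simps)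
  define z where "z = (m \<rhd> X) \<cdot> (A \<lhd> \<psi>) \<cdot> (A \<otimes> X \<lhd> B) \<cdot> (\<delta> \<rhd> X)"
  define z' where "z' = (m \<rhd> X) \<cdot> (A \<lhd> B \<rhd> X) \<cdot> (\<psi> \<rhd> X \<otimes> X) \<cdot> (X \<lhd> \<delta>)"
  have z: "z \<in> hom C (X \<otimes> X) (A \<otimes> X)"
    unfolding z_def by (rule in_hom, (rule reads arrows | fact)+)
  have z': "z' \<in> hom C (X \<otimes> X) (A \<otimes> X)"
    unfolding z'_def by (rule in_hom, (rule reads arrows | fact)+)
  have l: "(d \<rhd> A \<otimes> X) \<cdot> (X \<lhd> ((q \<rhd> X) \<cdot> ((m \<rhd> X \<otimes> X) \<cdot> (A \<lhd> \<delta>)))) = (m \<rhd> X) \<cdot> (A \<lhd> z') \<cdot> (\<psi> \<rhd> X)"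
    by (rule diagram4[OF dq psi_m m_assoc z'_def, where S = "[Apply 0 2 0, Apply 1 1 0, Left 0, Right 3,
      Apply 2 4 0, Undo 3 1 1]"], (rule reads arrows | fact)+, simp add: run_simps)
  have r: "(d \<rhd> A \<otimes> X) \<cdot> (X \<lhd> (rho \<cdot> q)) = (m \<rhd> X) \<cdot> (A \<lhd> z) \<cdot> (\<psi> \<rhd> X)"
    by (rule diagram6[OF d_rho dq psi_m m_assoc delta_central z_def, where S = "[Apply 0 1 0, Left 0, Apply 1 1 2,
      Apply 2 3 1, Undo 3 5 0, Left 2, Left 4, Left 3, Undo 4 0 0, Right 2, Right 3, Apply 3 4 0, Undo 5 1 1]"],
      (rule reads arrows | fact)+, simp add: run_simps)
  have "(q \<rhd> X) \<cdot> ((m \<rhd> X \<otimes> X) \<cdot> (A \<lhd> \<delta>)) = rho \<cdot> q \<longleftrightarrow> z = z'"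
  proof
    assume c: "(q \<rhd> X) \<cdot> ((m \<rhd> X \<otimes> X) \<cdot> (A \<lhd> \<delta>)) = rho \<cdot> q"
    have lr: "(m \<rhd> X) \<cdot> (A \<lhd> z) \<cdot> (\<psi> \<rhd> X) = (m \<rhd> X) \<cdot> (A \<lhd> z') \<cdot> (\<psi> \<rhd> X)"
      using r unfolding c[symmetric] l by (rule sym)
    have "(m \<rhd> X) \<cdot> (A \<lhd> z) \<cdot> (\<psi> \<rhd> X) \<cdot> (X \<lhd> \<eta> \<rhd> X) = z"
      by (rule diagram2[OF psi_eta m_unit_left, where S = "[Apply 0 0 0, Right 0, Apply 1 1 0]"],
      (rule reads arrows | fact)+, simp add: run_simps)
    moreover have "(m \<rhd> X) \<cdot> (A \<lhd> z') \<cdot> (\<psi> \<rhd> X) \<cdot> (X \<lhd> \<eta> \<rhd> X) = z'"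
      by (rule diagram2[OF psi_eta m_unit_left, where S = "[Apply 0 0 0, Right 0, Apply 1 1 0]"],
      (rule reads arrows | fact)+, simp add: run_simps)
    ultimately show "z = z'" unfolding lr by (rule trans[OF sym])
  next
    assume zz: "z = z'"
    have l': "(d \<rhd> A \<otimes> X) \<cdot> (X \<lhd> ((q \<rhd> X) \<cdot> ((m \<rhd> X \<otimes> X) \<cdot> (A \<lhd> \<delta>)))) = (d \<rhd> A \<otimes> X) \<cdot> (X \<lhd> (rho \<cdot> q))"
      unfolding l r zz by (rule refl)
    show "(q \<rhd> X) \<cdot> ((m \<rhd> X \<otimes> X) \<cdot> (A \<lhd> \<delta>)) = rho \<cdot> q"
      by (rule diagram2[OF zigzag_Y l', where S = "[Undo 0 3 0, Left 2, Left 1, Left 0, Apply 1 1 1, Right 0, Right 1,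
      Apply 0 2 0]"], (rule reads arrows | fact)+, simp add: run_simps)
  qed
  then show ?thesis unfolding casimir_form_def q_def z_def z'_def .
qed

section \<open>Isomorphisms of entwined modules and of bimodules\<close>

lemma P1_iff_colinear_iso:
  "P1 \<longleftrightarrow> (\<exists>f. AX_to_YA f \<and> (f \<rhd> X) \<cdot> rho_AX = rho \<cdot> f \<and> is_iso C f)"
proof -
  have "P1 \<longleftrightarrow> (\<exists>B. central_form B \<and> casimir_form B \<and> is_iso C (Psi B))"
    unfolding P1_iff_casimir using is_iso_Psi_iff by blast
  moreover have "AX_to_YA f \<longleftrightarrow> (\<exists>B. central_form B \<and> f = Psi B)" for f
    using AX_to_YA_imp_Psi[of f] Psi_bimodule by blast
  ultimately show ?thesis
    using Psi_colinear_iff by auto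
qed

lemma inverse_linear:
  assumes "inverse_arrows C f g" "f \<in> hom C M N" "M \<in> Ob C" "N \<in> Ob C" "R \<in> Ob C"
  shows "\<mu> \<in> hom C (M \<otimes> R) M \<Longrightarrow> \<mu>' \<in> hom C (N \<otimes> R) N \<Longrightarrow> f \<cdot> \<mu> = \<mu>' \<cdot> (f \<rhd> R) \<Longrightarrow> g \<cdot> \<mu>' = \<mu> \<cdot> (g \<rhd> R)"
    "\<mu> \<in> hom C (R \<otimes> M) M \<Longrightarrow> \<mu>' \<in> hom C (R \<otimes> N) N \<Longrightarrow> f \<cdot> \<mu> = \<mu>' \<cdot> (R \<lhd> f) \<Longrightarrow> g \<cdot> \<mu>' = \<mu> \<cdot> (R \<lhd> g)"
    "\<mu> \<in> hom C M (M \<otimes> R) \<Longrightarrow> \<mu>' \<in> hom C N (N \<otimes> R) \<Longrightarrow> (f \<rhd> R) \<cdot> \<mu> = \<mu>' \<cdot> f \<Longrightarrow> (g \<rhd> R) \<cdot> \<mu>' = \<mu> \<cdot> g"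
proof -
  have ob: "M \<in> Ob C" "N \<in> Ob C" "R \<in> Ob C" and hf: "f \<in> hom C M N"
    using assms by simp_all
  have hg: "g \<in> hom C N M" and gf: "g \<cdot> f = Id C M" and fg: "f \<cdot> g = Id C N"
    using assms(1) homD[OF hf] by (simp_all add: inverse_arrows_def)
  {
    assume h: "\<mu> \<in> hom C (M \<otimes> R) M" "\<mu>' \<in> hom C (N \<otimes> R) N"
      and l: "f \<cdot> \<mu> = \<mu>' \<cdot> (f \<rhd> R)"
    show "g \<cdot> \<mu>' = \<mu> \<cdot> (g \<rhd> R)"
      by (rule diagram3[OF fg l gf, where S = "[Undo 0 0 0, Undo 1 1 0, Apply 2 2 0]"], (rule reads arrows | fact)+,
      simp add: run_simps)
  next
    assume h: "\<mu> \<in> hom C (R \<otimes> M) M" "\<mu>' \<in> hom C (R \<otimes> N) N"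
      and l: "f \<cdot> \<mu> = \<mu>' \<cdot> (R \<lhd> f)"
    show "g \<cdot> \<mu>' = \<mu> \<cdot> (R \<lhd> g)"
      by (rule diagram3[OF fg l gf, where S = "[Undo 0 0 1, Undo 1 1 0, Apply 2 2 0]"], (rule reads arrows | fact)+,
      simp add: run_simps)
  next
    assume h: "\<mu> \<in> hom C M (M \<otimes> R)" "\<mu>' \<in> hom C N (N \<otimes> R)"
      and l: "(f \<rhd> R) \<cdot> \<mu> = \<mu>' \<cdot> f"
    show "(g \<rhd> R) \<cdot> \<mu>' = \<mu> \<cdot> g"
      by (rule diagram3[OF fg l gf, where S = "[Undo 0 0 0, Undo 1 1 0, Apply 2 2 0]"], (rule reads arrows | fact)+,
      simp add: run_simps)
  }
qed

abbreviation "E \<equiv> entwined_modules C A m \<eta> X \<psi> \<delta> \<epsilon>"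

lemma entwined_Ar: "((M, \<mu>, \<rho>), f, (N, \<mu>', \<rho>')) \<in> Ar E \<longleftrightarrow>
    entwined M \<mu> \<rho> \<and> entwined N \<mu>' \<rho>' \<and>
    f \<in> hom C M N \<and> f \<cdot> \<mu> = \<mu>' \<cdot> (f \<rhd> A) \<and> (f \<rhd> X) \<cdot> \<rho> = \<rho>' \<cdot> f"
  by (simp add: entwined_modules_def right_linear_def)

lemma entwined_simps:
  "P \<in> Ob E \<longleftrightarrow> entwined (fst P) (fst (snd P)) (snd (snd P))"
  "Dom E (P, f, Q) = P" "Cod E (P, f, Q) = Q" "(Q', g, R) \<cdot>\<^bsub>E\<^esub> (P, f, Q) = (P, g \<cdot> f, R)"
  "Id E P = (P, Id C (fst P), P)"
  by (auto simp: entwined_modules_def split: prod.splits)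

text \<open>The inverse in \<open>C\<close> of a linear and colinear arrow is again linear and
  colinear by \<open>inverse_linear\<close>, so invertibility may be tested in
  \<open>C\<close>.\<close>

lemma is_iso_entwined:
  assumes M: "entwined M \<mu> \<rho>" and N: "entwined N \<mu>' \<rho>'"
  shows "is_iso E ((M, \<mu>, \<rho>), f, (N, \<mu>', \<rho>')) \<longleftrightarrow> ((M, \<mu>, \<rho>), f, (N, \<mu>', \<rho>')) \<in> Ar E \<and> is_iso C f"
proof
  assume "is_iso E ((M, \<mu>, \<rho>), f, (N, \<mu>', \<rho>'))"
  then obtain G where G: "inverse_arrows E ((M, \<mu>, \<rho>), f, (N, \<mu>', \<rho>')) G" by (auto simp: is_iso_def)
  obtain P g Q where "G = (P, g, Q)" by (cases G)
  with G have "((M, \<mu>, \<rho>), f, (N, \<mu>', \<rho>')) \<in> Ar E" "((N, \<mu>', \<rho>'), g, (M, \<mu>, \<rho>)) \<in> Ar E"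
    "g \<cdot> f = Id C M" "f \<cdot> g = Id C N"
    by (auto simp: inverse_arrows_def entwined_simps hom_def)
  moreover from this have "inverse_arrows C f g"
    by (auto simp: inverse_arrows_def entwined_Ar hom_def)
  ultimately show "((M, \<mu>, \<rho>), f, (N, \<mu>', \<rho>')) \<in> Ar E \<and> is_iso C f" by (auto simp: is_iso_def)
next
  assume f: "((M, \<mu>, \<rho>), f, (N, \<mu>', \<rho>')) \<in> Ar E \<and> is_iso C f"
  then obtain g where g: "inverse_arrows C f g" by (auto simp: is_iso_def)
  have hf: "f \<in> hom C M N" using f by (simp add: entwined_Ar)
  then have hg: "g \<in> hom C N M" "g \<cdot> f = Id C M" "f \<cdot> g = Id C N"
    using g homD[OF hf] by (auto simp: inverse_arrows_def)
  have "((N, \<mu>', \<rho>'), g, (M, \<mu>, \<rho>)) \<in> Ar E"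
    using f M N hg entwined_moduleD[OF M] entwined_moduleD[OF N] inverse_linear(1,3)[OF g hf _ _ A_in_Ob]
      inverse_linear(1,3)[OF g hf _ _ X_in_Ob]
    by (simp add: entwined_Ar)
  then have "inverse_arrows E ((M, \<mu>, \<rho>), f, (N, \<mu>', \<rho>')) ((N, \<mu>', \<rho>'), g, (M, \<mu>, \<rho>))"
    using f hg by (simp add: inverse_arrows_def hom_def entwined_simps)
  then show "is_iso E ((M, \<mu>, \<rho>), f, (N, \<mu>', \<rho>'))" unfolding is_iso_def by blast
qed

abbreviation "P6 \<equiv> (\<exists>f. is_iso E (AX_entwined C A m X \<psi> \<delta>, f, YA_entwined C A m \<eta> X \<psi> \<delta> \<epsilon> Y b d) \<and>
   left_linear C A (m \<rhd> X) (wreath_left_action C A m X \<psi> Y b d) f)"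

lemma P1_iff_P6: "P1 \<longleftrightarrow> P6"
  unfolding P1_iff_colinear_iso AX_entwined_eq YA_entwined_eq
    is_iso_entwined[OF entwined_module_AX entwined_module_YA] wreath_left_action_eq
  by (auto simp: entwined_Ar entwined_module_AX entwined_module_YA AX_to_YA_def left_linear_def)

abbreviation "omega_AX \<equiv> mu_AX \<cdot> (A \<otimes> X \<lhd> d \<rhd> A) \<cdot> (rho_AX \<rhd> Y \<otimes> A)"

lemma AX_bimodule_eq: "AX_bimodule C A m X \<psi> \<delta> Y d = (A \<otimes> X, m \<rhd> X, omega_AX)"
  by (simp add: AX_bimodule_def entwined_to_wreath_def AX_entwined_eq)

lemma YA_bimodule_eq: "YA_bimodule C A m X \<psi> \<delta> Y b d = (Y \<otimes> A, nu, wr)"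
  by (simp add: YA_bimodule_def wreath_left_action_eq wr_def)

lemma bimodule_AX: "bimodule C A m \<eta> (Y \<otimes> A) wr unt (A \<otimes> X) (m \<rhd> X) omega_AX"
proof -
  have "(m \<rhd> X) \<cdot> (A \<lhd> (m \<rhd> X)) = (m \<rhd> X) \<cdot> (m \<rhd> A \<otimes> X)"
    by (rule diagram1[OF m_assoc, where S = "[Undo 0 0 0]"], (rule reads arrows | fact)+, simp add: run_simps)
  moreover have "(m \<rhd> X) \<cdot> (\<eta> \<rhd> A \<otimes> X) = Id C (A \<otimes> X)"
    by (rule diagram1[OF m_unit_left, where S = "[Apply 0 0 0]"], (rule reads arrows | fact)+, simp add: run_simps)
  moreover have "m \<rhd> X \<in> hom C (A \<otimes> A \<otimes> X) (A \<otimes> X)"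
    by (rule in_hom, (rule reads arrows | fact)+)
  moreover have "(m \<rhd> X) \<cdot> (A \<lhd> \<psi>) \<cdot> (A \<otimes> X \<lhd> d \<rhd> A) \<cdot> (((m \<rhd> X \<otimes> X) \<cdot> (A \<lhd> \<delta>)) \<rhd> Y \<otimes> A) \<cdot> ((m \<rhd> X) \<rhd> Y \<otimes> A) =
      (m \<rhd> X) \<cdot> (A \<lhd> ((m \<rhd> X) \<cdot> (A \<lhd> \<psi>) \<cdot> (A \<otimes> X \<lhd> d \<rhd> A) \<cdot> (((m \<rhd> X \<otimes> X) \<cdot> (A \<lhd> \<delta>)) \<rhd> Y \<otimes> A)))"
    by (rule diagram1[OF m_assoc, where S = "[Right 0, Apply 0 1 0, Right 2, Right 3, Apply 0 4 0]"],
      (rule reads arrows | fact)+, simp add: run_simps)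
  ultimately show ?thesis
    using entwined_to_wreath_module[OF entwined_module_AX]
    by (simp add: bimodule_def left_module_def X_in_Ob A_in_Ob)
qed

lemma bimodule_YA: "bimodule C A m \<eta> (Y \<otimes> A) wr unt (Y \<otimes> A) nu wr"
  using nu_left_module nu_in_hom wr_assoc wr_unit_right wr_in_hom wr_nu
  by (simp add: bimodule_def left_module_def right_module_def Y_in_Ob A_in_Ob)

abbreviation "P5 \<equiv> isomorphic (bimodules C A m \<eta> (Y \<otimes> A) wr unt)
   (AX_bimodule C A m X \<psi> \<delta> Y d) (YA_bimodule C A m X \<psi> \<delta> Y b d)"

lemma isomorphic_bimodules_iff:
  assumes M: "bimodule C A m \<eta> R n \<upsilon> M \<nu> \<mu>" and N: "bimodule C A m \<eta> R n \<upsilon> N \<nu>' \<mu>'" and R: "R \<in> Ob C"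
  shows "isomorphic (bimodules C A m \<eta> R n \<upsilon>) (M, \<nu>, \<mu>) (N, \<nu>', \<mu>') \<longleftrightarrow>
    (\<exists>f\<in>hom C M N. f \<cdot> \<nu> = \<nu>' \<cdot> (A \<lhd> f) \<and> f \<cdot> \<mu> = \<mu>' \<cdot> (f \<rhd> R) \<and> is_iso C f)"
    (is "?L \<longleftrightarrow> ?R")
proof
  let ?D = "bimodules C A m \<eta> R n \<upsilon>"
  assume ?L
  then obtain F G where "F \<in> hom ?D (M, \<nu>, \<mu>) (N, \<nu>', \<mu>')" "inverse_arrows ?D F G"
    by (auto simp: isomorphic_def is_iso_def)
  moreover obtain P f Q P' g Q' where "F = (P, f, Q)" "G = (P', g, Q')"
    by (cases F; cases G)
  ultimately have "f \<in> hom C M N \<and> g \<in> hom C N M \<and> f \<cdot> \<nu> = \<nu>' \<cdot> (A \<lhd> f) \<and> f \<cdot> \<mu> = \<mu>' \<cdot> (f \<rhd> R) \<and>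
      g \<cdot> f = Id C M \<and> f \<cdot> g = Id C N"
    by (auto simp: bimodules_def hom_def inverse_arrows_def left_linear_def right_linear_def)
  then show ?R by (auto simp: is_iso_def inverse_arrows_def hom_def)
next
  let ?D = "bimodules C A m \<eta> R n \<upsilon>"
  assume ?R
  then obtain f g where f: "f \<in> hom C M N" "f \<cdot> \<nu> = \<nu>' \<cdot> (A \<lhd> f)" "f \<cdot> \<mu> = \<mu>' \<cdot> (f \<rhd> R)"
    and g: "inverse_arrows C f g" by (auto simp: is_iso_def)
  have hg: "g \<in> hom C N M" "g \<cdot> f = Id C M" "f \<cdot> g = Id C N"
    using g homD[OF f(1)] by (auto simp: inverse_arrows_def)
  have "M \<in> Ob C" "N \<in> Ob C" "\<nu> \<in> hom C (A \<otimes> M) M" "\<nu>' \<in> hom C (A \<otimes> N) N" "\<mu> \<in> hom C (M \<otimes> R) M" "\<mu>' \<in> hom C (N \<otimes> R) N"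
    using M N by (simp_all add: bimodule_def left_module_def right_module_def)
  then have "g \<cdot> \<nu>' = \<nu> \<cdot> (A \<lhd> g)" "g \<cdot> \<mu>' = \<mu> \<cdot> (g \<rhd> R)"
    using inverse_linear(1)[OF g f(1) _ _ R] inverse_linear(2)[OF g f(1) _ _ A_in_Ob] f by auto
  then have "inverse_arrows ?D ((M, \<nu>, \<mu>), f, (N, \<nu>', \<mu>')) ((N, \<nu>', \<mu>'), g, (M, \<nu>, \<mu>))"
    using f hg M N by (simp add: bimodules_def hom_def inverse_arrows_def left_linear_def right_linear_def)
  moreover have "((M, \<nu>, \<mu>), f, (N, \<nu>', \<mu>')) \<in> hom ?D (M, \<nu>, \<mu>) (N, \<nu>', \<mu>')"
    using f M N by (simp add: bimodules_def hom_def left_linear_def right_linear_def)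
  ultimately show ?L unfolding isomorphic_def is_iso_def by blast
qed

lemma P1_iff_P5: "P1 \<longleftrightarrow> P5"
proof -
  have "P5 \<longleftrightarrow> (\<exists>f\<in>hom C (A \<otimes> X) (Y \<otimes> A). f \<cdot> (m \<rhd> X) = nu \<cdot> (A \<lhd> f) \<and> f \<cdot> omega_AX = wr \<cdot> (f \<rhd> Y \<otimes> A) \<and> is_iso C f)"
    unfolding AX_bimodule_eq YA_bimodule_eq
    by (rule isomorphic_bimodules_iff[OF bimodule_AX bimodule_YA]) (simp add: Y_in_Ob A_in_Ob)
  also have "\<dots> \<longleftrightarrow> (\<exists>f. AX_to_YA f \<and> (f \<rhd> X) \<cdot> rho_AX = rho \<cdot> f \<and> is_iso C f)"
  proof -
    have "f \<cdot> mu_AX = (Y \<lhd> m) \<cdot> (f \<rhd> A) \<and> (f \<rhd> X) \<cdot> rho_AX = rho \<cdot> f \<longleftrightarrow> f \<cdot> omega_AX = wr \<cdot> (f \<rhd> Y \<otimes> A)"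
      if "f \<in> hom C (A \<otimes> X) (Y \<otimes> A)" for f
      using entwined_linear_iff_wreath_linear[OF entwined_module_AX entwined_module_YA that]
      unfolding wr_rho[symmetric] .
    then show ?thesis unfolding AX_to_YA_def Bex_def by blast
  qed
  finally show ?thesis unfolding P1_iff_colinear_iso by simp
qed

end

section \<open>Right adjoints are unique\<close>

lemma is_functorD:
  assumes "is_functor C D FO FA"
  shows "X \<in> Ob C \<Longrightarrow> FO X \<in> Ob D"
    "f \<in> hom C X Y \<Longrightarrow> FA f \<in> hom D (FO X) (FO Y)"
    "X \<in> Ob C \<Longrightarrow> FA (Id C X) = Id D (FO X)"
    "f \<in> hom C X Y \<Longrightarrow> g \<in> hom C Y Z \<Longrightarrow> FA (Comp C g f) = Comp D (FA g) (FA f)"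
  using assms by (auto simp: is_functor_def hom_def)

lemma is_adjunctionE:
  assumes "is_adjunction C D FO FA GO GA"
  obtains u c where "\<And>X. X \<in> Ob C \<Longrightarrow> u X \<in> hom C X (GO (FO X))"
    "\<And>f X Y. f \<in> hom C X Y \<Longrightarrow> Comp C (u Y) f = Comp C (GA (FA f)) (u X)"
    "\<And>Y. Y \<in> Ob D \<Longrightarrow> c Y \<in> hom D (FO (GO Y)) Y"
    "\<And>g X Y. g \<in> hom D X Y \<Longrightarrow> Comp D g (c X) = Comp D (c Y) (FA (GA g))"
    "\<And>X. X \<in> Ob C \<Longrightarrow> Comp D (c (FO X)) (FA (u X)) = Id D (FO X)"
    "\<And>Y. Y \<in> Ob D \<Longrightarrow> Comp C (GA (c Y)) (u (GO Y)) = Id C (GO Y)"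
proof -
  obtain u c where
    "\<forall>X\<in>Ob C. u X \<in> hom C X (GO (FO X))"
    "\<forall>f\<in>Ar C. Comp C (u (Cod C f)) f = Comp C (GA (FA f)) (u (Dom C f))"
    "\<forall>Y\<in>Ob D. c Y \<in> hom D (FO (GO Y)) Y"
    "\<forall>g\<in>Ar D. Comp D g (c (Dom D g)) = Comp D (c (Cod D g)) (FA (GA g))"
    "\<forall>X\<in>Ob C. Comp D (c (FO X)) (FA (u X)) = Id D (FO X)"
    "\<forall>Y\<in>Ob D. Comp C (GA (c Y)) (u (GO Y)) = Id C (GO Y)"
    using assms unfolding is_adjunction_def by blast
  moreover from this have "Comp C (u Y) f = Comp C (GA (FA f)) (u X)" if "f \<in> hom C X Y" for f X Y
    using that by (auto simp: hom_def)
  moreover from calculation have "Comp D g (c X) = Comp D (c Y) (FA (GA g))" if "g \<in> hom D X Y" for g X Y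
    using that by (auto simp: hom_def)
  ultimately show thesis using that[of u c] by blast
qed

lemma is_adjunctionI:
  assumes "is_category C" "is_category D" "is_functor C D FO FA" "is_functor D C GO GA"
    and "\<And>X. X \<in> Ob C \<Longrightarrow> u X \<in> hom C X (GO (FO X))"
    "\<And>f X Y. f \<in> hom C X Y \<Longrightarrow> Comp C (u Y) f = Comp C (GA (FA f)) (u X)"
    "\<And>Y. Y \<in> Ob D \<Longrightarrow> c Y \<in> hom D (FO (GO Y)) Y"
    "\<And>g X Y. g \<in> hom D X Y \<Longrightarrow> Comp D g (c X) = Comp D (c Y) (FA (GA g))"
    "\<And>X. X \<in> Ob C \<Longrightarrow> Comp D (c (FO X)) (FA (u X)) = Id D (FO X)"
    "\<And>Y. Y \<in> Ob D \<Longrightarrow> Comp C (GA (c Y)) (u (GO Y)) = Id C (GO Y)"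
  shows "is_adjunction C D FO FA GO GA"
proof -
  have "\<And>f. f \<in> Ar C \<Longrightarrow> f \<in> hom C (Dom C f) (Cod C f)" "\<And>g. g \<in> Ar D \<Longrightarrow> g \<in> hom D (Dom D g) (Cod D g)"
    by (simp_all add: hom_def)
  then show ?thesis
    using assms unfolding is_adjunction_def by (intro conjI exI[of _ u] exI[of _ c]) auto
qed

text \<open>Both \<open>G\<close> and \<open>H\<close> are right adjoint to \<open>F\<close>, and
  the two comparison arrows are the mates of the identity of \<open>F\<close>. The composite in the
  other order is the instance with \<open>G\<close> and \<open>H\<close> exchanged.\<close>

lemma mates_inverse:
  fixes E :: "('p, 'b, 'y) category_scheme" and R :: "('q, 'c, 'x) category_scheme"
  assumes E: "is_category E" and R: "is_category R"
    and F: "is_functor E R FO FA" and G: "is_functor R E GO GA" and H: "is_functor R E HO HA"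
    and u: "\<And>P. P \<in> Ob E \<Longrightarrow> u P \<in> hom E P (GO (FO P))"
    and un: "\<And>f P Q. f \<in> hom E P Q \<Longrightarrow> u Q \<cdot>\<^bsub>E\<^esub> f = GA (FA f) \<cdot>\<^bsub>E\<^esub> u P"
    and c: "\<And>N. N \<in> Ob R \<Longrightarrow> c N \<in> hom R (FO (GO N)) N"
    and t: "\<And>N. N \<in> Ob R \<Longrightarrow> GA (c N) \<cdot>\<^bsub>E\<^esub> u (GO N) = Id E (GO N)"
    and u': "\<And>P. P \<in> Ob E \<Longrightarrow> u' P \<in> hom E P (HO (FO P))"
    and c': "\<And>N. N \<in> Ob R \<Longrightarrow> c' N \<in> hom R (FO (HO N)) N"
    and cn': "\<And>g N N'. g \<in> hom R N N' \<Longrightarrow> g \<cdot>\<^bsub>R\<^esub> c' N = c' N' \<cdot>\<^bsub>R\<^esub> FA (HA g)"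
    and t': "\<And>P. P \<in> Ob E \<Longrightarrow> c' (FO P) \<cdot>\<^bsub>R\<^esub> FA (u' P) = Id R (FO P)"
    and N: "N \<in> Ob R"
  shows "(GA (c' N) \<cdot>\<^bsub>E\<^esub> u (HO N)) \<cdot>\<^bsub>E\<^esub> (HA (c N) \<cdot>\<^bsub>E\<^esub> u' (GO N)) = Id E (GO N)"
proof -
  interpret E: category_structure E by unfold_locales (rule E)
  interpret R: category_structure R by unfold_locales (rule R)
  note Fh = is_functorD(2)[OF F] and Gh = is_functorD(2)[OF G] and Hh = is_functorD(2)[OF H]
  note Fc = is_functorD(4)[OF F] and Gc = is_functorD(4)[OF G]
  note Fo = is_functorD(1)[OF F] and Go = is_functorD(1)[OF G] and Ho = is_functorD(1)[OF H]
  let ?a = "HA (c N) \<cdot>\<^bsub>E\<^esub> u' (GO N)"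
  have a: "?a \<in> hom E (GO N) (HO N)"
    by (rule E.comp_in_hom[OF u'[OF Go[OF N]] Hh[OF c[OF N]]])
  \<comment> \<open>The comparison arrow turns one counit into the other; this property
    characterizes it.\<close>
  have "c' N \<cdot>\<^bsub>R\<^esub> FA ?a = c' N \<cdot>\<^bsub>R\<^esub> (FA (HA (c N)) \<cdot>\<^bsub>R\<^esub> FA (u' (GO N)))"
    by (simp only: Fc[OF u'[OF Go[OF N]] Hh[OF c[OF N]]])
  also have "\<dots> = (c' N \<cdot>\<^bsub>R\<^esub> FA (HA (c N))) \<cdot>\<^bsub>R\<^esub> FA (u' (GO N))"
    by (rule R.comp_assoc[OF Fh[OF u'[OF Go[OF N]]] Fh[OF Hh[OF c[OF N]]] c'[OF N], symmetric])
  also have "\<dots> = (c N \<cdot>\<^bsub>R\<^esub> c' (FO (GO N))) \<cdot>\<^bsub>R\<^esub> FA (u' (GO N))"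
    by (simp only: cn'[OF c[OF N]])
  also have "\<dots> = c N \<cdot>\<^bsub>R\<^esub> (c' (FO (GO N)) \<cdot>\<^bsub>R\<^esub> FA (u' (GO N)))"
    by (rule R.comp_assoc[OF Fh[OF u'[OF Go[OF N]]] c'[OF Fo[OF Go[OF N]]] c[OF N]])
  also have "\<dots> = c N"
    by (simp only: t'[OF Go[OF N]] R.comp_Id[OF c[OF N]])
  finally have ca: "c' N \<cdot>\<^bsub>R\<^esub> FA ?a = c N" .
  have "(GA (c' N) \<cdot>\<^bsub>E\<^esub> u (HO N)) \<cdot>\<^bsub>E\<^esub> ?a = GA (c' N) \<cdot>\<^bsub>E\<^esub> (u (HO N) \<cdot>\<^bsub>E\<^esub> ?a)"
    by (rule E.comp_assoc[OF a u[OF Ho[OF N]] Gh[OF c'[OF N]]])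
  also have "\<dots> = GA (c' N) \<cdot>\<^bsub>E\<^esub> (GA (FA ?a) \<cdot>\<^bsub>E\<^esub> u (GO N))"
    by (simp only: un[OF a])
  also have "\<dots> = (GA (c' N) \<cdot>\<^bsub>E\<^esub> GA (FA ?a)) \<cdot>\<^bsub>E\<^esub> u (GO N)"
    by (rule E.comp_assoc[OF u[OF Go[OF N]] Gh[OF Fh[OF a]] Gh[OF c'[OF N]], symmetric])
  also have "\<dots> = GA (c N) \<cdot>\<^bsub>E\<^esub> u (GO N)"
    by (simp only: Gc[OF Fh[OF a] c'[OF N], symmetric] ca)
  finally show ?thesis by (simp only: t[OF N])
qed

lemma mate_natural:
  fixes E :: "('p, 'b, 'y) category_scheme" and R :: "('q, 'c, 'x) category_scheme"
  assumes E: "is_category E" and R: "is_category R"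
    and F: "is_functor E R FO FA" and G: "is_functor R E GO GA" and H: "is_functor R E HO HA"
    and c: "\<And>N. N \<in> Ob R \<Longrightarrow> c N \<in> hom R (FO (GO N)) N"
    and cn: "\<And>g N N'. g \<in> hom R N N' \<Longrightarrow> g \<cdot>\<^bsub>R\<^esub> c N = c N' \<cdot>\<^bsub>R\<^esub> FA (GA g)"
    and u': "\<And>P. P \<in> Ob E \<Longrightarrow> u' P \<in> hom E P (HO (FO P))"
    and un': "\<And>f P Q. f \<in> hom E P Q \<Longrightarrow> u' Q \<cdot>\<^bsub>E\<^esub> f = HA (FA f) \<cdot>\<^bsub>E\<^esub> u' P"
    and g: "g \<in> hom R N N'"
  shows "HA g \<cdot>\<^bsub>E\<^esub> (HA (c N) \<cdot>\<^bsub>E\<^esub> u' (GO N)) = (HA (c N') \<cdot>\<^bsub>E\<^esub> u' (GO N')) \<cdot>\<^bsub>E\<^esub> GA g"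
proof -
  interpret E: category_structure E by unfold_locales (rule E)
  interpret R: category_structure R by unfold_locales (rule R)
  note Fh = is_functorD(2)[OF F] and Gh = is_functorD(2)[OF G] and Hh = is_functorD(2)[OF H]
  note Hc = is_functorD(4)[OF H]
  note Go = is_functorD(1)[OF G]
  have N: "N \<in> Ob R" "N' \<in> Ob R" using R.homD[OF g] by auto
  have "HA g \<cdot>\<^bsub>E\<^esub> (HA (c N) \<cdot>\<^bsub>E\<^esub> u' (GO N)) = (HA g \<cdot>\<^bsub>E\<^esub> HA (c N)) \<cdot>\<^bsub>E\<^esub> u' (GO N)"
    by (rule E.comp_assoc[OF u'[OF Go[OF N(1)]] Hh[OF c[OF N(1)]] Hh[OF g], symmetric])
  also have "\<dots> = HA (c N' \<cdot>\<^bsub>R\<^esub> FA (GA g)) \<cdot>\<^bsub>E\<^esub> u' (GO N)"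
    by (simp only: Hc[OF c[OF N(1)] g, symmetric] cn[OF g])
  also have "\<dots> = (HA (c N') \<cdot>\<^bsub>E\<^esub> HA (FA (GA g))) \<cdot>\<^bsub>E\<^esub> u' (GO N)"
    by (simp only: Hc[OF Fh[OF Gh[OF g]] c[OF N(2)]])
  also have "\<dots> = HA (c N') \<cdot>\<^bsub>E\<^esub> (HA (FA (GA g)) \<cdot>\<^bsub>E\<^esub> u' (GO N))"
    by (rule E.comp_assoc[OF u'[OF Go[OF N(1)]] Hh[OF Fh[OF Gh[OF g]]] Hh[OF c[OF N(2)]]])
  also have "\<dots> = HA (c N') \<cdot>\<^bsub>E\<^esub> (u' (GO N') \<cdot>\<^bsub>E\<^esub> GA g)"
    by (simp only: un'[OF Gh[OF g]])
  also have "\<dots> = (HA (c N') \<cdot>\<^bsub>E\<^esub> u' (GO N')) \<cdot>\<^bsub>E\<^esub> GA g"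
    by (rule E.comp_assoc[OF Gh[OF g] u'[OF Go[OF N(2)]] Hh[OF c[OF N(2)]], symmetric])
  finally show ?thesis .
qed

text \<open>A Frobenius functor has some right adjoint that is also a left adjoint. Right adjoints
  being isomorphic, the second adjunction can be moved to any given one: its unit and counit are
  composed with the natural isomorphisms \<open>b\<close> and \<open>a\<close>.\<close>

lemma adjunction_transfer:
  fixes E :: "('p, 'b, 'y) category_scheme" and R :: "('q, 'c, 'x) category_scheme"
  assumes E: "is_category E" and R: "is_category R"
    and FG: "is_adjunction E R FO FA GO GA" and FH: "is_adjunction E R FO FA HO HA"
    and HF: "is_adjunction R E HO HA FO FA"
  shows "is_adjunction R E GO GA FO FA"
proof -
  interpret E: category_structure E by unfold_locales (rule E)
  interpret R: category_structure R by unfold_locales (rule R)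
  have F: "is_functor E R FO FA" and G: "is_functor R E GO GA" and H: "is_functor R E HO HA"
    using FG FH by (simp_all add: is_adjunction_def)
  note Fh = is_functorD(2)[OF F] and Gh = is_functorD(2)[OF G] and Hh = is_functorD(2)[OF H]
  note Fc = is_functorD(4)[OF F] and Gc = is_functorD(4)[OF G] and Hc = is_functorD(4)[OF H]
  note Fo = is_functorD(1)[OF F] and Go = is_functorD(1)[OF G] and Ho = is_functorD(1)[OF H]
  obtain u c where u: "\<And>P. P \<in> Ob E \<Longrightarrow> u P \<in> hom E P (GO (FO P))"
    and un: "\<And>f P Q. f \<in> hom E P Q \<Longrightarrow> u Q \<cdot>\<^bsub>E\<^esub> f = GA (FA f) \<cdot>\<^bsub>E\<^esub> u P"
    and c: "\<And>N. N \<in> Ob R \<Longrightarrow> c N \<in> hom R (FO (GO N)) N"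
    and cn: "\<And>g N N'. g \<in> hom R N N' \<Longrightarrow> g \<cdot>\<^bsub>R\<^esub> c N = c N' \<cdot>\<^bsub>R\<^esub> FA (GA g)"
    and t1: "\<And>P. P \<in> Ob E \<Longrightarrow> c (FO P) \<cdot>\<^bsub>R\<^esub> FA (u P) = Id R (FO P)"
    and t2: "\<And>N. N \<in> Ob R \<Longrightarrow> GA (c N) \<cdot>\<^bsub>E\<^esub> u (GO N) = Id E (GO N)"
    by (rule is_adjunctionE[OF FG]) (rule that; assumption)
  obtain u' c' where u': "\<And>P. P \<in> Ob E \<Longrightarrow> u' P \<in> hom E P (HO (FO P))"
    and un': "\<And>f P Q. f \<in> hom E P Q \<Longrightarrow> u' Q \<cdot>\<^bsub>E\<^esub> f = HA (FA f) \<cdot>\<^bsub>E\<^esub> u' P"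
    and c': "\<And>N. N \<in> Ob R \<Longrightarrow> c' N \<in> hom R (FO (HO N)) N"
    and cn': "\<And>g N N'. g \<in> hom R N N' \<Longrightarrow> g \<cdot>\<^bsub>R\<^esub> c' N = c' N' \<cdot>\<^bsub>R\<^esub> FA (HA g)"
    and t1': "\<And>P. P \<in> Ob E \<Longrightarrow> c' (FO P) \<cdot>\<^bsub>R\<^esub> FA (u' P) = Id R (FO P)"
    and t2': "\<And>N. N \<in> Ob R \<Longrightarrow> HA (c' N) \<cdot>\<^bsub>E\<^esub> u' (HO N) = Id E (HO N)"
    by (rule is_adjunctionE[OF FH]) (rule that; assumption)
  obtain v w where v: "\<And>N. N \<in> Ob R \<Longrightarrow> v N \<in> hom R N (FO (HO N))"
    and vn: "\<And>g N N'. g \<in> hom R N N' \<Longrightarrow> v N' \<cdot>\<^bsub>R\<^esub> g = FA (HA g) \<cdot>\<^bsub>R\<^esub> v N"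
    and w: "\<And>P. P \<in> Ob E \<Longrightarrow> w P \<in> hom E (HO (FO P)) P"
    and wn: "\<And>f P Q. f \<in> hom E P Q \<Longrightarrow> f \<cdot>\<^bsub>E\<^esub> w P = w Q \<cdot>\<^bsub>E\<^esub> HA (FA f)"
    and s1: "\<And>N. N \<in> Ob R \<Longrightarrow> w (HO N) \<cdot>\<^bsub>E\<^esub> HA (v N) = Id E (HO N)"
    and s2: "\<And>P. P \<in> Ob E \<Longrightarrow> FA (w P) \<cdot>\<^bsub>R\<^esub> v (FO P) = Id R (FO P)"
    by (rule is_adjunctionE[OF HF]) (rule that; assumption)
  define a where "a N = HA (c N) \<cdot>\<^bsub>E\<^esub> u' (GO N)" for N
  define b where "b N = GA (c' N) \<cdot>\<^bsub>E\<^esub> u (HO N)" for N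
  have a: "a N \<in> hom E (GO N) (HO N)" if "N \<in> Ob R" for N
    unfolding a_def by (rule E.comp_in_hom[OF u'[OF Go[OF that]] Hh[OF c[OF that]]])
  have b: "b N \<in> hom E (HO N) (GO N)" if "N \<in> Ob R" for N
    unfolding b_def by (rule E.comp_in_hom[OF u[OF Ho[OF that]] Gh[OF c'[OF that]]])
  have ba: "b N \<cdot>\<^bsub>E\<^esub> a N = Id E (GO N)" if "N \<in> Ob R" for N
    unfolding a_def b_def by (rule mates_inverse[OF E R F G H u un c t2 u' c' cn' t1' that])
  have ab: "a N \<cdot>\<^bsub>E\<^esub> b N = Id E (HO N)" if "N \<in> Ob R" for N
    unfolding a_def b_def by (rule mates_inverse[OF E R F H G u' un' c' t2' u c cn t1 that])
  have an: "HA g \<cdot>\<^bsub>E\<^esub> a N = a N' \<cdot>\<^bsub>E\<^esub> GA g" if "g \<in> hom R N N'" for g N N'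
    unfolding a_def by (rule mate_natural[OF E R F G H c cn u' un' that])
  have bn: "GA g \<cdot>\<^bsub>E\<^esub> b N = b N' \<cdot>\<^bsub>E\<^esub> HA g" if "g \<in> hom R N N'" for g N N'
    unfolding b_def by (rule mate_natural[OF E R F H G c' cn' u un that])
  have v2: "FA (b N) \<cdot>\<^bsub>R\<^esub> v N \<in> hom R N (FO (GO N))" if "N \<in> Ob R" for N
    by (rule R.comp_in_hom[OF v[OF that] Fh[OF b[OF that]]])
  have w2: "w P \<cdot>\<^bsub>E\<^esub> a (FO P) \<in> hom E (GO (FO P)) P" if "P \<in> Ob E" for P
    by (rule E.comp_in_hom[OF a[OF Fo[OF that]] w[OF that]])
  show ?thesis
  proof (rule is_adjunctionI[where u = "\<lambda>N. FA (b N) \<cdot>\<^bsub>R\<^esub> v N" and c = "\<lambda>P. w P \<cdot>\<^bsub>E\<^esub> a (FO P)", OF R E G F])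
    show "FA (b N) \<cdot>\<^bsub>R\<^esub> v N \<in> hom R N (FO (GO N))" if "N \<in> Ob R" for N
      using v2[OF that] .
    show "w P \<cdot>\<^bsub>E\<^esub> a (FO P) \<in> hom E (GO (FO P)) P" if "P \<in> Ob E" for P
      using w2[OF that] .
    show "(FA (b N') \<cdot>\<^bsub>R\<^esub> v N') \<cdot>\<^bsub>R\<^esub> g = FA (GA g) \<cdot>\<^bsub>R\<^esub> (FA (b N) \<cdot>\<^bsub>R\<^esub> v N)" if g: "g \<in> hom R N N'" for g N N'
    proof -
      have N: "N \<in> Ob R" "N' \<in> Ob R" using R.homD[OF g] by auto
      have "(FA (b N') \<cdot>\<^bsub>R\<^esub> v N') \<cdot>\<^bsub>R\<^esub> g = FA (b N') \<cdot>\<^bsub>R\<^esub> (FA (HA g) \<cdot>\<^bsub>R\<^esub> v N)"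
        by (simp only: R.comp_assoc[OF g v[OF N(2)] Fh[OF b[OF N(2)]]] vn[OF g])
      also have "\<dots> = (FA (b N') \<cdot>\<^bsub>R\<^esub> FA (HA g)) \<cdot>\<^bsub>R\<^esub> v N"
        by (rule R.comp_assoc[OF v[OF N(1)] Fh[OF Hh[OF g]] Fh[OF b[OF N(2)]], symmetric])
      also have "\<dots> = (FA (GA g) \<cdot>\<^bsub>R\<^esub> FA (b N)) \<cdot>\<^bsub>R\<^esub> v N"
        by (simp only: Fc[OF Hh[OF g] b[OF N(2)], symmetric] bn[OF g, symmetric] Fc[OF b[OF N(1)] Gh[OF g]])
      also have "\<dots> = FA (GA g) \<cdot>\<^bsub>R\<^esub> (FA (b N) \<cdot>\<^bsub>R\<^esub> v N)"
        by (rule R.comp_assoc[OF v[OF N(1)] Fh[OF b[OF N(1)]] Fh[OF Gh[OF g]]])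
      finally show ?thesis .
    qed
    show "f \<cdot>\<^bsub>E\<^esub> (w P \<cdot>\<^bsub>E\<^esub> a (FO P)) = (w Q \<cdot>\<^bsub>E\<^esub> a (FO Q)) \<cdot>\<^bsub>E\<^esub> GA (FA f)" if f: "f \<in> hom E P Q" for f P Q
    proof -
      have P: "P \<in> Ob E" "Q \<in> Ob E" using E.homD[OF f] by auto
      have "f \<cdot>\<^bsub>E\<^esub> (w P \<cdot>\<^bsub>E\<^esub> a (FO P)) = (w Q \<cdot>\<^bsub>E\<^esub> HA (FA f)) \<cdot>\<^bsub>E\<^esub> a (FO P)"
        by (simp only: E.comp_assoc[OF a[OF Fo[OF P(1)]] w[OF P(1)] f, symmetric] wn[OF f])
      also have "\<dots> = w Q \<cdot>\<^bsub>E\<^esub> (a (FO Q) \<cdot>\<^bsub>E\<^esub> GA (FA f))"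
        by (simp only: E.comp_assoc[OF a[OF Fo[OF P(1)]] Hh[OF Fh[OF f]] w[OF P(2)]] an[OF Fh[OF f]])
      also have "\<dots> = (w Q \<cdot>\<^bsub>E\<^esub> a (FO Q)) \<cdot>\<^bsub>E\<^esub> GA (FA f)"
        by (rule E.comp_assoc[OF Gh[OF Fh[OF f]] a[OF Fo[OF P(2)]] w[OF P(2)], symmetric])
      finally show ?thesis .
    qed
    show "(w (GO N) \<cdot>\<^bsub>E\<^esub> a (FO (GO N))) \<cdot>\<^bsub>E\<^esub> GA (FA (b N) \<cdot>\<^bsub>R\<^esub> v N) = Id E (GO N)" if N: "N \<in> Ob R" for N
    proof -
      note bN = b[OF N] and vN = v[OF N] and aN = a[OF N] and GN = Go[OF N] and HN = Ho[OF N]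
      have "(w (GO N) \<cdot>\<^bsub>E\<^esub> a (FO (GO N))) \<cdot>\<^bsub>E\<^esub> GA (FA (b N) \<cdot>\<^bsub>R\<^esub> v N) =
          (w (GO N) \<cdot>\<^bsub>E\<^esub> a (FO (GO N))) \<cdot>\<^bsub>E\<^esub> (GA (FA (b N)) \<cdot>\<^bsub>E\<^esub> GA (v N))"
        by (simp only: Gc[OF vN Fh[OF bN]])
      also have "\<dots> = ((w (GO N) \<cdot>\<^bsub>E\<^esub> a (FO (GO N))) \<cdot>\<^bsub>E\<^esub> GA (FA (b N))) \<cdot>\<^bsub>E\<^esub> GA (v N)"
        by (rule E.comp_assoc[OF Gh[OF vN] Gh[OF Fh[OF bN]] w2[OF GN], symmetric])
      also have "\<dots> = (w (GO N) \<cdot>\<^bsub>E\<^esub> (HA (FA (b N)) \<cdot>\<^bsub>E\<^esub> a (FO (HO N)))) \<cdot>\<^bsub>E\<^esub> GA (v N)"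
        by (simp only: E.comp_assoc[OF Gh[OF Fh[OF bN]] a[OF Fo[OF GN]] w[OF GN]] an[OF Fh[OF bN]])
      also have "\<dots> = ((b N \<cdot>\<^bsub>E\<^esub> w (HO N)) \<cdot>\<^bsub>E\<^esub> a (FO (HO N))) \<cdot>\<^bsub>E\<^esub> GA (v N)"
        by (simp only: E.comp_assoc[OF a[OF Fo[OF HN]] Hh[OF Fh[OF bN]] w[OF GN], symmetric] wn[OF bN])
      also have "\<dots> = (b N \<cdot>\<^bsub>E\<^esub> w (HO N)) \<cdot>\<^bsub>E\<^esub> (HA (v N) \<cdot>\<^bsub>E\<^esub> a N)"
        by (simp only: E.comp_assoc[OF Gh[OF vN] a[OF Fo[OF HN]] E.comp_in_hom[OF w[OF HN] bN]] an[OF vN])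
      also have "\<dots> = b N \<cdot>\<^bsub>E\<^esub> (w (HO N) \<cdot>\<^bsub>E\<^esub> (HA (v N) \<cdot>\<^bsub>E\<^esub> a N))"
        by (rule E.comp_assoc[OF E.comp_in_hom[OF aN Hh[OF vN]] w[OF HN] bN])
      also have "\<dots> = b N \<cdot>\<^bsub>E\<^esub> ((w (HO N) \<cdot>\<^bsub>E\<^esub> HA (v N)) \<cdot>\<^bsub>E\<^esub> a N)"
        by (simp only: E.comp_assoc[OF aN Hh[OF vN] w[OF HN]])
      also have "\<dots> = Id E (GO N)"
        by (simp only: s1[OF N] E.Id_comp[OF aN] ba[OF N])
      finally show ?thesis .
    qed
    show "FA (w P \<cdot>\<^bsub>E\<^esub> a (FO P)) \<cdot>\<^bsub>R\<^esub> (FA (b (FO P)) \<cdot>\<^bsub>R\<^esub> v (FO P)) = Id R (FO P)" if P: "P \<in> Ob E" for P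
    proof -
      note FP = Fo[OF P]
      have "FA (w P \<cdot>\<^bsub>E\<^esub> a (FO P)) \<cdot>\<^bsub>R\<^esub> (FA (b (FO P)) \<cdot>\<^bsub>R\<^esub> v (FO P)) =
          (FA (w P \<cdot>\<^bsub>E\<^esub> a (FO P)) \<cdot>\<^bsub>R\<^esub> FA (b (FO P))) \<cdot>\<^bsub>R\<^esub> v (FO P)"
        by (rule R.comp_assoc[OF v[OF FP] Fh[OF b[OF FP]] Fh[OF w2[OF P]], symmetric])
      also have "\<dots> = FA ((w P \<cdot>\<^bsub>E\<^esub> a (FO P)) \<cdot>\<^bsub>E\<^esub> b (FO P)) \<cdot>\<^bsub>R\<^esub> v (FO P)"
        by (simp only: Fc[OF b[OF FP] w2[OF P]])
      also have "\<dots> = FA (w P) \<cdot>\<^bsub>R\<^esub> v (FO P)"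
        by (simp only: E.comp_assoc[OF b[OF FP] a[OF FP] w[OF P]] ab[OF FP] E.comp_Id[OF w[OF P]])
      finally show ?thesis by (simp only: s2[OF P])
    qed
  qed
qed

section \<open>The forgetful functor\<close>

context algebra_in
begin

abbreviation "R \<equiv> right_modules C A m \<eta>"

lemma R_hom: "G \<in> hom R (M, \<mu>) (N, \<mu>') \<longleftrightarrow> (\<exists>f. G = ((M, \<mu>), f, (N, \<mu>')) \<and>
    right_module C A m \<eta> M \<mu> \<and> right_module C A m \<eta> N \<mu>' \<and> f \<in> hom C M N \<and> f \<cdot> \<mu> = \<mu>' \<cdot> (f \<rhd> A))"
  by (cases G) (auto simp: right_modules_def hom_def right_linear_def)

lemma R_simps [simp]:
  "(M, \<mu>) \<in> Ob R \<longleftrightarrow> right_module C A m \<eta> M \<mu>"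
  "(Q', g, S) \<cdot>\<^bsub>R\<^esub> (P, f, Q) = (P, g \<cdot> f, S)"
  "Id R (M, \<mu>) = ((M, \<mu>), Id C M, (M, \<mu>))"
  "Dom R (P, f, Q) = P" "Cod R (P, f, Q) = Q"
  by (auto simp: right_modules_def)

lemma R_category: "is_category R"
  unfolding is_category_def
proof (intro conjI ballI impI)
  fix P assume "P \<in> Ob R"
  then show "Id R P \<in> hom R P P"
    by (cases P) (auto simp: R_hom right_module_def lwhisker_def rwhisker_def Id_tenA A_in_Ob comp_Id Id_comp
        intro!: Id_in_hom)
next
  fix F assume "F \<in> Ar R"
  then obtain M \<mu> f N \<mu>' where F: "F = ((M, \<mu>), f, (N, \<mu>'))"
    and M: "right_module C A m \<eta> M \<mu>" and N: "right_module C A m \<eta> N \<mu>'" and f: "f \<in> hom C M N" "f \<cdot> \<mu> = \<mu>' \<cdot> (f \<rhd> A)"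
    by (auto simp: right_modules_def right_linear_def)
  show "Dom R F \<in> Ob R" "Cod R F \<in> Ob R" using F M N by simp_all
  show "F \<cdot>\<^bsub>R\<^esub> Id R (Dom R F) = F" "Id R (Cod R F) \<cdot>\<^bsub>R\<^esub> F = F"
    using F f(1) by (simp_all add: comp_Id Id_comp)
  fix G assume "G \<in> Ar R"
  then obtain M\<^sub>1 \<mu>\<^sub>1 g L \<mu>\<^sub>2 where G: "G = ((M\<^sub>1, \<mu>\<^sub>1), g, (L, \<mu>\<^sub>2))"
    and M': "right_module C A m \<eta> M\<^sub>1 \<mu>\<^sub>1" and L: "right_module C A m \<eta> L \<mu>\<^sub>2" and g: "g \<in> hom C M\<^sub>1 L" "g \<cdot> \<mu>\<^sub>1 = \<mu>\<^sub>2 \<cdot> (g \<rhd> A)"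
    by (auto simp: right_modules_def right_linear_def)
  show "G \<cdot>\<^bsub>R\<^esub> F \<in> hom R (Dom R F) (Cod R G)" if "Dom R G = Cod R F"
  proof -
    have ob: "M \<in> Ob C" "N \<in> Ob C" "L \<in> Ob C" and h: "\<mu> \<in> hom C (M \<otimes> A) M" "\<mu>' \<in> hom C (N \<otimes> A) N" "\<mu>\<^sub>2 \<in> hom C (L \<otimes> A) L"
      and hf: "f \<in> hom C M N" and fl: "f \<cdot> \<mu> = \<mu>' \<cdot> (f \<rhd> A)"
      and hg: "g \<in> hom C N L" and gl: "g \<cdot> \<mu>' = \<mu>\<^sub>2 \<cdot> (g \<rhd> A)"
      using M N L F G f g that right_moduleD by auto
    have "g \<cdot> f \<cdot> \<mu> = \<mu>\<^sub>2 \<cdot> ((g \<cdot> f) \<rhd> A)"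
      by (rule diagram2[OF fl gl, where S = "[Apply 0 0 0, Apply 1 1 0]"], (rule reads arrows | fact)+,
      simp add: run_simps)
    then show ?thesis using F G that M L comp_in_hom[OF hf hg] by (auto simp: R_hom)
  qed
  fix H assume "H \<in> Ar R"
  then obtain P h Q where H: "H = (P, h, Q)" "h \<in> hom C (fst P) (fst Q)"
    by (auto simp: right_modules_def)
  show "(H \<cdot>\<^bsub>R\<^esub> G) \<cdot>\<^bsub>R\<^esub> F = H \<cdot>\<^bsub>R\<^esub> (G \<cdot>\<^bsub>R\<^esub> F)" if "Dom R G = Cod R F \<and> Dom R H = Cod R G"
    using that F G H f(1) g(1) by (auto intro: comp_assoc)
qed

end

context dual_cowreath
begin

lemma E_hom: "G \<in> hom E (M, \<mu>, \<rho>) (N, \<mu>', \<rho>') \<longleftrightarrow> (\<exists>f. G = ((M, \<mu>, \<rho>), f, (N, \<mu>', \<rho>')) \<and>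
    entwined M \<mu> \<rho> \<and> entwined N \<mu>' \<rho>' \<and>
    f \<in> hom C M N \<and> f \<cdot> \<mu> = \<mu>' \<cdot> (f \<rhd> A) \<and> (f \<rhd> X) \<cdot> \<rho> = \<rho>' \<cdot> f)"
  by (cases G) (auto simp: hom_def entwined_modules_def right_linear_def)

lemma E_ArE:
  assumes "F \<in> Ar E"
  obtains M \<mu> \<rho> f N \<mu>' \<rho>' where "F = ((M, \<mu>, \<rho>), f, (N, \<mu>', \<rho>'))"
    "entwined M \<mu> \<rho>" "entwined N \<mu>' \<rho>'"
    "f \<in> hom C M N" "f \<cdot> \<mu> = \<mu>' \<cdot> (f \<rhd> A)" "(f \<rhd> X) \<cdot> \<rho> = \<rho>' \<cdot> f"
  using assms by (auto simp: entwined_modules_def right_linear_def)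

lemma E_category: "is_category E"
  unfolding is_category_def
proof (intro conjI ballI impI)
  fix P assume P: "P \<in> Ob E"
  obtain M \<mu> \<rho> where M: "P = (M, \<mu>, \<rho>)" by (cases P)
  have e: "entwined M \<mu> \<rho>" using P M by (simp add: entwined_simps)
  have h: "M \<in> Ob C" "\<mu> \<in> hom C (M \<otimes> A) M" "\<rho> \<in> hom C M (M \<otimes> X)"
    using entwined_moduleD[OF e] by simp_all
  have "Id C M \<cdot> \<mu> = \<mu> \<cdot> (Id C M \<rhd> A)"
    by (rule diagram0[where S = "[]"], (rule reads arrows | fact)+, simp add: run_simps)
  moreover have "(Id C M \<rhd> X) \<cdot> \<rho> = \<rho> \<cdot> Id C M"
    by (rule diagram0[where S = "[]"], (rule reads arrows | fact)+, simp add: run_simps)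
  ultimately show "Id E P \<in> hom E P P"
    using e Id_in_hom[OF h(1)] unfolding M entwined_simps E_hom by simp
next
  fix F assume "F \<in> Ar E"
  then obtain M \<mu> \<rho> f N \<mu>' \<rho>' where F: "F = ((M, \<mu>, \<rho>), f, (N, \<mu>', \<rho>'))"
    and M: "entwined M \<mu> \<rho>" and N: "entwined N \<mu>' \<rho>'"
    and f: "f \<in> hom C M N" "f \<cdot> \<mu> = \<mu>' \<cdot> (f \<rhd> A)" "(f \<rhd> X) \<cdot> \<rho> = \<rho>' \<cdot> f"
    by (rule E_ArE)
  show "Dom E F \<in> Ob E" "Cod E F \<in> Ob E" using F M N by (simp_all add: entwined_simps)
  show "F \<cdot>\<^bsub>E\<^esub> Id E (Dom E F) = F" "Id E (Cod E F) \<cdot>\<^bsub>E\<^esub> F = F"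
    using F f(1) by (simp_all add: entwined_simps comp_Id Id_comp)
  fix G assume "G \<in> Ar E"
  then obtain M\<^sub>1 \<mu>\<^sub>1 \<rho>\<^sub>1 g L \<mu>\<^sub>2 \<rho>\<^sub>2 where G: "G = ((M\<^sub>1, \<mu>\<^sub>1, \<rho>\<^sub>1), g, (L, \<mu>\<^sub>2, \<rho>\<^sub>2))"
    and M1: "entwined M\<^sub>1 \<mu>\<^sub>1 \<rho>\<^sub>1" and L: "entwined L \<mu>\<^sub>2 \<rho>\<^sub>2"
    and g: "g \<in> hom C M\<^sub>1 L" "g \<cdot> \<mu>\<^sub>1 = \<mu>\<^sub>2 \<cdot> (g \<rhd> A)" "(g \<rhd> X) \<cdot> \<rho>\<^sub>1 = \<rho>\<^sub>2 \<cdot> g"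
    by (rule E_ArE)
  show "G \<cdot>\<^bsub>E\<^esub> F \<in> hom E (Dom E F) (Cod E G)" if "Dom E G = Cod E F"
  proof -
    have ob: "M \<in> Ob C" "N \<in> Ob C" "L \<in> Ob C"
      and h: "\<mu> \<in> hom C (M \<otimes> A) M" "\<mu>' \<in> hom C (N \<otimes> A) N" "\<mu>\<^sub>2 \<in> hom C (L \<otimes> A) L"
        "\<rho> \<in> hom C M (M \<otimes> X)" "\<rho>' \<in> hom C N (N \<otimes> X)" "\<rho>\<^sub>2 \<in> hom C L (L \<otimes> X)"
      and hf: "f \<in> hom C M N" and fl: "f \<cdot> \<mu> = \<mu>' \<cdot> (f \<rhd> A)" and fc: "(f \<rhd> X) \<cdot> \<rho> = \<rho>' \<cdot> f"
      and hg: "g \<in> hom C N L" and gl: "g \<cdot> \<mu>' = \<mu>\<^sub>2 \<cdot> (g \<rhd> A)" and gc: "(g \<rhd> X) \<cdot> \<rho>' = \<rho>\<^sub>2 \<cdot> g"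
      using M N L F G f g that entwined_moduleD by (auto simp: entwined_simps)
    have "g \<cdot> f \<cdot> \<mu> = \<mu>\<^sub>2 \<cdot> ((g \<cdot> f) \<rhd> A)"
      by (rule diagram2[OF fl gl, where S = "[Apply 0 0 0, Apply 1 1 0]"], (rule reads arrows | fact)+,
      simp add: run_simps)
    moreover have "((g \<cdot> f) \<rhd> X) \<cdot> \<rho> = \<rho>\<^sub>2 \<cdot> (g \<cdot> f)"
      by (rule diagram2[OF fc gc, where S = "[Apply 0 0 0, Apply 1 1 0]"], (rule reads arrows | fact)+,
      simp add: run_simps)
    ultimately show ?thesis using M L comp_in_hom[OF hf hg] unfolding F G entwined_simps E_hom by simp
  qed
  fix H assume "H \<in> Ar E"
  then obtain M\<^sub>3 \<mu>\<^sub>3 \<rho>\<^sub>3 h K \<mu>\<^sub>4 \<rho>\<^sub>4 where H: "H = ((M\<^sub>3, \<mu>\<^sub>3, \<rho>\<^sub>3), h, (K, \<mu>\<^sub>4, \<rho>\<^sub>4))" and h: "h \<in> hom C M\<^sub>3 K"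
    by (rule E_ArE)
  show "(H \<cdot>\<^bsub>E\<^esub> G) \<cdot>\<^bsub>E\<^esub> F = H \<cdot>\<^bsub>E\<^esub> (G \<cdot>\<^bsub>E\<^esub> F)" if "Dom E G = Cod E F \<and> Dom E H = Cod E G"
    using that F G H f(1) g(1) h by (auto simp: entwined_simps intro: comp_assoc)
qed

lemma forget_simps [simp]:
  "forget_object (M, \<mu>, \<rho>) = (M, \<mu>)"
  "forget_arrow (P, f, Q) = (forget_object P, f, forget_object Q)"
  by (simp_all add: forget_object_def forget_arrow_def)

lemma forget_functor: "is_functor E R forget_object forget_arrow"
  unfolding is_functor_def
proof (intro conjI ballI impI)
  fix P assume "P \<in> Ob E"
  then show "forget_object P \<in> Ob R" "forget_arrow (Id E P) = Id R (forget_object P)"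
    by (cases P; simp add: entwined_simps entwined_module_def)+
next
  fix F assume "F \<in> Ar E"
  then show "forget_arrow F \<in> hom R (forget_object (Dom E F)) (forget_object (Cod E F))"
    by (rule E_ArE) (auto simp: R_hom entwined_simps entwined_module_def)
  fix G assume "G \<in> Ar E"
  obtain P f Q P' g Q' where "F = (P, f, Q)" "G = (P', g, Q')" by (cases F; cases G)
  then show "forget_arrow (G \<cdot>\<^bsub>E\<^esub> F) = forget_arrow G \<cdot>\<^bsub>R\<^esub> forget_arrow F"
    by (simp add: entwined_simps)
qed

definition cofree_object :: "'o \<times> 'a \<Rightarrow> 'o \<times> 'a \<times> 'a" where
  "cofree_object = (\<lambda>(M, \<mu>). (M \<otimes> X, (\<mu> \<rhd> X) \<cdot> (M \<lhd> \<psi>), (\<mu> \<rhd> X \<otimes> X) \<cdot> (M \<lhd> \<delta>)))"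

definition cofree_arrow :: "('o \<times> 'a) \<times> 'a \<times> ('o \<times> 'a) \<Rightarrow> ('o \<times> 'a \<times> 'a) \<times> 'a \<times> ('o \<times> 'a \<times> 'a)" where
  "cofree_arrow = (\<lambda>(P, f, Q). (cofree_object P, f \<rhd> X, cofree_object Q))"

lemma cofree_simps [simp]:
  "cofree_object (M, \<mu>) = (M \<otimes> X, (\<mu> \<rhd> X) \<cdot> (M \<lhd> \<psi>), (\<mu> \<rhd> X \<otimes> X) \<cdot> (M \<lhd> \<delta>))"
  "cofree_arrow (P, f, Q) = (cofree_object P, f \<rhd> X, cofree_object Q)"
  by (simp_all add: cofree_object_def cofree_arrow_def)

lemma cofree_functor: "is_functor R E cofree_object cofree_arrow"
  unfolding is_functor_def
proof (intro conjI ballI impI)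
  fix P assume P: "P \<in> Ob R"
  obtain M \<mu> where M: "P = (M, \<mu>)" by (cases P)
  with P have r: "right_module C A m \<eta> M \<mu>" by simp
  show "cofree_object P \<in> Ob E"
    unfolding M entwined_simps cofree_simps fst_conv snd_conv by (rule entwined_module_cofree[OF r])
  have "Id C M \<rhd> X = Id C (M \<otimes> X)"
    unfolding rwhisker_def by (rule Id_tenA[OF right_moduleD(1)[OF r] X_in_Ob])
  then show "cofree_arrow (Id R P) = Id E (cofree_object P)"
    unfolding M R_simps entwined_simps cofree_simps fst_conv by simp
next
  fix F assume "F \<in> Ar R"
  then obtain M \<mu> f N \<mu>' where F: "F = ((M, \<mu>), f, (N, \<mu>'))"
    and M: "right_module C A m \<eta> M \<mu>" and N: "right_module C A m \<eta> N \<mu>'" and f: "f \<in> hom C M N" "f \<cdot> \<mu> = \<mu>' \<cdot> (f \<rhd> A)"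
    by (auto simp: right_modules_def right_linear_def)
  show "cofree_arrow F \<in> hom E (cofree_object (Dom R F)) (cofree_object (Cod R F))"
  proof -
    have ob: "M \<in> Ob C" "N \<in> Ob C" and h: "\<mu> \<in> hom C (M \<otimes> A) M" "\<mu>' \<in> hom C (N \<otimes> A) N"
      and hf: "f \<in> hom C M N" and fl: "f \<cdot> \<mu> = \<mu>' \<cdot> (f \<rhd> A)"
      using right_moduleD(1,2)[OF M] right_moduleD(1,2)[OF N] f by simp_all
    have "(f \<rhd> X) \<cdot> ((\<mu> \<rhd> X) \<cdot> (M \<lhd> \<psi>)) = (\<mu>' \<rhd> X) \<cdot> (N \<lhd> \<psi>) \<cdot> ((f \<rhd> X) \<rhd> A)"
      by (rule diagram1[OF fl, where S = "[Apply 0 1 0, Left 0]"], (rule reads arrows | fact)+, simp add: run_simps)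
    moreover have "((f \<rhd> X) \<rhd> X) \<cdot> ((\<mu> \<rhd> X \<otimes> X) \<cdot> (M \<lhd> \<delta>)) = (\<mu>' \<rhd> X \<otimes> X) \<cdot> (N \<lhd> \<delta>) \<cdot> (f \<rhd> X)"
      by (rule diagram1[OF fl, where S = "[Apply 0 1 0, Left 0]"], (rule reads arrows | fact)+, simp add: run_simps)
    moreover have "f \<rhd> X \<in> hom C (M \<otimes> X) (N \<otimes> X)"
      by (rule in_hom, (rule reads arrows | fact)+)
    ultimately show ?thesis
      using entwined_module_cofree[OF M] entwined_module_cofree[OF N] unfolding F cofree_simps R_simps E_hom by blast
  qed
  fix G assume "G \<in> Ar R"
  then obtain P L \<mu>\<^sub>2 g where G: "G = (P, g, (L, \<mu>\<^sub>2))" "g \<in> hom C (fst P) L" "right_module C A m \<eta> L \<mu>\<^sub>2"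
    by (auto simp: right_modules_def)
  show "cofree_arrow (G \<cdot>\<^bsub>R\<^esub> F) = cofree_arrow G \<cdot>\<^bsub>E\<^esub> cofree_arrow F" if "Dom R G = Cod R F"
  proof -
    have ob: "M \<in> Ob C" "N \<in> Ob C" "L \<in> Ob C" and hf: "f \<in> hom C M N" and hg: "g \<in> hom C N L"
      using that F G M N f(1) right_moduleD(1) by auto
    have "(g \<cdot> f) \<rhd> X = (g \<rhd> X) \<cdot> (f \<rhd> X)"
      by (rule diagram0[where S = "[]"], (rule reads arrows | fact)+, simp add: run_simps)
    then show ?thesis unfolding F G cofree_simps R_simps entwined_simps by simp
  qed
qed

text \<open>The coaction is the unit and \<open>\<mu> \<cdot> (M \<lhd> \<epsilon>)\<close> the
  counit. One triangle identity is the counit axiom of entwined modules, the other comes from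
  \<open>counit_left\<close>.\<close>

lemma forget_cofree_adjunction: "is_adjunction E R forget_object forget_arrow cofree_object cofree_arrow"
proof (rule is_adjunctionI[where u = "\<lambda>(M, \<mu>, \<rho>). ((M, \<mu>, \<rho>), \<rho>, cofree_object (M, \<mu>))"
      and c = "\<lambda>(M, \<mu>). (forget_object (cofree_object (M, \<mu>)), \<mu> \<cdot> (M \<lhd> \<epsilon>), (M, \<mu>))",
      OF E_category R_category forget_functor cofree_functor], goal_cases)
  case (1 P)
  obtain M \<mu> \<rho> where P: "P = (M, \<mu>, \<rho>)" by (cases P)
  then have e: "entwined M \<mu> \<rho>" using 1 by (simp add: entwined_simps)
  then have "right_module C A m \<eta> M \<mu>" by (simp add: entwined_module_def)
  then show ?case
    using e entwined_module_cofree[of M \<mu>] entwined_moduleD[OF e]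
    unfolding P prod.case forget_simps cofree_simps E_hom by blast
next
  case (2 F P Q)
  obtain M \<mu> \<rho> N \<mu>' \<rho>' where "P = (M, \<mu>, \<rho>)" "Q = (N, \<mu>', \<rho>')" by (cases P; cases Q)
  then show ?case using 2 by (auto simp: E_hom entwined_simps)
next
  case (3 N)
  obtain M \<mu> where N: "N = (M, \<mu>)" by (cases N)
  with 3 have r: "right_module C A m \<eta> M \<mu>" by simp
  have ob: "M \<in> Ob C" and h: "\<mu> \<in> hom C (M \<otimes> A) M"
    and mu_assoc: "\<mu> \<cdot> (\<mu> \<rhd> A) = \<mu> \<cdot> (M \<lhd> m)"
    using right_moduleD[OF r] by simp_all
  have "\<mu> \<cdot> (M \<lhd> \<epsilon>) \<cdot> ((\<mu> \<rhd> X) \<cdot> (M \<lhd> \<psi>)) = \<mu> \<cdot> ((\<mu> \<cdot> (M \<lhd> \<epsilon>)) \<rhd> A)"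
    by (rule diagram2[OF mu_assoc epsilon_central, where S = "[Right 1, Apply 0 2 0, Apply 1 0 1, Undo 0 1 0]"],
      (rule reads arrows | fact)+, simp add: run_simps)
  moreover have "\<mu> \<cdot> (M \<lhd> \<epsilon>) \<in> hom C (M \<otimes> X) M"
    by (rule in_hom, (rule reads arrows | fact)+)
  moreover have "right_module C A m \<eta> (M \<otimes> X) ((\<mu> \<rhd> X) \<cdot> (M \<lhd> \<psi>))"
    using entwined_module_cofree[OF r] by (simp add: entwined_module_def)
  ultimately show ?case using r unfolding N prod.case forget_simps cofree_simps R_hom by blast
next
  case (4 F P Q)
  obtain M \<mu> N \<mu>' where PQ: "P = (M, \<mu>)" "Q = (N, \<mu>')" by (cases P; cases Q)
  with 4 obtain f where F: "F = ((M, \<mu>), f, (N, \<mu>'))" and M: "right_module C A m \<eta> M \<mu>" and N: "right_module C A m \<eta> N \<mu>'"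
    and hf: "f \<in> hom C M N" and fl: "f \<cdot> \<mu> = \<mu>' \<cdot> (f \<rhd> A)" by (auto simp: R_hom)
  have ob: "M \<in> Ob C" "N \<in> Ob C" and h: "\<mu> \<in> hom C (M \<otimes> A) M" "\<mu>' \<in> hom C (N \<otimes> A) N"
    using M N right_moduleD by auto
  have "f \<cdot> (\<mu> \<cdot> (M \<lhd> \<epsilon>)) = \<mu>' \<cdot> (N \<lhd> \<epsilon>) \<cdot> (f \<rhd> X)"
    by (rule diagram1[OF fl, where S = "[Apply 0 1 0, Left 0]"], (rule reads arrows | fact)+, simp add: run_simps)
  then show ?case by (simp add: PQ F)
next
  case (5 P)
  then show ?case by (cases P) (simp add: entwined_simps entwined_moduleD)
next
  case (6 N)
  obtain M \<mu> where N: "N = (M, \<mu>)" by (cases N)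
  with 6 have r: "right_module C A m \<eta> M \<mu>" by simp
  have ob: "M \<in> Ob C" and h: "\<mu> \<in> hom C (M \<otimes> A) M"
    and mu_assoc: "\<mu> \<cdot> (\<mu> \<rhd> A) = \<mu> \<cdot> (M \<lhd> m)" and mu_unit: "\<mu> \<cdot> (M \<lhd> \<eta>) = Id C M"
    using right_moduleD[OF r] by simp_all
  have "((\<mu> \<cdot> (M \<lhd> \<epsilon>)) \<rhd> X) \<cdot> ((\<mu> \<rhd> X \<otimes> X) \<cdot> (M \<lhd> \<delta>)) = Id C (M \<otimes> X)"
    by (rule diagram3[OF mu_assoc counit_left mu_unit, where S = "[Right 1, Apply 0 2 0, Apply 1 0 1,
      Apply 2 0 0]"], (rule reads arrows | fact)+, simp add: run_simps)
  then show ?case by (simp add: N entwined_simps)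
qed

abbreviation "P9 \<equiv> frobenius_functor E R forget_object forget_arrow"

lemma P9_iff: "P9 \<longleftrightarrow> is_adjunction R E cofree_object cofree_arrow forget_object forget_arrow"
  using forget_cofree_adjunction adjunction_transfer[OF E_category R_category forget_cofree_adjunction]
  unfolding frobenius_functor_def by blast

text \<open>The unit inserts \<open>t\<close> and the counit contracts a coaction with
  \<open>B\<close>. Centrality gives right linearity of both, the Casimir law gives colinearity of
  the counit, and each triangle identity uses one of the two unit conditions.\<close>

lemma P1_imp_P9:
  assumes "P1"
  shows "P9"
proof -
  obtain t B where t: "central_element t" and B: "central_form B" and "casimir_form B"
    and u1: "m \<cdot> (A \<lhd> B) \<cdot> (t \<rhd> X) = \<epsilon>" and u2: "m \<cdot> (A \<lhd> B) \<cdot> ((\<psi> \<rhd> X) \<cdot> (X \<lhd> t)) = \<epsilon>"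
    using assms unfolding P1_iff_frobenius_system by blast
  have ht: "t \<in> hom C \<one> (A \<otimes> X)" and hB: "B \<in> hom C (X \<otimes> X) A"
    and ct: "(m \<rhd> X) \<cdot> (A \<lhd> t) = (m \<rhd> X) \<cdot> (A \<lhd> \<psi>) \<cdot> (t \<rhd> A)"
    and cB: "m \<cdot> (A \<lhd> B) \<cdot> ((\<psi> \<rhd> X) \<cdot> (X \<lhd> \<psi>)) = m \<cdot> (B \<rhd> A)"
    and cas: "(m \<rhd> X) \<cdot> (A \<lhd> \<psi>) \<cdot> (A \<otimes> X \<lhd> B) \<cdot> (\<delta> \<rhd> X) = (m \<rhd> X) \<cdot> (A \<lhd> B \<rhd> X) \<cdot> (\<psi> \<rhd> X \<otimes> X) \<cdot> (X \<lhd> \<delta>)"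
    using t B \<open>casimir_form B\<close> by (simp_all add: central_element_iff central_form_iff casimir_form_def)
  have "is_adjunction R E cofree_object cofree_arrow forget_object forget_arrow"
  proof (rule is_adjunctionI[where c = "\<lambda>(M, \<mu>, \<rho>). (cofree_object (M, \<mu>), \<mu> \<cdot> (M \<lhd> B) \<cdot> (\<rho> \<rhd> X), (M, \<mu>, \<rho>))"
      and u = "\<lambda>(M, \<mu>). ((M, \<mu>), (\<mu> \<rhd> X) \<cdot> (M \<lhd> t), forget_object (cofree_object (M, \<mu>)))",
      OF R_category E_category cofree_functor forget_functor], goal_cases)
    case (1 N)
    obtain M \<mu> where N: "N = (M, \<mu>)" by (cases N)
    with 1 have r: "right_module C A m \<eta> M \<mu>" by simp
    have ob: "M \<in> Ob C" and h: "\<mu> \<in> hom C (M \<otimes> A) M"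
      and mu_assoc: "\<mu> \<cdot> (\<mu> \<rhd> A) = \<mu> \<cdot> (M \<lhd> m)"
      using right_moduleD[OF r] by simp_all
    have "(\<mu> \<rhd> X) \<cdot> (M \<lhd> t) \<cdot> \<mu> = (\<mu> \<rhd> X) \<cdot> (M \<lhd> \<psi>) \<cdot> (((\<mu> \<rhd> X) \<cdot> (M \<lhd> t)) \<rhd> A)"
      by (rule diagram2[OF mu_assoc ct, where S = "[Right 0, Apply 0 1 0, Apply 1 0 1, Undo 0 2 0, Left 1]"],
      (rule reads arrows | fact)+, simp add: run_simps)
    moreover have "(\<mu> \<rhd> X) \<cdot> (M \<lhd> t) \<in> hom C M (M \<otimes> X)"
      by (rule in_hom, (rule reads arrows | fact)+)
    moreover have "right_module C A m \<eta> (M \<otimes> X) ((\<mu> \<rhd> X) \<cdot> (M \<lhd> \<psi>))"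
      using entwined_module_cofree[OF r] by (simp add: entwined_module_def)
    ultimately show ?case using r unfolding N prod.case forget_simps cofree_simps R_hom by blast
  next
    case (2 F P Q)
    obtain M \<mu> N \<mu>' where PQ: "P = (M, \<mu>)" "Q = (N, \<mu>')" by (cases P; cases Q)
    with 2 obtain f where F: "F = ((M, \<mu>), f, (N, \<mu>'))" and M: "right_module C A m \<eta> M \<mu>" and N: "right_module C A m \<eta> N \<mu>'"
      and hf: "f \<in> hom C M N" and fl: "f \<cdot> \<mu> = \<mu>' \<cdot> (f \<rhd> A)" by (auto simp: R_hom)
    have ob: "M \<in> Ob C" "N \<in> Ob C" and h: "\<mu> \<in> hom C (M \<otimes> A) M" "\<mu>' \<in> hom C (N \<otimes> A) N"
      using M N right_moduleD by auto
    have "(\<mu>' \<rhd> X) \<cdot> (N \<lhd> t) \<cdot> f = (f \<rhd> X) \<cdot> ((\<mu> \<rhd> X) \<cdot> (M \<lhd> t))"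
      by (rule diagram1[OF fl, where S = "[Right 0, Undo 0 1 0]"], (rule reads arrows | fact)+, simp add: run_simps)
    then show ?case by (simp add: PQ F)
  next
    case (3 P)
    obtain M \<mu> \<rho> where P: "P = (M, \<mu>, \<rho>)" by (cases P)
    then have e: "entwined M \<mu> \<rho>" using 3 by (simp add: entwined_simps)
    then have r: "right_module C A m \<eta> M \<mu>" by (simp add: entwined_module_def)
    have h: "M \<in> Ob C" "\<mu> \<in> hom C (M \<otimes> A) M" "\<rho> \<in> hom C M (M \<otimes> X)"
      and mu_assoc: "\<mu> \<cdot> (\<mu> \<rhd> A) = \<mu> \<cdot> (M \<lhd> m)"
      and rho_mu: "\<rho> \<cdot> \<mu> = (\<mu> \<rhd> X) \<cdot> (M \<lhd> \<psi>) \<cdot> (\<rho> \<rhd> A)"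
      and rho_rho: "(\<rho> \<rhd> X) \<cdot> \<rho> = (\<mu> \<rhd> X \<otimes> X) \<cdot> (M \<lhd> \<delta>) \<cdot> \<rho>"
      using entwined_moduleD[OF e] by simp_all
    have "\<mu> \<cdot> (M \<lhd> B) \<cdot> (\<rho> \<rhd> X) \<cdot> ((\<mu> \<rhd> X) \<cdot> (M \<lhd> \<psi>)) = \<mu> \<cdot> ((\<mu> \<cdot> (M \<lhd> B) \<cdot> (\<rho> \<rhd> X)) \<rhd> A)"
      by (rule diagram3[OF rho_mu mu_assoc cB, where S = "[Apply 0 1 0, Right 3, Apply 1 4 0, Left 0, Apply 2 1 1,
      Undo 1 2 0]"], (rule reads arrows | fact)+, simp add: run_simps)
    moreover have "((\<mu> \<cdot> (M \<lhd> B) \<cdot> (\<rho> \<rhd> X)) \<rhd> X) \<cdot> ((\<mu> \<rhd> X \<otimes> X) \<cdot> (M \<lhd> \<delta>)) = \<rho> \<cdot> (\<mu> \<cdot> (M \<lhd> B) \<cdot> (\<rho> \<rhd> X))"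
      by (rule diagram4[OF rho_mu mu_assoc cas rho_rho, where S = "[Apply 0 1 0, Right 3, Apply 1 4 0, Left 0,
      Undo 2 1 1, Undo 1 4 0, Left 3, Left 2, Undo 3 0 0, Right 1, Undo 0 2 0]"], (rule reads arrows | fact)+,
      simp add: run_simps)
    moreover have "\<mu> \<cdot> (M \<lhd> B) \<cdot> (\<rho> \<rhd> X) \<in> hom C (M \<otimes> X) M"
      by (rule in_hom, (rule reads arrows | fact)+)
    ultimately show ?case
      using e entwined_module_cofree[OF r] unfolding P prod.case forget_simps cofree_simps E_hom by blast
  next
    case (4 F P Q)
    obtain M \<mu> \<rho> N \<mu>' \<rho>' where PQ: "P = (M, \<mu>, \<rho>)" "Q = (N, \<mu>', \<rho>')" by (cases P; cases Q)
    with 4 obtain f where F: "F = ((M, \<mu>, \<rho>), f, (N, \<mu>', \<rho>'))"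
      and M: "entwined M \<mu> \<rho>" and N: "entwined N \<mu>' \<rho>'"
      and hf: "f \<in> hom C M N" and fl: "f \<cdot> \<mu> = \<mu>' \<cdot> (f \<rhd> A)" and fc: "(f \<rhd> X) \<cdot> \<rho> = \<rho>' \<cdot> f"
      by (auto simp: E_hom)
    have h: "M \<in> Ob C" "\<mu> \<in> hom C (M \<otimes> A) M" "\<rho> \<in> hom C M (M \<otimes> X)"
      and h': "N \<in> Ob C" "\<mu>' \<in> hom C (N \<otimes> A) N" "\<rho>' \<in> hom C N (N \<otimes> X)"
      using entwined_moduleD[OF M] entwined_moduleD[OF N] by simp_all
    have "f \<cdot> (\<mu> \<cdot> (M \<lhd> B) \<cdot> (\<rho> \<rhd> X)) = \<mu>' \<cdot> (N \<lhd> B) \<cdot> (\<rho>' \<rhd> X) \<cdot> (f \<rhd> X)"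
      by (rule diagram2[OF fl fc, where S = "[Apply 0 2 0, Left 1, Apply 1 0 0]"], (rule reads arrows | fact)+,
      simp add: run_simps)
    then show ?case by (simp add: PQ F entwined_simps)
  next
    case (5 N)
    obtain M \<mu> where N: "N = (M, \<mu>)" by (cases N)
    with 5 have r: "right_module C A m \<eta> M \<mu>" by simp
    have ob: "M \<in> Ob C" and h: "\<mu> \<in> hom C (M \<otimes> A) M"
      and mu_assoc: "\<mu> \<cdot> (\<mu> \<rhd> A) = \<mu> \<cdot> (M \<lhd> m)" and mu_unit: "\<mu> \<cdot> (M \<lhd> \<eta>) = Id C M"
      using right_moduleD[OF r] by simp_all
    have "(\<mu> \<rhd> X) \<cdot> (M \<lhd> \<psi>) \<cdot> (M \<otimes> X \<lhd> B) \<cdot> (((\<mu> \<rhd> X \<otimes> X) \<cdot> (M \<lhd> \<delta>)) \<rhd> X) \<cdot> (((\<mu> \<rhd> X) \<cdot> (M \<lhd> t)) \<rhd> X) = Id C (M \<otimes> X)"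
      by (rule diagram7[OF mu_assoc cas m_assoc ct u1 counit_left mu_unit, where S = "[Right 3, Right 4, Apply 0 5 0,
      Apply 1 2 1, Right 1, Right 2, Right 3, Right 4, Apply 0 5 0, Undo 2 4 1, Right 0, Left 3, Undo 3 1 1, Right 2,
      Apply 2 3 1, Apply 4 1 2, Apply 5 0 1, Apply 6 0 0]"], (rule reads arrows | fact)+, simp add: run_simps)
    then show ?case by (simp add: N entwined_simps)
  next
    case (6 P)
    obtain M \<mu> \<rho> where P: "P = (M, \<mu>, \<rho>)" by (cases P)
    then have e: "entwined M \<mu> \<rho>" using 6 by (simp add: entwined_simps)
    have h: "M \<in> Ob C" "\<mu> \<in> hom C (M \<otimes> A) M" "\<rho> \<in> hom C M (M \<otimes> X)"
      and mu_assoc: "\<mu> \<cdot> (\<mu> \<rhd> A) = \<mu> \<cdot> (M \<lhd> m)"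
      and rho_mu: "\<rho> \<cdot> \<mu> = (\<mu> \<rhd> X) \<cdot> (M \<lhd> \<psi>) \<cdot> (\<rho> \<rhd> A)"
      and mu_eps: "\<mu> \<cdot> (M \<lhd> \<epsilon>) \<cdot> \<rho> = Id C M"
      using entwined_moduleD[OF e] by simp_all
    have "\<mu> \<cdot> (M \<lhd> B) \<cdot> (\<rho> \<rhd> X) \<cdot> ((\<mu> \<rhd> X) \<cdot> (M \<lhd> t)) = Id C M"
      by (rule diagram4[OF rho_mu mu_assoc u2 mu_eps, where S = "[Apply 0 1 0, Right 3, Apply 1 4 0, Left 0,
      Apply 2 1 1, Apply 3 0 0]"], (rule reads arrows | fact)+, simp add: run_simps)
    then show ?case by (simp add: P)
  qed
  then show ?thesis unfolding P9_iff .
qed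

end

section \<open>Recovering a Frobenius system from the adjunction\<close>

context strict_monoidal
begin

lemma generatorD:
  assumes "left_tensor_generator C \<one>" "Y \<in> Ob C" "Z \<in> Ob C" "W \<in> Ob C"
    and "f \<in> hom C (Y \<otimes> Z) W" "g \<in> hom C (Y \<otimes> Z) W"
    and "\<And>h. h \<in> hom C \<one> Y \<Longrightarrow> f \<cdot> (h \<rhd> Z) = g \<cdot> (h \<rhd> Z)"
  shows "f = g"
  using assms unfolding left_tensor_generator_def by blast

end

context dual_cowreath
begin

lemma right_module_free:
  assumes "Z \<in> Ob C"
  shows "right_module C A m \<eta> (Z \<otimes> A) (Z \<lhd> m)"
proof -
  have Z: "Z \<in> Ob C" by (rule assms)
  have "(Z \<lhd> m) \<cdot> ((Z \<lhd> m) \<rhd> A) = (Z \<lhd> m) \<cdot> (Z \<otimes> A \<lhd> m)"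
    by (rule diagram1[OF m_assoc, where S = "[Apply 0 0 1]"], (rule reads arrows | fact)+, simp add: run_simps)
  moreover have "(Z \<lhd> m) \<cdot> (Z \<otimes> A \<lhd> \<eta>) = Id C (Z \<otimes> A)"
    by (rule diagram1[OF m_unit_right, where S = "[Apply 0 0 1]"], (rule reads arrows | fact)+, simp add: run_simps)
  moreover have "Z \<lhd> m \<in> hom C ((Z \<otimes> A) \<otimes> A) (Z \<otimes> A)"
    by (rule in_hom, (rule reads arrows | fact)+)
  ultimately show ?thesis
    using ten_in_Ob[OF Z A_in_Ob] unfolding right_module_def by blast
qed

lemma P9_imp_P1:
  assumes gen: "left_tensor_generator C \<one>" and "P9"
  shows "P1"
proof -
  have "is_adjunction R E cofree_object cofree_arrow forget_object forget_arrow"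
    using \<open>P9\<close> unfolding P9_iff .
  then obtain v w where v: "\<And>N. N \<in> Ob R \<Longrightarrow> v N \<in> hom R N (forget_object (cofree_object N))"
    and vn: "\<And>f N N'. f \<in> hom R N N' \<Longrightarrow> v N' \<cdot>\<^bsub>R\<^esub> f = forget_arrow (cofree_arrow f) \<cdot>\<^bsub>R\<^esub> v N"
    and w: "\<And>P. P \<in> Ob E \<Longrightarrow> w P \<in> hom E (cofree_object (forget_object P)) P"
    and wn: "\<And>f P Q. f \<in> hom E P Q \<Longrightarrow> f \<cdot>\<^bsub>E\<^esub> w P = w Q \<cdot>\<^bsub>E\<^esub> cofree_arrow (forget_arrow f)"
    and s1: "\<And>N. N \<in> Ob R \<Longrightarrow> w (cofree_object N) \<cdot>\<^bsub>E\<^esub> cofree_arrow (v N) = Id E (cofree_object N)"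
    and s2: "\<And>P. P \<in> Ob E \<Longrightarrow> forget_arrow (w P) \<cdot>\<^bsub>R\<^esub> v (forget_object P) = Id R (forget_object P)"
    by (rule is_adjunctionE) (rule that; assumption)
  define v' where "v' M \<mu> = fst (snd (v (M, \<mu>)))" for M \<mu>
  define w' where "w' M \<mu> \<rho> = fst (snd (w (M, \<mu>, \<rho>)))" for M \<mu> \<rho>
  have v_hom: "v (M, \<mu>) = ((M, \<mu>), v' M \<mu>, (M \<otimes> X, (\<mu> \<rhd> X) \<cdot> (M \<lhd> \<psi>)))"
    "v' M \<mu> \<in> hom C M (M \<otimes> X)" "v' M \<mu> \<cdot> \<mu> = (\<mu> \<rhd> X) \<cdot> (M \<lhd> \<psi>) \<cdot> (v' M \<mu> \<rhd> A)"
    if "right_module C A m \<eta> M \<mu>" for M \<mu>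
    using v[of "(M, \<mu>)"] that unfolding v'_def R_simps forget_simps cofree_simps R_hom by auto
  have v_nat: "v' N \<mu>' \<cdot> f = (f \<rhd> X) \<cdot> v' M \<mu>"
    if M: "right_module C A m \<eta> M \<mu>" and N: "right_module C A m \<eta> N \<mu>'" and "f \<in> hom C M N" "f \<cdot> \<mu> = \<mu>' \<cdot> (f \<rhd> A)" for M \<mu> N \<mu>' f
  proof -
    have "((M, \<mu>), f, (N, \<mu>')) \<in> hom R (M, \<mu>) (N, \<mu>')" using that by (auto simp: R_hom)
    from vn[OF this] show ?thesis
      unfolding v_hom(1)[OF M] v_hom(1)[OF N] R_simps forget_simps cofree_simps by simp
  qed
  have w_hom: "w (M, \<mu>, \<rho>) = ((M \<otimes> X, (\<mu> \<rhd> X) \<cdot> (M \<lhd> \<psi>), (\<mu> \<rhd> X \<otimes> X) \<cdot> (M \<lhd> \<delta>)), w' M \<mu> \<rho>, (M, \<mu>, \<rho>))"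
    "w' M \<mu> \<rho> \<in> hom C (M \<otimes> X) M" "w' M \<mu> \<rho> \<cdot> ((\<mu> \<rhd> X) \<cdot> (M \<lhd> \<psi>)) = \<mu> \<cdot> (w' M \<mu> \<rho> \<rhd> A)"
    "(w' M \<mu> \<rho> \<rhd> X) \<cdot> ((\<mu> \<rhd> X \<otimes> X) \<cdot> (M \<lhd> \<delta>)) = \<rho> \<cdot> w' M \<mu> \<rho>"
    if "entwined M \<mu> \<rho>" for M \<mu> \<rho>
    using w[of "(M, \<mu>, \<rho>)"] that unfolding w'_def entwined_simps forget_simps cofree_simps E_hom fst_conv snd_conv by auto
  have w_nat: "f \<cdot> w' M \<mu> \<rho> = w' N \<mu>' \<rho>' \<cdot> (f \<rhd> X)"
    if F: "((M, \<mu>, \<rho>), f, (N, \<mu>', \<rho>')) \<in> hom E (M, \<mu>, \<rho>) (N, \<mu>', \<rho>')" for M \<mu> \<rho> N \<mu>' \<rho>' f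
  proof -
    have M: "entwined M \<mu> \<rho>" and N: "entwined N \<mu>' \<rho>'"
      using F unfolding E_hom by blast+
    from wn[OF F] show ?thesis
      unfolding w_hom(1)[OF M] w_hom(1)[OF N] entwined_simps forget_simps cofree_simps by simp
  qed
  let ?c1 = "\<lambda>M \<mu>. (\<mu> \<rhd> X) \<cdot> (M \<lhd> \<psi>)" and ?c2 = "\<lambda>M \<mu>. (\<mu> \<rhd> X \<otimes> X) \<cdot> (M \<lhd> \<delta>)"
  have cofree_hom: "((M \<otimes> X, ?c1 M \<mu>, ?c2 M \<mu>), f \<rhd> X, (N \<otimes> X, ?c1 N \<mu>', ?c2 N \<mu>')) \<in>
      hom E (M \<otimes> X, ?c1 M \<mu>, ?c2 M \<mu>) (N \<otimes> X, ?c1 N \<mu>', ?c2 N \<mu>')"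
    if "right_module C A m \<eta> M \<mu>" "right_module C A m \<eta> N \<mu>'" "f \<in> hom C M N" "f \<cdot> \<mu> = \<mu>' \<cdot> (f \<rhd> A)" for M \<mu> N \<mu>' f
  proof -
    have "((M, \<mu>), f, (N, \<mu>')) \<in> hom R (M, \<mu>) (N, \<mu>')" using that by (auto simp: R_hom)
    from is_functorD(2)[OF cofree_functor this] show ?thesis unfolding cofree_simps .
  qed
  note A = right_module_A and GA = entwined_module_cofree[OF right_module_A]
  define va where "va = v' A m"
  define k where "k = w' (A \<otimes> X) ((m \<rhd> X) \<cdot> (A \<lhd> \<psi>)) ((m \<rhd> X \<otimes> X) \<cdot> (A \<lhd> \<delta>))"
  have va: "va \<in> hom C A (A \<otimes> X)" and va_right: "va \<cdot> m = (m \<rhd> X) \<cdot> (A \<lhd> \<psi>) \<cdot> (va \<rhd> A)"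
    using v_hom[OF A] by (simp_all add: va_def)
  have k: "k \<in> hom C ((A \<otimes> X) \<otimes> X) (A \<otimes> X)"
    and k_right: "k \<cdot> ((((m \<rhd> X) \<cdot> (A \<lhd> \<psi>)) \<rhd> X) \<cdot> (A \<otimes> X \<lhd> \<psi>)) = (m \<rhd> X) \<cdot> (A \<lhd> \<psi>) \<cdot> (k \<rhd> A)"
    and k_col: "(k \<rhd> X) \<cdot> ((((m \<rhd> X) \<cdot> (A \<lhd> \<psi>)) \<rhd> X \<otimes> X) \<cdot> (A \<otimes> X \<lhd> \<delta>)) = (m \<rhd> X \<otimes> X) \<cdot> (A \<lhd> \<delta>) \<cdot> k"
    using w_hom(2,3,4)[OF GA] unfolding k_def by blast+
  \<comment> \<open>The test morphisms: each \<open>h : \<one> \<rightarrow> Z\<close> induces a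
    right linear arrow from \<open>A\<close> to the free module \<open>Z A\<close>.\<close>
  have h_right: "(h \<rhd> A) \<cdot> m = (Z \<lhd> m) \<cdot> ((h \<rhd> A) \<rhd> A)" "h \<rhd> A \<in> hom C A (Z \<otimes> A)"
    if hZ: "Z \<in> Ob C" and hh: "h \<in> hom C \<one> Z" for Z h
  proof -
    show "(h \<rhd> A) \<cdot> m = (Z \<lhd> m) \<cdot> ((h \<rhd> A) \<rhd> A)"
      by (rule diagram0[where S = "[Left 0]"], (rule reads arrows | fact)+, simp add: run_simps)
    show "h \<rhd> A \<in> hom C A (Z \<otimes> A)"
      by (rule in_hom, (rule reads arrows | fact)+)
  qed
  \<comment> \<open>Naturality along the test morphisms and the generator property force the
    component at a free module to be a whiskering of the one at \<open>A\<close>.\<close>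
  have v_free: "v' (Z \<otimes> A) (Z \<lhd> m) = Z \<lhd> va" if Z: "Z \<in> Ob C" for Z
  proof (rule generatorD[OF gen Z A_in_Ob])
    show "Z \<otimes> A \<otimes> X \<in> Ob C" using Z A_in_Ob X_in_Ob by simp
    show "v' (Z \<otimes> A) (Z \<lhd> m) \<in> hom C (Z \<otimes> A) (Z \<otimes> A \<otimes> X)"
      using v_hom(2)[OF right_module_free[OF Z]] Z A_in_Ob X_in_Ob by (simp add: ten_assoc)
    show "Z \<lhd> va \<in> hom C (Z \<otimes> A) (Z \<otimes> A \<otimes> X)"
      by (rule in_hom, (rule reads arrows | fact)+)
    fix h assume h: "h \<in> hom C \<one> Z"
    have "(Z \<lhd> va) \<cdot> (h \<rhd> A) = ((h \<rhd> A) \<rhd> X) \<cdot> va"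
      by (rule diagram0[where S = "[Right 0]"], (rule reads arrows | fact)+, simp add: run_simps)
    then show "v' (Z \<otimes> A) (Z \<lhd> m) \<cdot> (h \<rhd> A) = (Z \<lhd> va) \<cdot> (h \<rhd> A)"
      using v_nat[OF A right_module_free[OF Z] h_right(2)[OF Z h] h_right(1)[OF Z h]] by (simp add: va_def)
  qed
  have w_free: "w' ((Z \<otimes> A) \<otimes> X) (((Z \<lhd> m) \<rhd> X) \<cdot> (Z \<otimes> A \<lhd> \<psi>)) (((Z \<lhd> m) \<rhd> X \<otimes> X) \<cdot> (Z \<otimes> A \<lhd> \<delta>)) = Z \<lhd> k"
    (is "?w = _") if Z: "Z \<in> Ob C" for Z
  proof (rule generatorD[OF gen Z])
    show "A \<otimes> X \<otimes> X \<in> Ob C" "Z \<otimes> A \<otimes> X \<in> Ob C" using Z A_in_Ob X_in_Ob by simp_all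
    show "?w \<in> hom C (Z \<otimes> A \<otimes> X \<otimes> X) (Z \<otimes> A \<otimes> X)"
      using w_hom(2)[OF entwined_module_cofree[OF right_module_free[OF Z]]] Z A_in_Ob X_in_Ob by (simp add: ten_assoc)
    show "Z \<lhd> k \<in> hom C (Z \<otimes> A \<otimes> X \<otimes> X) (Z \<otimes> A \<otimes> X)"
      by (rule in_hom, (rule reads arrows | fact)+)
    fix h assume h: "h \<in> hom C \<one> Z"
    have "(Z \<lhd> k) \<cdot> (h \<rhd> A \<otimes> X \<otimes> X) = ((h \<rhd> A) \<rhd> X) \<cdot> k"
      by (rule diagram0[where S = "[Right 0]"], (rule reads arrows | fact)+, simp add: run_simps)
    moreover have "((h \<rhd> A) \<rhd> X) \<rhd> X = h \<rhd> A \<otimes> X \<otimes> X"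
      by (rule diagram0[where S = "[]"], (rule reads arrows | fact)+, simp add: run_simps)
    ultimately show "?w \<cdot> (h \<rhd> A \<otimes> X \<otimes> X) = (Z \<lhd> k) \<cdot> (h \<rhd> A \<otimes> X \<otimes> X)"
      using w_nat[OF cofree_hom[OF A right_module_free[OF Z] h_right(2)[OF Z h] h_right(1)[OF Z h]]]
      unfolding k_def by metis
  qed
  \<comment> \<open>The multiplication of \<open>A\<close> is a morphism from the free module
    \<open>A A\<close> to \<open>A\<close>, and naturality along it is left linearity.\<close>
  have va_left: "va \<cdot> m = (m \<rhd> X) \<cdot> (A \<lhd> va)"
    using v_nat[OF right_module_free[OF A_in_Ob] A m_in_hom m_assoc[symmetric]]
    unfolding v_free[OF A_in_Ob] va_def .
  have k_left: "k \<cdot> ((m \<rhd> X) \<rhd> X) = (m \<rhd> X) \<cdot> (A \<lhd> k)"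
    using w_nat[OF cofree_hom[OF right_module_free[OF A_in_Ob] A m_in_hom m_assoc[symmetric]]]
    unfolding w_free[OF A_in_Ob] k_def by (rule sym)
  txt \<open>The components at the module \<open>AX\<close>, presented as a quotient of the free module \<open>AXA\<close>.\<close>
  have AX: "right_module C A m \<eta> (A \<otimes> X) mu_AX"
    using GA by (simp add: entwined_module_def)
  have mu_hom: "mu_AX \<in> hom C ((A \<otimes> X) \<otimes> A) (A \<otimes> X)" and mu_lin: "mu_AX \<cdot> (A \<otimes> X \<lhd> m) = mu_AX \<cdot> (mu_AX \<rhd> A)"
    using right_moduleD[OF AX] by simp_all
  have AX_ob: "A \<otimes> X \<in> Ob C" using A_in_Ob X_in_Ob by simp
  define vx where "vx = v' (A \<otimes> X) mu_AX"
  define kx where "kx = w' ((A \<otimes> X) \<otimes> X) (?c1 (A \<otimes> X) mu_AX) (?c2 (A \<otimes> X) mu_AX)"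
  have vx: "vx \<in> hom C (A \<otimes> X) ((A \<otimes> X) \<otimes> X)"
    using v_hom(2)[OF AX] by (simp add: vx_def)
  have kx: "kx \<in> hom C (((A \<otimes> X) \<otimes> X) \<otimes> X) ((A \<otimes> X) \<otimes> X)"
    using w_hom(2)[OF entwined_module_cofree[OF AX]] by (simp add: kx_def)
  have vx_mu: "vx \<cdot> ((m \<rhd> X) \<cdot> (A \<lhd> \<psi>)) = (((m \<rhd> X) \<cdot> (A \<lhd> \<psi>)) \<rhd> X) \<cdot> (A \<otimes> X \<lhd> va)"
    using v_nat[OF right_module_free[OF AX_ob] AX mu_hom mu_lin] unfolding v_free[OF AX_ob] vx_def .
  have kx_mu: "(((m \<rhd> X) \<cdot> (A \<lhd> \<psi>)) \<rhd> X) \<cdot> (A \<otimes> X \<lhd> k) = kx \<cdot> ((((m \<rhd> X) \<cdot> (A \<lhd> \<psi>)) \<rhd> X) \<rhd> X)"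
    using w_nat[OF cofree_hom[OF right_module_free[OF AX_ob] AX mu_hom mu_lin]] unfolding w_free[OF AX_ob] kx_def .
  \<comment> \<open>A coaction is itself a morphism of entwined modules into the cofree one, and the
    counit of the adjunction is natural along it.\<close>
  have rho_k: "(m \<rhd> X \<otimes> X) \<cdot> (A \<lhd> \<delta>) \<cdot> k = kx \<cdot> (((m \<rhd> X \<otimes> X) \<cdot> (A \<lhd> \<delta>)) \<rhd> X)"
  proof -
    have "((A \<otimes> X, mu_AX, rho_AX), rho_AX, ((A \<otimes> X) \<otimes> X, ?c1 (A \<otimes> X) mu_AX, ?c2 (A \<otimes> X) mu_AX)) \<in>
        hom E (A \<otimes> X, mu_AX, rho_AX) ((A \<otimes> X) \<otimes> X, ?c1 (A \<otimes> X) mu_AX, ?c2 (A \<otimes> X) mu_AX)"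
      using GA entwined_module_cofree[OF AX] entwined_moduleD[OF GA] unfolding E_hom by blast
    from w_nat[OF this] show ?thesis unfolding k_def kx_def .
  qed
  have z1: "k \<cdot> (va \<rhd> X) = Id C (A \<otimes> X)"
  proof -
    have "(A, m) \<in> Ob R" using A by simp
    from s1[OF this] show ?thesis
      unfolding v_hom(1)[OF A] cofree_simps w_hom(1)[OF GA] entwined_simps va_def k_def by simp
  qed
  have z2: "k \<cdot> vx = Id C (A \<otimes> X)"
  proof -
    have "(A \<otimes> X, mu_AX, rho_AX) \<in> Ob E" unfolding entwined_simps fst_conv snd_conv by (rule GA)
    from s2[OF this] show ?thesis
      unfolding forget_simps v_hom(1)[OF AX] w_hom(1)[OF GA] R_simps vx_def k_def by simp
  qed
  \<comment> \<open>By left linearity \<open>va\<close> and \<open>k\<close> are determined by their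
    restrictions along the unit of \<open>A\<close>. These are \<open>t\<close> and, before the
    counit is applied, the product on \<open>X\<close> belonging to the Frobenius structure, from
    which \<open>B\<close> is extracted.\<close>
  define t where "t = va \<cdot> \<eta>"
  define B where "B = m \<cdot> (A \<lhd> \<epsilon>) \<cdot> k \<cdot> (\<eta> \<rhd> X \<otimes> X)"
  have ht: "t \<in> hom C \<one> (A \<otimes> X)"
    unfolding t_def by (rule in_hom, (rule reads arrows | fact)+)
  have hB: "B \<in> hom C (X \<otimes> X) A"
    unfolding B_def by (rule in_hom, (rule reads arrows | fact)+)
  have "(m \<rhd> X) \<cdot> (A \<lhd> t) = va"
    by (rule diagram3[OF t_def va_left m_unit_right, where S = "[Apply 0 0 1, Undo 1 1 0, Apply 2 0 0]"],
      (rule reads arrows | fact)+, simp add: run_simps)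
  moreover have "(m \<rhd> X) \<cdot> (A \<lhd> \<psi>) \<cdot> (t \<rhd> A) = va"
    by (rule diagram3[OF t_def va_right m_unit_left, where S = "[Apply 0 0 0, Undo 1 1 0, Apply 2 0 0]"],
      (rule reads arrows | fact)+, simp add: run_simps)
  ultimately have "central_element t"
    using ht by (simp add: central_element_iff)
  have ABk: "m \<cdot> (A \<lhd> B) = m \<cdot> (A \<lhd> \<epsilon>) \<cdot> k"
    by (rule diagram4[OF B_def m_assoc k_left m_unit_right, where S = "[Apply 0 0 1, Undo 1 3 0, Left 2, Undo 2 1 0,
      Apply 3 0 0]"], (rule reads arrows | fact)+, simp add: run_simps)
  have BAk: "m \<cdot> (B \<rhd> A) = m \<cdot> (A \<lhd> \<epsilon>) \<cdot> k \<cdot> ((\<psi> \<rhd> X) \<cdot> (X \<lhd> \<psi>))"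
    by (rule diagram5[OF B_def m_assoc epsilon_central k_right m_unit_left, where S = "[Apply 0 0 0, Apply 1 3 0,
      Undo 2 2 1, Undo 1 4 0, Left 3, Undo 3 1 0, Right 0, Right 1, Apply 4 2 0]"], (rule reads arrows | fact)+,
      simp add: run_simps)
  have "m \<cdot> (A \<lhd> B) \<cdot> ((\<psi> \<rhd> X) \<cdot> (X \<lhd> \<psi>)) = m \<cdot> (B \<rhd> A)"
    by (rule diagram2[OF ABk BAk, where S = "[Apply 0 2 0, Undo 1 0 0]"], (rule reads arrows | fact)+,
      simp add: run_simps)
  then have "central_form B"
    using hB by (simp add: central_form_iff)
  \<comment> \<open>Both sides of the Casimir law equal \<open>k\<close> restricted along the unit
    of \<open>A\<close>: this one by naturality along the coaction, the other by colinearity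
    \<open>k_col\<close>.\<close>
  have casL: "(m \<rhd> X) \<cdot> (A \<lhd> \<psi>) \<cdot> (A \<otimes> X \<lhd> B) \<cdot> (\<delta> \<rhd> X) = k \<cdot> (\<eta> \<rhd> X \<otimes> X)"
  proof -
    have kx_eq: "kx = (((m \<rhd> X) \<cdot> (A \<lhd> \<psi>)) \<rhd> X) \<cdot> (A \<otimes> X \<lhd> k) \<cdot> (A \<otimes> X \<lhd> \<eta> \<rhd> X \<otimes> X)"
      by (rule diagram3[OF m_unit_right psi_eta kx_mu, where S = "[Undo 0 0 0, Undo 1 0 1, Undo 2 1 0]"],
      (rule reads arrows | fact)+, simp add: run_simps)
    have counit_AX: "(m \<rhd> X) \<cdot> (A \<lhd> \<psi>) \<cdot> (A \<otimes> X \<lhd> \<epsilon>) \<cdot> ((m \<rhd> X \<otimes> X) \<cdot> (A \<lhd> \<delta>)) = Id C (A \<otimes> X)"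
      by (rule entwined_moduleD(8)[OF GA])
    \<comment> \<open>The counit axiom of \<open>A X\<close> is inserted after \<open>k\<close>, and
      the coaction it contains is pulled through \<open>k\<close> by \<open>rho_k\<close>.\<close>
    have k_eq: "k = (m \<rhd> X) \<cdot> (A \<lhd> \<psi>) \<cdot> (A \<otimes> X \<lhd> \<epsilon>) \<cdot> kx \<cdot> (((m \<rhd> X \<otimes> X) \<cdot> (A \<lhd> \<delta>)) \<rhd> X)"
      by (rule diagram2[OF counit_AX rho_k, where S = "[Undo 0 1 0, Apply 1 0 0]"], (rule reads arrows | fact)+,
      simp add: run_simps)
    have "(m \<rhd> X) \<cdot> (A \<lhd> \<psi>) \<cdot> (A \<otimes> X \<lhd> \<epsilon>) \<cdot> kx \<cdot> (((m \<rhd> X \<otimes> X) \<cdot> (A \<lhd> \<delta>)) \<rhd> X) \<cdot> (\<eta> \<rhd> X \<otimes> X) =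
        (m \<rhd> X) \<cdot> (A \<lhd> \<psi>) \<cdot> (A \<otimes> X \<lhd> \<epsilon>) \<cdot> kx \<cdot> (\<delta> \<rhd> X)"
      by (rule diagram1[OF m_unit_left, where S = "[Right 0, Apply 0 1 0]"], (rule reads arrows | fact)+,
      simp add: run_simps)
    moreover have "(m \<rhd> X) \<cdot> (A \<lhd> \<psi>) \<cdot> (A \<otimes> X \<lhd> \<epsilon>) \<cdot> kx \<cdot> (\<delta> \<rhd> X) = (m \<rhd> X) \<cdot> (A \<lhd> \<psi>) \<cdot> (A \<otimes> X \<lhd> B) \<cdot> (\<delta> \<rhd> X)"
      by (rule diagram4[OF kx_eq m_assoc psi_m B_def, where S = "[Apply 0 1 0, Right 4, Right 5, Apply 1 6 0, Right 3,
      Undo 2 4 1, Undo 3 1 2]"], (rule reads arrows | fact)+, simp add: run_simps)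
    ultimately show ?thesis using k_eq by simp
  qed
  have "(m \<rhd> X) \<cdot> (A \<lhd> B \<rhd> X) \<cdot> (\<psi> \<rhd> X \<otimes> X) \<cdot> (X \<lhd> \<delta>) = k \<cdot> (\<eta> \<rhd> X \<otimes> X)"
    by (rule diagram6[OF ABk m_unit_left k_col m_assoc counit_left m_unit_right, where S = "[Apply 0 2 0,
      Undo 1 2 0, Left 1, Left 0, Apply 2 1 0, Right 3, Apply 3 4 0, Apply 4 2 1, Apply 5 2 0]"],
      (rule reads arrows | fact)+, simp add: run_simps)
  then have "casimir_form B"
    using casL by (simp add: casimir_form_def)
  moreover have "m \<cdot> (A \<lhd> B) \<cdot> (t \<rhd> X) = \<epsilon>"
    by (rule diagram4[OF ABk t_def z1 m_unit_left, where S = "[Apply 0 1 0, Apply 1 0 0, Apply 2 1 0, Right 0,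
      Apply 3 1 0]"], (rule reads arrows | fact)+, simp add: run_simps)
  moreover have "m \<cdot> (A \<lhd> B) \<cdot> ((\<psi> \<rhd> X) \<cdot> (X \<lhd> t)) = \<epsilon>"
  proof -
    \<comment> \<open>Moving \<open>t\<close> past \<open>X\<close> gives the component at
      \<open>A X\<close> restricted along the unit, so the triangle identity \<open>z2\<close>
      becomes applicable.\<close>
    have vx_eq: "(\<psi> \<rhd> X) \<cdot> (X \<lhd> t) = vx \<cdot> (\<eta> \<rhd> X)"
      by (rule diagram4[OF t_def m_unit_left vx_mu psi_eta, where S = "[Apply 0 0 1, Undo 1 3 0, Left 2, Left 1,
      Undo 2 2 0, Right 1, Apply 1 2 0, Apply 3 0 0]"], (rule reads arrows | fact)+, simp add: run_simps)
    show "m \<cdot> (A \<lhd> B) \<cdot> ((\<psi> \<rhd> X) \<cdot> (X \<lhd> t)) = \<epsilon>"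
      by (rule diagram4[OF vx_eq ABk z2 m_unit_left, where S = "[Apply 0 0 0, Apply 1 2 0, Apply 2 1 0, Right 0,
      Apply 3 1 0]"], (rule reads arrows | fact)+, simp add: run_simps)
  qed
  ultimately show "P1"
    using \<open>central_element t\<close> \<open>central_form B\<close> unfolding P1_iff_frobenius_system by blast
qed

end

section \<open>Tensor products over an algebra\<close>

context strict_monoidal
begin

lemma is_coequalizerD:
  assumes "is_coequalizer C f g q" "f \<in> hom C U V"
  shows "g \<in> hom C U V" "q \<in> hom C V (Cod C q)" "q \<cdot> f = q \<cdot> g"
    "h \<in> hom C V Z \<Longrightarrow> h \<cdot> f = h \<cdot> g \<Longrightarrow> \<exists>!k. k \<in> hom C (Cod C q) Z \<and> k \<cdot> q = h"
proof -
  have f: "Dom C f = U" "Cod C f = V" using assms(2) by (simp_all add: hom_def)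
  have c: "g \<in> hom C U V" "q \<in> Ar C" "Dom C q = V" "q \<cdot> f = q \<cdot> g"
    "\<And>h. h \<in> Ar C \<Longrightarrow> Dom C h = V \<and> h \<cdot> f = h \<cdot> g \<Longrightarrow> \<exists>!k. k \<in> hom C (Cod C q) (Cod C h) \<and> k \<cdot> q = h"
    using assms(1) unfolding is_coequalizer_def f by blast+
  show "g \<in> hom C U V" "q \<cdot> f = q \<cdot> g" by (fact c)+
  show "q \<in> hom C V (Cod C q)" using c(2,3) by (simp add: hom_def)
  show "\<exists>!k. k \<in> hom C (Cod C q) Z \<and> k \<cdot> q = h" if "h \<in> hom C V Z" "h \<cdot> f = h \<cdot> g"
  proof -
    have h: "h \<in> Ar C" "Dom C h = V" "Cod C h = Z" using that(1) by (simp_all add: hom_def)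
    show ?thesis using c(5)[OF h(1)] h(2) that(2) unfolding h(3) by blast
  qed
qed

lemma is_coequalizerI:
  assumes "f \<in> hom C U V" "g \<in> hom C U V" "q \<in> hom C V Q" "q \<cdot> f = q \<cdot> g"
    and ex: "\<And>h Z. h \<in> hom C V Z \<Longrightarrow> h \<cdot> f = h \<cdot> g \<Longrightarrow> \<exists>k \<in> hom C Q Z. k \<cdot> q = h"
    and un: "\<And>x y Z. x \<in> hom C Q Z \<Longrightarrow> y \<in> hom C Q Z \<Longrightarrow> x \<cdot> q = y \<cdot> q \<Longrightarrow> x = y"
  shows "is_coequalizer C f g q"
proof -
  have d: "f \<in> Ar C" "Dom C f = U" "Cod C f = V" "q \<in> Ar C" "Dom C q = V" "Cod C q = Q"
    using assms(1,3) by (simp_all add: hom_def)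
  have "\<exists>!k. k \<in> hom C Q (Cod C h) \<and> k \<cdot> q = h"
    if h: "h \<in> Ar C" "Dom C h = V \<and> h \<cdot> f = h \<cdot> g" for h
  proof -
    have "h \<in> hom C V (Cod C h)" using h by (simp add: hom_def)
    then obtain k where k: "k \<in> hom C Q (Cod C h)" "k \<cdot> q = h" using ex h(2) by blast
    show ?thesis
    proof (rule ex1I[of _ k])
      show "k \<in> hom C Q (Cod C h) \<and> k \<cdot> q = h" using k by blast
      fix x assume x: "x \<in> hom C Q (Cod C h) \<and> x \<cdot> q = h"
      then show "x = k" using un[of x "Cod C h" k] k by simp
    qed
  qed
  then show ?thesis using d assms(2,4) unfolding is_coequalizer_def d by blast
qed

lemma coequalizers_isomorphic:
  assumes q: "is_coequalizer C f g q" and q': "is_coequalizer C f g q'" and f: "f \<in> hom C U V"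
  obtains k k' where "k \<in> hom C (Cod C q) (Cod C q')" "k' \<in> hom C (Cod C q') (Cod C q)"
    "k \<cdot> q = q'" "k' \<cdot> k = Id C (Cod C q)" "k \<cdot> k' = Id C (Cod C q')"
proof -
  note D = is_coequalizerD[OF q f] and D' = is_coequalizerD[OF q' f]
  obtain k where k: "k \<in> hom C (Cod C q) (Cod C q')" "k \<cdot> q = q'" using D(4)[OF D'(2,3)] by blast
  obtain k' where k': "k' \<in> hom C (Cod C q') (Cod C q)" "k' \<cdot> q' = q" using D'(4)[OF D(2,3)] by blast
  have "(k' \<cdot> k) \<cdot> q = q"
    unfolding comp_assoc[OF D(2) k(1) k'(1)] k(2) by (rule k'(2))
  then have "k' \<cdot> k = Id C (Cod C q)"
    using D(4)[OF D(2,3)] comp_in_hom[OF k(1) k'(1)] Id_in_hom[of "Cod C q"] Id_comp[OF D(2)] homD[OF k(1)] by blast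
  moreover have "(k \<cdot> k') \<cdot> q' = q'"
    unfolding comp_assoc[OF D'(2) k'(1) k(1)] k'(2) by (rule k(2))
  then have "k \<cdot> k' = Id C (Cod C q')"
    using D'(4)[OF D'(2,3)] comp_in_hom[OF k'(1) k(1)] Id_in_hom[of "Cod C q'"] Id_comp[OF D'(2)] homD[OF k(1)] by blast
  ultimately show thesis using that k k' by blast
qed

end

context algebra_in
begin

abbreviation "bimod \<equiv> bimodule C A m \<eta> A m \<eta>"
abbreviation "Bim \<equiv> bimodules_monoidal C A m \<eta>"

lemma bimodD:
  assumes "bimod M \<nu> \<mu>"
  shows "M \<in> Ob C" "\<nu> \<in> hom C (A \<otimes> M) M" "\<mu> \<in> hom C (M \<otimes> A) M"
    "\<nu> \<cdot> (A \<lhd> \<nu>) = \<nu> \<cdot> (m \<rhd> M)" "\<nu> \<cdot> (\<eta> \<rhd> M) = Id C M"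
    "\<mu> \<cdot> (\<mu> \<rhd> A) = \<mu> \<cdot> (M \<lhd> m)" "\<mu> \<cdot> (M \<lhd> \<eta>) = Id C M" "\<mu> \<cdot> (\<nu> \<rhd> A) = \<nu> \<cdot> (A \<lhd> \<mu>)"
  using assms by (simp_all add: bimodule_def left_module_def right_module_def)

text \<open>All tensor products over \<open>A\<close> needed here have a left factor that is free as a right module, so that the
  coequalizers defining them split.\<close>

lemma split_coequalizer:
  assumes "W \<in> Ob C" and M: "right_module C A m \<eta> M \<mu>" and N: "left_module C A m \<eta> N \<nu>"
    and "u \<in> hom C M (W \<otimes> A)" "u' \<in> hom C (W \<otimes> A) M"
    and u'u: "u' \<cdot> u = Id C M" and uu': "u \<cdot> u' = Id C (W \<otimes> A)" and um: "u \<cdot> \<mu> = (W \<lhd> m) \<cdot> (u \<rhd> A)"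
  shows "is_coequalizer C (\<mu> \<rhd> N) (M \<lhd> \<nu>) ((W \<lhd> \<nu>) \<cdot> (u \<rhd> N))"
proof (rule is_coequalizerI)
  have ob: "W \<in> Ob C" "M \<in> Ob C" "N \<in> Ob C" and h: "\<mu> \<in> hom C (M \<otimes> A) M" "\<nu> \<in> hom C (A \<otimes> N) N"
    and hu: "u \<in> hom C M (W \<otimes> A)" "u' \<in> hom C (W \<otimes> A) M"
    and nu_assoc: "\<nu> \<cdot> (A \<lhd> \<nu>) = \<nu> \<cdot> (m \<rhd> N)" and nu_unit: "\<nu> \<cdot> (\<eta> \<rhd> N) = Id C N"
    using assms by (simp_all add: left_module_def right_module_def)
  show "\<mu> \<rhd> N \<in> hom C (M \<otimes> A \<otimes> N) (M \<otimes> N)"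
    by (rule in_hom, (rule reads arrows | fact)+)
  show "M \<lhd> \<nu> \<in> hom C (M \<otimes> A \<otimes> N) (M \<otimes> N)"
    by (rule in_hom, (rule reads arrows | fact)+)
  show "(W \<lhd> \<nu>) \<cdot> (u \<rhd> N) \<in> hom C (M \<otimes> N) (W \<otimes> N)"
    by (rule in_hom, (rule reads arrows | fact)+)
  show "(W \<lhd> \<nu>) \<cdot> (u \<rhd> N) \<cdot> (\<mu> \<rhd> N) = (W \<lhd> \<nu>) \<cdot> (u \<rhd> N) \<cdot> (M \<lhd> \<nu>)"
    by (rule diagram2[OF um nu_assoc, where S = "[Apply 0 0 0, Undo 1 1 1, Right 0]"], (rule reads arrows | fact)+,
      simp add: run_simps)
  \<comment> \<open>Inserting the unit of \<open>A\<close> splits the candidate projection. The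
    section provides the factorization of \<open>h\<close> and also its uniqueness.\<close>
  have sec: "(W \<lhd> \<nu>) \<cdot> (u \<rhd> N) \<cdot> ((u' \<rhd> N) \<cdot> (W \<lhd> \<eta> \<rhd> N)) = Id C (W \<otimes> N)"
    by (rule diagram2[OF uu' nu_unit, where S = "[Apply 0 1 0, Apply 1 0 1]"], (rule reads arrows | fact)+,
      simp add: run_simps)
  {
    fix h Z assume hh: "h \<in> hom C (M \<otimes> N) Z" and hq: "h \<cdot> (\<mu> \<rhd> N) = h \<cdot> (M \<lhd> \<nu>)"
    have Z: "Z \<in> Ob C" using homD[OF hh] by simp
    have "h \<cdot> ((u' \<rhd> N) \<cdot> (W \<lhd> \<eta> \<rhd> N)) \<cdot> ((W \<lhd> \<nu>) \<cdot> (u \<rhd> N)) = h"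
    proof -
      have u'm: "u' \<cdot> (W \<lhd> m) = \<mu> \<cdot> (u' \<rhd> A)"
        by (rule diagram3[OF uu' um u'u, where S = "[Undo 0 0 0, Undo 1 1 0, Apply 2 2 0]"],
      (rule reads arrows | fact)+, simp add: run_simps)
      show "h \<cdot> ((u' \<rhd> N) \<cdot> (W \<lhd> \<eta> \<rhd> N)) \<cdot> ((W \<lhd> \<nu>) \<cdot> (u \<rhd> N)) = h"
        by (rule diagram4[OF hq u'm m_unit_left u'u, where S = "[Left 1, Left 2, Undo 0 3 0, Undo 1 2 0, Apply 2 1 1,
      Apply 3 0 0]"], (rule reads arrows | fact)+, simp add: run_simps)
    qed
    moreover have "h \<cdot> ((u' \<rhd> N) \<cdot> (W \<lhd> \<eta> \<rhd> N)) \<in> hom C (W \<otimes> N) Z"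
      by (rule in_hom, (rule reads arrows | fact)+)
    ultimately show "\<exists>k\<in>hom C (W \<otimes> N) Z. k \<cdot> ((W \<lhd> \<nu>) \<cdot> (u \<rhd> N)) = h" by blast
  next
    fix x y Z assume hx: "x \<in> hom C (W \<otimes> N) Z" and hy: "y \<in> hom C (W \<otimes> N) Z"
      and xy: "x \<cdot> ((W \<lhd> \<nu>) \<cdot> (u \<rhd> N)) = y \<cdot> ((W \<lhd> \<nu>) \<cdot> (u \<rhd> N))"
    have Z: "Z \<in> Ob C" using homD[OF hx] by simp
    show "x = y"
      by (rule diagram2[OF sec xy, where S = "[Undo 0 0 0, Apply 1 2 0, Apply 0 0 0]"], (rule reads arrows | fact)+,
      simp add: run_simps)
  }
qed

text \<open>Meant for \<open>u : M \<rightarrow> W A\<close> with inverse \<open>u'\<close>, that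
  is, for a right module \<open>M\<close> free on \<open>W\<close>. It collects the chosen
  projection \<open>q\<close>, the chosen object \<open>Z\<close> with its actions, an isomorphism
  \<open>k\<close> from \<open>Z\<close> to \<open>W N\<close>, and a section of \<open>q\<close>.
  The values hidden behind \<open>SOME\<close> and \<open>THE\<close> thus become named data that a
  locale can fix.\<close>

definition tensor_split where
  "tensor_split W u u' M \<nu>\<^sub>0 \<mu> N \<nu> \<mu>' q Z l r k k' \<longleftrightarrow>
     balanced_proj C (M, \<nu>\<^sub>0, \<mu>) (N, \<nu>, \<mu>') = q \<and> balanced_tensor C A (M, \<nu>\<^sub>0, \<mu>) (N, \<nu>, \<mu>') = (Z, l, r) \<and>
     Z \<in> Ob C \<and> q \<in> hom C (M \<otimes> N) Z \<and> q \<cdot> (\<mu> \<rhd> N) = q \<cdot> (M \<lhd> \<nu>) \<and>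
     l \<in> hom C (A \<otimes> Z) Z \<and> l \<cdot> (A \<lhd> q) = q \<cdot> (\<nu>\<^sub>0 \<rhd> N) \<and>
     r \<in> hom C (Z \<otimes> A) Z \<and> r \<cdot> (q \<rhd> A) = q \<cdot> (M \<lhd> \<mu>') \<and>
     k \<in> hom C Z (W \<otimes> N) \<and> k' \<in> hom C (W \<otimes> N) Z \<and> k' \<cdot> k = Id C Z \<and> k \<cdot> k' = Id C (W \<otimes> N) \<and>
     k \<cdot> q = (W \<lhd> \<nu>) \<cdot> (u \<rhd> N) \<and> q \<cdot> ((u' \<rhd> N) \<cdot> (W \<lhd> \<eta> \<rhd> N) \<cdot> k) = Id C Z"

lemma tensor_splitD:
  assumes "tensor_split W u u' M \<nu>\<^sub>0 \<mu> N \<nu> \<mu>' q Z l r k k'"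
  shows "balanced_proj C (M, \<nu>\<^sub>0, \<mu>) (N, \<nu>, \<mu>') = q" "balanced_tensor C A (M, \<nu>\<^sub>0, \<mu>) (N, \<nu>, \<mu>') = (Z, l, r)"
     "Z \<in> Ob C" "q \<in> hom C (M \<otimes> N) Z" "q \<cdot> (\<mu> \<rhd> N) = q \<cdot> (M \<lhd> \<nu>)"
     "l \<in> hom C (A \<otimes> Z) Z" "l \<cdot> (A \<lhd> q) = q \<cdot> (\<nu>\<^sub>0 \<rhd> N)"
     "r \<in> hom C (Z \<otimes> A) Z" "r \<cdot> (q \<rhd> A) = q \<cdot> (M \<lhd> \<mu>')"
     "k \<in> hom C Z (W \<otimes> N)" "k' \<in> hom C (W \<otimes> N) Z" "k' \<cdot> k = Id C Z" "k \<cdot> k' = Id C (W \<otimes> N)"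
     "k \<cdot> q = (W \<lhd> \<nu>) \<cdot> (u \<rhd> N)" "q \<cdot> ((u' \<rhd> N) \<cdot> (W \<lhd> \<eta> \<rhd> N) \<cdot> k) = Id C Z"
  using assms unfolding tensor_split_def by blast+

text \<open>A split projection can be cancelled after whiskering on either side, and this makes the
  two actions described in \<open>balanced_tensor\<close> unique.\<close>

lemma tensor_split_exists:
  assumes W: "W \<in> Ob C" and M: "bimod M \<nu>\<^sub>0 \<mu>" and N: "bimod N \<nu> \<mu>'"
    and u: "u \<in> hom C M (W \<otimes> A)" "u' \<in> hom C (W \<otimes> A) M"
    and u'u: "u' \<cdot> u = Id C M" and uu': "u \<cdot> u' = Id C (W \<otimes> A)" and um: "u \<cdot> \<mu> = (W \<lhd> m) \<cdot> (u \<rhd> A)"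
  shows "\<exists>q Z l r k k'. tensor_split W u u' M \<nu>\<^sub>0 \<mu> N \<nu> \<mu>' q Z l r k k'"
proof -
  define q where "q = balanced_proj C (M, \<nu>\<^sub>0, \<mu>) (N, \<nu>, \<mu>')"
  define Z where "Z = Cod C q"
  have ob: "W \<in> Ob C" "M \<in> Ob C" "N \<in> Ob C"
    and h: "\<nu>\<^sub>0 \<in> hom C (A \<otimes> M) M" "\<mu> \<in> hom C (M \<otimes> A) M" "\<nu> \<in> hom C (A \<otimes> N) N" "\<mu>' \<in> hom C (N \<otimes> A) N"
    and hu: "u \<in> hom C M (W \<otimes> A)" "u' \<in> hom C (W \<otimes> A) M"
    and nu_unit: "\<nu> \<cdot> (\<eta> \<rhd> N) = Id C N"
    and comp0: "\<mu> \<cdot> (\<nu>\<^sub>0 \<rhd> A) = \<nu>\<^sub>0 \<cdot> (A \<lhd> \<mu>)" and comp1: "\<mu>' \<cdot> (\<nu> \<rhd> A) = \<nu> \<cdot> (A \<lhd> \<mu>')"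
    using W bimodD[OF M] bimodD[OF N] u by blast+
  have c: "is_coequalizer C (\<mu> \<rhd> N) (M \<lhd> \<nu>) ((W \<lhd> \<nu>) \<cdot> (u \<rhd> N))"
    using M N by (intro split_coequalizer[OF W _ _ u u'u uu' um]) (simp_all add: bimodule_def)
  \<comment> \<open>The choice is made among coequalizers of the same pair, so the chosen projection
    is isomorphic to the explicit split one.\<close>
  then have cq: "is_coequalizer C (\<mu> \<rhd> N) (M \<lhd> \<nu>) q"
    unfolding q_def balanced_proj_def prod.case by (rule someI)
  have hm: "\<mu> \<rhd> N \<in> hom C (M \<otimes> A \<otimes> N) (M \<otimes> N)"
    by (rule in_hom, (rule reads arrows | fact)+)
  have kap: "(W \<lhd> \<nu>) \<cdot> (u \<rhd> N) \<in> hom C (M \<otimes> N) (W \<otimes> N)"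
    by (rule in_hom, (rule reads arrows | fact)+)
  then have codk: "Cod C ((W \<lhd> \<nu>) \<cdot> (u \<rhd> N)) = W \<otimes> N" by (simp add: hom_def)
  obtain k k' where k: "k \<in> hom C Z (W \<otimes> N)" and k': "k' \<in> hom C (W \<otimes> N) Z" and kq: "k \<cdot> q = (W \<lhd> \<nu>) \<cdot> (u \<rhd> N)"
    and k'k: "k' \<cdot> k = Id C Z" and kk': "k \<cdot> k' = Id C (W \<otimes> N)"
    using coequalizers_isomorphic[OF cq c hm] unfolding codk Z_def[symmetric] by blast
  have hq: "q \<in> hom C (M \<otimes> N) Z" and qc: "q \<cdot> (\<mu> \<rhd> N) = q \<cdot> (M \<lhd> \<nu>)"
    using is_coequalizerD(2,3)[OF cq hm] by (simp_all add: Z_def)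
  have Z: "Z \<in> Ob C" using homD[OF hq] by simp
  have sec: "q \<cdot> ((u' \<rhd> N) \<cdot> (W \<lhd> \<eta> \<rhd> N) \<cdot> k) = Id C Z"
    by (rule diagram4[OF k'k kq uu' nu_unit, where S = "[Undo 0 4 0, Apply 1 3 0, Apply 2 2 0, Apply 3 1 1,
      Apply 0 0 0]"], (rule reads arrows | fact)+, simp add: run_simps)
  have u'm: "u' \<cdot> (W \<lhd> m) = \<mu> \<cdot> (u' \<rhd> A)"
    by (rule diagram3[OF uu' um u'u, where S = "[Undo 0 0 0, Undo 1 1 0, Apply 2 2 0]"],
      (rule reads arrows | fact)+, simp add: run_simps)
  define l where "l = q \<cdot> (\<nu>\<^sub>0 \<rhd> N) \<cdot> (A \<lhd> ((u' \<rhd> N) \<cdot> (W \<lhd> \<eta> \<rhd> N) \<cdot> k))"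
  define r where "r = q \<cdot> (M \<lhd> \<mu>') \<cdot> (((u' \<rhd> N) \<cdot> (W \<lhd> \<eta> \<rhd> N) \<cdot> k) \<rhd> A)"
  have hl: "l \<in> hom C (A \<otimes> Z) Z"
    unfolding l_def by (rule in_hom, (rule reads arrows | fact)+)
  have hr: "r \<in> hom C (Z \<otimes> A) Z"
    unfolding r_def by (rule in_hom, (rule reads arrows | fact)+)
  have lq: "l \<cdot> (A \<lhd> q) = q \<cdot> (\<nu>\<^sub>0 \<rhd> N)"
    by (rule diagram7[OF l_def kq qc comp0 u'm m_unit_left u'u, where S = "[Apply 0 1 0, Apply 1 0 1, Left 1,
      Left 2, Left 3, Undo 2 4 0, Apply 3 3 0, Undo 4 2 1, Apply 5 1 2, Apply 6 0 1]"], (rule reads arrows | fact)+,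
      simp add: run_simps)
  have rq: "r \<cdot> (q \<rhd> A) = q \<cdot> (M \<lhd> \<mu>')"
    by (rule diagram7[OF r_def kq comp1 qc u'm m_unit_left u'u, where S = "[Apply 0 1 0, Apply 1 0 0, Left 1,
      Left 2, Apply 2 3 1, Undo 3 4 0, Right 2, Undo 4 3 0, Right 1, Apply 5 2 1, Right 0, Apply 6 1 0]"],
      (rule reads arrows | fact)+, simp add: run_simps)
  have "(THE l. l \<in> hom C (A \<otimes> Z) Z \<and> l \<cdot> (A \<lhd> q) = q \<cdot> (\<nu>\<^sub>0 \<rhd> N)) = l"
  proof (rule the_equality)
    show "l \<in> hom C (A \<otimes> Z) Z \<and> l \<cdot> (A \<lhd> q) = q \<cdot> (\<nu>\<^sub>0 \<rhd> N)" using hl lq by blast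
    fix x assume x: "x \<in> hom C (A \<otimes> Z) Z \<and> x \<cdot> (A \<lhd> q) = q \<cdot> (\<nu>\<^sub>0 \<rhd> N)"
    then have hx: "x \<in> hom C (A \<otimes> Z) Z" and xq: "x \<cdot> (A \<lhd> q) = q \<cdot> (\<nu>\<^sub>0 \<rhd> N)" by blast+
    show "x = l"
      by (rule diagram3[OF sec xq lq, where S = "[Undo 0 0 1, Apply 1 3 0, Undo 2 3 0, Apply 0 0 1]"],
      (rule reads arrows | fact)+, simp add: run_simps)
  qed
  moreover have "(THE r. r \<in> hom C (Z \<otimes> A) Z \<and> r \<cdot> (q \<rhd> A) = q \<cdot> (M \<lhd> \<mu>')) = r"
  proof (rule the_equality)
    show "r \<in> hom C (Z \<otimes> A) Z \<and> r \<cdot> (q \<rhd> A) = q \<cdot> (M \<lhd> \<mu>')" using hr rq by blast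
    fix x assume x: "x \<in> hom C (Z \<otimes> A) Z \<and> x \<cdot> (q \<rhd> A) = q \<cdot> (M \<lhd> \<mu>')"
    then have hx: "x \<in> hom C (Z \<otimes> A) Z" and xq: "x \<cdot> (q \<rhd> A) = q \<cdot> (M \<lhd> \<mu>')" by blast+
    show "x = r"
      by (rule diagram3[OF sec xq rq, where S = "[Undo 0 0 0, Apply 1 3 0, Undo 2 3 0, Apply 0 0 0]"],
      (rule reads arrows | fact)+, simp add: run_simps)
  qed
  ultimately have "balanced_tensor C A (M, \<nu>\<^sub>0, \<mu>) (N, \<nu>, \<mu>') = (Z, l, r)"
    unfolding balanced_tensor_def prod.case Let_def q_def[symmetric] Z_def[symmetric] by simp
  then show ?thesis
    using Z hq qc hl lq hr rq k k' k'k kk' kq sec q_def[symmetric] unfolding tensor_split_def by blast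
qed

section \<open>Computing in the monoidal category of bimodules\<close>

lemma Bim_simps [simp]:
  "(M, \<nu>, \<mu>) \<in> Ob Bim \<longleftrightarrow> bimod M \<nu> \<mu>"
  "Dom Bim (P, f, Q) = P" "Cod Bim (P, f, Q) = Q"
  "Id Bim (M, \<nu>, \<mu>) = ((M, \<nu>, \<mu>), Id C M, (M, \<nu>, \<mu>))"
  "(Q', g, S) \<cdot>\<^bsub>Bim\<^esub> (P, f, Q) = (P, g \<cdot> f, S)"
  "TenO Bim = balanced_tensor C A" "Unit Bim = (A, m, m)"
  by (simp_all add: bimodules_monoidal_def bimodules_def category.extend_def monoidal.fields_def)

lemma Bim_hom: "F \<in> hom Bim (M, \<nu>, \<mu>) (N, \<nu>', \<mu>') \<longleftrightarrow> (\<exists>f. F = ((M, \<nu>, \<mu>), f, (N, \<nu>', \<mu>')) \<and>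
    bimod M \<nu> \<mu> \<and> bimod N \<nu>' \<mu>' \<and> f \<in> hom C M N \<and> f \<cdot> \<nu> = \<nu>' \<cdot> (A \<lhd> f) \<and> f \<cdot> \<mu> = \<mu>' \<cdot> (f \<rhd> A))"
  by (cases F) (auto simp: bimodules_monoidal_def bimodules_def category.extend_def monoidal.fields_def hom_def
      left_linear_def right_linear_def)

lemma Bim_TenA: "(P, f, P') \<boxtimes>\<^bsub>Bim\<^esub> (Q, g, Q') = (balanced_tensor C A P Q,
    THE h. h \<in> hom C (fst (balanced_tensor C A P Q)) (fst (balanced_tensor C A P' Q')) \<and>
           h \<cdot> balanced_proj C P Q = balanced_proj C P' Q' \<cdot> (f \<boxtimes> g), balanced_tensor C A P' Q')"
  by (simp add: bimodules_monoidal_def category.extend_def monoidal.fields_def)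

lemma Bim_Assoc: "Assoc Bim P Q S = (balanced_tensor C A (balanced_tensor C A P Q) S,
    THE a. a \<in> hom C (fst (balanced_tensor C A (balanced_tensor C A P Q) S)) (fst (balanced_tensor C A P (balanced_tensor C A Q S))) \<and>
       a \<cdot> balanced_proj C (balanced_tensor C A P Q) S \<cdot> (balanced_proj C P Q \<rhd> fst S) =
       balanced_proj C P (balanced_tensor C A Q S) \<cdot> (fst P \<lhd> balanced_proj C Q S),
    balanced_tensor C A P (balanced_tensor C A Q S))"
  by (simp add: bimodules_monoidal_def category.extend_def monoidal.fields_def Let_def)

lemma Bim_Lun: "Lun Bim (M, \<nu>, \<mu>) = (balanced_tensor C A (A, m, m) (M, \<nu>, \<mu>),
    THE l. l \<in> hom C (fst (balanced_tensor C A (A, m, m) (M, \<nu>, \<mu>))) M \<and> l \<cdot> balanced_proj C (A, m, m) (M, \<nu>, \<mu>) = \<nu>,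
    (M, \<nu>, \<mu>))"
  by (simp add: bimodules_monoidal_def category.extend_def monoidal.fields_def Let_def)

lemma Bim_Run: "Run Bim (M, \<nu>, \<mu>) = (balanced_tensor C A (M, \<nu>, \<mu>) (A, m, m),
    THE r. r \<in> hom C (fst (balanced_tensor C A (M, \<nu>, \<mu>) (A, m, m))) M \<and> r \<cdot> balanced_proj C (M, \<nu>, \<mu>) (A, m, m) = \<mu>,
    (M, \<nu>, \<mu>))"
  by (simp add: bimodules_monoidal_def category.extend_def monoidal.fields_def Let_def)

text \<open>The Frobenius condition in \<open>Bim\<close> mentions inverses of the structural
  isomorphisms; this computes them from inverses in \<open>C\<close>.\<close>

lemma Bim_inverse_arrow:
  assumes P: "bimod M \<nu> \<mu>" and Q: "bimod N \<nu>' \<mu>'"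
    and f: "f \<in> hom C M N" "f \<cdot> \<nu> = \<nu>' \<cdot> (A \<lhd> f)" "f \<cdot> \<mu> = \<mu>' \<cdot> (f \<rhd> A)"
    and hg: "g \<in> hom C N M" and gf: "g \<cdot> f = Id C M" and fg: "f \<cdot> g = Id C N"
  shows "inverse_arrow Bim ((M, \<nu>, \<mu>), f, (N, \<nu>', \<mu>')) = ((N, \<nu>', \<mu>'), g, (M, \<nu>, \<mu>))"
proof -
  have ob: "M \<in> Ob C" "N \<in> Ob C" and h: "\<nu> \<in> hom C (A \<otimes> M) M" "\<mu> \<in> hom C (M \<otimes> A) M" "\<nu>' \<in> hom C (A \<otimes> N) N" "\<mu>' \<in> hom C (N \<otimes> A) N"
    using bimodD[OF P] bimodD[OF Q] by blast+
  have hf: "f \<in> hom C M N" and fl: "f \<cdot> \<nu> = \<nu>' \<cdot> (A \<lhd> f)" and fr: "f \<cdot> \<mu> = \<mu>' \<cdot> (f \<rhd> A)" by (fact f)+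
  have "g \<cdot> \<nu>' = \<nu> \<cdot> (A \<lhd> g)"
    by (rule diagram3[OF fg fl gf, where S = "[Undo 0 0 1, Undo 1 1 0, Apply 2 2 0]"], (rule reads arrows | fact)+,
      simp add: run_simps)
  moreover have "g \<cdot> \<mu>' = \<mu> \<cdot> (g \<rhd> A)"
    by (rule diagram3[OF fg fr gf, where S = "[Undo 0 0 0, Undo 1 1 0, Apply 2 2 0]"], (rule reads arrows | fact)+,
      simp add: run_simps)
  ultimately have "((N, \<nu>', \<mu>'), g, (M, \<nu>, \<mu>)) \<in> hom Bim (N, \<nu>', \<mu>') (M, \<nu>, \<mu>)"
    using P Q hg unfolding Bim_hom by blast
  moreover have "((M, \<nu>, \<mu>), f, (N, \<nu>', \<mu>')) \<in> hom Bim (M, \<nu>, \<mu>) (N, \<nu>', \<mu>')"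
    using P Q f unfolding Bim_hom by blast
  ultimately have i: "inverse_arrows Bim ((M, \<nu>, \<mu>), f, (N, \<nu>', \<mu>')) ((N, \<nu>', \<mu>'), g, (M, \<nu>, \<mu>))"
    unfolding inverse_arrows_def Bim_simps gf fg by (simp add: hom_def)
  show ?thesis
    unfolding inverse_arrow_def
  proof (rule the_equality[where P = "inverse_arrows Bim ((M, \<nu>, \<mu>), f, (N, \<nu>', \<mu>'))", OF i])
    fix H assume H: "inverse_arrows Bim ((M, \<nu>, \<mu>), f, (N, \<nu>', \<mu>')) H"
    then have "H \<in> hom Bim (N, \<nu>', \<mu>') (M, \<nu>, \<mu>)" unfolding inverse_arrows_def Bim_simps by blast
    then obtain h where h: "H = ((N, \<nu>', \<mu>'), h, (M, \<nu>, \<mu>))" and hh: "h \<in> hom C N M" unfolding Bim_hom by blast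
    have hf': "h \<cdot> f = Id C M"
      using H unfolding h inverse_arrows_def Bim_simps by simp
    have "h = g"
      by (rule diagram2[OF fg hf', where S = "[Undo 0 0 0, Apply 1 1 0]"], (rule reads arrows | fact)+,
      simp add: run_simps)
    then show "H = ((N, \<nu>', \<mu>'), g, (M, \<nu>, \<mu>))" by (simp add: h)
  qed
qed

text \<open>Each law is verified after composition with the projection, where it is a law of one of
  the factors, and the projection is then cancelled by its section.\<close>

lemma tensor_split_bimod:
  assumes s: "tensor_split W u u' M \<nu>\<^sub>0 \<mu> N \<nu> \<mu>' q Z l r k k'" and M: "bimod M \<nu>\<^sub>0 \<mu>" and N: "bimod N \<nu> \<mu>'"
    and W: "W \<in> Ob C" and u': "u' \<in> hom C (W \<otimes> A) M"
  shows "bimod Z l r"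
proof -
  define i where "i = (u' \<rhd> N) \<cdot> (W \<lhd> \<eta> \<rhd> N) \<cdot> k"
  have ob: "M \<in> Ob C" "N \<in> Ob C" "Z \<in> Ob C" "W \<in> Ob C" and hu': "u' \<in> hom C (W \<otimes> A) M"
    and h: "\<nu>\<^sub>0 \<in> hom C (A \<otimes> M) M" "\<mu> \<in> hom C (M \<otimes> A) M" "\<nu> \<in> hom C (A \<otimes> N) N" "\<mu>' \<in> hom C (N \<otimes> A) N"
    and hq: "q \<in> hom C (M \<otimes> N) Z" and hk: "k \<in> hom C Z (W \<otimes> N)"
    and hl: "l \<in> hom C (A \<otimes> Z) Z" and hr: "r \<in> hom C (Z \<otimes> A) Z"
    and lq: "l \<cdot> (A \<lhd> q) = q \<cdot> (\<nu>\<^sub>0 \<rhd> N)" and rq: "r \<cdot> (q \<rhd> A) = q \<cdot> (M \<lhd> \<mu>')" and qi: "q \<cdot> i = Id C Z"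
    and v1: "\<nu>\<^sub>0 \<cdot> (A \<lhd> \<nu>\<^sub>0) = \<nu>\<^sub>0 \<cdot> (m \<rhd> M)" and v2: "\<nu>\<^sub>0 \<cdot> (\<eta> \<rhd> M) = Id C M"
    and v3: "\<mu>' \<cdot> (\<mu>' \<rhd> A) = \<mu>' \<cdot> (N \<lhd> m)" and v4: "\<mu>' \<cdot> (N \<lhd> \<eta>) = Id C N"
    using bimodD[OF M] bimodD[OF N] tensor_splitD[OF s] W u' unfolding i_def by blast+
  have hi: "i \<in> hom C Z (M \<otimes> N)"
    unfolding i_def by (rule in_hom, (rule reads arrows | fact)+)
  have e1: "l \<cdot> (A \<lhd> l) \<cdot> (A \<otimes> A \<lhd> q) = l \<cdot> (m \<rhd> Z) \<cdot> (A \<otimes> A \<lhd> q)"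
    by (rule diagram2[OF lq v1, where S = "[Apply 0 0 1, Apply 0 1 0, Apply 1 0 0, Undo 0 1 0, Right 0]"],
      (rule reads arrows | fact)+, simp add: run_simps)
  have e2: "l \<cdot> (\<eta> \<rhd> Z) \<cdot> q = q"
    by (rule diagram2[OF lq v2, where S = "[Left 0, Apply 0 1 0, Apply 1 0 0]"], (rule reads arrows | fact)+,
      simp add: run_simps)
  have e3: "r \<cdot> (r \<rhd> A) \<cdot> (q \<rhd> A \<otimes> A) = r \<cdot> (Z \<lhd> m) \<cdot> (q \<rhd> A \<otimes> A)"
    by (rule diagram2[OF rq v3, where S = "[Apply 0 0 0, Apply 0 1 0, Apply 1 0 1, Undo 0 1 0, Left 0]"],
      (rule reads arrows | fact)+, simp add: run_simps)
  have e4: "r \<cdot> (Z \<lhd> \<eta>) \<cdot> q = q"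
    by (rule diagram2[OF rq v4, where S = "[Right 0, Apply 0 1 0, Apply 1 0 1]"], (rule reads arrows | fact)+,
      simp add: run_simps)
  have e5: "r \<cdot> (l \<rhd> A) \<cdot> (A \<lhd> q \<rhd> A) = l \<cdot> (A \<lhd> r) \<cdot> (A \<lhd> q \<rhd> A)"
    by (rule diagram2[OF lq rq, where S = "[Apply 0 0 0, Apply 1 1 0, Right 0, Undo 0 1 0, Undo 1 0 1]"],
      (rule reads arrows | fact)+, simp add: run_simps)
  have "l \<cdot> (A \<lhd> l) = l \<cdot> (m \<rhd> Z)"
    by (rule diagram2[OF qi e1, where S = "[Undo 0 0 2, Apply 1 1 0, Apply 0 0 2]"], (rule reads arrows | fact)+,
      simp add: run_simps)
  moreover have "l \<cdot> (\<eta> \<rhd> Z) = Id C Z"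
    by (rule diagram2[OF qi e2, where S = "[Undo 0 0 0, Apply 1 1 0, Apply 0 0 0]"], (rule reads arrows | fact)+,
      simp add: run_simps)
  moreover have "r \<cdot> (r \<rhd> A) = r \<cdot> (Z \<lhd> m)"
    by (rule diagram2[OF qi e3, where S = "[Undo 0 0 0, Apply 1 1 0, Apply 0 0 0]"], (rule reads arrows | fact)+,
      simp add: run_simps)
  moreover have "r \<cdot> (Z \<lhd> \<eta>) = Id C Z"
    by (rule diagram2[OF qi e4, where S = "[Undo 0 0 0, Apply 1 1 0, Apply 0 0 0]"], (rule reads arrows | fact)+,
      simp add: run_simps)
  moreover have "r \<cdot> (l \<rhd> A) = l \<cdot> (A \<lhd> r)"
    by (rule diagram2[OF qi e5, where S = "[Undo 0 0 1, Apply 1 1 0, Apply 0 0 1]"], (rule reads arrows | fact)+,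
      simp add: run_simps)
  ultimately show ?thesis
    using ob(3) hl hr unfolding bimodule_def left_module_def right_module_def by blast
qed

text \<open>An elimination rule: what is used later of a tensor product of arrows is only its type
  and its compatibility with the projections.\<close>

lemma tensor_split_TenA:
  assumes s: "tensor_split W u u' M \<nu>\<^sub>0 \<mu> N \<nu> \<mu>' q Z l r k k'"
    and s': "tensor_split W' v v' M' \<nu>\<^sub>1 \<mu>\<^sub>1 N' \<nu>\<^sub>2 \<mu>\<^sub>2 q' Z' l' r' j j'"
    and W: "W \<in> Ob C" and u: "u \<in> hom C M (W \<otimes> A)" "u' \<in> hom C (W \<otimes> A) M"
    and u'u: "u' \<cdot> u = Id C M" and uu': "u \<cdot> u' = Id C (W \<otimes> A)" and um: "u \<cdot> \<mu> = (W \<lhd> m) \<cdot> (u \<rhd> A)"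
    and M: "bimod M \<nu>\<^sub>0 \<mu>" and N: "bimod N \<nu> \<mu>'" and M': "bimod M' \<nu>\<^sub>1 \<mu>\<^sub>1" and N': "bimod N' \<nu>\<^sub>2 \<mu>\<^sub>2"
    and hf: "f \<in> hom C M M'" and fr: "f \<cdot> \<mu> = \<mu>\<^sub>1 \<cdot> (f \<rhd> A)"
    and hg: "g \<in> hom C N N'" and gl: "g \<cdot> \<nu> = \<nu>\<^sub>2 \<cdot> (A \<lhd> g)"
  obtains h where "((M, \<nu>\<^sub>0, \<mu>), f, (M', \<nu>\<^sub>1, \<mu>\<^sub>1)) \<boxtimes>\<^bsub>Bim\<^esub> ((N, \<nu>, \<mu>'), g, (N', \<nu>\<^sub>2, \<mu>\<^sub>2)) = ((Z, l, r), h, (Z', l', r'))"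
    "h \<in> hom C Z Z'" "h \<cdot> q = q' \<cdot> (f \<boxtimes> g)"
proof -
  have ob: "M \<in> Ob C" "N \<in> Ob C" "M' \<in> Ob C" "N' \<in> Ob C" "Z \<in> Ob C" "Z' \<in> Ob C"
    and hs: "\<mu> \<in> hom C (M \<otimes> A) M" "\<nu> \<in> hom C (A \<otimes> N) N" "\<mu>\<^sub>1 \<in> hom C (M' \<otimes> A) M'" "\<nu>\<^sub>2 \<in> hom C (A \<otimes> N') N'"
    and hq: "q \<in> hom C (M \<otimes> N) Z" and hq': "q' \<in> hom C (M' \<otimes> N') Z'" and hk: "k \<in> hom C Z (W \<otimes> N)"
    and qc': "q' \<cdot> (\<mu>\<^sub>1 \<rhd> N') = q' \<cdot> (M' \<lhd> \<nu>\<^sub>2)"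
    and kq: "k \<cdot> q = (W \<lhd> \<nu>) \<cdot> (u \<rhd> N)" and sec: "q \<cdot> ((u' \<rhd> N) \<cdot> (W \<lhd> \<eta> \<rhd> N) \<cdot> k) = Id C Z"
    using bimodD[OF M] bimodD[OF N] bimodD[OF M'] bimodD[OF N'] tensor_splitD[OF s] tensor_splitD[OF s'] by blast+
  have hu: "u \<in> hom C M (W \<otimes> A)" "u' \<in> hom C (W \<otimes> A) M" by (fact u)+
  define h where "h = q' \<cdot> (f \<boxtimes> g) \<cdot> ((u' \<rhd> N) \<cdot> (W \<lhd> \<eta> \<rhd> N) \<cdot> k)"
  have hh: "h \<in> hom C Z Z'"
    unfolding h_def by (rule in_hom, (rule reads arrows | fact)+)
  have u'm: "u' \<cdot> (W \<lhd> m) = \<mu> \<cdot> (u' \<rhd> A)"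
    by (rule diagram3[OF uu' um u'u, where S = "[Undo 0 0 0, Undo 1 1 0, Apply 2 2 0]"],
      (rule reads arrows | fact)+, simp add: run_simps)
  have hq1: "h \<cdot> q = q' \<cdot> (f \<boxtimes> g)"
    by (rule diagram8[OF h_def kq gl qc' fr u'm m_unit_left u'u, where S = "[Apply 0 1 0, Apply 1 0 0, Left 1,
      Left 2, Left 3, Apply 2 4 1, Undo 3 5 0, Right 3, Undo 4 4 0, Right 2, Undo 5 3 0, Right 1, Apply 6 2 1,
      Right 0, Apply 7 1 0, Left 0]"], (rule reads arrows | fact)+, simp add: run_simps)
  have "(THE h. h \<in> hom C Z Z' \<and> h \<cdot> q = q' \<cdot> (f \<boxtimes> g)) = h"
  proof (rule the_equality)
    show "h \<in> hom C Z Z' \<and> h \<cdot> q = q' \<cdot> (f \<boxtimes> g)" using hh hq1 by blast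
    fix x assume x: "x \<in> hom C Z Z' \<and> x \<cdot> q = q' \<cdot> (f \<boxtimes> g)"
    then have hx: "x \<in> hom C Z Z'" and xq: "x \<cdot> q = q' \<cdot> (f \<boxtimes> g)" by blast+
    show "x = h"
      by (rule diagram3[OF sec xq hq1, where S = "[Undo 0 0 0, Apply 1 3 0, Undo 2 3 0, Apply 0 0 0]"],
      (rule reads arrows | fact)+, simp add: run_simps)
  qed
  then have "((M, \<nu>\<^sub>0, \<mu>), f, (M', \<nu>\<^sub>1, \<mu>\<^sub>1)) \<boxtimes>\<^bsub>Bim\<^esub> ((N, \<nu>, \<mu>'), g, (N', \<nu>\<^sub>2, \<mu>\<^sub>2)) = ((Z, l, r), h, (Z', l', r'))"
    unfolding Bim_TenA tensor_splitD(1,2)[OF s] tensor_splitD(1,2)[OF s'] fst_conv by simp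
  then show thesis using that hh hq1 by blast
qed

end

section \<open>The wreath product as an algebra of bimodules\<close>

context dual_cowreath
begin

lemma bimod_A: "bimod A m m"
  using m_in_hom m_assoc m_unit_left m_unit_right A_in_Ob
  by (simp add: bimodule_def left_module_def right_module_def)

lemma bimod_S: "bimod (Y \<otimes> A) nu (Y \<lhd> m)"
proof -
  have "(Y \<lhd> m) \<cdot> (nu \<rhd> A) = nu \<cdot> (A \<lhd> Y \<lhd> m)"
    by (rule diagram1[OF nu_right_linear, where S = "[Undo 0 0 0]"], (rule reads arrows | fact)+,
      simp add: run_simps)
  then show ?thesis
    using nu_left_module nu_in_hom right_module_free[OF Y_in_Ob] ten_in_Ob[OF Y_in_Ob A_in_Ob]
    unfolding bimodule_def left_module_def by blast
qed

text \<open>The left action on the tensor square of \<open>Y A\<close> over \<open>A\<close>,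
  transported to \<open>Y Y A\<close>; see \<open>k1_l1\<close>.\<close>

definition lam2 :: 'a where
  "lam2 = (Y \<lhd> nu) \<cdot> (phi \<rhd> Y \<otimes> A)"

lemma lam2_in_hom [arrows]: "lam2 \<in> hom C (A \<otimes> Y \<otimes> Y \<otimes> A) (Y \<otimes> Y \<otimes> A)"
  unfolding lam2_def by (rule in_hom, (rule reads arrows | fact)+)

text \<open>The multiplication of the \<open>A\<close>-ring \<open>Y A\<close> after its tensor
  square over \<open>A\<close> is identified with \<open>Y Y A\<close>; see
  \<open>mul'_nu\<close>.\<close>

definition mul' :: 'a where
  "mul' = (Y \<lhd> m) \<cdot> (mul \<rhd> A)"

lemma mul'_in_hom [arrows]: "mul' \<in> hom C (Y \<otimes> Y \<otimes> A) (Y \<otimes> A)"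
  unfolding mul'_def by (rule in_hom, (rule reads arrows | fact)+)

lemma mul'_nu: "mul' \<cdot> (Y \<lhd> nu) = wr"
  by (rule diagram2[OF mul'_def wr_eq, where S = "[Apply 0 1 0, Undo 1 0 0]"], (rule reads arrows | fact)+,
      simp add: run_simps)

lemma mul'_left: "mul' \<cdot> lam2 = nu \<cdot> (A \<lhd> mul')"
  by (rule diagram5[OF mul'_def lam2_def nu_def m_assoc mul_central, where S = "[Apply 0 1 0, Apply 1 0 0,
      Apply 2 1 1, Left 2, Undo 3 3 1, Apply 4 0 0, Apply 3 2 1, Right 1, Undo 2 2 0, Undo 0 0 1]"],
      (rule reads arrows | fact)+, simp add: run_simps)

lemma mul'_right: "mul' \<cdot> (Y \<otimes> Y \<lhd> m) = (Y \<lhd> m) \<cdot> (mul' \<rhd> A)"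
  by (rule diagram2[OF mul'_def m_assoc, where S = "[Apply 0 1 0, Left 0, Undo 1 1 1, Undo 0 0 0]"],
      (rule reads arrows | fact)+, simp add: run_simps)

lemma extension_bimodule_eq: "extension_bimodule C (Y \<otimes> A) wr ext = (Y \<otimes> A, nu, Y \<lhd> m)"
  by (simp add: extension_bimodule_def wr_ext_left wr_ext_right)

abbreviation "I_YA \<equiv> Id C (Y \<otimes> A)"

text \<open>As a right module \<open>Y A\<close> is literally free on \<open>Y\<close>, so
  identities serve as the arrows \<open>u\<close> and \<open>u'\<close> of
  \<open>tensor_split\<close>; likewise \<open>A\<close> is free on the unit object in
  \<open>split_A\<close>.\<close>

lemma split_S: "Y \<in> Ob C" "I_YA \<in> hom C (Y \<otimes> A) (Y \<otimes> A)" "I_YA \<cdot> I_YA = I_YA"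
    "I_YA \<cdot> (Y \<lhd> m) = (Y \<lhd> m) \<cdot> (I_YA \<rhd> A)" "I_YA \<cdot> nu = nu \<cdot> (A \<lhd> I_YA)"
proof -
  show "Y \<in> Ob C" by (rule Y_in_Ob)
  show "Id C (Y \<otimes> A) \<in> hom C (Y \<otimes> A) (Y \<otimes> A)"
    by (rule in_hom, (rule reads arrows | fact)+)
  show "Id C (Y \<otimes> A) \<cdot> Id C (Y \<otimes> A) = Id C (Y \<otimes> A)"
    by (rule diagram0[where S = "[]"], (rule reads arrows | fact)+, simp add: run_simps)
  show "Id C (Y \<otimes> A) \<cdot> (Y \<lhd> m) = (Y \<lhd> m) \<cdot> (Id C (Y \<otimes> A) \<rhd> A)"
    by (rule diagram0[where S = "[]"], (rule reads arrows | fact)+, simp add: run_simps)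
  show "Id C (Y \<otimes> A) \<cdot> nu = nu \<cdot> (A \<lhd> Id C (Y \<otimes> A))"
    by (rule diagram0[where S = "[]"], (rule reads arrows | fact)+, simp add: run_simps)
qed

lemma split_A: "\<one> \<in> Ob C" "Id C A \<in> hom C A (\<one> \<otimes> A)" "Id C A \<in> hom C (\<one> \<otimes> A) A" "Id C A \<cdot> Id C A = Id C A"
    "Id C A \<cdot> Id C A = Id C (\<one> \<otimes> A)" "Id C A \<cdot> m = (\<one> \<lhd> m) \<cdot> (Id C A \<rhd> A)"
proof -
  show "\<one> \<in> Ob C" by (rule unit_in_Ob)
  show "Id C A \<in> hom C A (\<one> \<otimes> A)"
    by (rule in_hom, (rule reads arrows | fact)+)
  show "Id C A \<in> hom C (\<one> \<otimes> A) A"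
    by (rule in_hom, (rule reads arrows | fact)+)
  show "Id C A \<cdot> Id C A = Id C A"
    by (rule diagram0[where S = "[]"], (rule reads arrows | fact)+, simp add: run_simps)
  show "Id C A \<cdot> Id C A = Id C (\<one> \<otimes> A)"
    by (rule diagram0[where S = "[]"], (rule reads arrows | fact)+, simp add: run_simps)
  show "Id C A \<cdot> m = (\<one> \<lhd> m) \<cdot> (Id C A \<rhd> A)"
    by (rule diagram0[where S = "[]"], (rule reads arrows | fact)+, simp add: run_simps)
qed

end

text \<open>The tensor square is fixed before the other products, since it occurs as a factor in
  both bracketings of the tensor cube.\<close>

locale wreath_square = dual_cowreath C A m \<eta> X Y \<psi> \<delta> \<epsilon> b d
  for C :: "('o, 'a) monoidal" (structure) and A m \<eta> X Y \<psi> \<delta> \<epsilon> b d +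
  fixes q1 l1 r1 k1 i1 :: 'a and Z1 :: 'o
  assumes split1: "tensor_split Y I_YA I_YA (Y \<otimes> A) nu (Y \<lhd> m) (Y \<otimes> A) nu (Y \<lhd> m) q1 Z1 l1 r1 k1 i1"
begin

lemma Z1_in_Ob [arrows]: "Z1 \<in> Ob C"
  and q1_in_hom [arrows]: "q1 \<in> hom C ((Y \<otimes> A) \<otimes> Y \<otimes> A) Z1"
  and l1_in_hom [arrows]: "l1 \<in> hom C (A \<otimes> Z1) Z1"
  and l1_q1: "l1 \<cdot> (A \<lhd> q1) = q1 \<cdot> (nu \<rhd> Y \<otimes> A)"
  and r1_in_hom [arrows]: "r1 \<in> hom C (Z1 \<otimes> A) Z1"
  and r1_q1: "r1 \<cdot> (q1 \<rhd> A) = q1 \<cdot> (Y \<otimes> A \<lhd> Y \<lhd> m)"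
  and k1_in_hom [arrows]: "k1 \<in> hom C Z1 (Y \<otimes> Y \<otimes> A)"
  and i1_in_hom [arrows]: "i1 \<in> hom C (Y \<otimes> Y \<otimes> A) Z1"
  and i1_k1: "i1 \<cdot> k1 = Id C Z1"
  and k1_i1: "k1 \<cdot> i1 = Id C (Y \<otimes> Y \<otimes> A)"
  and k1_q1': "k1 \<cdot> q1 = (Y \<lhd> nu) \<cdot> (Id C (Y \<otimes> A) \<rhd> Y \<otimes> A)"
  and q1_split: "q1 \<cdot> ((Id C (Y \<otimes> A) \<rhd> Y \<otimes> A) \<cdot> (Y \<lhd> \<eta> \<rhd> Y \<otimes> A) \<cdot> k1) = Id C Z1"
  using tensor_splitD[OF split1] by blast+

lemma k1_q1: "k1 \<cdot> q1 = Y \<lhd> nu"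
  by (rule diagram1[OF k1_q1', where S = "[Apply 0 0 0]"], (rule reads arrows | fact)+, simp add: run_simps)

text \<open>Verified after composition with \<open>q1\<close>, which is then cancelled by its
  section. The same pattern proves the other compatibilities of the identifications with the
  actions.\<close>

lemma k1_l1: "k1 \<cdot> l1 = lam2 \<cdot> (A \<lhd> k1)"
proof -
  have eq: "k1 \<cdot> l1 \<cdot> (A \<lhd> q1) = lam2 \<cdot> (A \<lhd> k1) \<cdot> (A \<lhd> q1)"
    by (rule diagram6[OF l1_q1 k1_q1 nu_def phi_m m_assoc lam2_def, where S = "[Apply 0 0 0, Apply 1 1 0,
      Apply 2 0 0, Apply 2 2 1, Apply 3 1 1, Apply 4 3 2, Right 0, Right 2, Right 1, Undo 2 3 1, Undo 2 0 2,
      Undo 5 1 0, Undo 1 0 1]"], (rule reads arrows | fact)+, simp add: run_simps)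
  show ?thesis
  proof -
    show "k1 \<cdot> l1 = lam2 \<cdot> (A \<lhd> k1)"
      by (rule diagram2[OF q1_split eq, where S = "[Undo 0 0 1, Apply 1 2 0, Apply 0 0 1]"],
      (rule reads arrows | fact)+, simp add: run_simps)
  qed
qed

lemma k1_r1: "k1 \<cdot> r1 = (Y \<lhd> Y \<lhd> m) \<cdot> (k1 \<rhd> A)"
proof -
  have eq: "k1 \<cdot> r1 \<cdot> (q1 \<rhd> A) = (Y \<lhd> Y \<lhd> m) \<cdot> (k1 \<rhd> A) \<cdot> (q1 \<rhd> A)"
    by (rule diagram3[OF r1_q1 k1_q1 nu_right_linear, where S = "[Apply 0 0 0, Apply 1 1 0, Apply 2 0 1,
      Undo 1 0 0]"], (rule reads arrows | fact)+, simp add: run_simps)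
  show "k1 \<cdot> r1 = (Y \<lhd> Y \<lhd> m) \<cdot> (k1 \<rhd> A)"
    by (rule diagram2[OF q1_split eq, where S = "[Undo 0 0 0, Apply 1 2 0, Apply 0 0 0]"],
      (rule reads arrows | fact)+, simp add: run_simps)
qed

lemma split_Z1: "Y \<otimes> Y \<in> Ob C" "k1 \<in> hom C Z1 ((Y \<otimes> Y) \<otimes> A)" "i1 \<in> hom C ((Y \<otimes> Y) \<otimes> A) Z1"
    "k1 \<cdot> i1 = Id C ((Y \<otimes> Y) \<otimes> A)" "k1 \<cdot> r1 = (Y \<otimes> Y \<lhd> m) \<cdot> (k1 \<rhd> A)"
proof -
  show "Y \<otimes> Y \<in> Ob C" using Y_in_Ob by simp
  show "k1 \<in> hom C Z1 ((Y \<otimes> Y) \<otimes> A)"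
    by (rule in_hom, (rule reads arrows | fact)+)
  show "i1 \<in> hom C ((Y \<otimes> Y) \<otimes> A) Z1"
    by (rule in_hom, (rule reads arrows | fact)+)
  show "k1 \<cdot> i1 = Id C ((Y \<otimes> Y) \<otimes> A)"
    by (rule diagram1[OF k1_i1, where S = "[Apply 0 0 0]"], (rule reads arrows | fact)+, simp add: run_simps)
  show "k1 \<cdot> r1 = (Y \<otimes> Y \<lhd> m) \<cdot> (k1 \<rhd> A)"
    by (rule diagram1[OF k1_r1, where S = "[Apply 0 0 0]"], (rule reads arrows | fact)+, simp add: run_simps)
qed

lemma bimod_Z1: "bimod Z1 l1 r1"
  by (rule tensor_split_bimod[OF split1 bimod_S bimod_S split_S(1,2)])

end

text \<open>Write \<open>S\<close> for the bimodule \<open>Y A\<close>. Index 1 belongs to the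
  tensor square of \<open>S\<close>, index 3 to the square tensored with \<open>S\<close> on the
  right, index 4 to the square tensored with \<open>S\<close> on the left, and the letters L and R
  to the products with the unit bimodule \<open>A\<close> on that side.\<close>

locale wreath_tensors = wreath_square C A m \<eta> X Y \<psi> \<delta> \<epsilon> b d q1 l1 r1 k1 i1 Z1
  for C :: "('o, 'a) monoidal" (structure) and A m \<eta> X Y \<psi> \<delta> \<epsilon> b d q1 l1 r1 k1 i1 Z1 +
  fixes q3 l3 r3 k3 i3 q4 l4 r4 k4 i4 qL lL rL kL iL qR lR rR kR iR :: 'a
    and Z3 Z4 ZL ZR :: 'o
  assumes split3: "tensor_split (Y \<otimes> Y) k1 i1 Z1 l1 r1 (Y \<otimes> A) nu (Y \<lhd> m) q3 Z3 l3 r3 k3 i3"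
    and split4: "tensor_split Y I_YA I_YA (Y \<otimes> A) nu (Y \<lhd> m) Z1 l1 r1 q4 Z4 l4 r4 k4 i4"
    and splitL: "tensor_split \<one> (Id C A) (Id C A) A m m (Y \<otimes> A) nu (Y \<lhd> m) qL ZL lL rL kL iL"
    and splitR: "tensor_split Y I_YA I_YA (Y \<otimes> A) nu (Y \<lhd> m) A m m qR ZR lR rR kR iR"
begin

lemma Z3_in_Ob [arrows]: "Z3 \<in> Ob C"
  and q3_in_hom [arrows]: "q3 \<in> hom C (Z1 \<otimes> Y \<otimes> A) Z3"
  and l3_in_hom [arrows]: "l3 \<in> hom C (A \<otimes> Z3) Z3"
  and l3_q3: "l3 \<cdot> (A \<lhd> q3) = q3 \<cdot> (l1 \<rhd> Y \<otimes> A)"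
  and r3_in_hom [arrows]: "r3 \<in> hom C (Z3 \<otimes> A) Z3"
  and r3_q3: "r3 \<cdot> (q3 \<rhd> A) = q3 \<cdot> (Z1 \<lhd> Y \<lhd> m)"
  and k3_in_hom [arrows]: "k3 \<in> hom C Z3 ((Y \<otimes> Y) \<otimes> Y \<otimes> A)"
  and i3_in_hom [arrows]: "i3 \<in> hom C ((Y \<otimes> Y) \<otimes> Y \<otimes> A) Z3"
  and i3_k3: "i3 \<cdot> k3 = Id C Z3"
  and k3_i3: "k3 \<cdot> i3 = Id C ((Y \<otimes> Y) \<otimes> Y \<otimes> A)"
  and k3_q3: "k3 \<cdot> q3 = (Y \<otimes> Y \<lhd> nu) \<cdot> (k1 \<rhd> Y \<otimes> A)"
  and q3_split: "q3 \<cdot> ((i1 \<rhd> Y \<otimes> A) \<cdot> (Y \<otimes> Y \<lhd> \<eta> \<rhd> Y \<otimes> A) \<cdot> k3) = Id C Z3"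
  using tensor_splitD[OF split3] by blast+

lemma Z4_in_Ob [arrows]: "Z4 \<in> Ob C"
  and q4_in_hom [arrows]: "q4 \<in> hom C ((Y \<otimes> A) \<otimes> Z1) Z4"
  and l4_in_hom [arrows]: "l4 \<in> hom C (A \<otimes> Z4) Z4"
  and l4_q4: "l4 \<cdot> (A \<lhd> q4) = q4 \<cdot> (nu \<rhd> Z1)"
  and r4_in_hom [arrows]: "r4 \<in> hom C (Z4 \<otimes> A) Z4"
  and r4_q4: "r4 \<cdot> (q4 \<rhd> A) = q4 \<cdot> (Y \<otimes> A \<lhd> r1)"
  and k4_in_hom [arrows]: "k4 \<in> hom C Z4 (Y \<otimes> Z1)"
  and i4_in_hom [arrows]: "i4 \<in> hom C (Y \<otimes> Z1) Z4"
  and i4_k4: "i4 \<cdot> k4 = Id C Z4"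
  and k4_i4: "k4 \<cdot> i4 = Id C (Y \<otimes> Z1)"
  and k4_q4: "k4 \<cdot> q4 = (Y \<lhd> l1) \<cdot> (Id C (Y \<otimes> A) \<rhd> Z1)"
  and q4_split: "q4 \<cdot> ((Id C (Y \<otimes> A) \<rhd> Z1) \<cdot> (Y \<lhd> \<eta> \<rhd> Z1) \<cdot> k4) = Id C Z4"
  using tensor_splitD[OF split4] by blast+

lemma ZL_in_Ob [arrows]: "ZL \<in> Ob C"
  and qL_in_hom [arrows]: "qL \<in> hom C (A \<otimes> Y \<otimes> A) ZL"
  and lL_in_hom [arrows]: "lL \<in> hom C (A \<otimes> ZL) ZL"
  and lL_qL: "lL \<cdot> (A \<lhd> qL) = qL \<cdot> (m \<rhd> Y \<otimes> A)"
  and rL_in_hom [arrows]: "rL \<in> hom C (ZL \<otimes> A) ZL"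
  and rL_qL: "rL \<cdot> (qL \<rhd> A) = qL \<cdot> (A \<lhd> Y \<lhd> m)"
  and kL_in_hom [arrows]: "kL \<in> hom C ZL (\<one> \<otimes> Y \<otimes> A)"
  and iL_in_hom [arrows]: "iL \<in> hom C (\<one> \<otimes> Y \<otimes> A) ZL"
  and iL_kL: "iL \<cdot> kL = Id C ZL"
  and kL_iL: "kL \<cdot> iL = Id C (\<one> \<otimes> Y \<otimes> A)"
  and kL_qL': "kL \<cdot> qL = (\<one> \<lhd> nu) \<cdot> (Id C A \<rhd> Y \<otimes> A)"
  and qL_split: "qL \<cdot> ((Id C A \<rhd> Y \<otimes> A) \<cdot> (\<one> \<lhd> \<eta> \<rhd> Y \<otimes> A) \<cdot> kL) = Id C ZL"
  using tensor_splitD[OF splitL] by blast+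

lemma ZR_in_Ob [arrows]: "ZR \<in> Ob C"
  and qR_in_hom [arrows]: "qR \<in> hom C ((Y \<otimes> A) \<otimes> A) ZR"
  and lR_in_hom [arrows]: "lR \<in> hom C (A \<otimes> ZR) ZR"
  and lR_qR: "lR \<cdot> (A \<lhd> qR) = qR \<cdot> (nu \<rhd> A)"
  and rR_in_hom [arrows]: "rR \<in> hom C (ZR \<otimes> A) ZR"
  and rR_qR: "rR \<cdot> (qR \<rhd> A) = qR \<cdot> (Y \<otimes> A \<lhd> m)"
  and kR_in_hom [arrows]: "kR \<in> hom C ZR (Y \<otimes> A)"
  and iR_in_hom [arrows]: "iR \<in> hom C (Y \<otimes> A) ZR"
  and iR_kR: "iR \<cdot> kR = Id C ZR"
  and kR_iR: "kR \<cdot> iR = Id C (Y \<otimes> A)"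
  and kR_qR': "kR \<cdot> qR = (Y \<lhd> m) \<cdot> (Id C (Y \<otimes> A) \<rhd> A)"
  and qR_split: "qR \<cdot> ((Id C (Y \<otimes> A) \<rhd> A) \<cdot> (Y \<lhd> \<eta> \<rhd> A) \<cdot> kR) = Id C ZR"
  using tensor_splitD[OF splitR] by blast+

lemma kL_qL: "kL \<cdot> qL = nu"
  by (rule diagram1[OF kL_qL', where S = "[Apply 0 0 0]"], (rule reads arrows | fact)+, simp add: run_simps)

lemma kR_qR: "kR \<cdot> qR = Y \<lhd> m"
  by (rule diagram1[OF kR_qR', where S = "[Apply 0 0 0]"], (rule reads arrows | fact)+, simp add: run_simps)

lemma kL_lL: "kL \<cdot> lL = nu \<cdot> (A \<lhd> kL)"
proof -
  have nu_assoc: "nu \<cdot> (A \<lhd> nu) = nu \<cdot> (m \<rhd> Y \<otimes> A)" by (rule nu_left_module)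
  have eq: "kL \<cdot> lL \<cdot> (A \<lhd> qL) = nu \<cdot> (A \<lhd> kL) \<cdot> (A \<lhd> qL)"
    by (rule diagram3[OF lL_qL kL_qL nu_assoc, where S = "[Apply 0 0 0, Apply 1 1 0, Undo 2 0 0, Undo 1 0 1]"],
      (rule reads arrows | fact)+, simp add: run_simps)
  show "kL \<cdot> lL = nu \<cdot> (A \<lhd> kL)"
    by (rule diagram2[OF qL_split eq, where S = "[Undo 0 0 1, Apply 1 2 0, Apply 0 0 1]"],
      (rule reads arrows | fact)+, simp add: run_simps)
qed

lemma kL_rL: "kL \<cdot> rL = (Y \<lhd> m) \<cdot> (kL \<rhd> A)"
proof -
  have eq: "kL \<cdot> rL \<cdot> (qL \<rhd> A) = (Y \<lhd> m) \<cdot> (kL \<rhd> A) \<cdot> (qL \<rhd> A)"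
    by (rule diagram3[OF rL_qL kL_qL nu_right_linear, where S = "[Apply 0 0 0, Apply 1 1 0, Apply 2 0 0,
      Undo 1 0 0]"], (rule reads arrows | fact)+, simp add: run_simps)
  show "kL \<cdot> rL = (Y \<lhd> m) \<cdot> (kL \<rhd> A)"
    by (rule diagram2[OF qL_split eq, where S = "[Undo 0 0 0, Apply 1 2 0, Apply 0 0 0]"],
      (rule reads arrows | fact)+, simp add: run_simps)
qed

lemma kR_lR: "kR \<cdot> lR = nu \<cdot> (A \<lhd> kR)"
proof -
  have eq: "kR \<cdot> lR \<cdot> (A \<lhd> qR) = nu \<cdot> (A \<lhd> kR) \<cdot> (A \<lhd> qR)"
    by (rule diagram3[OF lR_qR kR_qR nu_right_linear, where S = "[Apply 0 0 0, Apply 1 1 0, Undo 2 0 0,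
      Undo 1 0 1]"], (rule reads arrows | fact)+, simp add: run_simps)
  show "kR \<cdot> lR = nu \<cdot> (A \<lhd> kR)"
    by (rule diagram2[OF qR_split eq, where S = "[Undo 0 0 1, Apply 1 2 0, Apply 0 0 1]"],
      (rule reads arrows | fact)+, simp add: run_simps)
qed

lemma kR_rR: "kR \<cdot> rR = (Y \<lhd> m) \<cdot> (kR \<rhd> A)"
proof -
  have eq: "kR \<cdot> rR \<cdot> (qR \<rhd> A) = (Y \<lhd> m) \<cdot> (kR \<rhd> A) \<cdot> (qR \<rhd> A)"
    by (rule diagram3[OF rR_qR kR_qR m_assoc, where S = "[Apply 0 0 0, Apply 1 1 0, Undo 2 0 1, Undo 1 0 0]"],
      (rule reads arrows | fact)+, simp add: run_simps)
  show "kR \<cdot> rR = (Y \<lhd> m) \<cdot> (kR \<rhd> A)"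
    by (rule diagram2[OF qR_split eq, where S = "[Undo 0 0 0, Apply 1 2 0, Apply 0 0 0]"],
      (rule reads arrows | fact)+, simp add: run_simps)
qed

lemma kL_in_hom': "kL \<in> hom C ZL (Y \<otimes> A)" "iL \<in> hom C (Y \<otimes> A) ZL" "kL \<cdot> iL = Id C (Y \<otimes> A)"
  using kL_in_hom iL_in_hom kL_iL by (simp_all add: Y_in_Ob A_in_Ob)

lemma I4_K4: "i4 \<cdot> (Y \<lhd> i1) \<cdot> ((Y \<lhd> k1) \<cdot> k4) = Id C Z4"
  by (rule diagram2[OF i1_k1 i4_k4, where S = "[Apply 0 1 1, Apply 1 0 0]"], (rule reads arrows | fact)+,
      simp add: run_simps)

lemma bimod_Z3: "bimod Z3 l3 r3"
  by (rule tensor_split_bimod[OF split3 bimod_Z1 bimod_S split_Z1(1,3)])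

lemma bimod_Z4: "bimod Z4 l4 r4"
  by (rule tensor_split_bimod[OF split4 bimod_S bimod_Z1 split_S(1,2)])

lemma bimod_ZL: "bimod ZL lL rL"
  by (rule tensor_split_bimod[OF splitL bimod_A bimod_S split_A(1,3)])

lemma bimod_ZR: "bimod ZR lR rR"
  by (rule tensor_split_bimod[OF splitR bimod_S bimod_A split_S(1,2)])

definition mS :: 'a where
  "mS = mul' \<cdot> k1"

lemma mS_in_hom [arrows]: "mS \<in> hom C Z1 (Y \<otimes> A)"
  unfolding mS_def by (rule in_hom, (rule reads arrows | fact)+)

lemma mS_q1: "mS \<cdot> q1 = wr"
  by (rule diagram3[OF mS_def k1_q1 mul'_nu, where S = "[Apply 0 1 0, Apply 1 0 0, Apply 2 0 0]"],
      (rule reads arrows | fact)+, simp add: run_simps)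

lemma mS_left: "mS \<cdot> l1 = nu \<cdot> (A \<lhd> mS)"
  by (rule diagram3[OF mS_def k1_l1 mul'_left, where S = "[Apply 0 1 0, Apply 1 0 0, Apply 2 1 0, Undo 0 0 1]"],
      (rule reads arrows | fact)+, simp add: run_simps)

lemma mS_right: "mS \<cdot> r1 = (Y \<lhd> m) \<cdot> (mS \<rhd> A)"
  by (rule diagram3[OF mS_def k1_r1 mul'_right, where S = "[Apply 0 1 0, Apply 1 0 0, Apply 2 1 0, Undo 0 0 0]"],
      (rule reads arrows | fact)+, simp add: run_simps)

abbreviation "S \<equiv> (Y \<otimes> A, nu, Y \<lhd> m)"
abbreviation "S2 \<equiv> (Z1, l1, r1)"

lemma extension_mult_eq: "extension_mult C A (Y \<otimes> A) wr ext = (S2, mS, S)"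
proof -
  have "(THE h. h \<in> hom C Z1 (Y \<otimes> A) \<and> h \<cdot> q1 = wr) = mS"
  proof (rule the_equality)
    show "mS \<in> hom C Z1 (Y \<otimes> A) \<and> mS \<cdot> q1 = wr" using mS_in_hom mS_q1 by blast
    fix x assume x: "x \<in> hom C Z1 (Y \<otimes> A) \<and> x \<cdot> q1 = wr"
    then have hx: "x \<in> hom C Z1 (Y \<otimes> A)" and xq: "x \<cdot> q1 = wr" by blast+
    show "x = mS"
      by (rule diagram3[OF q1_split xq mS_q1, where S = "[Undo 0 0 0, Apply 1 2 0, Undo 2 2 0, Apply 0 0 0]"],
      (rule reads arrows | fact)+, simp add: run_simps)
  qed
  then show ?thesis
    unfolding extension_mult_def extension_bimodule_eq Let_def tensor_splitD(1,2)[OF split1] fst_conv by simp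
qed

lemma extension_unit_eq: "extension_unit C A m (Y \<otimes> A) wr ext = ((A, m, m), ext, S)"
  by (simp add: extension_unit_def extension_bimodule_eq)

text \<open>Both bracketings of the tensor cube are identified with \<open>Y Y Y A\<close>, where
  the associator becomes the identity, as \<open>K4_as\<close> states.\<close>

definition as :: 'a where
  "as = i4 \<cdot> (Y \<lhd> i1) \<cdot> k3"

lemma as_in_hom [arrows]: "as \<in> hom C Z3 Z4"
  unfolding as_def by (rule in_hom, (rule reads arrows | fact)+)

lemma K4_as: "(Y \<lhd> k1) \<cdot> k4 \<cdot> as = k3"
  by (rule diagram3[OF as_def k4_i4 k1_i1, where S = "[Apply 0 0 0, Apply 1 2 0, Apply 2 1 1]"],
      (rule reads arrows | fact)+, simp add: run_simps)

lemma as_q: "as \<cdot> q3 \<cdot> (q1 \<rhd> Y \<otimes> A) = q4 \<cdot> (Y \<otimes> A \<lhd> q1)"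
proof -
  have eq: "(Y \<lhd> k1) \<cdot> k4 \<cdot> as \<cdot> q3 \<cdot> (q1 \<rhd> Y \<otimes> A) = (Y \<lhd> k1) \<cdot> k4 \<cdot> (q4 \<cdot> (Y \<otimes> A \<lhd> q1))"
    by (rule diagram9[OF K4_as k3_q3 k1_q1 nu_def phi_m m_assoc lam2_def k1_l1 k4_q4, where S = "[Apply 0 2 0,
      Apply 1 1 0, Apply 2 0 0, Apply 3 0 1, Apply 3 2 2, Apply 4 1 2, Apply 5 3 3, Right 0, Right 2, Right 1,
      Undo 3 3 2, Undo 3 0 3, Undo 6 1 1, Undo 2 0 2, Undo 7 1 1, Undo 8 1 0]"], (rule reads arrows | fact)+,
      simp add: run_simps)
  show "as \<cdot> q3 \<cdot> (q1 \<rhd> Y \<otimes> A) = q4 \<cdot> (Y \<otimes> A \<lhd> q1)"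
    by (rule diagram2[OF I4_K4 eq, where S = "[Undo 0 3 0, Apply 1 0 0, Apply 0 2 0]"], (rule reads arrows | fact)+,
      simp add: run_simps)
qed

lemma Assoc_eq_as: "Assoc Bim S S S = ((Z3, l3, r3), as, (Z4, l4, r4))"
proof -
  have "(THE a. a \<in> hom C Z3 Z4 \<and> a \<cdot> q3 \<cdot> (q1 \<rhd> Y \<otimes> A) = q4 \<cdot> (Y \<otimes> A \<lhd> q1)) = as"
  proof (rule the_equality)
    show "as \<in> hom C Z3 Z4 \<and> as \<cdot> q3 \<cdot> (q1 \<rhd> Y \<otimes> A) = q4 \<cdot> (Y \<otimes> A \<lhd> q1)" using as_in_hom as_q by blast
    fix x assume x: "x \<in> hom C Z3 Z4 \<and> x \<cdot> q3 \<cdot> (q1 \<rhd> Y \<otimes> A) = q4 \<cdot> (Y \<otimes> A \<lhd> q1)"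
    then have hx: "x \<in> hom C Z3 Z4" and xq: "x \<cdot> q3 \<cdot> (q1 \<rhd> Y \<otimes> A) = q4 \<cdot> (Y \<otimes> A \<lhd> q1)" by blast+
    have xq3: "x \<cdot> q3 = as \<cdot> q3"
      by (rule diagram3[OF q1_split xq as_q, where S = "[Undo 0 0 0, Apply 1 2 0, Undo 2 2 0, Apply 0 0 0]"],
      (rule reads arrows | fact)+, simp add: run_simps)
    show "x = as"
      by (rule diagram2[OF q3_split xq3, where S = "[Undo 0 0 0, Apply 1 3 0, Apply 0 0 0]"],
      (rule reads arrows | fact)+, simp add: run_simps)
  qed
  then show ?thesis
    unfolding Bim_Assoc tensor_splitD(1,2)[OF split1] tensor_splitD(1,2)[OF split3] tensor_splitD(1,2)[OF split4] fst_conv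
    by simp
qed

lemma as_linear: "as \<cdot> l3 = l4 \<cdot> (A \<lhd> as)" "as \<cdot> r3 = r4 \<cdot> (as \<rhd> A)"
proof -
  have l: "as \<cdot> l3 \<cdot> (A \<lhd> (q3 \<cdot> (q1 \<rhd> Y \<otimes> A))) = l4 \<cdot> (A \<lhd> as) \<cdot> (A \<lhd> (q3 \<cdot> (q1 \<rhd> Y \<otimes> A)))"
    by (rule diagram4[OF l3_q3 l1_q1 as_q l4_q4, where S = "[Apply 0 1 0, Apply 1 0 0, Apply 2 1 0, Right 0,
      Undo 3 1 0, Undo 2 0 1]"], (rule reads arrows | fact)+, simp add: run_simps)
  have l': "as \<cdot> l3 \<cdot> (A \<lhd> q3) = l4 \<cdot> (A \<lhd> as) \<cdot> (A \<lhd> q3)"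
    by (rule diagram2[OF q1_split l, where S = "[Undo 0 0 1, Apply 1 2 0, Apply 0 0 1]"],
      (rule reads arrows | fact)+, simp add: run_simps)
  show "as \<cdot> l3 = l4 \<cdot> (A \<lhd> as)"
    by (rule diagram2[OF q3_split l', where S = "[Undo 0 0 1, Apply 1 3 0, Apply 0 0 1]"],
      (rule reads arrows | fact)+, simp add: run_simps)
  have r: "as \<cdot> r3 \<cdot> ((q3 \<cdot> (q1 \<rhd> Y \<otimes> A)) \<rhd> A) = r4 \<cdot> (as \<rhd> A) \<cdot> ((q3 \<cdot> (q1 \<rhd> Y \<otimes> A)) \<rhd> A)"
    by (rule diagram4[OF r3_q3 as_q r1_q1 r4_q4, where S = "[Apply 0 1 0, Right 0, Apply 1 1 0, Undo 2 0 2,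
      Undo 3 1 0, Undo 1 0 0]"], (rule reads arrows | fact)+, simp add: run_simps)
  have r': "as \<cdot> r3 \<cdot> (q3 \<rhd> A) = r4 \<cdot> (as \<rhd> A) \<cdot> (q3 \<rhd> A)"
    by (rule diagram2[OF q1_split r, where S = "[Undo 0 0 0, Apply 1 2 0, Apply 0 0 0]"],
      (rule reads arrows | fact)+, simp add: run_simps)
  show "as \<cdot> r3 = r4 \<cdot> (as \<rhd> A)"
    by (rule diagram2[OF q3_split r', where S = "[Undo 0 0 0, Apply 1 3 0, Apply 0 0 0]"],
      (rule reads arrows | fact)+, simp add: run_simps)
qed

definition as' :: 'a where
  "as' = i3 \<cdot> ((Y \<lhd> k1) \<cdot> k4)"

lemma as'_in_hom [arrows]: "as' \<in> hom C Z4 Z3"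
  unfolding as'_def by (rule in_hom, (rule reads arrows | fact)+)

lemma inverse_Assoc: "inverse_arrow Bim (Assoc Bim S S S) = ((Z4, l4, r4), as', (Z3, l3, r3))"
proof -
  have "as' \<cdot> as = Id C Z3"
    by (rule diagram5[OF as'_def as_def k4_i4 k1_i1 i3_k3, where S = "[Apply 0 1 0, Apply 1 0 0, Apply 2 2 0,
      Apply 3 1 1, Apply 4 0 0]"], (rule reads arrows | fact)+, simp add: run_simps)
  moreover have "as \<cdot> as' = Id C Z4"
    by (rule diagram5[OF as'_def as_def k3_i3 i1_k1 i4_k4, where S = "[Apply 0 0 0, Apply 1 3 0, Apply 2 2 0,
      Apply 3 1 1, Apply 4 0 0]"], (rule reads arrows | fact)+, simp add: run_simps)
  ultimately show ?thesis
    unfolding Assoc_eq_as by (intro Bim_inverse_arrow bimod_Z3 bimod_Z4 as_in_hom as'_in_hom as_linear)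
qed

lemma Lun_S: "Lun Bim S = ((ZL, lL, rL), kL, S)"
proof -
  have "(THE l. l \<in> hom C ZL (Y \<otimes> A) \<and> l \<cdot> qL = nu) = kL"
  proof (rule the_equality)
    show "kL \<in> hom C ZL (Y \<otimes> A) \<and> kL \<cdot> qL = nu" using kL_in_hom' kL_qL by blast
    fix x assume x: "x \<in> hom C ZL (Y \<otimes> A) \<and> x \<cdot> qL = nu"
    then have hx: "x \<in> hom C ZL (Y \<otimes> A)" and xq: "x \<cdot> qL = nu" by blast+
    show "x = kL"
      by (rule diagram3[OF qL_split xq kL_qL, where S = "[Undo 0 0 0, Apply 1 2 0, Undo 2 2 0, Apply 0 0 0]"],
      (rule reads arrows | fact)+, simp add: run_simps)
  qed
  then show ?thesis
    unfolding Bim_Lun tensor_splitD(1,2)[OF splitL] fst_conv by simp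
qed

lemma Run_S: "Run Bim S = ((ZR, lR, rR), kR, S)"
proof -
  have "(THE l. l \<in> hom C ZR (Y \<otimes> A) \<and> l \<cdot> qR = Y \<lhd> m) = kR"
  proof (rule the_equality)
    show "kR \<in> hom C ZR (Y \<otimes> A) \<and> kR \<cdot> qR = Y \<lhd> m" using kR_in_hom kR_qR by blast
    fix x assume x: "x \<in> hom C ZR (Y \<otimes> A) \<and> x \<cdot> qR = Y \<lhd> m"
    then have hx: "x \<in> hom C ZR (Y \<otimes> A)" and xq: "x \<cdot> qR = Y \<lhd> m" by blast+
    show "x = kR"
      by (rule diagram3[OF qR_split xq kR_qR, where S = "[Undo 0 0 0, Apply 1 2 0, Undo 2 2 0, Apply 0 0 0]"],
      (rule reads arrows | fact)+, simp add: run_simps)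
  qed
  then show ?thesis
    unfolding Bim_Run tensor_splitD(1,2)[OF splitR] fst_conv by simp
qed

lemma inverse_Lun: "inverse_arrow Bim (Lun Bim S) = (S, iL, (ZL, lL, rL))"
  unfolding Lun_S by (intro Bim_inverse_arrow bimod_ZL bimod_S kL_in_hom' kL_lL kL_rL iL_kL)

lemma inverse_Run: "inverse_arrow Bim (Run Bim S) = (S, iR, (ZR, lR, rR))"
  unfolding Run_S by (intro Bim_inverse_arrow bimod_ZR bimod_S kR_in_hom iR_in_hom kR_lR kR_rR iR_kR kR_iR)

text \<open>The inverse unit isomorphisms insert the unit of \<open>A\<close> and project. In this
  form they can be composed with whiskered arrows, which are known only through their composites
  with projections.\<close>

lemma iL_eq: "iL = qL \<cdot> (\<eta> \<rhd> Y \<otimes> A)"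
proof -
  have nu_unit: "nu \<cdot> (\<eta> \<rhd> Y \<otimes> A) = Id C (Y \<otimes> A)" by (rule nu_left_module)
  show "iL = qL \<cdot> (\<eta> \<rhd> Y \<otimes> A)"
    by (rule diagram3[OF nu_unit kL_qL iL_kL, where S = "[Undo 0 0 0, Undo 1 1 0, Apply 2 2 0]"],
      (rule reads arrows | fact)+, simp add: run_simps)
qed

lemma iR_eq: "iR = qR \<cdot> (Y \<otimes> A \<lhd> \<eta>)"
  by (rule diagram3[OF m_unit_right kR_qR iR_kR, where S = "[Undo 0 0 1, Undo 1 1 0, Apply 2 2 0]"],
      (rule reads arrows | fact)+, simp add: run_simps)

text \<open>The last character of each name refers to the product in which the arrow starts; the
  target is supplied at each use.\<close>

lemmas TenA_S1 = tensor_split_TenA[OF split1 _ split_S(1,2,2,3,3,4) bimod_S bimod_S]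
lemmas TenA_S4 = tensor_split_TenA[OF split4 _ split_S(1,2,2,3,3,4) bimod_S bimod_Z1]
lemmas TenA_SR = tensor_split_TenA[OF splitR _ split_S(1,2,2,3,3,4) bimod_S bimod_A]
lemmas TenA_SL = tensor_split_TenA[OF splitL _ split_A(1,2,3,4,5,6) bimod_A bimod_S]
lemmas TenA_S3 = tensor_split_TenA[OF split3 _ split_Z1(1,2,3) i1_k1 split_Z1(4,5) bimod_Z1 bimod_S]

lemma S_lwhisker_mS: obtains x where "S \<lhd>\<^bsub>Bim\<^esub> (S2, mS, S) = ((Z4, l4, r4), x, S2)"
    "x \<in> hom C Z4 Z1" "x \<cdot> q4 = q1 \<cdot> (Id C (Y \<otimes> A) \<boxtimes> mS)"
  unfolding lwhisker_def[of Bim] Bim_simps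
  by (rule TenA_S4[OF split1 bimod_S bimod_S split_S(2,4) mS_in_hom mS_left])

lemma S_rwhisker_mS: obtains x where "(S2, mS, S) \<rhd>\<^bsub>Bim\<^esub> S = ((Z3, l3, r3), x, S2)"
    "x \<in> hom C Z3 Z1" "x \<cdot> q3 = q1 \<cdot> (mS \<boxtimes> Id C (Y \<otimes> A))"
  unfolding rwhisker_def[of Bim] Bim_simps
  by (rule TenA_S3[OF split1 bimod_S bimod_S mS_in_hom mS_right split_S(2,5)])

lemma ext_left: "ext \<cdot> m = nu \<cdot> (A \<lhd> ext)"
  by (rule diagram4[OF ext_eq m_assoc unt_central nu_def, where S = "[Apply 0 1 0, Left 0, Undo 1 1 1,
      Apply 2 0 0, Apply 1 2 1, Right 1, Undo 3 2 0, Undo 0 0 1]"], (rule reads arrows | fact)+, simp add: run_simps)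

lemma ext_right: "ext \<cdot> m = (Y \<lhd> m) \<cdot> (ext \<rhd> A)"
  by (rule diagram2[OF ext_eq m_assoc, where S = "[Apply 0 1 0, Left 0, Undo 1 1 1, Undo 0 0 0]"],
      (rule reads arrows | fact)+, simp add: run_simps)

lemma ext_rwhisker_S: obtains x where "((A, m, m), ext, S) \<rhd>\<^bsub>Bim\<^esub> S = ((ZL, lL, rL), x, S2)"
    "x \<in> hom C ZL Z1" "x \<cdot> qL = q1 \<cdot> (ext \<boxtimes> Id C (Y \<otimes> A))"
  unfolding rwhisker_def[of Bim] Bim_simps
  by (rule TenA_SL[OF split1 bimod_S bimod_S ext_in_hom ext_right split_S(2,5)])

lemma S_lwhisker_ext: obtains x where "S \<lhd>\<^bsub>Bim\<^esub> ((A, m, m), ext, S) = ((ZR, lR, rR), x, S2)"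
    "x \<in> hom C ZR Z1" "x \<cdot> qR = q1 \<cdot> (Id C (Y \<otimes> A) \<boxtimes> ext)"
  unfolding lwhisker_def[of Bim] Bim_simps
  by (rule TenA_SR[OF split1 bimod_S bimod_S split_S(2,4) ext_in_hom ext_left])

text \<open>Composed with the projections, the laws become \<open>wr_assoc\<close>,
  \<open>wr_ext_left\<close> and \<open>wr_ext_right\<close>; the projections are then
  cancelled.\<close>

lemma algebra_Bim: "algebra Bim S (S2, mS, S) ((A, m, m), ext, S)"
proof -
  have o: "S \<in> Ob Bim" using bimod_S unfolding Bim_simps .
  have SS: "balanced_tensor C A S S = S2" by (rule tensor_splitD(2)[OF split1])
  have h1: "(S2, mS, S) \<in> hom Bim (S \<otimes>\<^bsub>Bim\<^esub> S) S"
    unfolding Bim_simps SS Bim_hom using bimod_Z1 bimod_S mS_in_hom mS_left mS_right by blast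
  have h2: "((A, m, m), ext, S) \<in> hom Bim \<one>\<^bsub>Bim\<^esub> S"
    unfolding Bim_simps Bim_hom using bimod_A bimod_S ext_in_hom ext_left ext_right by blast
  obtain x1 where w1: "S \<lhd>\<^bsub>Bim\<^esub> (S2, mS, S) = ((Z4, l4, r4), x1, S2)"
    and hx1: "x1 \<in> hom C Z4 Z1" and x1q: "x1 \<cdot> q4 = q1 \<cdot> (Id C (Y \<otimes> A) \<boxtimes> mS)"
    by (rule S_lwhisker_mS)
  obtain x3 where w3: "(S2, mS, S) \<rhd>\<^bsub>Bim\<^esub> S = ((Z3, l3, r3), x3, S2)"
    and hx3: "x3 \<in> hom C Z3 Z1" and x3q: "x3 \<cdot> q3 = q1 \<cdot> (mS \<boxtimes> Id C (Y \<otimes> A))"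
    by (rule S_rwhisker_mS)
  obtain x7 where w7: "((A, m, m), ext, S) \<rhd>\<^bsub>Bim\<^esub> S = ((ZL, lL, rL), x7, S2)"
    and hx7: "x7 \<in> hom C ZL Z1" and x7q: "x7 \<cdot> qL = q1 \<cdot> (ext \<boxtimes> Id C (Y \<otimes> A))"
    by (rule ext_rwhisker_S)
  obtain x8 where w8: "S \<lhd>\<^bsub>Bim\<^esub> ((A, m, m), ext, S) = ((ZR, lR, rR), x8, S2)"
    and hx8: "x8 \<in> hom C ZR Z1" and x8q: "x8 \<cdot> qR = q1 \<cdot> (Id C (Y \<otimes> A) \<boxtimes> ext)"
    by (rule S_lwhisker_ext)
  have a1: "mS \<cdot> x3 \<cdot> q3 \<cdot> (q1 \<rhd> Y \<otimes> A) = wr \<cdot> (wr \<rhd> Y \<otimes> A)"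
    by (rule diagram2[OF x3q mS_q1, where S = "[Apply 0 1 0, Apply 1 0 0, Apply 1 1 0]"],
      (rule reads arrows | fact)+, simp add: run_simps)
  have a2: "mS \<cdot> (x1 \<cdot> as) \<cdot> q3 \<cdot> (q1 \<rhd> Y \<otimes> A) = wr \<cdot> (Y \<otimes> A \<lhd> wr)"
    by (rule diagram3[OF as_q x1q mS_q1, where S = "[Apply 0 0 0, Apply 1 1 0, Apply 2 2 0, Apply 2 0 2]"],
      (rule reads arrows | fact)+, simp add: run_simps)
  have a3: "mS \<cdot> x3 \<cdot> q3 = mS \<cdot> (x1 \<cdot> as) \<cdot> q3"
    by (rule diagram4[OF q1_split a1 wr_assoc a2, where S = "[Undo 0 0 0, Apply 1 2 0, Apply 2 2 0, Undo 3 2 0,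
      Apply 0 0 0]"], (rule reads arrows | fact)+, simp add: run_simps)
  have a4: "mS \<cdot> x3 = mS \<cdot> (x1 \<cdot> as)"
    by (rule diagram2[OF q3_split a3, where S = "[Undo 0 0 0, Apply 1 3 0, Apply 0 0 0]"],
      (rule reads arrows | fact)+, simp add: run_simps)
  have a5: "mS \<cdot> x7 \<cdot> qL = nu"
    by (rule diagram3[OF x7q mS_q1 wr_ext_left, where S = "[Apply 0 0 0, Apply 1 1 0, Apply 2 0 0]"],
      (rule reads arrows | fact)+, simp add: run_simps)
  have a6: "mS \<cdot> x7 = kL"
    by (rule diagram3[OF qL_split a5 kL_qL, where S = "[Undo 0 0 0, Apply 1 2 0, Undo 2 2 0, Apply 0 0 0]"],
      (rule reads arrows | fact)+, simp add: run_simps)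
  have a7: "mS \<cdot> x8 \<cdot> qR = Y \<lhd> m"
    by (rule diagram3[OF x8q mS_q1 wr_ext_right, where S = "[Apply 0 0 0, Apply 1 1 0, Apply 2 0 0]"],
      (rule reads arrows | fact)+, simp add: run_simps)
  have a8: "mS \<cdot> x8 = kR"
    by (rule diagram3[OF qR_split a7 kR_qR, where S = "[Undo 0 0 0, Apply 1 2 0, Undo 2 2 0, Apply 0 0 0]"],
      (rule reads arrows | fact)+, simp add: run_simps)
  have a9: "mS \<cdot> x1 \<cdot> as = mS \<cdot> (x1 \<cdot> as)"
    by (rule diagram0[where S = "[]"], (rule reads arrows | fact)+, simp add: run_simps)
  show ?thesis
    unfolding algebra_def w1 w3 w7 w8 Assoc_eq_as Lun_S Run_S Bim_simps(5) a4 a6 a8 a9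
    using o h1 h2 by blast
qed

section \<open>Frobenius systems of the \<open>A\<close>-ring\<close>

definition theta_ext :: "'a \<Rightarrow> 'a" where
  "theta_ext \<theta> = m \<cdot> (\<theta> \<rhd> A)"

text \<open>The right linear extension of \<open>e\<close> from the unit object to \<open>A\<close>;
  \<open>i1\<close> leads from \<open>Y Y A\<close> back to the chosen tensor square.\<close>

definition e_ext :: "'a \<Rightarrow> 'a" where
  "e_ext e = i1 \<cdot> (Y \<otimes> Y \<lhd> m) \<cdot> (e \<rhd> A)"

text \<open>The extension is right linear by associativity of \<open>m\<close>; commutation of
  \<open>\<theta>\<close> with \<open>phi\<close> becomes its left linearity.\<close>

lemma theta_ext_bimodule:
  assumes "left_arr Y phi \<one> (Id C A) \<theta>"
  shows "(S, theta_ext \<theta>, (A, m, m)) \<in> hom Bim S (A, m, m)"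
proof -
  have h: "\<theta> \<in> hom C Y A" and c: "m \<cdot> (\<theta> \<rhd> A) \<cdot> phi = m \<cdot> (A \<lhd> \<theta>)"
    using assms unfolding left_arr_to_unit by blast+
  have "m \<cdot> (\<theta> \<rhd> A) \<cdot> nu = m \<cdot> (A \<lhd> (m \<cdot> (\<theta> \<rhd> A)))"
    by (rule diagram3[OF nu_def m_assoc c, where S = "[Apply 0 0 0, Left 1, Undo 1 2 0, Apply 2 0 0, Apply 1 1 0]"],
      (rule reads arrows | fact)+, simp add: run_simps)
  moreover have "m \<cdot> (\<theta> \<rhd> A) \<cdot> (Y \<lhd> m) = m \<cdot> ((m \<cdot> (\<theta> \<rhd> A)) \<rhd> A)"
    by (rule diagram1[OF m_assoc, where S = "[Left 0, Undo 0 1 0]"], (rule reads arrows | fact)+,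
      simp add: run_simps)
  moreover have "m \<cdot> (\<theta> \<rhd> A) \<in> hom C (Y \<otimes> A) A"
    by (rule in_hom, (rule reads arrows | fact)+)
  ultimately show ?thesis unfolding Bim_hom theta_ext_def using bimod_S bimod_A by blast
qed

text \<open>A right linear arrow on the free module \<open>Y A\<close> is determined by its
  restriction along the unit of \<open>A\<close>, and left linearity of the arrow is commutation of
  this restriction with \<open>phi\<close>.\<close>

lemma theta_ext_surj:
  assumes "F \<in> hom Bim S (A, m, m)"
  shows "\<exists>\<theta>. left_arr Y phi \<one> (Id C A) \<theta> \<and> F = (S, theta_ext \<theta>, (A, m, m))"
proof -
  obtain f where F: "F = (S, f, (A, m, m))" and hf: "f \<in> hom C (Y \<otimes> A) A" and fl: "f \<cdot> nu = m \<cdot> (A \<lhd> f)"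
    and fr: "f \<cdot> (Y \<lhd> m) = m \<cdot> (f \<rhd> A)"
    using assms unfolding Bim_hom by blast
  have "f \<cdot> (Y \<lhd> \<eta>) \<in> hom C Y A"
    by (rule in_hom, (rule reads arrows | fact)+)
  moreover have "m \<cdot> ((f \<cdot> (Y \<lhd> \<eta>)) \<rhd> A) \<cdot> phi = m \<cdot> (A \<lhd> (f \<cdot> (Y \<lhd> \<eta>)))"
    by (rule diagram5[OF fr m_unit_left m_unit_right nu_def fl, where S = "[Undo 0 2 0, Apply 1 1 1, Undo 2 1 1,
      Right 0, Undo 3 1 0, Apply 4 1 0]"], (rule reads arrows | fact)+, simp add: run_simps)
  ultimately have "left_arr Y phi \<one> (Id C A) (f \<cdot> (Y \<lhd> \<eta>))"
    unfolding left_arr_to_unit using left_obj_Y by blast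
  moreover have "f = m \<cdot> ((f \<cdot> (Y \<lhd> \<eta>)) \<rhd> A)"
    by (rule diagram2[OF m_unit_left fr, where S = "[Undo 0 0 1, Apply 1 1 0]"], (rule reads arrows | fact)+,
      simp add: run_simps)
  ultimately show ?thesis unfolding F theta_ext_def by blast
qed

lemma e_ext_bimodule:
  assumes "left_arr \<one> (Id C A) (Y \<otimes> Y) phi2 e"
  shows "((A, m, m), e_ext e, S2) \<in> hom Bim (A, m, m) S2"
proof -
  have h: "e \<in> hom C \<one> ((Y \<otimes> Y) \<otimes> A)" and c: "(Y \<otimes> Y \<lhd> m) \<cdot> (e \<rhd> A) = (Y \<otimes> Y \<lhd> m) \<cdot> (((Y \<lhd> phi) \<cdot> (phi \<rhd> Y)) \<rhd> A) \<cdot> (A \<lhd> e)"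
    using assms unfolding left_arr_from_unit by blast+
  have l1_eq: "l1 = i1 \<cdot> lam2 \<cdot> (A \<lhd> k1)"
    by (rule diagram2[OF i1_k1 k1_l1, where S = "[Undo 0 1 0, Apply 1 0 0]"], (rule reads arrows | fact)+,
      simp add: run_simps)
  have r1_eq: "r1 = i1 \<cdot> (Y \<lhd> Y \<lhd> m) \<cdot> (k1 \<rhd> A)"
    by (rule diagram2[OF i1_k1 k1_r1, where S = "[Undo 0 1 0, Apply 1 0 0]"], (rule reads arrows | fact)+,
      simp add: run_simps)
  have "i1 \<cdot> (Y \<otimes> Y \<lhd> m) \<cdot> (e \<rhd> A) \<cdot> m = l1 \<cdot> (A \<lhd> (i1 \<cdot> (Y \<otimes> Y \<lhd> m) \<cdot> (e \<rhd> A)))"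
    by (rule diagram6[OF m_assoc c nu_def lam2_def k1_i1 l1_eq, where S = "[Left 0, Undo 0 1 2, Apply 1 0 0,
      Apply 0 3 2, Right 2, Right 1, Undo 2 3 1, Undo 3 2 0, Undo 4 2 1, Undo 5 3 0]"], (rule reads arrows | fact)+,
      simp add: run_simps)
  moreover have "i1 \<cdot> (Y \<otimes> Y \<lhd> m) \<cdot> (e \<rhd> A) \<cdot> m = r1 \<cdot> ((i1 \<cdot> (Y \<otimes> Y \<lhd> m) \<cdot> (e \<rhd> A)) \<rhd> A)"
    by (rule diagram3[OF m_assoc k1_i1 r1_eq, where S = "[Left 0, Undo 0 1 2, Undo 1 2 0, Undo 2 3 0]"],
      (rule reads arrows | fact)+, simp add: run_simps)
  moreover have "i1 \<cdot> (Y \<otimes> Y \<lhd> m) \<cdot> (e \<rhd> A) \<in> hom C A Z1"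
    by (rule in_hom, (rule reads arrows | fact)+)
  ultimately show ?thesis unfolding Bim_hom e_ext_def using bimod_Z1 bimod_A by blast
qed

text \<open>The arrow \<open>e\<close> is the value at the unit of \<open>A\<close>. Extending this
  value by right linearity and by left linearity gives the same arrow, and this equality is the
  centrality of \<open>e\<close>.\<close>

lemma e_ext_surj:
  assumes "F \<in> hom Bim (A, m, m) S2"
  shows "\<exists>e. left_arr \<one> (Id C A) (Y \<otimes> Y) phi2 e \<and> F = ((A, m, m), e_ext e, S2)"
proof -
  obtain f where F: "F = ((A, m, m), f, S2)" and hf: "f \<in> hom C A Z1" and fl: "f \<cdot> m = l1 \<cdot> (A \<lhd> f)"
    and fr: "f \<cdot> m = r1 \<cdot> (f \<rhd> A)"
    using assms unfolding Bim_hom by blast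
  have eta_r: "k1 \<cdot> f = (Y \<otimes> Y \<lhd> m) \<cdot> ((k1 \<cdot> f \<cdot> \<eta>) \<rhd> A)"
  proof -
    have fu: "f \<cdot> m \<cdot> (\<eta> \<rhd> A) = f"
      by (rule diagram1[OF m_unit_left, where S = "[Apply 0 0 0]"], (rule reads arrows | fact)+, simp add: run_simps)
    have fr': "k1 \<cdot> (f \<cdot> m \<cdot> (\<eta> \<rhd> A)) = (Y \<otimes> Y \<lhd> m) \<cdot> ((k1 \<cdot> f \<cdot> \<eta>) \<rhd> A)"
      by (rule diagram2[OF fr k1_r1, where S = "[Apply 0 1 0, Apply 1 2 0]"], (rule reads arrows | fact)+,
      simp add: run_simps)
    show ?thesis using fr' unfolding fu .
  qed
  have eta_l: "k1 \<cdot> f = (Y \<otimes> Y \<lhd> m) \<cdot> (((Y \<lhd> phi) \<cdot> (phi \<rhd> Y)) \<rhd> A) \<cdot> (A \<lhd> (k1 \<cdot> f \<cdot> \<eta>))"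
  proof -
    have fu: "f \<cdot> m \<cdot> (A \<lhd> \<eta>) = f"
      by (rule diagram1[OF m_unit_right, where S = "[Apply 0 0 0]"], (rule reads arrows | fact)+, simp add: run_simps)
    have fl': "k1 \<cdot> (f \<cdot> m \<cdot> (A \<lhd> \<eta>)) = (Y \<otimes> Y \<lhd> m) \<cdot> (((Y \<lhd> phi) \<cdot> (phi \<rhd> Y)) \<rhd> A) \<cdot> (A \<lhd> (k1 \<cdot> f \<cdot> \<eta>))"
      by (rule diagram4[OF fl k1_l1 lam2_def nu_def, where S = "[Apply 0 1 0, Apply 1 2 0, Apply 2 3 0,
      Apply 3 4 1]"], (rule reads arrows | fact)+, simp add: run_simps)
    show ?thesis using fl' unfolding fu .
  qed
  have "k1 \<cdot> f \<cdot> \<eta> \<in> hom C \<one> ((Y \<otimes> Y) \<otimes> A)"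
    by (rule in_hom, (rule reads arrows | fact)+)
  moreover have "(Y \<otimes> Y \<lhd> m) \<cdot> ((k1 \<cdot> f \<cdot> \<eta>) \<rhd> A) =
      (Y \<otimes> Y \<lhd> m) \<cdot> (((Y \<lhd> phi) \<cdot> (phi \<rhd> Y)) \<rhd> A) \<cdot> (A \<lhd> (k1 \<cdot> f \<cdot> \<eta>))"
    using eta_r eta_l by (rule trans[OF sym])
  ultimately have "left_arr \<one> (Id C A) (Y \<otimes> Y) phi2 (k1 \<cdot> f \<cdot> \<eta>)"
    unfolding left_arr_from_unit using left_obj_YY by blast
  moreover have "f = i1 \<cdot> (Y \<otimes> Y \<lhd> m) \<cdot> ((k1 \<cdot> f \<cdot> \<eta>) \<rhd> A)"
    by (rule diagram2[OF i1_k1 eta_r, where S = "[Undo 0 1 0, Apply 1 0 0]"], (rule reads arrows | fact)+,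
      simp add: run_simps)
  ultimately show ?thesis unfolding F e_ext_def by blast
qed

text \<open>Under the identifications, each composite occurring in the Frobenius conditions of
  \<open>Bim\<close> is the right linear extension of the corresponding arrow in
  \<open>frobenius_system'\<close>. Such an extension determines the arrow, so the conditions match
  one by one.\<close>

lemma frobenius_Bim_iff:
  assumes lt: "left_arr Y phi \<one> (Id C A) \<theta>" and le: "left_arr \<one> (Id C A) (Y \<otimes> Y) phi2 e"
    and F: "F = (S, theta_ext \<theta>, (A, m, m))" and G: "G = ((A, m, m), e_ext e, S2)"
  shows "(S \<lhd>\<^bsub>Bim\<^esub> (S2, mS, S)) \<cdot>\<^bsub>Bim\<^esub> Assoc Bim S S S \<cdot>\<^bsub>Bim\<^esub> (G \<rhd>\<^bsub>Bim\<^esub> S) \<cdot>\<^bsub>Bim\<^esub> inverse_arrow Bim (Lun Bim S) =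
        ((S2, mS, S) \<rhd>\<^bsub>Bim\<^esub> S) \<cdot>\<^bsub>Bim\<^esub> inverse_arrow Bim (Assoc Bim S S S) \<cdot>\<^bsub>Bim\<^esub> (S \<lhd>\<^bsub>Bim\<^esub> G) \<cdot>\<^bsub>Bim\<^esub> inverse_arrow Bim (Run Bim S) \<and>
        Lun Bim S \<cdot>\<^bsub>Bim\<^esub> (F \<rhd>\<^bsub>Bim\<^esub> S) \<cdot>\<^bsub>Bim\<^esub> G = ((A, m, m), ext, S) \<and>
        Run Bim S \<cdot>\<^bsub>Bim\<^esub> (S \<lhd>\<^bsub>Bim\<^esub> F) \<cdot>\<^bsub>Bim\<^esub> G = ((A, m, m), ext, S) \<longleftrightarrow> frobenius_system' \<theta> e"
proof -
  have ht: "\<theta> \<in> hom C Y A"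
    using lt unfolding left_arr_to_unit by blast
  have he: "e \<in> hom C \<one> ((Y \<otimes> Y) \<otimes> A)" and ec: "(Y \<otimes> Y \<lhd> m) \<cdot> (e \<rhd> A) = (Y \<otimes> Y \<lhd> m) \<cdot> (((Y \<lhd> phi) \<cdot> (phi \<rhd> Y)) \<rhd> A) \<cdot> (A \<lhd> e)"
    using le unfolding left_arr_from_unit by blast+
  define f where "f = theta_ext \<theta>"
  define g where "g = e_ext e"
  have hf: "f \<in> hom C (Y \<otimes> A) A" and fl: "f \<cdot> nu = m \<cdot> (A \<lhd> f)" and fr: "f \<cdot> (Y \<lhd> m) = m \<cdot> (f \<rhd> A)"
    using theta_ext_bimodule[OF lt] unfolding Bim_hom f_def by blast+
  have hg: "g \<in> hom C A Z1" and gl: "g \<cdot> m = l1 \<cdot> (A \<lhd> g)" and gr: "g \<cdot> m = r1 \<cdot> (g \<rhd> A)"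
    using e_ext_bimodule[OF le] unfolding Bim_hom g_def by blast+
  have f_eq: "f = m \<cdot> (\<theta> \<rhd> A)" by (simp add: f_def theta_ext_def)
  have g_eq: "g = i1 \<cdot> (Y \<otimes> Y \<lhd> m) \<cdot> (e \<rhd> A)" by (simp add: g_def e_ext_def)
  have g_eta: "k1 \<cdot> g \<cdot> \<eta> = e"
    by (rule diagram3[OF g_eq k1_i1 m_unit_right, where S = "[Apply 0 1 0, Apply 1 3 0, Left 0, Apply 2 1 2]"],
      (rule reads arrows | fact)+, simp add: run_simps)
  have nu_assoc: "nu \<cdot> (A \<lhd> nu) = nu \<cdot> (m \<rhd> Y \<otimes> A)" by (rule nu_left_module)
  obtain x1 where w1: "S \<lhd>\<^bsub>Bim\<^esub> (S2, mS, S) = ((Z4, l4, r4), x1, S2)"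
    and hx1: "x1 \<in> hom C Z4 Z1" and x1q: "x1 \<cdot> q4 = q1 \<cdot> (Id C (Y \<otimes> A) \<boxtimes> mS)"
    by (rule S_lwhisker_mS)
  obtain x3 where w3: "(S2, mS, S) \<rhd>\<^bsub>Bim\<^esub> S = ((Z3, l3, r3), x3, S2)"
    and hx3: "x3 \<in> hom C Z3 Z1" and x3q: "x3 \<cdot> q3 = q1 \<cdot> (mS \<boxtimes> Id C (Y \<otimes> A))"
    by (rule S_rwhisker_mS)
  obtain x2 where w2: "G \<rhd>\<^bsub>Bim\<^esub> S = ((ZL, lL, rL), x2, (Z3, l3, r3))"
    and hx2: "x2 \<in> hom C ZL Z3" and x2q: "x2 \<cdot> qL = q3 \<cdot> (g \<boxtimes> Id C (Y \<otimes> A))"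
    unfolding rwhisker_def[of Bim] Bim_simps G g_def[symmetric]
    by (rule TenA_SL[OF split3 bimod_Z1 bimod_S hg gr split_S(2,5)])
  obtain x4 where w4: "S \<lhd>\<^bsub>Bim\<^esub> G = ((ZR, lR, rR), x4, (Z4, l4, r4))"
    and hx4: "x4 \<in> hom C ZR Z4" and x4q: "x4 \<cdot> qR = q4 \<cdot> (Id C (Y \<otimes> A) \<boxtimes> g)"
    unfolding lwhisker_def[of Bim] Bim_simps G g_def[symmetric]
    by (rule TenA_SR[OF split4 bimod_S bimod_Z1 split_S(2,4) hg gl])
  obtain x5 where w5: "F \<rhd>\<^bsub>Bim\<^esub> S = (S2, x5, (ZL, lL, rL))"
    and hx5: "x5 \<in> hom C Z1 ZL" and x5q: "x5 \<cdot> q1 = qL \<cdot> (f \<boxtimes> Id C (Y \<otimes> A))"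
    unfolding rwhisker_def[of Bim] Bim_simps F f_def[symmetric]
    by (rule TenA_S1[OF splitL bimod_A bimod_S hf fr split_S(2,5)])
  obtain x6 where w6: "S \<lhd>\<^bsub>Bim\<^esub> F = (S2, x6, (ZR, lR, rR))"
    and hx6: "x6 \<in> hom C Z1 ZR" and x6q: "x6 \<cdot> q1 = qR \<cdot> (Id C (Y \<otimes> A) \<boxtimes> f)"
    unfolding lwhisker_def[of Bim] Bim_simps F f_def[symmetric]
    by (rule TenA_S1[OF splitR bimod_S bimod_A split_S(2,4) hf fl])
  \<comment> \<open>The arrows \<open>x1\<close> to \<open>x6\<close> are known only on projections.
    The following facts express them through the identifications, or evaluate them on the inverse
    unit isomorphisms.\<close>
  have y1q: "k1 \<cdot> x1 \<cdot> q4 = (Y \<lhd> mul') \<cdot> (Y \<lhd> k1) \<cdot> k4 \<cdot> q4"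
    by (rule diagram6[OF x1q k1_q1 mS_def mul'_left k1_l1 k4_q4, where S = "[Apply 0 0 0, Apply 1 1 0, Apply 2 0 2,
      Undo 3 1 1, Undo 4 0 1, Undo 5 0 0]"], (rule reads arrows | fact)+, simp add: run_simps)
  have y1: "k1 \<cdot> x1 = (Y \<lhd> mul') \<cdot> (Y \<lhd> k1) \<cdot> k4"
    by (rule diagram2[OF q4_split y1q, where S = "[Undo 0 0 0, Apply 1 2 0, Apply 0 0 0]"],
      (rule reads arrows | fact)+, simp add: run_simps)
  have y2: "x2 \<cdot> iL = q3 \<cdot> ((g \<cdot> \<eta>) \<rhd> Y \<otimes> A)"
    by (rule diagram2[OF iL_eq x2q, where S = "[Apply 0 0 0, Apply 1 1 0]"], (rule reads arrows | fact)+,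
      simp add: run_simps)
  have y3q: "k1 \<cdot> x3 \<cdot> q3 = (Y \<lhd> nu) \<cdot> (mul \<rhd> Y \<otimes> A) \<cdot> k3 \<cdot> q3"
    by (rule diagram6[OF x3q mS_def mul'_def k1_q1 nu_assoc k3_q3, where S = "[Apply 0 0 0, Apply 1 0 0,
      Apply 2 1 0, Apply 3 3 0, Undo 4 2 1, Right 1, Undo 5 0 0]"], (rule reads arrows | fact)+, simp add: run_simps)
  have y3: "k1 \<cdot> x3 = (Y \<lhd> nu) \<cdot> (mul \<rhd> Y \<otimes> A) \<cdot> k3"
    by (rule diagram2[OF q3_split y3q, where S = "[Undo 0 0 0, Apply 1 3 0, Apply 0 0 0]"],
      (rule reads arrows | fact)+, simp add: run_simps)
  have y4: "x4 \<cdot> iR = q4 \<cdot> (Y \<otimes> A \<lhd> (g \<cdot> \<eta>))"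
    by (rule diagram2[OF iR_eq x4q, where S = "[Apply 0 0 0, Apply 1 1 0]"], (rule reads arrows | fact)+,
      simp add: run_simps)
  have y5q: "kL \<cdot> x5 \<cdot> q1 = nu \<cdot> (\<theta> \<rhd> Y \<otimes> A) \<cdot> k1 \<cdot> q1"
    by (rule diagram5[OF x5q kL_qL f_eq nu_assoc k1_q1, where S = "[Apply 0 0 0, Apply 1 1 0, Apply 2 0 0,
      Undo 3 1 0, Right 0, Undo 4 0 0]"], (rule reads arrows | fact)+, simp add: run_simps)
  have y5: "kL \<cdot> x5 = nu \<cdot> (\<theta> \<rhd> Y \<otimes> A) \<cdot> k1"
    by (rule diagram2[OF q1_split y5q, where S = "[Undo 0 0 0, Apply 1 2 0, Apply 0 0 0]"],
      (rule reads arrows | fact)+, simp add: run_simps)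
  have y6q: "kR \<cdot> x6 \<cdot> q1 = (Y \<lhd> f) \<cdot> k1 \<cdot> q1"
    by (rule diagram4[OF x6q kR_qR fl k1_q1, where S = "[Apply 0 0 0, Apply 1 1 0, Undo 2 0 1, Undo 3 0 0]"],
      (rule reads arrows | fact)+, simp add: run_simps)
  have y6: "kR \<cdot> x6 = (Y \<lhd> f) \<cdot> k1"
    by (rule diagram2[OF q1_split y6q, where S = "[Undo 0 0 0, Apply 1 2 0, Apply 0 0 0]"],
      (rule reads arrows | fact)+, simp add: run_simps)
  \<comment> \<open>\<open>E1\<close> and \<open>E1'\<close> are the two sides of the Frobenius
    condition in \<open>T'\<close>; \<open>E2\<close> and \<open>E3\<close> are its two unit
    composites.\<close>
  define E1 where "E1 = (Y \<otimes> Y \<lhd> m) \<cdot> ((Y \<lhd> mul) \<rhd> A) \<cdot> ((Y \<otimes> Y \<lhd> phi) \<cdot> (e \<rhd> Y))"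
  define E1' where "E1' = (Y \<otimes> Y \<lhd> m) \<cdot> (((Y \<lhd> phi) \<cdot> (mul \<rhd> Y)) \<rhd> A) \<cdot> (Y \<lhd> e)"
  define E2 where "E2 = (Y \<lhd> m) \<cdot> (((\<one> \<lhd> phi) \<cdot> (\<theta> \<rhd> Y)) \<rhd> A) \<cdot> e"
  define E3 where "E3 = (Y \<lhd> m) \<cdot> ((Y \<lhd> \<theta>) \<rhd> A) \<cdot> e"
  have hE1: "E1 \<in> hom C Y (Y \<otimes> Y \<otimes> A)"
    unfolding E1_def by (rule in_hom, (rule reads arrows | fact)+)
  have hE1': "E1' \<in> hom C Y (Y \<otimes> Y \<otimes> A)"
    unfolding E1'_def by (rule in_hom, (rule reads arrows | fact)+)
  have hE2: "E2 \<in> hom C \<one> (Y \<otimes> A)"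
    unfolding E2_def by (rule in_hom, (rule reads arrows | fact)+)
  have hE3: "E3 \<in> hom C \<one> (Y \<otimes> A)"
    unfolding E3_def by (rule in_hom, (rule reads arrows | fact)+)
  have c1: "x1 \<cdot> as \<cdot> x2 \<cdot> iL = i1 \<cdot> (Y \<otimes> Y \<lhd> m) \<cdot> (E1 \<rhd> A)"
  proof -
    have r: "k1 \<cdot> (x1 \<cdot> as \<cdot> x2 \<cdot> iL) = (Y \<otimes> Y \<lhd> m) \<cdot> (E1 \<rhd> A)"
      by (rule diagram9[OF y1 K4_as y2 k3_q3 g_eta nu_def mul'_def m_assoc E1_def, where S = "[Apply 0 3 0,
      Apply 1 2 0, Apply 2 0 0, Apply 3 2 0, Apply 4 0 0, Apply 5 1 2, Apply 6 3 1, Left 2, Undo 7 3 2, Undo 8 0 0]"],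
      (rule reads arrows | fact)+, simp add: run_simps)
    show "x1 \<cdot> as \<cdot> x2 \<cdot> iL = i1 \<cdot> (Y \<otimes> Y \<lhd> m) \<cdot> (E1 \<rhd> A)"
      by (rule diagram2[OF i1_k1 r, where S = "[Undo 0 4 0, Apply 1 0 0]"], (rule reads arrows | fact)+,
      simp add: run_simps)
  qed
  \<comment> \<open>On this side a scalar stands to the left of \<open>e\<close>, and centrality of
    \<open>e\<close> is what moves it to the right.\<close>
  have c1': "x3 \<cdot> as' \<cdot> x4 \<cdot> iR = i1 \<cdot> (Y \<otimes> Y \<lhd> m) \<cdot> (E1' \<rhd> A)"
  proof -
    have r: "k1 \<cdot> (x3 \<cdot> as' \<cdot> x4 \<cdot> iR) = (Y \<otimes> Y \<lhd> m) \<cdot> (E1' \<rhd> A)"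
      by (rule diagram_eq[OF valid_Cons[OF y3 valid_Cons[OF as'_def valid_Cons[OF k3_i3 valid_Cons[OF y4 valid_Cons[OF
      k4_q4 valid_Cons[OF k1_l1 valid_Cons[OF g_eta valid_Cons[OF lam2_def valid_Cons[OF nu_def valid_Cons[OF ec
      valid_Cons[OF m_assoc valid_Cons[OF E1'_def valid_Nil]]]]]]]]]]]], where S = "[Apply 0 3 0, Apply 1 2 0,
      Apply 2 4 0, Apply 3 0 0, Apply 4 2 0, Apply 5 2 1, Apply 6 0 2, Apply 7 1 1, Apply 8 2 2, Undo 9 0 1, Left 1,
      Apply 8 3 1, Left 2, Undo 10 3 2, Undo 11 0 0]"], (rule reads arrows | fact)+, simp add: run_simps)
    show "x3 \<cdot> as' \<cdot> x4 \<cdot> iR = i1 \<cdot> (Y \<otimes> Y \<lhd> m) \<cdot> (E1' \<rhd> A)"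
      by (rule diagram2[OF i1_k1 r, where S = "[Undo 0 4 0, Apply 1 0 0]"], (rule reads arrows | fact)+,
      simp add: run_simps)
  qed
  have c2: "kL \<cdot> x5 \<cdot> g = (Y \<lhd> m) \<cdot> (E2 \<rhd> A)"
    by (rule diagram6[OF y5 g_eq k1_i1 nu_def m_assoc E2_def, where S = "[Apply 0 1 0, Apply 1 0 0, Apply 2 2 0,
      Left 1, Apply 3 3 0, Left 2, Undo 4 3 1, Undo 5 0 0]"], (rule reads arrows | fact)+, simp add: run_simps)
  have c3: "kR \<cdot> x6 \<cdot> g = (Y \<lhd> m) \<cdot> (E3 \<rhd> A)"
    by (rule diagram6[OF y6 g_eq k1_i1 f_eq m_assoc E3_def, where S = "[Apply 0 1 0, Apply 1 0 0, Apply 2 2 0,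
      Apply 3 2 1, Left 1, Undo 4 2 1, Undo 5 0 0]"], (rule reads arrows | fact)+, simp add: run_simps)
  \<comment> \<open>Restriction along the unit of \<open>A\<close> undoes a right linear extension;
    the same argument gives \<open>unit_inject\<close>.\<close>
  have i1: "E1 = E1'" if eq: "i1 \<cdot> (Y \<otimes> Y \<lhd> m) \<cdot> (E1 \<rhd> A) = i1 \<cdot> (Y \<otimes> Y \<lhd> m) \<cdot> (E1' \<rhd> A)"
  proof -
    have a1: "k1 \<cdot> (i1 \<cdot> (Y \<otimes> Y \<lhd> m) \<cdot> (E1 \<rhd> A)) \<cdot> (Y \<lhd> \<eta>) = E1"
      by (rule diagram2[OF k1_i1 m_unit_right, where S = "[Apply 0 3 0, Left 0, Apply 1 1 2]"],
      (rule reads arrows | fact)+, simp add: run_simps)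
    have a2: "k1 \<cdot> (i1 \<cdot> (Y \<otimes> Y \<lhd> m) \<cdot> (E1' \<rhd> A)) \<cdot> (Y \<lhd> \<eta>) = E1'"
      by (rule diagram2[OF k1_i1 m_unit_right, where S = "[Apply 0 3 0, Left 0, Apply 1 1 2]"],
      (rule reads arrows | fact)+, simp add: run_simps)
    show ?thesis using a1 unfolding eq a2 by (rule sym)
  qed
  have unit_inject: "v = w" if hv: "v \<in> hom C \<one> (Y \<otimes> A)" and hw: "w \<in> hom C \<one> (Y \<otimes> A)"
    and eq: "(Y \<lhd> m) \<cdot> (v \<rhd> A) = (Y \<lhd> m) \<cdot> (w \<rhd> A)" for v w
  proof -
    have a1: "(Y \<lhd> m) \<cdot> (v \<rhd> A) \<cdot> \<eta> = v"
      by (rule diagram1[OF m_unit_right, where S = "[Left 0, Apply 0 1 1]"], (rule reads arrows | fact)+,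
      simp add: run_simps)
    have a2: "(Y \<lhd> m) \<cdot> (w \<rhd> A) \<cdot> \<eta> = w"
      by (rule diagram1[OF m_unit_right, where S = "[Left 0, Apply 0 1 1]"], (rule reads arrows | fact)+,
      simp add: run_simps)
    show ?thesis using a1 unfolding eq a2 by (rule sym)
  qed
  have "x1 \<cdot> as \<cdot> x2 \<cdot> iL = x3 \<cdot> as' \<cdot> x4 \<cdot> iR \<longleftrightarrow> E1 = E1'"
    unfolding c1 c1' using i1 by blast
  moreover have "kL \<cdot> x5 \<cdot> g = ext \<longleftrightarrow> E2 = unt"
    unfolding c2 ext_eq using unit_inject[OF hE2 unt_in_hom] by blast
  moreover have "kR \<cdot> x6 \<cdot> g = ext \<longleftrightarrow> E3 = unt"
    unfolding c3 ext_eq using unit_inject[OF hE3 unt_in_hom] by blast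
  ultimately show ?thesis
    unfolding w1 w2 w3 w4 w5 w6 inverse_Assoc inverse_Lun inverse_Run unfolding G Assoc_eq_as Lun_S Run_S Bim_simps(5)
      g_def[symmetric] prod.inject frobenius_system'_def E1_def[symmetric] E1'_def[symmetric] E2_def[symmetric] E3_def[symmetric]
    using lt le by blast
qed

text \<open>As \<open>theta_ext\<close> and \<open>e_ext\<close> reach all bimodule morphisms of the
  relevant types, quantifying over these morphisms amounts to quantifying over
  \<open>\<theta>\<close> and \<open>e\<close>.\<close>

lemma frobenius_ring_iff: "frobenius_ring C A m \<eta> (extension_bimodule C (Y \<otimes> A) wr ext) (extension_mult C A (Y \<otimes> A) wr ext)
      (extension_unit C A m (Y \<otimes> A) wr ext) \<longleftrightarrow> (\<exists>\<theta> e. frobenius_system' \<theta> e)"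
proof -
  have u: "\<one>\<^bsub>Bim\<^esub> = (A, m, m)" by (rule Bim_simps)
  have SS: "S \<otimes>\<^bsub>Bim\<^esub> S = S2" unfolding Bim_simps by (rule tensor_splitD(2)[OF split1])
  have la: "frobenius_system' \<theta> e \<Longrightarrow> left_arr Y phi \<one> (Id C A) \<theta> \<and> left_arr \<one> (Id C A) (Y \<otimes> Y) phi2 e" for \<theta> e
    by (simp add: frobenius_system'_def)
  have parametrize: "(\<exists>F\<in>hom Bim S (A, m, m). \<exists>G\<in>hom Bim (A, m, m) S2. Q F G) \<longleftrightarrow> (\<exists>\<theta> e. frobenius_system' \<theta> e)"
    if "\<And>\<theta> e. left_arr Y phi \<one> (Id C A) \<theta> \<Longrightarrow> left_arr \<one> (Id C A) (Y \<otimes> Y) phi2 e \<Longrightarrow>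
      Q (S, theta_ext \<theta>, (A, m, m)) ((A, m, m), e_ext e, S2) \<longleftrightarrow> frobenius_system' \<theta> e" for Q
    using that theta_ext_surj e_ext_surj theta_ext_bimodule e_ext_bimodule la by metis
  show ?thesis
    unfolding frobenius_ring_def extension_mult_eq extension_unit_eq extension_bimodule_eq frobenius_algebra_def u SS
    by (subst parametrize[OF frobenius_Bim_iff[OF _ _ refl refl]]) (use algebra_Bim in blast)+
qed

end

context dual_cowreath
begin

abbreviation "P2 \<equiv> frobenius_ring C A m \<eta> (extension_bimodule C (Y \<otimes> A) wr ext) (extension_mult C A (Y \<otimes> A) wr ext)
  (extension_unit C A m (Y \<otimes> A) wr ext)"

text \<open>The locales take the chosen tensor products as parameters;
  \<open>tensor_split_exists\<close> now supplies them, the square before the products that contain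
  it.\<close>

lemma P1_iff_P2: "P1 \<longleftrightarrow> P2"
proof -
  obtain q1 Z1 l1 r1 k1 i1 where s1: "tensor_split Y I_YA I_YA (Y \<otimes> A) nu (Y \<lhd> m) (Y \<otimes> A) nu (Y \<lhd> m) q1 Z1 l1 r1 k1 i1"
    using tensor_split_exists[OF split_S(1) bimod_S bimod_S split_S(2,2,3,3,4)] by blast
  interpret wreath_square C A m \<eta> X Y \<psi> \<delta> \<epsilon> b d q1 l1 r1 k1 i1 Z1
    by unfold_locales (rule s1)
  obtain q3 Z3 l3 r3 k3 i3 where s3: "tensor_split (Y \<otimes> Y) k1 i1 Z1 l1 r1 (Y \<otimes> A) nu (Y \<lhd> m) q3 Z3 l3 r3 k3 i3"
    using tensor_split_exists[OF split_Z1(1) bimod_Z1 bimod_S split_Z1(2,3) i1_k1 split_Z1(4,5)] by blast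
  obtain q4 Z4 l4 r4 k4 i4 where s4: "tensor_split Y I_YA I_YA (Y \<otimes> A) nu (Y \<lhd> m) Z1 l1 r1 q4 Z4 l4 r4 k4 i4"
    using tensor_split_exists[OF split_S(1) bimod_S bimod_Z1 split_S(2,2,3,3,4)] by blast
  obtain qL ZL lL rL kL iL where sL: "tensor_split \<one> (Id C A) (Id C A) A m m (Y \<otimes> A) nu (Y \<lhd> m) qL ZL lL rL kL iL"
    using tensor_split_exists[OF split_A(1) bimod_A bimod_S split_A(2-6)] by blast
  obtain qR ZR lR rR kR iR where sR: "tensor_split Y I_YA I_YA (Y \<otimes> A) nu (Y \<lhd> m) A m m qR ZR lR rR kR iR"
    using tensor_split_exists[OF split_S(1) bimod_S bimod_A split_S(2,2,3,3,4)] by blast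
  interpret wreath_tensors C A m \<eta> X Y \<psi> \<delta> \<epsilon> b d q1 l1 r1 k1 i1 Z1
    q3 l3 r3 k3 i3 q4 l4 r4 k4 i4 qL lL rL kL iL qR lR rR kR iR Z3 Z4 ZL ZR
    by unfold_locales (fact s3 s4 sL sR)+
  show ?thesis
    unfolding P1_iff_P3 P3_iff frobenius_ring_iff ..
qed

text \<open>A Frobenius extension demands in addition an algebra and an algebra morphism, and both
  are at hand for \<open>wr\<close> and \<open>ext\<close>.\<close>

lemma P2_iff_P4: "P2 \<longleftrightarrow> frobenius_extension C A m \<eta> (Y \<otimes> A) wr unt ext"
  unfolding frobenius_extension_def frobenius_ring_def
  using algebra_wreath algebra_morphism_ext by blast

end

theorem theorem5p6:
  fixes C :: "('o, 'a) monoidal" (structure)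
    and A X Y :: 'o and m \<eta> \<psi> \<delta> \<epsilon> b d :: 'a
  assumes "strict_monoidal_category C"
    and "has_coequalizers C"
    and "\<forall>Z\<in>Ob C. left_coflat C Z"
    and "algebra C A m \<eta>"
    and "\<forall>M \<nu>. left_module C A m \<eta> M \<nu> \<longrightarrow> robust C A m \<eta> M \<nu>"
    and "cowreath C A m \<eta> X \<psi> \<delta> \<epsilon>"
    and "adjoint_objects C X Y b d"
  shows "let
      T = right_transfer C A m \<eta>;
      T' = left_transfer C A m \<eta>;
      E = entwined_modules C A m \<eta> X \<psi> \<delta> \<epsilon>;
      YA = Y \<otimes> A;
      mw = wreath_mult C A m X \<psi> \<delta> Y b d;
      \<eta>w = wreath_unit C \<epsilon> Y b;
      i = wreath_extension C A m \<epsilon> Y b;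
      P1 = frobenius_coalgebra T (X, \<psi>)
             (cowreath_comult C A m \<eta> X \<psi> \<delta>) (cowreath_counit C A m \<eta> X \<psi> \<epsilon>);
      P2 = frobenius_ring C A m \<eta>
             (extension_bimodule C YA mw i) (extension_mult C A YA mw i) (extension_unit C A m YA mw i);
      P3 = frobenius_algebra T' (Y, dual_transfer C A X \<psi> Y b d)
             (dual_mult C A m \<eta> X \<psi> \<delta> Y b d) (dual_unit C A m \<eta> X \<psi> \<epsilon> Y b d);
      P4 = frobenius_extension C A m \<eta> YA mw \<eta>w i;
      P5 = isomorphic (bimodules C A m \<eta> YA mw \<eta>w)
             (AX_bimodule C A m X \<psi> \<delta> Y d) (YA_bimodule C A m X \<psi> \<delta> Y b d);
      P6 = (\<exists>f. is_iso E (AX_entwined C A m X \<psi> \<delta>, f, YA_entwined C A m \<eta> X \<psi> \<delta> \<epsilon> Y b d) \<and>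
             left_linear C A (m \<rhd> X) (wreath_left_action C A m X \<psi> Y b d) f);
      P7 = (\<exists>t. (\<one>\<^bsub>T\<^esub>, t, (X, \<psi>)) \<in> Ar T \<and>
             is_iso C (((m \<cdot> (m \<rhd> A)) \<rhd> X) \<cdot> (A \<otimes> A \<lhd> \<psi>) \<cdot> (A \<otimes> A \<otimes> X \<lhd> d \<rhd> A) \<cdot>
                       (A \<lhd> \<delta> \<rhd> Y \<otimes> A) \<cdot> (t \<rhd> Y \<otimes> A)));
      P8 = (\<exists>B. ((X, \<psi>) \<otimes>\<^bsub>T\<^esub> (X, \<psi>), B, \<one>\<^bsub>T\<^esub>) \<in> Ar T \<and>
             (m \<rhd> X) \<cdot> (A \<lhd> \<psi>) \<cdot> (A \<otimes> X \<lhd> B) \<cdot> (\<delta> \<rhd> X) =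
             (m \<rhd> X) \<cdot> (A \<lhd> B \<rhd> X) \<cdot> (\<psi> \<rhd> X \<otimes> X) \<cdot> (X \<lhd> \<delta>) \<and>
             is_iso C ((Y \<lhd> m) \<cdot> (Y \<otimes> A \<lhd> B) \<cdot> (Y \<lhd> \<psi> \<rhd> X) \<cdot> (b \<rhd> A \<otimes> X)));
      P9 = frobenius_functor E (right_modules C A m \<eta>) forget_object forget_arrow
    in (P1 \<longleftrightarrow> P2) \<and> (P1 \<longleftrightarrow> P3) \<and> (P1 \<longleftrightarrow> P4) \<and> (P1 \<longleftrightarrow> P5) \<and> (P1 \<longleftrightarrow> P6) \<and> (P1 \<longleftrightarrow> P7) \<and> (P1 \<longleftrightarrow> P8) \<and>
       (left_tensor_generator C \<one> \<longrightarrow> (P1 \<longleftrightarrow> P9))"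
proof -
  interpret dual_cowreath C A m \<eta> X Y \<psi> \<delta> \<epsilon> b d
    using assms by unfold_locales
  show ?thesis
    unfolding Let_def wr_def[symmetric] ext_def[symmetric] wreath_unit_eq
    using P1_iff_P2 P2_iff_P4 P1_iff_P3 P1_iff_P5 P1_iff_P6 P1_iff_P7 P1_iff_P8 P1_imp_P9 P9_imp_P1 by blast
qed

end
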